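(* Let $(A,\mathfrak m,k)$ be a commutative Noetherian local ring, let $M$ be a nonzero finitely generated $A$-module having reducible complexity, and let $N$ be a nonzero finitely generated $A$-module. If $\operatorname{cx}M>0$, let $K_0=M$, let $K_1,\dots,K_c$ be $A$-modules and let $\eta_i\in\operatorname{Ext}_A^{|\eta_i|}(K_{i-1},K_{i-1})$ ($i=1,\dots,c$) be homogeneous elements of positive degree $|\eta_i|$, given by exact sequences $$0\to K_{i-1}\to K_i\to\Omega_A^{|\eta_i|-1}(K_{i-1})\to 0 ,$$ such that $\operatorname{depth}K_i=\operatorname{depth}M$ and $\operatorname{cx}K_i<\operatorname{cx}K_{i-1}$ for $i=1,\dots,c$, and $\operatorname{cx}K_c=0$. (If $\operatorname{cx}M=0$, put $c=0$, so that $|\eta_1|+\cdots+|\eta_c|-c=0$.) Put $\mathrm q^A(M,N)=\sup\{n\mid\operatorname{Tor}^A_n(M,N)\ne0\}$. Then the following are equivalent. (i) There exists an integer $t>\operatorname{depth}A-\operatorname{depth}M$ such that $\operatorname{Tor}^A_{t+i}(M,N)=0$ for $0\le i\le|\eta_1|+\cdots+|\eta_c|-c$. (ii) $\mathrm q^A(M,N)<\infty$. (iii) $\operatorname{depth}A-\operatorname{depth}M-\operatorname{depth}N\le\mathrm q^A(M,N)\le\operatorname{depth}A-\operatorname{depth}M$.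
   Context: All modules are finitely generated. Complexity: for an $A$-module $X$ the $n$-th Betti number is $\beta_n(X)=\dim_k\operatorname{Ext}_A^n(X,k)$, and $\operatorname{cx}X=\inf\{t\in\mathbb N_0 \mid \exists\, a\in\mathbb R \text{ with } \beta_n(X)\le a n^{t-1}\text{ for } n\gg 0\}$ (where $\mathbb N_0=\{0,1,2,\dots\}$; the value is $\infty$ if no such $t$ exists). Thus $\operatorname{cx}X=0$ iff $X$ has finite projective dimension. Syzygies and $K_\eta$: if $\cdots\to P_1\to P_0\to X\to 0$ is the minimal free resolution of $X$, then $\Omega_A^n(X)$ denotes the cokernel of $P_{n+1}\to P_n$ (so $\Omega_A^0(X)=X$). For a homogeneous element $\eta\in\operatorname{Ext}_A^*(X,Y)$ of degree $|\eta|>0$, choose a map $f_\eta:\Omega_A^{|\eta|}(X)\to Y$ representing $\eta$, and let $K_\eta$ be the pushout of $f_\eta$ and the inclusion $\Omega_A^{|\eta|}(X)\hookrightarrow P_{|\eta|-1}$. There is an exact sequence $0\to Y\to K_\eta\to\Omega_A^{|\eta|-1}(X)\to 0$ (the exact sequence giving $\eta$), and up to isomorphism $K_\eta$ is independent of the choice of $f_\eta$. In the claim, $K_i=K_{\eta_i}$. Reducible complexity: the class of $A$-modules having reducible complexity is defined inductively, inside the class of $A$-modules of finite complexity, by: (1) every module of finite projective dimension has reducible complexity; (2) a module $X$ with $0<\operatorname{cx}X<\infty$ has reducible complexity if there is a homogeneous $\eta\in\operatorname{Ext}_A^*(X,X)$ of positive degree such that $\operatorname{cx}K_\eta<\operatorname{cx}X$,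 $\operatorname{depth}K_\eta=\operatorname{depth}X$, and $K_\eta$ has reducible complexity. Consequently modules $K_i$ and elements $\eta_i$ as in the claim always exist when $M$ has reducible complexity and $\operatorname{cx}M>0$. *)

theory Defs
  imports "HOL-Algebra.Module" "HOL-Algebra.QuotRing" "HOL-Algebra.Ring_Divisibility" "HOL-Library.Extended_Real"
begin

section \<open>Local rings and modules\<close>

locale noetherian_local_ring = cring A + noetherian_ring A for A (structure) +
  assumes unique_maximal_ideal: "\<exists>!I. maximalideal I A"

definition max_ideal :: "'a ring \<Rightarrow> 'a set" where
  "max_ideal A = (THE I. maximalideal I A)"

definition mod_span :: "'a ring \<Rightarrow> ('a, 'm) module \<Rightarrow> 'm set \<Rightarrow> 'm set" where
  "mod_span A M S = \<Inter>{U. submodule U A M \<and> S \<subseteq> U}"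

definition fg_module :: "'a ring \<Rightarrow> ('a, 'm) module \<Rightarrow> bool" where
  "fg_module A M \<longleftrightarrow>
     module A M \<and> (\<exists>S. finite S \<and> S \<subseteq> carrier M \<and> mod_span A M S = carrier M)"

definition is_zero_mod :: "('a, 'm) module \<Rightarrow> bool" where
  "is_zero_mod M \<longleftrightarrow> carrier M = {\<zero>\<^bsub>M\<^esub>}"

text \<open>Homomorphisms are extensional functions, so that equal maps are equal as elements of \<open>Hom\<close>.\<close>

definition mod_hom :: "'a ring \<Rightarrow> ('a, 'm) module \<Rightarrow> ('a, 'n) module \<Rightarrow> ('m \<Rightarrow> 'n) set" where
  "mod_hom A M N =
     {f \<in> carrier M \<rightarrow>\<^sub>E carrier N.
        (\<forall>x\<in>carrier M. \<forall>y\<in>carrier M. f (x \<oplus>\<^bsub>M\<^esub> y) = f x \<oplus>\<^bsub>N\<^esub> f y) \<and>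
        (\<forall>a\<in>carrier A. \<forall>x\<in>carrier M. f (a \<odot>\<^bsub>M\<^esub> x) = a \<odot>\<^bsub>N\<^esub> f x)}"

definition mod_iso :: "'a ring \<Rightarrow> ('a, 'm) module \<Rightarrow> ('a, 'n) module \<Rightarrow> bool" where
  "mod_iso A M N \<longleftrightarrow> (\<exists>f\<in>mod_hom A M N. bij_betw f (carrier M) (carrier N))"

text \<open>The record type \<^typ>\<open>('a, 'm) module\<close> extends rings; its multiplicative fields play no role in
  \<^const>\<open>module\<close> and are left unspecified.\<close>

definition hom_mod :: "'a ring \<Rightarrow> ('a, 'm) module \<Rightarrow> ('a, 'n) module \<Rightarrow> ('a, 'm \<Rightarrow> 'n) module" where
  "hom_mod A M N =
     \<lparr>carrier = mod_hom A M N, monoid.mult = undefined, monoid.one = undefined,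
      ring.zero = (\<lambda>x\<in>carrier M. \<zero>\<^bsub>N\<^esub>),
      ring.add = (\<lambda>f g. \<lambda>x\<in>carrier M. f x \<oplus>\<^bsub>N\<^esub> g x),
      module.smult = (\<lambda>a f. \<lambda>x\<in>carrier M. a \<odot>\<^bsub>N\<^esub> f x)\<rparr>"

definition self_mod :: "'a ring \<Rightarrow> ('a, 'a) module" where
  "self_mod A =
     \<lparr>carrier = carrier A, monoid.mult = monoid.mult A, monoid.one = monoid.one A,
      ring.zero = ring.zero A, ring.add = ring.add A,
      module.smult = monoid.mult A\<rparr>"

definition quot_mod :: "('a, 'm) module \<Rightarrow> 'm set \<Rightarrow> ('a, 'm set) module" where
  "quot_mod M U =
     \<lparr>carrier = a_rcosets\<^bsub>M\<^esub> U, monoid.mult = undefined, monoid.one = undefined, ring.zero = U,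
      ring.add = set_add M,
      module.smult = (\<lambda>a X. \<Union>x\<in>X. U +>\<^bsub>M\<^esub> (a \<odot>\<^bsub>M\<^esub> x))\<rparr>"

definition dsum_mod :: "('a, 'm) module \<Rightarrow> ('a, 'n) module \<Rightarrow> ('a, 'm \<times> 'n) module" where
  "dsum_mod M N =
     \<lparr>carrier = carrier M \<times> carrier N, monoid.mult = undefined, monoid.one = undefined,
      ring.zero = (\<zero>\<^bsub>M\<^esub>, \<zero>\<^bsub>N\<^esub>),
      ring.add = (\<lambda>(x, y) (x', y'). (x \<oplus>\<^bsub>M\<^esub> x', y \<oplus>\<^bsub>N\<^esub> y')),
      module.smult = (\<lambda>a (x, y). (a \<odot>\<^bsub>M\<^esub> x, a \<odot>\<^bsub>N\<^esub> y))\<rparr>"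

text \<open>The free module on a set \<open>S\<close>: finitely supported functions vanishing outside \<open>S\<close>.
  In particular \<open>free_mod A {..<n}\<close> is \<open>A\<^sup>n\<close>.\<close>

definition free_mod :: "'a ring \<Rightarrow> 's set \<Rightarrow> ('a, 's \<Rightarrow> 'a) module" where
  "free_mod A S =
     \<lparr>carrier = {v. (\<forall>s\<in>S. v s \<in> carrier A) \<and> (\<forall>s. s \<notin> S \<longrightarrow> v s = \<zero>\<^bsub>A\<^esub>) \<and>
                    finite {s. v s \<noteq> \<zero>\<^bsub>A\<^esub>}},
      monoid.mult = undefined, monoid.one = undefined,
      ring.zero = (\<lambda>_. \<zero>\<^bsub>A\<^esub>),
      ring.add = (\<lambda>u v s. u s \<oplus>\<^bsub>A\<^esub> v s),
      module.smult = (\<lambda>a v s. a \<otimes>\<^bsub>A\<^esub> v s)\<rparr>"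

definition unit_vec :: "'a ring \<Rightarrow> 's \<Rightarrow> 's \<Rightarrow> 'a" where
  "unit_vec A s = (\<lambda>t. if t = s then \<one>\<^bsub>A\<^esub> else \<zero>\<^bsub>A\<^esub>)"

definition ideal_smult :: "'a ring \<Rightarrow> 'a set \<Rightarrow> ('a, 'm) module \<Rightarrow> 'm set" where
  "ideal_smult A I M = mod_span A M {a \<odot>\<^bsub>M\<^esub> x | a x. a \<in> I \<and> x \<in> carrier M}"

definition residue_mod :: "'a ring \<Rightarrow> ('a, 'a set) module" where
  "residue_mod A = quot_mod (self_mod A) (max_ideal A)"

text \<open>For an \<open>A\<close>-module \<open>V\<close> annihilated by the maximal ideal, i.e. a vector space over the residue
  field \<open>k\<close>: the number of elements of a \<open>k\<close>-basis of \<open>V\<close>. Scalars of \<open>k\<close> are represented by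
  elements of \<open>A\<close>, a scalar being zero iff its representative lies in the maximal ideal.\<close>

definition k_basis :: "'a ring \<Rightarrow> ('a, 'v) module \<Rightarrow> 'v set \<Rightarrow> bool" where
  "k_basis A V B \<longleftrightarrow>
     finite B \<and> B \<subseteq> carrier V \<and> mod_span A V B = carrier V \<and>
     (\<forall>a\<in>B \<rightarrow> carrier A.
        (\<Oplus>\<^bsub>V\<^esub>v\<in>B. a v \<odot>\<^bsub>V\<^esub> v) = \<zero>\<^bsub>V\<^esub> \<longrightarrow> (\<forall>v\<in>B. a v \<in> max_ideal A))"

definition k_dim :: "'a ring \<Rightarrow> ('a, 'v) module \<Rightarrow> nat" where
  "k_dim A V = (THE n. \<exists>B. k_basis A V B \<and> card B = n)"


section \<open>Depth\<close>

definition regular_seq :: "'a ring \<Rightarrow> ('a, 'm) module \<Rightarrow> 'a list \<Rightarrow> bool" where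
  "regular_seq A M xs \<longleftrightarrow>
     set xs \<subseteq> carrier A \<and>
     (\<forall>i<length xs. \<forall>m\<in>carrier M.
        xs ! i \<odot>\<^bsub>M\<^esub> m \<in> ideal_smult A (set (take i xs)) M \<longrightarrow>
        m \<in> ideal_smult A (set (take i xs)) M) \<and>
     ideal_smult A (set xs) M \<noteq> carrier M"

text \<open>The zero module has infinite depth by convention.\<close>

definition depth :: "'a ring \<Rightarrow> ('a, 'm) module \<Rightarrow> enat" where
  "depth A M =
     (if is_zero_mod M then \<infinity>
      else Sup {enat (length xs) | xs. set xs \<subseteq> max_ideal A \<and> regular_seq A M xs})"


section \<open>Resolutions\<close>

text \<open>Complexes are indexed by all integers, with \<open>d n : P n \<rightarrow> P (n - 1)\<close>; a resolution is zero in
  negative degrees.\<close>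

definition resolution ::
  "'a ring \<Rightarrow> ('a, 'x) module \<Rightarrow> (int \<Rightarrow> ('a, 'p) module) \<Rightarrow> (int \<Rightarrow> 'p \<Rightarrow> 'p) \<Rightarrow> ('p \<Rightarrow> 'x) \<Rightarrow> bool"
  where
  "resolution A X P d e \<longleftrightarrow>
     (\<forall>n. module A (P n)) \<and> (\<forall>n<0. is_zero_mod (P n)) \<and>
     (\<forall>n. d n \<in> mod_hom A (P n) (P (n - 1))) \<and>
     e \<in> mod_hom A (P 0) X \<and> e ` carrier (P 0) = carrier X \<and>
     a_kernel (P 0) X e = d 1 ` carrier (P 1) \<and>
     (\<forall>n>0. a_kernel (P n) (P (n - 1)) (d n) = d (n + 1) ` carrier (P (n + 1)))"

definition min_free_resolution ::
  "'a ring \<Rightarrow> ('a, 'x) module \<Rightarrow>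
     (int \<Rightarrow> nat) \<Rightarrow> (int \<Rightarrow> (nat \<Rightarrow> 'a) \<Rightarrow> (nat \<Rightarrow> 'a)) \<Rightarrow> ((nat \<Rightarrow> 'a) \<Rightarrow> 'x) \<Rightarrow> bool"
  where
  "min_free_resolution A X r d e \<longleftrightarrow>
     resolution A X (\<lambda>n. free_mod A {..<r n}) d e \<and>
     (\<forall>n. d n ` carrier (free_mod A {..<r n})
           \<subseteq> ideal_smult A (max_ideal A) (free_mod A {..<r (n - 1)}))"

text \<open>A fixed minimal free resolution of \<open>X\<close> (unique up to isomorphism): its modules and its
  differentials.\<close>

definition min_res ::
  "'a ring \<Rightarrow> ('a, 'x) module \<Rightarrow> (int \<Rightarrow> nat) \<times> (int \<Rightarrow> (nat \<Rightarrow> 'a) \<Rightarrow> (nat \<Rightarrow> 'a))"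
  where
  "min_res A X = (SOME (r, d). \<exists>e. min_free_resolution A X r d e)"

definition res_mod :: "'a ring \<Rightarrow> ('a, 'x) module \<Rightarrow> int \<Rightarrow> ('a, nat \<Rightarrow> 'a) module" where
  "res_mod A X n = free_mod A {..<fst (min_res A X) n}"

definition res_diff :: "'a ring \<Rightarrow> ('a, 'x) module \<Rightarrow> int \<Rightarrow> (nat \<Rightarrow> 'a) \<Rightarrow> (nat \<Rightarrow> 'a)" where
  "res_diff A X n = snd (min_res A X) n"

text \<open>A finitely generated projective module is a direct summand of some \<open>A\<^sup>n\<close>, hence isomorphic to a
  submodule of \<open>A\<^sup>n\<close>; so the carrier type \<^typ>\<open>nat \<Rightarrow> 'a\<close> suffices below.\<close>

definition fg_projective :: "'a ring \<Rightarrow> ('a, 'p) module \<Rightarrow> bool" where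
  "fg_projective A P \<longleftrightarrow>
     module A P \<and>
     (\<exists>n (Q :: ('a, nat \<Rightarrow> 'a) module).
        module A Q \<and> mod_iso A (dsum_mod P Q) (free_mod A {..<n::nat}))"

definition finite_proj_dim :: "'a ring \<Rightarrow> ('a, 'x) module \<Rightarrow> bool" where
  "finite_proj_dim A X \<longleftrightarrow>
     (\<exists>(P :: int \<Rightarrow> ('a, nat \<Rightarrow> 'a) module) d e l.
        resolution A X P d e \<and> (\<forall>n. fg_projective A (P n)) \<and> (\<forall>n>l. is_zero_mod (P n)))"


section \<open>Ext, Betti numbers and complexity\<close>

text \<open>\<open>Ext\<^sup>n(X, Y)\<close> is the cohomology of \<open>Hom(P, Y)\<close>, where \<open>P\<close> is the minimal free resolution
  of \<open>X\<close>.\<close>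

definition ext_cocycles ::
  "'a ring \<Rightarrow> int \<Rightarrow> ('a, 'x) module \<Rightarrow> ('a, 'y) module \<Rightarrow> ((nat \<Rightarrow> 'a) \<Rightarrow> 'y) set" where
  "ext_cocycles A n X Y =
     {f \<in> mod_hom A (res_mod A X n) Y.
        \<forall>p\<in>carrier (res_mod A X (n + 1)). f (res_diff A X (n + 1) p) = \<zero>\<^bsub>Y\<^esub>}"

definition ext_coboundaries ::
  "'a ring \<Rightarrow> int \<Rightarrow> ('a, 'x) module \<Rightarrow> ('a, 'y) module \<Rightarrow> ((nat \<Rightarrow> 'a) \<Rightarrow> 'y) set" where
  "ext_coboundaries A n X Y =
     {\<lambda>p\<in>carrier (res_mod A X n). g (res_diff A X n p) | g. g \<in> mod_hom A (res_mod A X (n - 1)) Y}"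

definition ext_mod ::
  "'a ring \<Rightarrow> int \<Rightarrow> ('a, 'x) module \<Rightarrow> ('a, 'y) module \<Rightarrow> ('a, ((nat \<Rightarrow> 'a) \<Rightarrow> 'y) set) module" where
  "ext_mod A n X Y =
     quot_mod ((hom_mod A (res_mod A X n) Y)\<lparr>carrier := ext_cocycles A n X Y\<rparr>)
              (ext_coboundaries A n X Y)"

definition betti :: "'a ring \<Rightarrow> ('a, 'x) module \<Rightarrow> nat \<Rightarrow> nat" where
  "betti A X n = k_dim A (ext_mod A (int n) X (residue_mod A))"

text \<open>The infimum of the empty set in \<^typ>\<open>enat\<close> is \<open>\<infinity>\<close>. The exponent \<open>t - 1\<close> is taken in the reals,
  so that for \<open>t = 0\<close> the bound is \<open>a / n\<close>.\<close>

definition cx :: "'a ring \<Rightarrow> ('a, 'x) module \<Rightarrow> enat" where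
  "cx A X = Inf {enat t | t. \<exists>a::real. \<forall>\<^sub>F n in sequentially.
                               real (betti A X n) \<le> a * real n powr (real t - 1)}"


section \<open>Tor\<close>

definition bilinear_relations ::
  "'a ring \<Rightarrow> ('a, 'm) module \<Rightarrow> ('a, 'n) module \<Rightarrow> ('m \<times> 'n \<Rightarrow> 'a) set" where
  "bilinear_relations A M N =
     (let F = free_mod A (carrier M \<times> carrier N); \<delta> = (\<lambda>x y. unit_vec A (x, y)) in
      mod_span A F
       ({\<delta> (x \<oplus>\<^bsub>M\<^esub> x') y \<ominus>\<^bsub>F\<^esub> (\<delta> x y \<oplus>\<^bsub>F\<^esub> \<delta> x' y) | x x' y.
           x \<in> carrier M \<and> x' \<in> carrier M \<and> y \<in> carrier N} \<union>
        {\<delta> x (y \<oplus>\<^bsub>N\<^esub> y') \<ominus>\<^bsub>F\<^esub> (\<delta> x y \<oplus>\<^bsub>F\<^esub> \<delta> x y') | x y y'.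
           x \<in> carrier M \<and> y \<in> carrier N \<and> y' \<in> carrier N} \<union>
        {\<delta> (a \<odot>\<^bsub>M\<^esub> x) y \<ominus>\<^bsub>F\<^esub> a \<odot>\<^bsub>F\<^esub> \<delta> x y | a x y.
           a \<in> carrier A \<and> x \<in> carrier M \<and> y \<in> carrier N} \<union>
        {\<delta> x (a \<odot>\<^bsub>N\<^esub> y) \<ominus>\<^bsub>F\<^esub> a \<odot>\<^bsub>F\<^esub> \<delta> x y | a x y.
           a \<in> carrier A \<and> x \<in> carrier M \<and> y \<in> carrier N}))"

definition tensor_mod ::
  "'a ring \<Rightarrow> ('a, 'm) module \<Rightarrow> ('a, 'n) module \<Rightarrow> ('a, ('m \<times> 'n \<Rightarrow> 'a) set) module" where
  "tensor_mod A M N = quot_mod (free_mod A (carrier M \<times> carrier N)) (bilinear_relations A M N)"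

definition tensor_elt ::
  "'a ring \<Rightarrow> ('a, 'm) module \<Rightarrow> ('a, 'n) module \<Rightarrow> 'm \<Rightarrow> 'n \<Rightarrow> ('m \<times> 'n \<Rightarrow> 'a) set" where
  "tensor_elt A M N x y =
     bilinear_relations A M N +>\<^bsub>free_mod A (carrier M \<times> carrier N)\<^esub> unit_vec A (x, y)"

text \<open>\<open>f \<otimes> id\<^sub>N\<close>, the unique linear map with \<open>x \<otimes> y \<mapsto> f x \<otimes> y\<close>.\<close>

definition tensor_map ::
  "'a ring \<Rightarrow> ('a, 'm) module \<Rightarrow> ('a, 'p) module \<Rightarrow> ('a, 'n) module \<Rightarrow> ('m \<Rightarrow> 'p) \<Rightarrow>
     ('m \<times> 'n \<Rightarrow> 'a) set \<Rightarrow> ('p \<times> 'n \<Rightarrow> 'a) set" where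
  "tensor_map A M M' N f =
     (THE h. h \<in> mod_hom A (tensor_mod A M N) (tensor_mod A M' N) \<and>
             (\<forall>x\<in>carrier M. \<forall>y\<in>carrier N. h (tensor_elt A M N x y) = tensor_elt A M' N (f x) y))"

text \<open>\<open>Tor\<^sub>n(M, N)\<close> is the homology of \<open>P \<otimes> N\<close>, where \<open>P\<close> is the minimal free resolution of \<open>M\<close>; it
  vanishes for negative \<open>n\<close>.\<close>

definition tor_diff ::
  "'a ring \<Rightarrow> int \<Rightarrow> ('a, 'm) module \<Rightarrow> ('a, 'n) module \<Rightarrow>
     ((nat \<Rightarrow> 'a) \<times> 'n \<Rightarrow> 'a) set \<Rightarrow> ((nat \<Rightarrow> 'a) \<times> 'n \<Rightarrow> 'a) set" where
  "tor_diff A n M N = tensor_map A (res_mod A M n) (res_mod A M (n - 1)) N (res_diff A M n)"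

definition tor_mod ::
  "'a ring \<Rightarrow> int \<Rightarrow> ('a, 'm) module \<Rightarrow> ('a, 'n) module \<Rightarrow>
     ('a, ((nat \<Rightarrow> 'a) \<times> 'n \<Rightarrow> 'a) set set) module" where
  "tor_mod A n M N =
     (let C = (\<lambda>i. tensor_mod A (res_mod A M i) N) in
      quot_mod ((C n)\<lparr>carrier := a_kernel (C n) (C (n - 1)) (tor_diff A n M N)\<rparr>)
               (tor_diff A (n + 1) M N ` carrier (C (n + 1))))"

definition q_tor :: "'a ring \<Rightarrow> ('a, 'm) module \<Rightarrow> ('a, 'n) module \<Rightarrow> ereal" where
  "q_tor A M N = Sup {ereal (real_of_int n) | n. \<not> is_zero_mod (tor_mod A n M N)}"


section \<open>Syzygies, the modules \<open>K\<^sub>\<eta>\<close>, and reducible complexity\<close>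

definition syzygy :: "'a ring \<Rightarrow> int \<Rightarrow> ('a, 'x) module \<Rightarrow> ('a, (nat \<Rightarrow> 'a) set) module" where
  "syzygy A n X =
     quot_mod (res_mod A X n) (res_diff A X (n + 1) ` carrier (res_mod A X (n + 1)))"

definition syzygy_proj :: "'a ring \<Rightarrow> int \<Rightarrow> ('a, 'x) module \<Rightarrow> (nat \<Rightarrow> 'a) \<Rightarrow> (nat \<Rightarrow> 'a) set" where
  "syzygy_proj A n X p =
     (res_diff A X (n + 1) ` carrier (res_mod A X (n + 1))) +>\<^bsub>res_mod A X n\<^esub> p"

text \<open>For \<open>n > 0\<close>, the inclusion of the \<open>n\<close>-th syzygy into \<open>P (n - 1)\<close>, induced by the differential.\<close>

definition syzygy_incl :: "'a ring \<Rightarrow> int \<Rightarrow> ('a, 'x) module \<Rightarrow> (nat \<Rightarrow> 'a) set \<Rightarrow> (nat \<Rightarrow> 'a)" where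
  "syzygy_incl A n X w = the_elem (res_diff A X n ` w)"

definition represents ::
  "'a ring \<Rightarrow> int \<Rightarrow> ('a, 'x) module \<Rightarrow> ('a, 'y) module \<Rightarrow>
     ((nat \<Rightarrow> 'a) set \<Rightarrow> 'y) \<Rightarrow> ((nat \<Rightarrow> 'a) \<Rightarrow> 'y) set \<Rightarrow> bool" where
  "represents A n X Y f \<eta> \<longleftrightarrow>
     f \<in> mod_hom A (syzygy A n X) Y \<and>
     (\<lambda>p\<in>carrier (res_mod A X n). f (syzygy_proj A n X p)) \<in> \<eta>"

text \<open>The pushout of \<open>f\<close> and the inclusion of the \<open>n\<close>-th syzygy into \<open>P (n - 1)\<close>.\<close>

definition syzygy_pushout ::
  "'a ring \<Rightarrow> int \<Rightarrow> ('a, 'x) module \<Rightarrow> ('a, 'y) module \<Rightarrow>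
     ((nat \<Rightarrow> 'a) set \<Rightarrow> 'y) \<Rightarrow> ('a, ('y \<times> (nat \<Rightarrow> 'a)) set) module" where
  "syzygy_pushout A n X Y f =
     quot_mod (dsum_mod Y (res_mod A X (n - 1)))
       ((\<lambda>w. (f w, \<ominus>\<^bsub>res_mod A X (n - 1)\<^esub> syzygy_incl A n X w)) ` carrier (syzygy A n X))"

definition K_mod ::
  "'a ring \<Rightarrow> int \<Rightarrow> ('a, 'x) module \<Rightarrow> ('a, 'y) module \<Rightarrow>
     ((nat \<Rightarrow> 'a) \<Rightarrow> 'y) set \<Rightarrow> ('a, ('y \<times> (nat \<Rightarrow> 'a)) set) module" where
  "K_mod A n X Y \<eta> = syzygy_pushout A n X Y (SOME f. represents A n X Y f \<eta>)"

text \<open>Every finitely generated module is isomorphic to a quotient of some \<open>A\<^sup>n\<close>, hence to a module with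
  carrier type \<^typ>\<open>(nat \<Rightarrow> 'a) set\<close>. The inductive definition is carried out in this type, with
  \<open>K\<^sub>\<eta>\<close> represented by an isomorphic copy, and is then transported along isomorphism.\<close>

inductive red_cx_std :: "'a ring \<Rightarrow> ('a, (nat \<Rightarrow> 'a) set) module \<Rightarrow> bool"
  for A :: "'a ring" where
  finite_pd: "fg_module A X \<Longrightarrow> finite_proj_dim A X \<Longrightarrow> red_cx_std A X"
| reduce:
    "fg_module A X \<Longrightarrow> 0 < cx A X \<Longrightarrow> cx A X < \<infinity> \<Longrightarrow>
     0 < n \<Longrightarrow> \<eta> \<in> carrier (ext_mod A n X X) \<Longrightarrow>
     fg_module A K \<Longrightarrow> mod_iso A K (K_mod A n X X \<eta>) \<Longrightarrow>
     cx A K < cx A X \<Longrightarrow> depth A K = depth A X \<Longrightarrow> red_cx_std A K \<Longrightarrow>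
     red_cx_std A X"

definition reducible_complexity :: "'a ring \<Rightarrow> ('a, 'm) module \<Rightarrow> bool" where
  "reducible_complexity A M \<longleftrightarrow>
     fg_module A M \<and> (\<exists>X. red_cx_std A X \<and> mod_iso A M X)"

end

theory Submission
  imports Defs
begin

text \<open>Let \<open>X = K\<^sub>i\<^sub>-\<^sub>1\<close>, \<open>n = |\<eta>\<^sub>i|\<close>, and let \<open>P\<close> be the minimal free resolution of \<open>X\<close>. The cocycle of \<open>\<eta>\<^sub>i\<close> extends to
  a chain map \<open>P\<^sub>j\<^sub>+\<^sub>n \<rightarrow> P\<^sub>j\<close>, whose mapping cone is a free resolution of \<open>K\<^sub>i\<close>. The resulting long exact
  sequence relates \<open>Tor\<^sub>j(X, N)\<close>, \<open>Tor\<^sub>j(K\<^sub>i, N)\<close> and \<open>Tor\<^sub>j\<^sub>+\<^sub>n\<^sub>-\<^sub>1(X, N)\<close>: if the outer two vanish, so does the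
  one in the middle, and wherever \<open>Tor(K\<^sub>i, N)\<close> vanishes, the vanishing of \<open>Tor(X, N)\<close> is periodic of
  period \<open>n\<close>. The module \<open>K\<^sub>c\<close> has finite projective dimension \<open>g\<close>, and the Auslander-Buchsbaum formula
  gives \<open>g = depth A - depth M\<close>. So a window of vanishing Tor of \<open>M\<close> above degree \<open>g\<close> shrinks by
  \<open>|\<eta>\<^sub>i| - 1\<close> on passing from \<open>K\<^sub>i\<^sub>-\<^sub>1\<close> to \<open>K\<^sub>i\<close>, and going back from \<open>K\<^sub>c\<close> to \<open>M\<close>, periodicity spreads it
  to all degrees above \<open>g\<close>. For the lower bound, vanishing of the Tor of \<open>M\<close> above degree \<open>q\<close>
  is inherited by \<open>K\<^sub>c\<close>, and a minimal free resolution of length \<open>g\<close> whose tensor product with \<open>N\<close> is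
  exact above degree \<open>q\<close> has \<open>g \<le> depth N + q\<close>.\<close>

subsection \<open>Linear maps and powers of modules\<close>

text \<open>Tor is defined through a chosen minimal resolution, whereas the cone of the lift of
  eta_i resolves K_i but need not be minimal. Hence Tor has to be shown independent of the
  resolution, and its vanishing is expressed by resolutions alone (\<open>tor_exact\<close>); from
  there on the chain of modules enters only as a table of truth values indexed by a stage i and a
  degree. The length of the window in (i) comes from the table: stage i costs |eta_i| - 1 degrees,
  and the window left for K_(i-1) always contains a full period |eta_i|. That K_c has complexity
  zero is turned into finite length of its minimal resolution, because Betti numbers are the ranks
  in it. The equality depth K_c = depth M enters twice: it makes g depend on M alone, and it forces
  K_c to be nonzero. The lower bound in (iii) also rests on Tor_0(M, N) being nonzero: then the
  degrees of nonzero Tor form a finite nonempty set, whose maximum is the supremum q.\<close>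

locale local_noeth = noetherian_local_ring A for A :: "'a ring" (structure)

text \<open>For finite \<open>S\<close>, the power \<open>N\<^sup>S\<close> replaces \<open>A\<^sup>S \<otimes> N\<close>.\<close>

definition pow_mod :: "('a, 'n) module \<Rightarrow> 's set \<Rightarrow> ('a, 's \<Rightarrow> 'n) module" where
  "pow_mod N S =
     \<lparr>carrier = {v. (\<forall>s\<in>S. v s \<in> carrier N) \<and> (\<forall>s. s \<notin> S \<longrightarrow> v s = \<zero>\<^bsub>N\<^esub>)},
      monoid.mult = undefined, monoid.one = undefined,
      ring.zero = (\<lambda>_. \<zero>\<^bsub>N\<^esub>),
      ring.add = (\<lambda>u v s. u s \<oplus>\<^bsub>N\<^esub> v s),
      module.smult = (\<lambda>a v s. a \<odot>\<^bsub>N\<^esub> v s)\<rparr>"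

text \<open>In A^S tensor N, identified with N^S, this is e_s tensor n.\<close>

definition single :: "('a, 'n) module \<Rightarrow> 's \<Rightarrow> 'n \<Rightarrow> 's \<Rightarrow> 'n" where
  "single N s n = (\<lambda>t. if t = s then n else \<zero>\<^bsub>N\<^esub>)"

context local_noeth
begin

text \<open>Unlike in \<open>mod_hom\<close>, nothing is required outside the carrier, so that
  lambda terms can be composed and added as they stand.\<close>

definition lin :: "('a, 'm) module \<Rightarrow> ('a, 'n) module \<Rightarrow> ('m \<Rightarrow> 'n) \<Rightarrow> bool" where
  "lin M N f \<longleftrightarrow> f \<in> carrier M \<rightarrow> carrier N \<and>
     (\<forall>x\<in>carrier M. \<forall>y\<in>carrier M. f (x \<oplus>\<^bsub>M\<^esub> y) = f x \<oplus>\<^bsub>N\<^esub> f y) \<and>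
     (\<forall>a\<in>carrier A. \<forall>x\<in>carrier M. f (a \<odot>\<^bsub>M\<^esub> x) = a \<odot>\<^bsub>N\<^esub> f x)"

lemma lin_closed: "lin M N f \<Longrightarrow> x \<in> carrier M \<Longrightarrow> f x \<in> carrier N"
  by (auto simp: lin_def)

lemma lin_add:
  "lin M N f \<Longrightarrow> x \<in> carrier M \<Longrightarrow> y \<in> carrier M \<Longrightarrow> f (x \<oplus>\<^bsub>M\<^esub> y) = f x \<oplus>\<^bsub>N\<^esub> f y"
  by (auto simp: lin_def)

lemma lin_smult:
  "lin M N f \<Longrightarrow> a \<in> carrier A \<Longrightarrow> x \<in> carrier M \<Longrightarrow> f (a \<odot>\<^bsub>M\<^esub> x) = a \<odot>\<^bsub>N\<^esub> f x"
  by (auto simp: lin_def)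

lemma mod_hom_iff: "f \<in> mod_hom A M N \<longleftrightarrow> lin M N f \<and> f \<in> extensional (carrier M)"
  by (auto simp: mod_hom_def lin_def PiE_def)

lemma mod_hom_lin: "f \<in> mod_hom A M N \<Longrightarrow> lin M N f"
  by (simp add: mod_hom_iff)

lemma lin_cong: "lin M N f \<Longrightarrow> module A M \<Longrightarrow> (\<And>x. x \<in> carrier M \<Longrightarrow> f x = g x) \<Longrightarrow> lin M N g"
proof -
  assume f: "lin M N f" and M: "module A M" and eq: "\<And>x. x \<in> carrier M \<Longrightarrow> f x = g x"
  interpret M: module A M by fact
  show ?thesis using f unfolding lin_def by (auto simp: eq[symmetric] Pi_def)
qed

lemma lin_restrict: "lin M N f \<Longrightarrow> module A M \<Longrightarrow> restrict f (carrier M) \<in> mod_hom A M N"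
  by (simp add: mod_hom_iff) (erule (1) lin_cong, simp)

lemma lin_zero:
  assumes "lin M N f" "module A M" "module A N" shows "f \<zero>\<^bsub>M\<^esub> = \<zero>\<^bsub>N\<^esub>"
proof -
  interpret M: module A M by fact
  interpret N: module A N by fact
  have "f (\<zero> \<odot>\<^bsub>M\<^esub> \<zero>\<^bsub>M\<^esub>) = \<zero> \<odot>\<^bsub>N\<^esub> f \<zero>\<^bsub>M\<^esub>" using assms(1) by (intro lin_smult) auto
  thus ?thesis using lin_closed[OF assms(1)] by simp
qed

lemma lin_neg:
  assumes "lin M N f" "module A M" "module A N" "x \<in> carrier M"
  shows "f (\<ominus>\<^bsub>M\<^esub> x) = \<ominus>\<^bsub>N\<^esub> f x"
proof -
  interpret M: module A M by fact
  interpret N: module A N by fact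
  have "f (\<ominus>\<^bsub>M\<^esub> x) \<oplus>\<^bsub>N\<^esub> f x = f (\<ominus>\<^bsub>M\<^esub> x \<oplus>\<^bsub>M\<^esub> x)"
    using lin_add[OF assms(1), of "\<ominus>\<^bsub>M\<^esub> x" x] assms(4) by simp
  also have "\<dots> = \<zero>\<^bsub>N\<^esub>" using assms(4) lin_zero[OF assms(1-3)] by (simp add: M.l_neg)
  finally show ?thesis using lin_closed[OF assms(1)] assms(4) N.minus_equality by auto
qed

lemma lin_minus:
  assumes "lin M N f" "module A M" "module A N" "x \<in> carrier M" "y \<in> carrier M"
  shows "f (x \<ominus>\<^bsub>M\<^esub> y) = f x \<ominus>\<^bsub>N\<^esub> f y"
proof -
  interpret M: module A M by fact
  show ?thesis using assms by (simp add: a_minus_def lin_add[OF assms(1)] lin_neg[OF assms(1)])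
qed

lemma lin_comp: "lin M N f \<Longrightarrow> lin N P g \<Longrightarrow> lin M P (\<lambda>x. g (f x))"
  unfolding lin_def by (auto simp: Pi_def)

lemma lin_id: "lin M M (\<lambda>x. x)"
  by (auto simp: lin_def)

lemma lin_plus:
  assumes "lin M N f" "lin M N g" "module A M" "module A N"
  shows "lin M N (\<lambda>x. f x \<oplus>\<^bsub>N\<^esub> g x)"
proof -
  interpret N: module A N by fact
  show ?thesis using assms(1,2) unfolding lin_def
    by (auto simp: Pi_def N.smult_r_distr N.a_ac)
qed

lemma lin_uminus:
  assumes "lin M N f" "module A N"
  shows "lin M N (\<lambda>x. \<ominus>\<^bsub>N\<^esub> f x)"
proof -
  interpret N: module A N by fact
  show ?thesis using assms(1) unfolding lin_def
    by (auto simp: Pi_def N.minus_add N.smult_r_minus)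
qed

lemma lin_scale:
  assumes "lin M N f" "module A N" "a \<in> carrier A"
  shows "lin M N (\<lambda>x. a \<odot>\<^bsub>N\<^esub> f x)"
proof -
  interpret N: module A N by fact
  have "a \<odot>\<^bsub>N\<^esub> (b \<odot>\<^bsub>N\<^esub> x) = b \<odot>\<^bsub>N\<^esub> (a \<odot>\<^bsub>N\<^esub> x)" if "b \<in> carrier A" "x \<in> carrier N" for b x
    using that assms(3) by (metis m_comm N.smult_assoc1)
  then show ?thesis using assms(1,3) unfolding lin_def
    by (auto simp: Pi_def N.smult_r_distr)
qed

lemma lin_const_zero: "module A N \<Longrightarrow> lin M N (\<lambda>x. \<zero>\<^bsub>N\<^esub>)"
proof -
  assume "module A N"
  then interpret N: module A N .
  show ?thesis unfolding lin_def by (auto simp: Pi_def)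
qed

section \<open>The ring as a module, powers of modules, free modules\<close>

lemma self_simps [simp]:
  "carrier (self_mod A) = carrier A" "\<zero>\<^bsub>self_mod A\<^esub> = \<zero>" "x \<oplus>\<^bsub>self_mod A\<^esub> y = x \<oplus> y"
  "a \<odot>\<^bsub>self_mod A\<^esub> x = a \<otimes> x" "\<ominus>\<^bsub>self_mod A\<^esub> x = \<ominus> x" "finsum (self_mod A) = finsum A"
  by (simp_all add: self_mod_def a_inv_def finsum_def m_inv_def finprod_def fun_eq_iff)

lemma module_self: "module A (self_mod A)"
proof (rule moduleI)
  show "abelian_group (self_mod A)"
    by (rule abelian_groupI) (auto simp: a_ac intro: exI[of _ "\<ominus> _"] bexI[of _ "\<ominus> _"] l_neg)
qed (auto simp: l_distr r_distr m_assoc is_cring)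

lemma pow_carrier:
  "v \<in> carrier (pow_mod N S) \<longleftrightarrow> (\<forall>s\<in>S. v s \<in> carrier N) \<and> (\<forall>s. s \<notin> S \<longrightarrow> v s = \<zero>\<^bsub>N\<^esub>)"
  by (simp add: pow_mod_def)

lemma pow_simps [simp]:
  "\<zero>\<^bsub>pow_mod N S\<^esub> = (\<lambda>_. \<zero>\<^bsub>N\<^esub>)" "u \<oplus>\<^bsub>pow_mod N S\<^esub> v = (\<lambda>s. u s \<oplus>\<^bsub>N\<^esub> v s)"
  "a \<odot>\<^bsub>pow_mod N S\<^esub> v = (\<lambda>s. a \<odot>\<^bsub>N\<^esub> v s)"
  by (simp_all add: pow_mod_def)

lemma pow_at: "module A N \<Longrightarrow> v \<in> carrier (pow_mod N S) \<Longrightarrow> v s \<in> carrier N"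
  by (cases "s \<in> S") (auto simp: pow_carrier module_def abelian_group_def abelian_monoid.zero_closed)

lemma module_pow:
  assumes "module A N" shows "module A (pow_mod N S)"
proof -
  interpret N: module A N by fact
  have at: "(\<And>s. v s \<in> carrier N)" if "v \<in> carrier (pow_mod N S)" for v
    using pow_at[OF assms that] by blast
  show ?thesis
  proof (rule moduleI)
    show "abelian_group (pow_mod N S)"
    proof (rule abelian_groupI)
      fix x assume x: "x \<in> carrier (pow_mod N S)"
      have "(\<lambda>s. \<ominus>\<^bsub>N\<^esub> x s) \<in> carrier (pow_mod N S)" using x by (auto simp: pow_carrier)
      thus "\<exists>y\<in>carrier (pow_mod N S). y \<oplus>\<^bsub>pow_mod N S\<^esub> x = \<zero>\<^bsub>pow_mod N S\<^esub>"
        using at[OF x] by (intro bexI) (simp_all add: N.l_neg)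
    next
      fix x y assume *: "x \<in> carrier (pow_mod N S)" "y \<in> carrier (pow_mod N S)"
      show "x \<oplus>\<^bsub>pow_mod N S\<^esub> y \<in> carrier (pow_mod N S)" using * by (auto simp: pow_carrier)
      show "x \<oplus>\<^bsub>pow_mod N S\<^esub> y = y \<oplus>\<^bsub>pow_mod N S\<^esub> x"
        using at[OF *(1)] at[OF *(2)] by (simp add: fun_eq_iff N.a_comm)
      fix z assume **: "z \<in> carrier (pow_mod N S)"
      show "x \<oplus>\<^bsub>pow_mod N S\<^esub> y \<oplus>\<^bsub>pow_mod N S\<^esub> z = x \<oplus>\<^bsub>pow_mod N S\<^esub> (y \<oplus>\<^bsub>pow_mod N S\<^esub> z)"
        using at[OF *(1)] at[OF *(2)] at[OF **] by (simp add: fun_eq_iff N.a_assoc)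
    next
      fix x assume x: "x \<in> carrier (pow_mod N S)"
      show "\<zero>\<^bsub>pow_mod N S\<^esub> \<oplus>\<^bsub>pow_mod N S\<^esub> x = x" using at[OF x] by (simp add: fun_eq_iff)
    qed (simp add: pow_carrier)
  next
    fix a x assume *: "a \<in> carrier A" "x \<in> carrier (pow_mod N S)"
    show "a \<odot>\<^bsub>pow_mod N S\<^esub> x \<in> carrier (pow_mod N S)" using * by (auto simp: pow_carrier)
    fix b assume b: "b \<in> carrier A"
    show "(a \<oplus> b) \<odot>\<^bsub>pow_mod N S\<^esub> x = a \<odot>\<^bsub>pow_mod N S\<^esub> x \<oplus>\<^bsub>pow_mod N S\<^esub> b \<odot>\<^bsub>pow_mod N S\<^esub> x"
      and "a \<otimes> b \<odot>\<^bsub>pow_mod N S\<^esub> x = a \<odot>\<^bsub>pow_mod N S\<^esub> (b \<odot>\<^bsub>pow_mod N S\<^esub> x)"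
      using * b at[OF *(2)] by (simp_all add: fun_eq_iff N.smult_l_distr N.smult_assoc1)
  next
    fix a x y assume *: "a \<in> carrier A" "x \<in> carrier (pow_mod N S)" "y \<in> carrier (pow_mod N S)"
    show "a \<odot>\<^bsub>pow_mod N S\<^esub> (x \<oplus>\<^bsub>pow_mod N S\<^esub> y) = a \<odot>\<^bsub>pow_mod N S\<^esub> x \<oplus>\<^bsub>pow_mod N S\<^esub> a \<odot>\<^bsub>pow_mod N S\<^esub> y"
      using * at[OF *(2)] at[OF *(3)] by (simp add: fun_eq_iff N.smult_r_distr)
  next
    fix x assume x: "x \<in> carrier (pow_mod N S)"
    show "\<one> \<odot>\<^bsub>pow_mod N S\<^esub> x = x" using at[OF x] by (simp add: fun_eq_iff)
  qed (rule is_cring)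
qed

lemma pow_neg:
  assumes "module A N" "v \<in> carrier (pow_mod N S)"
  shows "\<ominus>\<^bsub>pow_mod N S\<^esub> v = (\<lambda>s. \<ominus>\<^bsub>N\<^esub> v s)"
proof -
  interpret N: module A N by fact
  interpret P: module A "pow_mod N S" by (rule module_pow) fact
  have "(\<lambda>s. \<ominus>\<^bsub>N\<^esub> v s) \<in> carrier (pow_mod N S)" using assms by (auto simp: pow_carrier)
  moreover have "(\<lambda>s. \<ominus>\<^bsub>N\<^esub> v s) \<oplus>\<^bsub>pow_mod N S\<^esub> v = \<zero>\<^bsub>pow_mod N S\<^esub>"
    using pow_at[OF assms] by (simp add: N.l_neg)
  ultimately show ?thesis using P.minus_equality assms(2) by blast
qed

lemma pow_minus:
  assumes "module A N" "v \<in> carrier (pow_mod N S)"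
  shows "u \<ominus>\<^bsub>pow_mod N S\<^esub> v = (\<lambda>s. u s \<ominus>\<^bsub>N\<^esub> v s)"
  using pow_neg[OF assms] by (simp add: a_minus_def)

text \<open>Free modules as powers of A: facts about powers of N then serve both a free module and
  its tensor product with N. For finite \<open>S\<close> this is \<open>free_mod A S\<close>; for
  infinite \<open>S\<close> it is the full product.\<close>

abbreviation fr :: "'s set \<Rightarrow> ('a, 's \<Rightarrow> 'a) module" where
  "fr S \<equiv> pow_mod (self_mod A) S"

lemma free_mod_eq: "finite S \<Longrightarrow> free_mod A S = fr S"
proof -
  assume S: "finite S"
  have "finite {s. v s \<noteq> \<zero>}" if "\<forall>s. s \<notin> S \<longrightarrow> v s = \<zero>" for v
    by (rule finite_subset[OF _ S]) (use that in auto)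
  then show ?thesis by (auto simp: free_mod_def pow_mod_def)
qed

lemma module_fr: "module A (fr S)"
  by (intro module_pow module_self)

lemma single_in:
  assumes "module A N" "s \<in> S" "n \<in> carrier N" shows "single N s n \<in> carrier (pow_mod N S)"
proof -
  interpret N: module A N by fact
  show ?thesis using assms by (auto simp: pow_carrier single_def)
qed

lemma unit_vec_single: "unit_vec A s = single (self_mod A) s \<one>"
  by (auto simp: unit_vec_def single_def)

lemma unit_vec_in: "s \<in> S \<Longrightarrow> unit_vec A s \<in> carrier (fr S)"
  by (auto simp: unit_vec_def pow_carrier)

lemma single_smult_unit: "a \<in> carrier A \<Longrightarrow> single (self_mod A) s a = a \<odot>\<^bsub>fr S\<^esub> unit_vec A s"
  by (auto simp: unit_vec_def single_def)

text \<open>For finite \<open>S\<close> every vector is a sum of vectors with a single nonzero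
  coordinate; the coordinates are cleared one at a time.\<close>

lemma pow_induct [consumes 3, case_names zero single add]:
  assumes N: "module A N" and S: "finite S" and v: "v \<in> carrier (pow_mod N S)"
    and zero: "P (\<lambda>_. \<zero>\<^bsub>N\<^esub>)"
    and single: "\<And>s n. s \<in> S \<Longrightarrow> n \<in> carrier N \<Longrightarrow> P (single N s n)"
    and add: "\<And>u v. u \<in> carrier (pow_mod N S) \<Longrightarrow> v \<in> carrier (pow_mod N S) \<Longrightarrow> P u \<Longrightarrow> P v \<Longrightarrow>
       P (u \<oplus>\<^bsub>pow_mod N S\<^esub> v)"
  shows "P v"
proof -
  interpret N: module A N by fact
  have "P v" if "finite T" "T \<subseteq> S" "v \<in> carrier (pow_mod N T)" for T v
    using that
  proof (induction T arbitrary: v)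
    case empty
    hence "v = (\<lambda>_. \<zero>\<^bsub>N\<^esub>)" by (auto simp: pow_carrier)
    thus ?case using zero by simp
  next
    case (insert t T)
    let ?u = "v(t := \<zero>\<^bsub>N\<^esub>)"
    have u: "?u \<in> carrier (pow_mod N T)" using insert.prems insert.hyps by (auto simp: pow_carrier)
    have 1: "P ?u" using insert.IH u insert.prems by blast
    have u': "?u \<in> carrier (pow_mod N S)" using insert.prems by (auto simp: pow_carrier)
    have s: "v t \<in> carrier N" by (rule pow_at[OF N insert.prems(2)])
    have t: "t \<in> S" using insert.prems by blast
    have "v s \<in> carrier N" for s by (rule pow_at[OF N insert.prems(2)])
    then have eq: "v = single N t (v t) \<oplus>\<^bsub>pow_mod N S\<^esub> ?u"
      by (simp add: single_def fun_eq_iff)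
    show ?case by (subst eq) (rule add[OF single_in[OF N t s] u' single[OF t s] 1])
  qed
  thus ?thesis using S v by blast
qed

lemma pow_lin_ext:
  assumes "module A N" "finite S" "module A P" "lin (pow_mod N S) P f" "lin (pow_mod N S) P g"
    and "\<And>s n. s \<in> S \<Longrightarrow> n \<in> carrier N \<Longrightarrow> f (single N s n) = g (single N s n)"
    and v: "v \<in> carrier (pow_mod N S)"
  shows "f v = g v"
  using assms(1,2) v
proof (induction rule: pow_induct)
  case zero
  have P: "module A (pow_mod N S)" by (rule module_pow) fact
  show ?case using lin_zero[OF assms(4) P assms(3)] lin_zero[OF assms(5) P assms(3)] by simp
next
  case (single s n) thus ?case by (rule assms(6))
next
  case (add u v) thus ?case by (simp add: lin_add[OF assms(4)] lin_add[OF assms(5)] del: pow_simps)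
qed

lemma fr_lin_ext:
  assumes "finite S" "module A P" "lin (fr S) P f" "lin (fr S) P g"
    and "\<And>s. s \<in> S \<Longrightarrow> f (unit_vec A s) = g (unit_vec A s)"
    and v: "v \<in> carrier (fr S)"
  shows "f v = g v"
proof (rule pow_lin_ext[OF module_self assms(1-4) _ v])
  fix s n assume "s \<in> S" "n \<in> carrier (self_mod A)"
  thus "f (single (self_mod A) s n) = g (single (self_mod A) s n)"
    using assms(5) unit_vec_in[of s S]
    by (simp add: single_smult_unit[of n s S] lin_smult[OF assms(3)] lin_smult[OF assms(4)] del: pow_simps)
qed

text \<open>The map \<open>f \<otimes> N\<close> from \<open>N\<^sup>S\<close> to \<open>N\<^sup>T\<close>, read off from the matrix of \<open>f\<close>.\<close>

definition act :: "('a, 'n) module \<Rightarrow> 's set \<Rightarrow> (('s \<Rightarrow> 'a) \<Rightarrow> ('t \<Rightarrow> 'a)) \<Rightarrow> ('s \<Rightarrow> 'n) \<Rightarrow> 't \<Rightarrow> 'n" where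
  "act N S f v = (\<lambda>i. \<Oplus>\<^bsub>N\<^esub>k\<in>S. f (unit_vec A k) i \<odot>\<^bsub>N\<^esub> v k)"

lemma act_lin:
  assumes N: "module A N" and S: "finite S" and f: "lin (fr S) (fr S') f"
  shows "lin (pow_mod N S) (pow_mod N S') (act N S f)"
proof -
  interpret N: module A N by fact
  have fc: "f (unit_vec A k) i \<in> carrier A" if "k \<in> S" for k i
    using pow_at[OF module_self lin_closed[OF f unit_vec_in[OF that]]] by simp
  have f0: "f (unit_vec A k) i = \<zero>" if "k \<in> S" "i \<notin> S'" for k i
    using lin_closed[OF f unit_vec_in[OF that(1)]] that by (simp add: pow_carrier)
  have at: "(\<And>s. v s \<in> carrier N)" if "v \<in> carrier (pow_mod N S)" for v
    using pow_at[OF N that] by blast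
  show ?thesis unfolding lin_def
  proof (intro conjI ballI funcsetI)
    fix v assume v: "v \<in> carrier (pow_mod N S)"
    have 1: "(\<lambda>k. f (unit_vec A k) i \<odot>\<^bsub>N\<^esub> v k) \<in> S \<rightarrow> carrier N" for i
      using at[OF v] fc by auto
    have "act N S f v i = \<zero>\<^bsub>N\<^esub>" if "i \<notin> S'" for i
      unfolding act_def using at[OF v] that by (intro N.add.finprod_one_eqI) (simp add: f0)
    then show "act N S f v \<in> carrier (pow_mod N S')" unfolding pow_carrier
      using N.finsum_closed[OF 1] by (simp add: act_def)
  next
    fix u v assume *: "u \<in> carrier (pow_mod N S)" "v \<in> carrier (pow_mod N S)"
    have 1: "(\<lambda>k. f (unit_vec A k) i \<odot>\<^bsub>N\<^esub> v k) \<in> S \<rightarrow> carrier N"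
       "(\<lambda>k. f (unit_vec A k) i \<odot>\<^bsub>N\<^esub> u k) \<in> S \<rightarrow> carrier N" for i
      using at[OF *(1)] at[OF *(2)] fc by auto
    show "act N S f (u \<oplus>\<^bsub>pow_mod N S\<^esub> v) = act N S f u \<oplus>\<^bsub>pow_mod N S'\<^esub> act N S f v"
      unfolding act_def pow_simps
      by (rule ext, subst N.finsum_addf[symmetric, OF 1(2) 1(1)], rule N.finsum_cong')
         (use at[OF *(1)] at[OF *(2)] fc in \<open>auto simp: N.smult_r_distr\<close>)
  next
    fix a v assume v: "a \<in> carrier A" "v \<in> carrier (pow_mod N S)"
    have 1: "(\<lambda>k. f (unit_vec A k) i \<odot>\<^bsub>N\<^esub> v k) \<in> S \<rightarrow> carrier N" for i
      using at[OF v(2)] fc by auto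
    have *: "x \<odot>\<^bsub>N\<^esub> (a \<odot>\<^bsub>N\<^esub> n) = a \<odot>\<^bsub>N\<^esub> (x \<odot>\<^bsub>N\<^esub> n)" if "x \<in> carrier A" "n \<in> carrier N" for x n
      using that v(1) by (metis m_comm N.smult_assoc1)
    show "act N S f (a \<odot>\<^bsub>pow_mod N S\<^esub> v) = a \<odot>\<^bsub>pow_mod N S'\<^esub> act N S f v"
      unfolding act_def pow_simps
      by (rule ext, subst N.finsum_smult_ldistr[OF S v(1) 1], rule N.finsum_cong')
         (use v(1) at[OF v(2)] fc in \<open>auto simp: *\<close>)
  qed
qed

lemma act_single:
  assumes N: "module A N" and S: "finite S" and f: "lin (fr S) (fr S') f"
    and s: "s \<in> S" and n: "n \<in> carrier N"
  shows "act N S f (single N s n) = (\<lambda>i. f (unit_vec A s) i \<odot>\<^bsub>N\<^esub> n)"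
proof
  interpret N: module A N by fact
  fix i
  have fc: "f (unit_vec A k) i \<in> carrier A" if "k \<in> S" for k
    using pow_at[OF module_self lin_closed[OF f unit_vec_in[OF that]]] by simp
  have "act N S f (single N s n) i = (\<Oplus>\<^bsub>N\<^esub>k\<in>S. if s = k then f (unit_vec A k) i \<odot>\<^bsub>N\<^esub> n else \<zero>\<^bsub>N\<^esub>)"
    unfolding act_def by (rule N.finsum_cong') (auto simp: single_def fc n)
  also have "\<dots> = f (unit_vec A s) i \<odot>\<^bsub>N\<^esub> n"
    using N.finsum_singleton[OF s S, of "\<lambda>k. f (unit_vec A k) i \<odot>\<^bsub>N\<^esub> n"] fc n by auto
  finally show "act N S f (single N s n) i = f (unit_vec A s) i \<odot>\<^bsub>N\<^esub> n" .
qed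

text \<open>The tensor x tensor n under the identification of A^S tensor N with N^S.\<close>

definition pure_tens :: "('a, 'n) module \<Rightarrow> 'n \<Rightarrow> ('s \<Rightarrow> 'a) \<Rightarrow> 's \<Rightarrow> 'n" where
  "pure_tens N n x = (\<lambda>i. x i \<odot>\<^bsub>N\<^esub> n)"

lemma pure_tens_lin:
  assumes N: "module A N" and n: "n \<in> carrier N"
  shows "lin (fr S) (pow_mod N S) (pure_tens N n)"
proof -
  interpret N: module A N by fact
  note at = pow_at[OF module_self, simplified]
  show ?thesis unfolding lin_def pure_tens_def
    using n by (auto simp: pow_carrier fun_eq_iff N.smult_assoc1 at intro!: N.smult_l_distr)
qed

lemma pure_tens_single:
  assumes N: "module A N" and n: "n \<in> carrier N"
  shows "pure_tens N n (single (self_mod A) s a) = single N s (a \<odot>\<^bsub>N\<^esub> n)"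
proof -
  interpret N: module A N by fact
  show ?thesis using n by (auto simp: pure_tens_def single_def fun_eq_iff)
qed

text \<open>The rule for f tensor id: x tensor n goes to f x tensor n. It ties \<open>act\<close> to
  \<open>tensor_map\<close>, which is specified by its values on such tensors.\<close>

lemma act_pure_tens:
  assumes N: "module A N" and S: "finite S" and f: "lin (fr S) (fr S') f"
    and n: "n \<in> carrier N" and x: "x \<in> carrier (fr S)"
  shows "act N S f (pure_tens N n x) = pure_tens N n (f x)"
proof -
  interpret N: module A N by fact
  show ?thesis
  proof (rule fr_lin_ext[OF S _ _ _ _ x, where P = "pow_mod N S'"])
    show "module A (pow_mod N S')" by (rule module_pow) fact
    show "lin (fr S) (pow_mod N S') (\<lambda>x. act N S f (pure_tens N n x))"
      by (rule lin_comp[OF pure_tens_lin[OF N n] act_lin[OF N S f]])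
    show "lin (fr S) (pow_mod N S') (\<lambda>x. pure_tens N n (f x))"
      by (rule lin_comp[OF f pure_tens_lin[OF N n]])
    fix s assume "s \<in> S"
    thus "act N S f (pure_tens N n (unit_vec A s)) = pure_tens N n (f (unit_vec A s))"
      by (simp add: unit_vec_single pure_tens_single[OF N n] n act_single[OF N S f])
         (simp add: unit_vec_single pure_tens_def)
  qed
qed

text \<open>Matrix multiplication without matrices: it suffices to compare both sides on vectors
  with one coordinate, and there \<open>act N S f\<close> produces a pure tensor, on which
  \<open>act N S' g\<close> is known.\<close>

lemma act_comp:
  assumes N: "module A N" and S: "finite S" "finite S'" and f: "lin (fr S) (fr S') f"
    and g: "lin (fr S') (fr S'') g" and v: "v \<in> carrier (pow_mod N S)"
  shows "act N S (\<lambda>x. g (f x)) v = act N S' g (act N S f v)"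
proof -
  have gf: "lin (fr S) (fr S'') (\<lambda>x. g (f x))" by (rule lin_comp[OF f g])
  show ?thesis
  proof (rule pow_lin_ext[OF N S(1) _ _ _ _ v, where P = "pow_mod N S''"])
    show "module A (pow_mod N S'')" by (rule module_pow[OF N])
    show "lin (pow_mod N S) (pow_mod N S'') (act N S (\<lambda>x. g (f x)))" by (rule act_lin[OF N S(1) gf])
    show "lin (pow_mod N S) (pow_mod N S'') (\<lambda>v. act N S' g (act N S f v))"
      by (rule lin_comp[OF act_lin[OF N S(1) f] act_lin[OF N S(2) g]])
    fix s n assume *: "s \<in> S" "n \<in> carrier N"
    have "act N S' g (act N S f (single N s n)) = act N S' g (pure_tens N n (f (unit_vec A s)))"
      using * by (simp add: act_single[OF N S(1) f] pure_tens_def)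
    also have "\<dots> = pure_tens N n (g (f (unit_vec A s)))"
      using * by (intro act_pure_tens[OF N S(2) g] lin_closed[OF f] unit_vec_in)
    finally show "act N S (\<lambda>x. g (f x)) (single N s n) = act N S' g (act N S f (single N s n))"
      using * by (simp add: act_single[OF N S(1) gf] pure_tens_def)
  qed
qed

lemma act_cong:
  assumes N: "module A N" and f: "lin (fr S) (fr S') f"
    and "\<And>x. x \<in> carrier (fr S) \<Longrightarrow> f x = g x" and v: "v \<in> carrier (pow_mod N S)"
  shows "act N S f v = act N S g v"
proof -
  interpret N: module A N by fact
  have "f (unit_vec A k) i \<in> carrier A" if "k \<in> S" for k i
    using pow_at[OF module_self lin_closed[OF f unit_vec_in[OF that]]] by simp
  then show ?thesis unfolding act_def
    using assms(3)[OF unit_vec_in] pow_at[OF N v] by (intro ext N.finsum_cong') auto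
qed

lemma act_id:
  assumes N: "module A N" and S: "finite S" and v: "v \<in> carrier (pow_mod N S)"
  shows "act N S (\<lambda>x. x) v = v"
proof -
  interpret N: module A N by fact
  show ?thesis
  proof (rule pow_lin_ext[OF N S module_pow[OF N] act_lin[OF N S lin_id] lin_id _ v])
    fix s n assume *: "s \<in> S" "n \<in> carrier N"
    show "act N S (\<lambda>x. x) (single N s n) = single N s n"
      using * act_single[OF N S lin_id *] by (auto simp: single_def unit_vec_def)
  qed
qed

lemma act_plus:
  assumes N: "module A N" and S: "finite S" and f: "lin (fr S) (fr S') f" and g: "lin (fr S) (fr S') g"
    and v: "v \<in> carrier (pow_mod N S)"
  shows "act N S (\<lambda>x. f x \<oplus>\<^bsub>fr S'\<^esub> g x) v = act N S f v \<oplus>\<^bsub>pow_mod N S'\<^esub> act N S g v"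
proof -
  interpret N: module A N by fact
  have fg: "lin (fr S) (fr S') (\<lambda>x. f x \<oplus>\<^bsub>fr S'\<^esub> g x)" by (rule lin_plus[OF f g module_fr module_fr])
  show ?thesis
  proof (rule pow_lin_ext[OF N S module_pow[OF N] act_lin[OF N S fg] _ _ v])
    show "lin (pow_mod N S) (pow_mod N S') (\<lambda>v. act N S f v \<oplus>\<^bsub>pow_mod N S'\<^esub> act N S g v)"
      by (intro lin_plus module_pow N act_lin S f g)
    fix s n assume *: "s \<in> S" "n \<in> carrier N"
    have "f (unit_vec A s) i \<in> carrier A" "g (unit_vec A s) i \<in> carrier A" for i
      using pow_at[OF module_self lin_closed[OF f unit_vec_in[OF *(1)]]]
        pow_at[OF module_self lin_closed[OF g unit_vec_in[OF *(1)]]] by simp_all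
    then show "act N S (\<lambda>x. f x \<oplus>\<^bsub>fr S'\<^esub> g x) (single N s n) = act N S f (single N s n) \<oplus>\<^bsub>pow_mod N S'\<^esub> act N S g (single N s n)"
      using * by (simp add: act_single[OF N S f *] act_single[OF N S g *] act_single[OF N S fg *, simplified] N.smult_l_distr)
  qed
qed

lemma act_uminus:
  assumes N: "module A N" and S: "finite S" and f: "lin (fr S) (fr S') f"
    and v: "v \<in> carrier (pow_mod N S)"
  shows "act N S (\<lambda>x. \<ominus>\<^bsub>fr S'\<^esub> f x) v = \<ominus>\<^bsub>pow_mod N S'\<^esub> act N S f v"
proof -
  interpret N: module A N by fact
  have fg: "lin (fr S) (fr S') (\<lambda>x. \<ominus>\<^bsub>fr S'\<^esub> f x)" by (rule lin_uminus[OF f module_fr])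
  show ?thesis
  proof (rule pow_lin_ext[OF N S module_pow[OF N] act_lin[OF N S fg] _ _ v])
    show "lin (pow_mod N S) (pow_mod N S') (\<lambda>v. \<ominus>\<^bsub>pow_mod N S'\<^esub> act N S f v)"
      by (intro lin_uminus module_pow N act_lin S f)
    fix s n assume *: "s \<in> S" "n \<in> carrier N"
    have "f (unit_vec A s) i \<in> carrier A" for i
      using pow_at[OF module_self lin_closed[OF f unit_vec_in[OF *(1)]]] by simp
    moreover have "act N S f (single N s n) \<in> carrier (pow_mod N S')"
      by (rule lin_closed[OF act_lin[OF N S f] single_in[OF N *]])
    ultimately show "act N S (\<lambda>x. \<ominus>\<^bsub>fr S'\<^esub> f x) (single N s n) = \<ominus>\<^bsub>pow_mod N S'\<^esub> act N S f (single N s n)"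
      using * by (simp add: pow_neg[OF N] act_single[OF N S f *] act_single[OF N S fg *])
         (simp add: pow_neg[OF module_self lin_closed[OF f unit_vec_in[OF *(1)]]] N.smult_l_minus)
  qed
qed

text \<open>With N = A nothing changes, so that exactness of a resolution is itself a case of
  vanishing homology with coefficients.\<close>

lemma act_self:
  assumes S: "finite S" and f: "lin (fr S) (fr S') f" and v: "v \<in> carrier (fr S)"
  shows "act (self_mod A) S f v = f v"
proof (rule fr_lin_ext[OF S module_fr act_lin[OF module_self S f] f _ v])
  fix s assume s: "s \<in> S"
  have "f (unit_vec A s) i \<in> carrier A" for i
    using pow_at[OF module_self lin_closed[OF f unit_vec_in[OF s]]] by simp
  thus "act (self_mod A) S f (unit_vec A s) = f (unit_vec A s)"
    using act_single[OF module_self S f s, of \<one>] by (simp add: unit_vec_single)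
qed

end

subsection \<open>Submodules, Noetherian modules and Nakayama's lemma\<close>

lemma sub_subset: "submodule U A N \<Longrightarrow> U \<subseteq> carrier N"
  using subgroup.subset[of U "add_monoid N"] by (simp add: submodule_def)

lemma sub_in: "submodule U A N \<Longrightarrow> x \<in> U \<Longrightarrow> x \<in> carrier N"
  using sub_subset by blast

lemma sub_zero: "submodule U A N \<Longrightarrow> \<zero>\<^bsub>N\<^esub> \<in> U"
  using subgroup.one_closed[of U "add_monoid N"] by (simp add: submodule_def)

lemma sub_add: "submodule U A N \<Longrightarrow> x \<in> U \<Longrightarrow> y \<in> U \<Longrightarrow> x \<oplus>\<^bsub>N\<^esub> y \<in> U"
  using subgroup.m_closed[of U "add_monoid N"] by (simp add: submodule_def)

lemma sub_neg: "submodule U A N \<Longrightarrow> x \<in> U \<Longrightarrow> \<ominus>\<^bsub>N\<^esub> x \<in> U"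
  using subgroup.m_inv_closed[of U "add_monoid N"] by (simp add: submodule_def a_inv_def)

lemma sub_minus: "submodule U A N \<Longrightarrow> x \<in> U \<Longrightarrow> y \<in> U \<Longrightarrow> x \<ominus>\<^bsub>N\<^esub> y \<in> U"
  by (simp add: a_minus_def sub_add sub_neg)

lemma sub_smult: "submodule U A N \<Longrightarrow> a \<in> carrier A \<Longrightarrow> x \<in> U \<Longrightarrow> a \<odot>\<^bsub>N\<^esub> x \<in> U"
  by (rule submodule.smult_closed)

context local_noeth
begin

lemma self_minus [simp]: "x \<ominus>\<^bsub>self_mod A\<^esub> y = x \<ominus> y"
  by (simp add: a_minus_def)

lemma pow_mono: "module A N \<Longrightarrow> S \<subseteq> T \<Longrightarrow> carrier (pow_mod N S) \<subseteq> carrier (pow_mod N T)"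
proof
  fix v assume "module A N" "S \<subseteq> T" and v: "v \<in> carrier (pow_mod N S)"
  then show "v \<in> carrier (pow_mod N T)" using pow_at[OF _ v] v by (auto simp: pow_carrier)
qed

lemma lin_mono:
  assumes "module A N" "S \<subseteq> T" "lin (pow_mod N T) P e" shows "lin (pow_mod N S) P e"
  unfolding lin_def
proof (intro conjI ballI funcsetI)
  note sub = subsetD[OF pow_mono[OF assms(1,2)]]
  fix x assume x: "x \<in> carrier (pow_mod N S)"
  show "e x \<in> carrier P" by (rule lin_closed[OF assms(3) sub[OF x]])
  show "e (x \<oplus>\<^bsub>pow_mod N S\<^esub> y) = e x \<oplus>\<^bsub>P\<^esub> e y" if "y \<in> carrier (pow_mod N S)" for y
    using lin_add[OF assms(3) sub[OF x] sub[OF that]] by simp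
  show "e (a \<odot>\<^bsub>pow_mod N S\<^esub> x) = a \<odot>\<^bsub>P\<^esub> e x" if "a \<in> carrier A" for a
    using lin_smult[OF assms(3) that sub[OF x]] by simp
qed

lemma minus_add_cancel:
  assumes "module A N" "x \<in> carrier N" "y \<in> carrier N"
  shows "(x \<ominus>\<^bsub>N\<^esub> y) \<oplus>\<^bsub>N\<^esub> y = x"
proof -
  interpret N: module A N by fact
  show ?thesis using assms(2,3) by (simp add: a_minus_def N.a_assoc N.l_neg)
qed

lemma minus_zero_right: "module A N \<Longrightarrow> x \<in> carrier N \<Longrightarrow> x \<ominus>\<^bsub>N\<^esub> \<zero>\<^bsub>N\<^esub> = x"
proof -
  assume N: "module A N" and x: "x \<in> carrier N"
  interpret N: module A N by fact
  show ?thesis using minus_add_cancel[OF N x N.zero_closed] x by simp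
qed

lemma subI:
  assumes "module A N" "U \<subseteq> carrier N" "\<zero>\<^bsub>N\<^esub> \<in> U"
    "\<And>x y. x \<in> U \<Longrightarrow> y \<in> U \<Longrightarrow> x \<oplus>\<^bsub>N\<^esub> y \<in> U"
    "\<And>a x. a \<in> carrier A \<Longrightarrow> x \<in> U \<Longrightarrow> a \<odot>\<^bsub>N\<^esub> x \<in> U"
  shows "submodule U A N"
proof -
  interpret N: module A N by fact
  have "\<ominus>\<^bsub>N\<^esub> x \<in> U" if "x \<in> U" for x
  proof -
    have "(\<ominus> \<one>) \<odot>\<^bsub>N\<^esub> x = \<ominus>\<^bsub>N\<^esub> x" using that assms(2) by (subst N.smult_l_minus) auto
    then show ?thesis using assms(5)[of "\<ominus> \<one>" x] that by simp
  qed
  then show ?thesis using assms by (intro N.submoduleI) auto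
qed

lemma sub_carrier: "module A N \<Longrightarrow> submodule (carrier N) A N"
  by (rule module.carrier_is_submodule)

lemma sub_triv: "module A N \<Longrightarrow> submodule {\<zero>\<^bsub>N\<^esub>} A N"
proof -
  assume N: "module A N"
  then interpret N: module A N .
  show ?thesis by (rule subI[OF N]) auto
qed

lemma sub_image:
  assumes "module A M" "module A N" "lin M N f" "submodule U A M"
  shows "submodule (f ` U) A N"
proof (rule subI[OF assms(2)])
  show "f ` U \<subseteq> carrier N" using lin_closed[OF assms(3)] sub_in[OF assms(4)] by auto
  show "\<zero>\<^bsub>N\<^esub> \<in> f ` U" using lin_zero[OF assms(3,1,2)] sub_zero[OF assms(4)] by (metis imageI)
next
  fix x y assume "x \<in> f ` U" "y \<in> f ` U"
  then obtain u v where *: "u \<in> U" "v \<in> U" "x = f u" "y = f v" by blast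
  then have "x \<oplus>\<^bsub>N\<^esub> y = f (u \<oplus>\<^bsub>M\<^esub> v)" using sub_in[OF assms(4)] by (simp add: lin_add[OF assms(3)])
  then show "x \<oplus>\<^bsub>N\<^esub> y \<in> f ` U" using * sub_add[OF assms(4)] by blast
next
  fix a x assume a: "a \<in> carrier A" and "x \<in> f ` U"
  then obtain u where *: "u \<in> U" "x = f u" by blast
  then have "a \<odot>\<^bsub>N\<^esub> x = f (a \<odot>\<^bsub>M\<^esub> u)" using a sub_in[OF assms(4)] by (simp add: lin_smult[OF assms(3)])
  then show "a \<odot>\<^bsub>N\<^esub> x \<in> f ` U" using * a sub_smult[OF assms(4)] by blast
qed

lemma sub_preimage:
  assumes "module A M" "module A N" "lin M N f" "submodule U A N"
  shows "submodule {x \<in> carrier M. f x \<in> U} A M"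
proof -
  interpret M: module A M by fact
  show ?thesis
    by (rule subI[OF assms(1)])
      (auto simp: lin_zero[OF assms(3,1,2)] lin_add[OF assms(3)] lin_smult[OF assms(3)]
        sub_add[OF assms(4)] sub_smult[OF assms(4)] sub_zero[OF assms(4)])
qed

section \<open>Spans, linear combinations and free covers\<close>

lemma span_incl: "S \<subseteq> mod_span A N S"
  by (auto simp: mod_span_def)

lemma span_least: "submodule U A N \<Longrightarrow> S \<subseteq> U \<Longrightarrow> mod_span A N S \<subseteq> U"
  by (auto simp: mod_span_def)

lemma span_sub:
  assumes "module A N" "S \<subseteq> carrier N" shows "submodule (mod_span A N S) A N"
proof -
  interpret N: module A N by fact
  show ?thesis
  proof (rule subI[OF assms(1)])
    show "mod_span A N S \<subseteq> carrier N" by (intro span_least sub_carrier assms)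
  qed (auto simp: mod_span_def sub_zero sub_add sub_smult)
qed

lemma span_mono: "S \<subseteq> T \<Longrightarrow> mod_span A N S \<subseteq> mod_span A N T"
  by (auto simp: mod_span_def)

definition lin_comb :: "('a, 'n) module \<Rightarrow> 's set \<Rightarrow> ('s \<Rightarrow> 'n) \<Rightarrow> ('s \<Rightarrow> 'a) \<Rightarrow> 'n" where
  "lin_comb N S b v = (\<Oplus>\<^bsub>N\<^esub>k\<in>S. v k \<odot>\<^bsub>N\<^esub> b k)"

lemma lin_comb_lin:
  assumes N: "module A N" and S: "finite S" and b: "b \<in> S \<rightarrow> carrier N"
  shows "lin (fr S) N (lin_comb N S b)"
proof -
  interpret N: module A N by fact
  have at: "(\<And>s. v s \<in> carrier A)" if "v \<in> carrier (fr S)" for v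
    using pow_at[OF module_self that] by simp
  have 1: "(\<lambda>k. v k \<odot>\<^bsub>N\<^esub> b k) \<in> S \<rightarrow> carrier N" if "v \<in> carrier (fr S)" for v
    using at[OF that] b by auto
  show ?thesis unfolding lin_def
  proof (intro conjI ballI funcsetI)
    fix v assume v: "v \<in> carrier (fr S)"
    show "lin_comb N S b v \<in> carrier N" unfolding lin_comb_def using N.finsum_closed[OF 1[OF v]] .
  next
    fix u v assume *: "u \<in> carrier (fr S)" "v \<in> carrier (fr S)"
    show "lin_comb N S b (u \<oplus>\<^bsub>fr S\<^esub> v) = lin_comb N S b u \<oplus>\<^bsub>N\<^esub> lin_comb N S b v"
      unfolding lin_comb_def pow_simps
      by (subst N.finsum_addf[symmetric, OF 1[OF *(1)] 1[OF *(2)]], rule N.finsum_cong')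
         (use at[OF *(1)] at[OF *(2)] b in \<open>auto simp: N.smult_l_distr Pi_def\<close>)
  next
    fix a v assume v: "a \<in> carrier A" "v \<in> carrier (fr S)"
    show "lin_comb N S b (a \<odot>\<^bsub>fr S\<^esub> v) = a \<odot>\<^bsub>N\<^esub> lin_comb N S b v"
      unfolding lin_comb_def pow_simps
      by (subst N.finsum_smult_ldistr[OF S v(1) 1[OF v(2)]], rule N.finsum_cong')
         (use v(1) at[OF v(2)] b in \<open>auto simp: N.smult_assoc1 Pi_def\<close>)
  qed
qed

lemma lin_comb_unit:
  assumes N: "module A N" and S: "finite S" and b: "b \<in> S \<rightarrow> carrier N" and s: "s \<in> S"
  shows "lin_comb N S b (unit_vec A s) = b s"
proof -
  interpret N: module A N by fact
  have "lin_comb N S b (unit_vec A s) = (\<Oplus>\<^bsub>N\<^esub>k\<in>S. if s = k then b k else \<zero>\<^bsub>N\<^esub>)"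
    unfolding lin_comb_def by (rule N.finsum_cong') (use b s in \<open>auto simp: unit_vec_def Pi_def\<close>)
  also have "\<dots> = b s" by (rule N.finsum_singleton[OF s S b])
  finally show ?thesis .
qed

lemma lin_ex:
  assumes N: "module A N" and S: "finite S" and b: "\<And>s. s \<in> S \<Longrightarrow> b s \<in> carrier N"
  obtains f where "lin (fr S) N f" "\<And>s. s \<in> S \<Longrightarrow> f (unit_vec A s) = b s"
  using lin_comb_lin[OF N S, of b] lin_comb_unit[OF N S, of b] b by blast

text \<open>The generators are numbered, so that the covering module lives on functions of naturals,
  the type in which minimal resolutions are defined.\<close>

lemma span_lin_ex:
  assumes N: "module A N" and B: "finite B" "B \<subseteq> carrier N"
  obtains r :: nat and e where "lin (fr {..<r}) N e" "e ` carrier (fr {..<r}) = mod_span A N B"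
proof -
  obtain r :: nat and b where b: "bij_betw b {..<r} B"
    using ex_bij_betw_nat_finite[OF B(1)] by (metis atLeast0LessThan)
  have bB: "b s \<in> B" if "s \<in> {..<r}" for s using b that by (auto simp: bij_betw_def)
  obtain e where e: "lin (fr {..<r}) N e" "\<And>s. s \<in> {..<r} \<Longrightarrow> e (unit_vec A s) = b s"
    using lin_ex[OF N, of "{..<r}" b] bB B(2) by blast
  have sub: "submodule (e ` carrier (fr {..<r})) A N"
    by (rule sub_image[OF module_fr N e(1) sub_carrier[OF module_fr]])
  have "e ` carrier (fr {..<r}) = mod_span A N B"
  proof
    show "mod_span A N B \<subseteq> e ` carrier (fr {..<r})"
    proof (rule span_least[OF sub], rule subsetI)
      fix x assume "x \<in> B"
      then obtain s where s: "s \<in> {..<r}" "b s = x" using b by (auto simp: bij_betw_def)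
      thus "x \<in> e ` carrier (fr {..<r})"
        using e(2)[OF s(1)] unit_vec_in[OF s(1)] by (metis imageI)
    qed
  next
    have sp: "submodule (mod_span A N B) A N" by (rule span_sub[OF N B(2)])
    show "e ` carrier (fr {..<r}) \<subseteq> mod_span A N B"
    proof (rule image_subsetI)
      fix v assume v: "v \<in> carrier (fr {..<r})"
      show "e v \<in> mod_span A N B" using module_self finite_lessThan v
      proof (induction rule: pow_induct)
        case zero
        then show ?case using lin_zero[OF e(1) module_fr N] sub_zero[OF sp] by simp
      next
        case (single s n)
        then have "e (n \<odot>\<^bsub>fr {..<r}\<^esub> unit_vec A s) = n \<odot>\<^bsub>N\<^esub> b s"
          using e(2) unit_vec_in[OF single(1)] by (subst lin_smult[OF e(1)]) auto
        moreover have "b s \<in> mod_span A N B" by (rule subsetD[OF span_incl bB[OF single(1)]])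
        ultimately show ?case using single single_smult_unit[of n s "{..<r}"] sub_smult[OF sp] by simp
      next
        case (add u v) then show ?case using sub_add[OF sp] by (simp add: lin_add[OF e(1)] del: pow_simps)
      qed
    qed
  qed
  with e(1) show ?thesis by (rule that)
qed

lemma fg_lin_ex:
  assumes "fg_module A N"
  obtains r :: nat and e where "lin (fr {..<r}) N e" "e ` carrier (fr {..<r}) = carrier N"
  using assms span_lin_ex unfolding fg_module_def by metis

lemma fg_module_D: "fg_module A N \<Longrightarrow> module A N"
  by (simp add: fg_module_def)

section \<open>Noetherian modules\<close>

lemma ideal_iff_sub: "ideal I A \<longleftrightarrow> submodule I A (self_mod A)"
proof
  assume I: "ideal I A"
  then interpret I: ideal I A .
  show "submodule I A (self_mod A)"
    by (rule subI[OF module_self]) (auto simp: I.I_l_closed)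
next
  assume I: "submodule I A (self_mod A)"
  have "\<ominus> x \<in> I" if "x \<in> I" for x using sub_neg[OF I that] by simp
  then have "subgroup I (add_monoid A)"
    using sub_in[OF I] sub_zero[OF I] sub_add[OF I] by (intro add.subgroupI) (auto simp: a_inv_def)
  moreover have "x \<otimes> a \<in> I" "a \<otimes> x \<in> I" if "a \<in> I" "x \<in> carrier A" for a x
    using sub_smult[OF I that(2,1)] sub_in[OF I that(1)] that m_comm[of a x] by simp_all
  ultimately show "ideal I A" by (intro idealI) (auto intro: ring_axioms)
qed

text \<open>Induction on the rank: the last coordinates of the elements of \<open>U\<close> form a
  finitely generated ideal. Elements of \<open>U\<close> lifting its generators, together with
  generators of the part of \<open>U\<close> with last coordinate zero, generate
  \<open>U\<close>.\<close>

lemma noetherian_free: "submodule U A (fr {..<n::nat}) \<Longrightarrow> \<exists>B. finite B \<and> B \<subseteq> U \<and> mod_span A (fr {..<n}) B = U"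
proof (induction n arbitrary: U)
  case 0
  have "U \<subseteq> {\<zero>\<^bsub>fr {..<0::nat}\<^esub>}"
  proof
    fix u assume "u \<in> U"
    then have "u \<in> carrier (fr {..<0::nat})" using sub_in[OF 0] by blast
    then show "u \<in> {\<zero>\<^bsub>fr {..<0::nat}\<^esub>}" by (auto simp: pow_carrier)
  qed
  then have U: "U = {\<zero>\<^bsub>fr {..<0::nat}\<^esub>}" using sub_zero[OF 0] by blast
  have "mod_span A (fr {..<0::nat}) U \<subseteq> U" by (rule span_least[OF 0]) simp
  moreover have "U \<subseteq> mod_span A (fr {..<0::nat}) U" by (rule span_incl)
  moreover have "finite U" using U by simp
  ultimately show ?case by blast
next
  case (Suc n)
  let ?F = "fr {..<Suc n}"
  note U = Suc.prems
  have Uat: "u s \<in> carrier A" if "u \<in> U" for u s using pow_at[OF module_self sub_in[OF U that]] by simp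
  have I: "submodule ((\<lambda>u. u n) ` U) A (self_mod A)"
    by (rule sub_image[OF module_fr module_self _ U]) (auto simp: lin_def pow_carrier)
  then have "ideal ((\<lambda>u. u n) ` U) A" by (simp only: ideal_iff_sub)
  from finetely_gen[OF this] obtain C where C: "C \<subseteq> carrier A" "finite C" "(\<lambda>u. u n) ` U = Idl C"
    by blast
  have "C \<subseteq> (\<lambda>u. u n) ` U" using C genideal_self by auto
  then have "\<forall>c\<in>C. \<exists>u. u \<in> U \<and> u n = c" by blast
  then obtain g where g: "\<And>c. c \<in> C \<Longrightarrow> g c \<in> U" "\<And>c. c \<in> C \<Longrightarrow> g c n = c" by metis
  let ?U = "{u \<in> U. u n = \<zero>}"
  have mem: "u \<in> carrier (fr {..<n}) \<longleftrightarrow> u \<in> carrier ?F \<and> u n = \<zero>" for u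
    by (auto simp: pow_carrier less_Suc_eq)
  have "submodule ?U A (fr {..<n})"
    using sub_add[OF U] sub_smult[OF U] sub_zero[OF U] sub_in[OF U]
    by (intro subI[OF module_fr]) (auto simp: mem)
  from Suc.IH[OF this] obtain B where B: "finite B" "B \<subseteq> ?U" "mod_span A (fr {..<n}) B = ?U" by blast
  let ?W = "mod_span A ?F (g ` C \<union> B)"
  have gCB: "g ` C \<union> B \<subseteq> U" using B g by auto
  then have W: "submodule ?W A ?F" using sub_in[OF U] by (intro span_sub[OF module_fr]) auto
  have WU: "?W \<subseteq> U" using span_least[OF U gCB] .
  have "U \<subseteq> ?W"
  proof
    fix u assume u: "u \<in> U"
    have J: "submodule ((\<lambda>u. u n) ` ?W) A (self_mod A)"
      by (rule sub_image[OF module_fr module_self _ W]) (auto simp: lin_def pow_carrier)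
    have "C \<subseteq> (\<lambda>u. u n) ` ?W"
    proof
      fix c assume c: "c \<in> C"
      have "g c \<in> ?W" using c span_incl[of "g ` C \<union> B" ?F] by blast
      then show "c \<in> (\<lambda>u. u n) ` ?W" using g(2)[OF c] by (metis imageI)
    qed
    then have "Idl C \<subseteq> (\<lambda>u. u n) ` ?W" by (rule genideal_minimal[OF J[folded ideal_iff_sub]])
    \<comment> \<open>The last coordinates attained on \<open>?W\<close> form an ideal containing
      \<open>C\<close>, hence all last coordinates of \<open>U\<close>. So some \<open>w\<close> in
      \<open>?W\<close> agrees with \<open>u\<close> there, and the difference falls under the
      induction hypothesis.\<close>
    then obtain w where w: "w \<in> ?W" "w n = u n" using imageI[OF u, of "\<lambda>u. u n"] unfolding C(3) by force
    have wU: "w \<in> U" using w WU by blast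
    have d: "u \<ominus>\<^bsub>?F\<^esub> w \<in> U" by (rule sub_minus[OF U u wU])
    have "(u \<ominus>\<^bsub>?F\<^esub> w) n = \<zero>" using w pow_minus[OF module_self sub_in[OF U wU]] Uat[OF u]
      by (simp add: a_minus_def r_neg)
    then have d': "u \<ominus>\<^bsub>?F\<^esub> w \<in> mod_span A (fr {..<n}) B" using d B(3) by simp
    have "submodule (?W \<inter> carrier (fr {..<n})) A (fr {..<n})"
      using sub_add[OF W] sub_smult[OF W] sub_zero[OF W] sub_in[OF W]
      by (intro subI[OF module_fr]) (auto simp: mem)
    moreover have "B \<subseteq> ?W \<inter> carrier (fr {..<n})"
      using B(2) span_incl[of "g ` C \<union> B" ?F] sub_in[OF U] by (auto simp: mem)
    ultimately have "u \<ominus>\<^bsub>?F\<^esub> w \<in> ?W" using d' span_least by blast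
    then have "(u \<ominus>\<^bsub>?F\<^esub> w) \<oplus>\<^bsub>?F\<^esub> w \<in> ?W" using w(1) by (rule sub_add[OF W])
    moreover have "(u \<ominus>\<^bsub>?F\<^esub> w) \<oplus>\<^bsub>?F\<^esub> w = u"
      by (rule minus_add_cancel[OF module_fr sub_in[OF U u] sub_in[OF U wU]])
    ultimately show "u \<in> ?W" by simp
  qed
  then have "?W = U" using WU by blast
  moreover have "finite (g ` C \<union> B)" using B C by simp
  ultimately show ?case using gCB by blast
qed

text \<open>The preimage of \<open>U\<close> in a free module covering \<open>N\<close> is finitely
  generated, and its generators are carried to generators of \<open>U\<close>.\<close>

lemma noetherian_fg:
  assumes "fg_module A N" "submodule U A N"
  shows "\<exists>B. finite B \<and> B \<subseteq> U \<and> mod_span A N B = U"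
proof -
  have N: "module A N" by (rule fg_module_D) fact
  obtain n :: nat and e where e: "lin (fr {..<n}) N e" "e ` carrier (fr {..<n}) = carrier N"
    using fg_lin_ex[OF assms(1)] by blast
  let ?V = "{x \<in> carrier (fr {..<n}). e x \<in> U}"
  obtain B where B: "finite B" "B \<subseteq> ?V" "mod_span A (fr {..<n}) B = ?V"
    using noetherian_free[OF sub_preimage[OF module_fr N e(1) assms(2)]] by blast
  have eB: "e ` B \<subseteq> U" using B(2) by auto
  have s: "submodule (mod_span A N (e ` B)) A N" using eB sub_in[OF assms(2)] by (intro span_sub[OF N]) auto
  have "?V \<subseteq> {x \<in> carrier (fr {..<n}). e x \<in> mod_span A N (e ` B)}"
    unfolding B(3)[symmetric] using B(2) span_incl[of "e ` B" N]
    by (intro span_least[OF sub_preimage[OF module_fr N e(1) s]]) auto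
  note V = this
  have "U \<subseteq> mod_span A N (e ` B)"
  proof
    fix u assume u: "u \<in> U"
    have "u \<in> e ` carrier (fr {..<n})" unfolding e(2) by (rule sub_in[OF assms(2) u])
    then obtain x where "x \<in> carrier (fr {..<n})" "u = e x" by blast
    then show "u \<in> mod_span A N (e ` B)" using V u by blast
  qed
  then show ?thesis using eB B(1) span_least[OF assms(2) eB] by blast
qed

text \<open>Zorn's lemma: the union of a chain is a finitely generated submodule, its generators lie
  in one member of the chain, and so the union is that member. In this way it belongs to the family,
  of which no closure property is assumed.\<close>

lemma maximal_submodule_exists:
  assumes "fg_module A N" "\<F> \<noteq> {}" "\<And>U. U \<in> \<F> \<Longrightarrow> submodule U A N"
  shows "\<exists>W\<in>\<F>. \<forall>U\<in>\<F>. W \<subseteq> U \<longrightarrow> U = W"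
proof -
  have N: "module A N" by (rule fg_module_D) fact
  show ?thesis
  proof (rule subset_Zorn_nonempty[OF assms(2)])
    fix \<C> assume C: "\<C> \<noteq> {}" "subset.chain \<F> \<C>"
    then have CF: "\<C> \<subseteq> \<F>" and tot: "\<And>X Y. X \<in> \<C> \<Longrightarrow> Y \<in> \<C> \<Longrightarrow> X \<subseteq> Y \<or> Y \<subseteq> X"
      by (auto simp: subset_chain_def)
    have sm: "submodule X A N" if "X \<in> \<C>" for X using that CF assms(3) by blast
    have "submodule (\<Union>\<C>) A N"
    proof (rule subI[OF N])
      show "\<Union>\<C> \<subseteq> carrier N" using sub_subset[OF sm] by blast
      obtain X where X: "X \<in> \<C>" using C(1) by blast
      show "\<zero>\<^bsub>N\<^esub> \<in> \<Union>\<C>" using sub_zero[OF sm[OF X]] X by blast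
    next
      fix x y assume "x \<in> \<Union>\<C>" "y \<in> \<Union>\<C>"
      then obtain X Y where XY: "X \<in> \<C>" "Y \<in> \<C>" "x \<in> X" "y \<in> Y" by blast
      from tot[OF XY(1,2)] show "x \<oplus>\<^bsub>N\<^esub> y \<in> \<Union>\<C>"
      proof
        assume "X \<subseteq> Y"
        then show ?thesis using sub_add[OF sm[OF XY(2)] _ XY(4), of x] XY by blast
      next
        assume "Y \<subseteq> X"
        then show ?thesis using sub_add[OF sm[OF XY(1)] XY(3), of y] XY by blast
      qed
    next
      fix a x assume a: "a \<in> carrier A" and "x \<in> \<Union>\<C>"
      then obtain X where X: "X \<in> \<C>" "x \<in> X" by blast
      then show "a \<odot>\<^bsub>N\<^esub> x \<in> \<Union>\<C>" using sub_smult[OF sm[OF X(1)] a X(2)] by blast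
    qed
    from noetherian_fg[OF assms(1) this] obtain B
      where B: "finite B" "B \<subseteq> \<Union>\<C>" "mod_span A N B = \<Union>\<C>" by blast
    obtain X where X: "X \<in> \<C>" "B \<subseteq> X"
      using finite_subset_Union_chain[OF B(1,2) C] by blast
    have "\<Union>\<C> \<subseteq> X" unfolding B(3)[symmetric] by (rule span_least[OF sm[OF X(1)] X(2)])
    then have "\<Union>\<C> = X" using X by blast
    then show "\<Union>\<C> \<in> \<F>" using X CF by auto
  qed
qed

lemma fg_self: "fg_module A (self_mod A)"
proof -
  have "mod_span A (self_mod A) {\<one>} = carrier (self_mod A)"
  proof
    show "mod_span A (self_mod A) {\<one>} \<subseteq> carrier (self_mod A)"
      by (rule span_least[OF sub_carrier[OF module_self]]) simp
    have s: "submodule (mod_span A (self_mod A) {\<one>}) A (self_mod A)"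
      by (rule span_sub[OF module_self]) simp
    show "carrier (self_mod A) \<subseteq> mod_span A (self_mod A) {\<one>}"
    proof
      fix x assume "x \<in> carrier (self_mod A)"
      then show "x \<in> mod_span A (self_mod A) {\<one>}"
        using sub_smult[OF s, of x \<one>] span_incl[of "{\<one>}" "self_mod A"] by simp
    qed
  qed
  then show ?thesis unfolding fg_module_def using module_self by (intro conjI exI[of _ "{\<one>}"]) auto
qed

section \<open>The maximal ideal, units and Nakayama's lemma\<close>

abbreviation \<mm> :: "'a set" where "\<mm> \<equiv> max_ideal A"

lemma max_ideal_max: "maximalideal \<mm> A"
  unfolding max_ideal_def using theI'[OF unique_maximal_ideal] .

lemma mm_sub: "submodule \<mm> A (self_mod A)"
  using max_ideal_max maximalideal.axioms(1) ideal_iff_sub by blast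

lemma mm_in: "x \<in> \<mm> \<Longrightarrow> x \<in> carrier A"
  using sub_in[OF mm_sub] by simp

lemma mm_zero: "\<zero> \<in> \<mm>" using sub_zero[OF mm_sub] by simp

lemma mm_add: "x \<in> \<mm> \<Longrightarrow> y \<in> \<mm> \<Longrightarrow> x \<oplus> y \<in> \<mm>" using sub_add[OF mm_sub] by simp

lemma mm_mult: "a \<in> carrier A \<Longrightarrow> y \<in> \<mm> \<Longrightarrow> a \<otimes> y \<in> \<mm>" using sub_smult[OF mm_sub] by simp

lemma mm_one: "\<one> \<notin> \<mm>"
proof
  assume "\<one> \<in> \<mm>"
  then have "\<mm> = carrier A" using mm_mult[of _ \<one>] mm_in by force
  then show False using max_ideal_max maximalideal.I_notcarr by blast
qed

text \<open>Among the proper ideals containing a non-unit \<open>a\<close> there is a maximal one;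
  it is a maximal ideal, hence the only one, and it contains \<open>a\<close>.\<close>

lemma mm_unit:
  assumes "a \<in> carrier A" "a \<notin> \<mm>" shows "a \<in> Units A"
proof (rule ccontr)
  assume nu: "a \<notin> Units A"
  let ?\<F> = "{I. submodule I A (self_mod A) \<and> a \<in> I \<and> I \<noteq> carrier A}"
  have "\<one> \<notin> PIdl a"
  proof
    assume "\<one> \<in> PIdl a"
    then obtain x where "x \<in> carrier A" "\<one> = x \<otimes> a" by (auto simp: cgenideal_def)
    then have "a \<in> Units A" using assms(1) m_comm[of x a] by (auto simp: Units_def)
    then show False using nu by simp
  qed
  then have "PIdl a \<in> ?\<F>"
    using cgenideal_ideal[OF assms(1)] cgenideal_self[OF assms(1)] ideal_iff_sub by auto
  then have "?\<F> \<noteq> {}" by blast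
  from maximal_submodule_exists[OF fg_self this]
  obtain W where W: "W \<in> ?\<F>" "\<And>U. U \<in> ?\<F> \<Longrightarrow> W \<subseteq> U \<Longrightarrow> U = W" by blast
  have "maximalideal W A"
  proof (rule maximalidealI)
    fix J assume "ideal J A" "W \<subseteq> J" "J \<subseteq> carrier A"
    then show "J = W \<or> J = carrier A" using W ideal_iff_sub by blast
  qed (use W ideal_iff_sub in auto)
  then have "W = \<mm>" using max_ideal_max unique_maximal_ideal by blast
  then show False using W assms by blast
qed

lemma min_gens:
  assumes N: "module A N" and U: "submodule U A N" and S0: "finite S0" and e: "lin (fr S0) N e"
  shows "\<exists>S\<subseteq>S0. (\<forall>x\<in>carrier (fr S0). \<exists>y\<in>carrier (fr S). e x \<ominus>\<^bsub>N\<^esub> e y \<in> U) \<and>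
     (\<forall>x\<in>carrier (fr S). e x \<in> U \<longrightarrow> (\<forall>k. x k \<in> \<mm>))"
  using S0 e
proof (induction S0 rule: finite_psubset_induct)
  case (psubset S0)
  interpret N: module A N by fact
  note e = psubset.prems
  show ?case
  proof (cases "\<forall>x\<in>carrier (fr S0). e x \<in> U \<longrightarrow> (\<forall>k. x k \<in> \<mm>)")
    case True
    have "e x \<ominus>\<^bsub>N\<^esub> e x \<in> U" if "x \<in> carrier (fr S0)" for x
      using lin_closed[OF e that] sub_zero[OF U] by (simp add: a_minus_def N.r_neg)
    then show ?thesis using True by (intro exI[of _ S0]) blast
  next
    case False
    then obtain x k where x: "x \<in> carrier (fr S0)" "e x \<in> U" "x k \<notin> \<mm>" by blast
    have xk: "x k \<in> carrier A" using pow_at[OF module_self x(1)] by simp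
    have k: "k \<in> S0" using x mm_zero by (auto simp: pow_carrier)
    let ?S = "S0 - {k}"
    have un: "x k \<in> Units A" by (rule mm_unit[OF xk x(3)])
    have sub: "y \<in> carrier (fr ?S) \<longleftrightarrow> y \<in> carrier (fr S0) \<and> y k = \<zero>" for y
      using k by (auto simp: pow_carrier)
    have "lin (fr ?S) N e" using lin_mono[OF module_self _ e, of ?S] by blast
    then obtain S where S: "S \<subseteq> ?S"
        "\<And>y. y \<in> carrier (fr ?S) \<Longrightarrow> \<exists>z\<in>carrier (fr S). e y \<ominus>\<^bsub>N\<^esub> e z \<in> U"
        "\<forall>x\<in>carrier (fr S). e x \<in> U \<longrightarrow> (\<forall>k. x k \<in> \<mm>)"
      using psubset.IH[of ?S] k by blast
    interpret F: module A "fr S0" by (rule module_fr)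
    have "\<exists>z\<in>carrier (fr S). e y \<ominus>\<^bsub>N\<^esub> e z \<in> U" if y: "y \<in> carrier (fr S0)" for y
    proof -
      have yk: "y k \<in> carrier A" using pow_at[OF module_self y] by simp
      \<comment> \<open>\<open>c\<close> is chosen so that subtracting \<open>c\<close> times the
        relation \<open>x\<close> clears coordinate \<open>k\<close> and changes \<open>e y\<close>
        only by an element of \<open>U\<close>.\<close>
      define c where "c = y k \<otimes> inv (x k)"
      have c: "c \<in> carrier A" "c \<otimes> x k = y k" using un yk xk by (auto simp: c_def m_assoc)
      define y' where "y' = y \<ominus>\<^bsub>fr S0\<^esub> c \<odot>\<^bsub>fr S0\<^esub> x"
      have cx: "c \<odot>\<^bsub>fr S0\<^esub> x \<in> carrier (fr S0)" using c x(1) by blast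
      have y'0: "y' \<in> carrier (fr S0)" unfolding y'_def using y cx by blast
      have "y' k = \<zero>" using pow_minus[OF module_self cx] c yk by (simp add: y'_def a_minus_def r_neg)
      then have "y' \<in> carrier (fr ?S)" using y'0 by (simp add: sub)
      then obtain z where z: "z \<in> carrier (fr S)" "e y' \<ominus>\<^bsub>N\<^esub> e z \<in> U" using S(2) by blast
      have z0: "z \<in> carrier (fr S0)" using z(1) S(1) pow_mono[OF module_self, of S S0] by blast
      have 1: "e y' = e y \<ominus>\<^bsub>N\<^esub> c \<odot>\<^bsub>N\<^esub> e x"
        unfolding y'_def lin_minus[OF e module_fr N y cx] lin_smult[OF e c(1) x(1)] ..
      have ec: "e x \<in> carrier N" "e y \<in> carrier N" "e z \<in> carrier N" using lin_closed[OF e] x(1) y z0 by auto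
      have "(e y' \<ominus>\<^bsub>N\<^esub> e z) \<oplus>\<^bsub>N\<^esub> c \<odot>\<^bsub>N\<^esub> e x \<in> U"
        by (rule sub_add[OF U z(2) sub_smult[OF U c(1) x(2)]])
      moreover have "(e y' \<ominus>\<^bsub>N\<^esub> e z) \<oplus>\<^bsub>N\<^esub> c \<odot>\<^bsub>N\<^esub> e x = e y \<ominus>\<^bsub>N\<^esub> e z"
        unfolding 1 a_minus_def using ec c(1) by (simp add: N.a_ac N.r_neg2 N.r_neg1 N.r_neg)
      ultimately show ?thesis using z(1) by auto
    qed
    then show ?thesis using S by blast
  qed
qed

text \<open>The hypothesis \<open>gen\<close> says N = U + mN. If \<open>U\<close> were proper, take
  a maximal proper submodule \<open>W\<close> containing it. Then N/W is simple and killed by the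
  maximal ideal, so \<open>W\<close> contains both \<open>U\<close> and mN.\<close>

lemma Nakayama:
  assumes fg: "fg_module A N" and U: "submodule U A N"
    and gen: "\<And>n. n \<in> carrier N \<Longrightarrow> \<exists>w\<in>ideal_smult A \<mm> N. n \<ominus>\<^bsub>N\<^esub> w \<in> U"
  shows "U = carrier N"
proof (rule ccontr)
  assume nU: "U \<noteq> carrier N"
  have N: "module A N" by (rule fg_module_D[OF fg])
  interpret N: module A N by fact
  define F where "F = {W. submodule W A N \<and> U \<subseteq> W \<and> W \<noteq> carrier N}"
  have "submodule V A N" if "V \<in> F" for V using that by (simp add: F_def)
  moreover have "F \<noteq> {}" using U nU by (auto simp: F_def)
  ultimately obtain W where WF: "W \<in> F" and max: "\<forall>V\<in>F. W \<subseteq> V \<longrightarrow> V = W" using maximal_submodule_exists[OF fg, of F] by blast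
  then have W: "submodule W A N" "U \<subseteq> W" "W \<noteq> carrier N" by (simp_all add: F_def)
  have W0: "z \<ominus>\<^bsub>N\<^esub> \<zero>\<^bsub>N\<^esub> \<in> W \<longleftrightarrow> z \<in> W" if "z \<in> carrier N" for z unfolding minus_zero_right[OF N that] ..
  have mW: "a \<odot>\<^bsub>N\<^esub> n \<in> W" if a: "a \<in> \<mm>" and n: "n \<in> carrier N" for a n
  proof (rule ccontr)
    assume an: "a \<odot>\<^bsub>N\<^esub> n \<notin> W"
    have aA: "a \<in> carrier A" by (rule mm_in[OF a])
    let ?y = "a \<odot>\<^bsub>N\<^esub> n"
    have y: "?y \<in> carrier N" using aA n by blast
    \<comment> \<open>This is W + Ay; it exceeds \<open>W\<close> because it contains
      \<open>y\<close>, so it is all of \<open>N\<close> by maximality.\<close>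
    let ?V = "{w \<in> carrier N. \<exists>b\<in>carrier A. w \<ominus>\<^bsub>N\<^esub> b \<odot>\<^bsub>N\<^esub> ?y \<in> W}"
    have V: "submodule ?V A N"
    proof (rule subI[OF N])
      show "\<zero>\<^bsub>N\<^esub> \<in> ?V" using sub_zero[OF W(1)] y W0 by (auto intro!: bexI[of _ \<zero>])
    next
      fix u v assume "u \<in> ?V" "v \<in> ?V"
      then obtain b c where *: "u \<in> carrier N" "v \<in> carrier N" "b \<in> carrier A" "c \<in> carrier A"
        "u \<ominus>\<^bsub>N\<^esub> b \<odot>\<^bsub>N\<^esub> ?y \<in> W" "v \<ominus>\<^bsub>N\<^esub> c \<odot>\<^bsub>N\<^esub> ?y \<in> W" by blast
      have "(u \<oplus>\<^bsub>N\<^esub> v) \<ominus>\<^bsub>N\<^esub> (b \<oplus> c) \<odot>\<^bsub>N\<^esub> ?y = (u \<ominus>\<^bsub>N\<^esub> b \<odot>\<^bsub>N\<^esub> ?y) \<oplus>\<^bsub>N\<^esub> (v \<ominus>\<^bsub>N\<^esub> c \<odot>\<^bsub>N\<^esub> ?y)"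
        using * y by (simp add: a_minus_def N.smult_l_distr N.minus_add N.a_ac)
      then show "u \<oplus>\<^bsub>N\<^esub> v \<in> ?V" using * sub_add[OF W(1) *(5,6)] by (auto intro!: bexI[of _ "b \<oplus> c"])
    next
      fix c u assume "c \<in> carrier A" "u \<in> ?V"
      then obtain b where *: "c \<in> carrier A" "u \<in> carrier N" "b \<in> carrier A" "u \<ominus>\<^bsub>N\<^esub> b \<odot>\<^bsub>N\<^esub> ?y \<in> W" by blast
      have "c \<odot>\<^bsub>N\<^esub> u \<ominus>\<^bsub>N\<^esub> (c \<otimes> b) \<odot>\<^bsub>N\<^esub> ?y = c \<odot>\<^bsub>N\<^esub> (u \<ominus>\<^bsub>N\<^esub> b \<odot>\<^bsub>N\<^esub> ?y)"
        using * y by (simp add: a_minus_def N.smult_assoc1 N.smult_r_distr N.smult_r_minus)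
      then show "c \<odot>\<^bsub>N\<^esub> u \<in> ?V" using * sub_smult[OF W(1) *(1,4)] by (auto intro!: bexI[of _ "c \<otimes> b"])
    qed auto
    have WV: "W \<subseteq> ?V" using sub_in[OF W(1)] y W0 by (auto intro!: bexI[of _ \<zero>])
    have yV: "?y \<in> ?V" using y sub_zero[OF W(1)] by (auto intro!: bexI[of _ \<one>] simp: a_minus_def N.r_neg)
    have "?V = carrier N"
    proof (rule ccontr)
      assume "?V \<noteq> carrier N"
      then have "?V \<in> F" using V W(2) WV unfolding F_def by blast
      then show False using max WV yV an by blast
    qed
    then obtain b where b: "b \<in> carrier A" "n \<ominus>\<^bsub>N\<^esub> b \<odot>\<^bsub>N\<^esub> ?y \<in> W" using n by blast
    \<comment> \<open>From n = b a n modulo \<open>W\<close> follows (1 - ba) n = 0 modulo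
      \<open>W\<close>; as ba is in the maximal ideal, 1 - ba is a unit.\<close>
    define u where "u = \<one> \<ominus> b \<otimes> a"
    have "u \<notin> \<mm>"
    proof
      assume "u \<in> \<mm>"
      then have "u \<oplus> b \<otimes> a \<in> \<mm>" using mm_add mm_mult[OF b(1) a] by blast
      moreover have "u \<oplus> b \<otimes> a = \<one>" using b(1) aA by (simp add: u_def a_minus_def a_assoc l_neg)
      ultimately show False using mm_one by simp
    qed
    then have un: "u \<in> Units A" using b(1) aA by (intro mm_unit) (auto simp: u_def)
    have "u \<odot>\<^bsub>N\<^esub> n = n \<ominus>\<^bsub>N\<^esub> b \<odot>\<^bsub>N\<^esub> ?y" using b(1) aA n
      by (simp add: u_def a_minus_def N.smult_l_distr N.smult_l_minus N.smult_assoc1)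
    then have "inv u \<odot>\<^bsub>N\<^esub> (u \<odot>\<^bsub>N\<^esub> n) \<in> W" using sub_smult[OF W(1) _ b(2)] un by simp
    then have "n \<in> W" using un n Units_closed[OF un] by (simp add: N.smult_assoc1[symmetric])
    then show False using an sub_smult[OF W(1) aA] by blast
  qed
  have "{a \<odot>\<^bsub>N\<^esub> x | a x. a \<in> \<mm> \<and> x \<in> carrier N} \<subseteq> W" using mW by blast
  then have I: "ideal_smult A \<mm> N \<subseteq> W" unfolding ideal_smult_def by (rule span_least[OF W(1)])
  have "n \<in> W" if n: "n \<in> carrier N" for n
  proof -
    obtain w where w: "w \<in> ideal_smult A \<mm> N" "n \<ominus>\<^bsub>N\<^esub> w \<in> U" using gen[OF n] by blast
    have wW: "w \<in> W" using w(1) I by blast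
    have "(n \<ominus>\<^bsub>N\<^esub> w) \<oplus>\<^bsub>N\<^esub> w \<in> W" using w(2) W(2) by (intro sub_add[OF W(1) _ wW]) blast
    then show ?thesis unfolding minus_add_cancel[OF N n sub_in[OF W(1) wW]] .
  qed
  then show False using W(3) sub_subset[OF W(1)] by blast
qed

subsection \<open>Depth modulo a submodule\<close>

text \<open>Quotients \<open>N/U\<close> are avoided, since dividing repeatedly changes the carrier type: regular elements,
  the socle and depth of \<open>N/U\<close> are all expressed in \<open>N\<close>, relative to \<open>U\<close>. Division by \<open>x\<close> replaces \<open>U\<close> by
  \<open>U + xN\<close>.\<close>

definition reg :: "('a, 'n) module \<Rightarrow> 'n set \<Rightarrow> 'a \<Rightarrow> bool" where
  "reg N U x \<longleftrightarrow> (\<forall>n\<in>carrier N. x \<odot>\<^bsub>N\<^esub> n \<in> U \<longrightarrow> n \<in> U)"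

definition soc :: "('a, 'n) module \<Rightarrow> 'n set \<Rightarrow> bool" where
  "soc N U \<longleftrightarrow> (\<exists>z\<in>carrier N - U. \<forall>a\<in>\<mm>. a \<odot>\<^bsub>N\<^esub> z \<in> U)"

definition add_mult :: "('a, 'n) module \<Rightarrow> 'n set \<Rightarrow> 'a \<Rightarrow> 'n set" where
  "add_mult N U x = {w \<in> carrier N. \<exists>n\<in>carrier N. w \<ominus>\<^bsub>N\<^esub> x \<odot>\<^bsub>N\<^esub> n \<in> U}"

text \<open>Sorting by associativity and commutativity can leave a summand between an element and
  its negative; these rules supply the cancellations then missing.\<close>

lemma add_cancel:
  assumes "module A N" "x \<in> carrier N" "y \<in> carrier N"
  shows "x \<oplus>\<^bsub>N\<^esub> (y \<oplus>\<^bsub>N\<^esub> \<ominus>\<^bsub>N\<^esub> x) = y" "\<ominus>\<^bsub>N\<^esub> x \<oplus>\<^bsub>N\<^esub> (y \<oplus>\<^bsub>N\<^esub> x) = y"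
    "z \<in> carrier N \<Longrightarrow> x \<oplus>\<^bsub>N\<^esub> (y \<oplus>\<^bsub>N\<^esub> (\<ominus>\<^bsub>N\<^esub> x \<oplus>\<^bsub>N\<^esub> z)) = y \<oplus>\<^bsub>N\<^esub> z"
    "z \<in> carrier N \<Longrightarrow> \<ominus>\<^bsub>N\<^esub> x \<oplus>\<^bsub>N\<^esub> (y \<oplus>\<^bsub>N\<^esub> (x \<oplus>\<^bsub>N\<^esub> z)) = y \<oplus>\<^bsub>N\<^esub> z"
proof -
  interpret N: module A N by fact
  show "x \<oplus>\<^bsub>N\<^esub> (y \<oplus>\<^bsub>N\<^esub> \<ominus>\<^bsub>N\<^esub> x) = y" "\<ominus>\<^bsub>N\<^esub> x \<oplus>\<^bsub>N\<^esub> (y \<oplus>\<^bsub>N\<^esub> x) = y"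
    using assms(2,3) by (simp_all add: N.a_lcomm[of x] N.a_lcomm[of "\<ominus>\<^bsub>N\<^esub> x"] N.r_neg N.l_neg)
  show "x \<oplus>\<^bsub>N\<^esub> (y \<oplus>\<^bsub>N\<^esub> (\<ominus>\<^bsub>N\<^esub> x \<oplus>\<^bsub>N\<^esub> z)) = y \<oplus>\<^bsub>N\<^esub> z"
    "\<ominus>\<^bsub>N\<^esub> x \<oplus>\<^bsub>N\<^esub> (y \<oplus>\<^bsub>N\<^esub> (x \<oplus>\<^bsub>N\<^esub> z)) = y \<oplus>\<^bsub>N\<^esub> z" if "z \<in> carrier N"
    using assms(2,3) that by (simp_all add: N.a_lcomm[of x y] N.a_lcomm[of "\<ominus>\<^bsub>N\<^esub> x" y] N.r_neg2 N.r_neg1)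
qed

lemma smult_lcomm:
  assumes "module A N" "a \<in> carrier A" "b \<in> carrier A" "x \<in> carrier N"
  shows "a \<odot>\<^bsub>N\<^esub> (b \<odot>\<^bsub>N\<^esub> x) = b \<odot>\<^bsub>N\<^esub> (a \<odot>\<^bsub>N\<^esub> x)"
  using assms by (metis m_comm module.smult_assoc1)

lemma lin_smult_right: "module A N \<Longrightarrow> z \<in> carrier N \<Longrightarrow> lin (self_mod A) N (\<lambda>a. a \<odot>\<^bsub>N\<^esub> z)"
proof -
  assume N: "module A N" and z: "z \<in> carrier N"
  interpret N: module A N by fact
  show ?thesis using z unfolding lin_def by (auto simp: N.smult_l_distr N.smult_assoc1)
qed

lemma lin_smult_left: "module A N \<Longrightarrow> a \<in> carrier A \<Longrightarrow> lin N N (\<lambda>z. a \<odot>\<^bsub>N\<^esub> z)"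
  using lin_scale[OF lin_id] by blast

section \<open>Prime avoidance and associated primes\<close>

lemma prime_contains_Inter:
  assumes P: "primeideal P A" and F: "finite F" "\<And>Q. Q \<in> F \<Longrightarrow> ideal Q A"
    and nQ: "\<And>Q. Q \<in> F \<Longrightarrow> \<not> Q \<subseteq> P"
  shows "\<exists>y\<in>carrier A. y \<notin> P \<and> (\<forall>Q\<in>F. y \<in> Q)"
  using F nQ
proof (induction F rule: finite_induct)
  case empty
  interpret P: primeideal P A by fact
  have "\<one> \<notin> P" using P.one_imp_carrier P.I_notcarr by blast
  then show ?case by blast
next
  case (insert Q F)
  interpret P: primeideal P A by fact
  interpret Q: ideal Q A using insert.prems by blast
  obtain y where y: "y \<in> carrier A" "y \<notin> P" "\<forall>Q\<in>F. y \<in> Q" using insert.IH insert.prems by blast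
  obtain x where x: "x \<in> Q" "x \<notin> P" using insert.prems(2)[of Q] by blast
  have xA: "x \<in> carrier A" using x by simp
  have "x \<otimes> y \<notin> P" using P.I_prime[OF xA y(1)] x y by blast
  moreover have "x \<otimes> y \<in> R" if R: "R \<in> insert Q F" for R
  proof (cases "R = Q")
    case True then show ?thesis using Q.I_r_closed x y by simp
  next
    case False
    then interpret R: ideal R A using R insert.prems by blast
    show ?thesis using R False R.I_l_closed xA y by blast
  qed
  ultimately show ?case using xA y(1) by blast
qed

text \<open>Induction on the set of primes, reduced to pairwise incomparable ones. Some
  \<open>x\<close> in \<open>I\<close> avoids all primes but \<open>P\<close>; if it lies in
  \<open>P\<close>, add to it an element outside \<open>P\<close> that is in \<open>I\<close> and in
  all the other primes.\<close>

lemma prime_avoidance: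
  assumes I: "ideal I A" and Ps: "finite Ps" "\<And>P. P \<in> Ps \<Longrightarrow> primeideal P A"
    and nI: "\<And>P. P \<in> Ps \<Longrightarrow> \<not> I \<subseteq> P"
  shows "\<exists>x\<in>I. \<forall>P\<in>Ps. x \<notin> P"
  using Ps nI
proof (induction Ps rule: finite_psubset_induct)
  case (psubset Ps)
  interpret I: ideal I A by fact
  show ?case
  proof (cases "\<exists>P\<in>Ps. \<exists>Q\<in>Ps. P \<noteq> Q \<and> Q \<subseteq> P")
    case True
    then obtain P Q where PQ: "P \<in> Ps" "Q \<in> Ps" "P \<noteq> Q" "Q \<subseteq> P" by blast
    then obtain x where "x \<in> I" "\<forall>P\<in>Ps - {Q}. x \<notin> P"
      using psubset.IH[of "Ps - {Q}"] psubset.prems by blast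
    then show ?thesis using PQ by blast
  next
    case incomp: False
    show ?thesis
    proof (cases "Ps = {}")
      case True then show ?thesis using I.zero_closed by blast
    next
      case False
      then obtain P where P: "P \<in> Ps" by blast
      then obtain x where x: "x \<in> I" "\<And>Q. Q \<in> Ps - {P} \<Longrightarrow> x \<notin> Q"
        using psubset.IH[of "Ps - {P}"] psubset.prems by blast
      interpret P: primeideal P A using psubset.prems P by blast
      show ?thesis
      proof (cases "x \<in> P")
        case False then show ?thesis using x by blast
      next
        case xP: True
        have id: "ideal Q A" if "Q \<in> insert I (Ps - {P})" for Q
          using that I psubset.prems(1) primeideal.axioms(1) by blast
        have "\<not> Q \<subseteq> P" if "Q \<in> insert I (Ps - {P})" for Q
          using that incomp P psubset.prems(2) by blast
        note nq = this
        have fin: "finite (insert I (Ps - {P}))" using psubset.hyps by simp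
        from prime_contains_Inter[OF P.primeideal_axioms fin id nq]
        obtain y where y: "y \<in> carrier A" "y \<notin> P" "\<forall>Q\<in>insert I (Ps - {P}). y \<in> Q" by blast
        have xA: "x \<in> carrier A" using x(1) by simp
        have "x \<oplus> y \<in> I" using x y by simp
        moreover have "x \<oplus> y \<notin> Q" if Q: "Q \<in> Ps" for Q
        proof
          assume s: "x \<oplus> y \<in> Q"
          interpret Q: primeideal Q A using psubset.prems Q by blast
          show False
          proof (cases "Q = P")
            case True
            have "(x \<oplus> y) \<oplus> \<ominus> x \<in> P" using s True xP by simp
            moreover have "(x \<oplus> y) \<oplus> \<ominus> x = y"
              using add_cancel(1)[OF module_self, of x y] xA y(1) by (simp add: a_assoc)
            ultimately show False using y by simp
          next
            case False
            then have yQ: "y \<in> Q" using y Q by blast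
            have "(x \<oplus> y) \<oplus> \<ominus> y \<in> Q" using s yQ by simp
            moreover have "(x \<oplus> y) \<oplus> \<ominus> y = x" using xA y(1) by (simp add: a_assoc r_neg)
            ultimately show False using x(2)[of Q] Q False by simp
          qed
        qed
        ultimately show ?thesis by blast
      qed
    qed
  qed
qed

text \<open>An annihilator of a nonzero element of N/U that is maximal among such annihilators is
  prime, and every zero divisor lies in one of these. They are finitely many: choose finitely many
  whose witnesses span a maximal submodule. The witness of any further prime \<open>P\<close> lies
  in that span, so it is killed by an element outside \<open>P\<close> common to the chosen primes,
  which is absurd.\<close>

lemma zero_divisors_in_associated_primes:
  assumes fg: "fg_module A N" and U: "submodule U A N"
  shows "\<exists>Ps. finite Ps \<and>
     (\<forall>P\<in>Ps. primeideal P A \<and> (\<exists>z\<in>carrier N - U. P = {a \<in> carrier A. a \<odot>\<^bsub>N\<^esub> z \<in> U})) \<and>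
     (\<forall>x\<in>carrier A. \<not> reg N U x \<longrightarrow> (\<exists>P\<in>Ps. x \<in> P))"
proof -
  have N: "module A N" by (rule fg_module_D[OF fg])
  interpret N: module A N by fact
  define ann where "ann = (\<lambda>z. {a \<in> carrier A. a \<odot>\<^bsub>N\<^esub> z \<in> U})"
  have ann_sub: "submodule (ann z) A (self_mod A)" if "z \<in> carrier N" for z
    using sub_preimage[OF module_self N lin_smult_right[OF N that] U] by (simp add: ann_def)
  define \<A> where "\<A> = ann ` (carrier N - U)"
  define \<M> where "\<M> = {P \<in> \<A>. \<forall>Q\<in>\<A>. P \<subseteq> Q \<longrightarrow> Q = P}"
  have \<A>_sub: "submodule P A (self_mod A)" if "P \<in> \<A>" for P using that ann_sub by (auto simp: \<A>_def)
  have maxi: "\<exists>M\<in>\<M>. P \<subseteq> M" if P: "P \<in> \<A>" for P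
  proof -
    have ne: "{Q \<in> \<A>. P \<subseteq> Q} \<noteq> {}" using P by blast
    obtain M where M: "M \<in> \<A>" "P \<subseteq> M" "\<And>Q. Q \<in> \<A> \<Longrightarrow> P \<subseteq> Q \<Longrightarrow> M \<subseteq> Q \<Longrightarrow> Q = M"
      using maximal_submodule_exists[OF fg_self ne] \<A>_sub by auto
    then have "M \<in> \<M>" unfolding \<M>_def by blast
    with M(2) show ?thesis by blast
  qed
  have prime: "primeideal M A" if M: "M \<in> \<M>" for M
  proof -
    obtain z where z: "z \<in> carrier N" "z \<notin> U" "M = ann z" using M by (auto simp: \<M>_def \<A>_def)
    show ?thesis
    proof (rule primeidealI)
      show "ideal M A" using ann_sub[OF z(1)] z(3) ideal_iff_sub by simp
      have "\<one> \<notin> M" using z by (simp add: ann_def)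
      then show "carrier A \<noteq> M" by auto
      fix a b assume ab: "a \<in> carrier A" "b \<in> carrier A" "a \<otimes> b \<in> M"
      show "a \<in> M \<or> b \<in> M"
      proof (rule disjCI)
        assume "b \<notin> M"
        \<comment> \<open>As \<open>b\<close> times \<open>z\<close> is nonzero modulo
          \<open>U\<close>, its annihilator competes in the family; it contains that of
          \<open>z\<close> and equals it by maximality.\<close>
        then have bz: "b \<odot>\<^bsub>N\<^esub> z \<in> carrier N - U" using ab z by (auto simp: ann_def)
        have "ann z \<subseteq> ann (b \<odot>\<^bsub>N\<^esub> z)"
        proof
          fix c assume "c \<in> ann z"
          then show "c \<in> ann (b \<odot>\<^bsub>N\<^esub> z)" using ab(2) z(1) sub_smult[OF U ab(2), of "c \<odot>\<^bsub>N\<^esub> z"]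
            by (simp add: ann_def smult_lcomm[OF N _ ab(2) z(1)])
        qed
        then have "ann (b \<odot>\<^bsub>N\<^esub> z) = M" using M bz z(3) by (auto simp: \<M>_def \<A>_def)
        moreover have "a \<in> ann (b \<odot>\<^bsub>N\<^esub> z)" using ab z by (simp add: ann_def N.smult_assoc1)
        ultimately show "a \<in> M" by simp
      qed
    qed (rule is_cring)
  qed
  have "\<forall>P\<in>\<M>. \<exists>z. z \<in> carrier N - U \<and> P = ann z" by (auto simp: \<M>_def \<A>_def)
  then obtain zz where zz: "\<And>P. P \<in> \<M> \<Longrightarrow> zz P \<in> carrier N - U" "\<And>P. P \<in> \<M> \<Longrightarrow> P = ann (zz P)"
    by metis
  define \<F> where "\<F> = {mod_span A N (zz ` F) | F. finite F \<and> F \<subseteq> \<M>}"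
  have "\<F> \<noteq> {}" unfolding \<F>_def by blast
  moreover have "submodule W A N" if W: "W \<in> \<F>" for W
  proof -
    obtain F where F: "W = mod_span A N (zz ` F)" "F \<subseteq> \<M>" using W by (auto simp: \<F>_def)
    have "zz ` F \<subseteq> carrier N" using F(2) zz(1) by blast
    then show ?thesis unfolding F(1) by (rule span_sub[OF N])
  qed
  ultimately obtain W where W: "W \<in> \<F>" "\<forall>V\<in>\<F>. W \<subseteq> V \<longrightarrow> V = W"
    using maximal_submodule_exists[OF fg, of \<F>] by blast
  then obtain F where F: "W = mod_span A N (zz ` F)" "finite F" "F \<subseteq> \<M>" by (auto simp: \<F>_def)
  have "\<M> \<subseteq> F"
  proof
    fix P assume P: "P \<in> \<M>"
    let ?V = "mod_span A N (zz ` insert P F)"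
    have "?V \<in> \<F>" unfolding \<F>_def using F P by blast
    moreover have "W \<subseteq> ?V" unfolding F(1) by (rule span_mono) blast
    ultimately have "?V = W" using W(2) by blast
    moreover have "zz P \<in> ?V" by (rule subsetD[OF span_incl]) blast
    ultimately have zW: "zz P \<in> W" by simp
    interpret P: primeideal P A by (rule prime[OF P])
    show "P \<in> F"
    proof (rule ccontr)
      assume PF: "P \<notin> F"
      have "\<not> Q \<subseteq> P" if "Q \<in> F" for Q using that PF P F(3) by (auto simp: \<M>_def)
      moreover have "ideal Q A" if "Q \<in> F" for Q using that F(3) prime primeideal.axioms(1) by blast
      ultimately obtain y where y: "y \<in> carrier A" "y \<notin> P" "\<forall>Q\<in>F. y \<in> Q"
        using prime_contains_Inter[OF P.primeideal_axioms F(2)] by blast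
      have "W \<subseteq> {z \<in> carrier N. y \<odot>\<^bsub>N\<^esub> z \<in> U}" unfolding F(1)
      proof (rule span_least[OF sub_preimage[OF N N lin_smult_left[OF N y(1)] U]])
        show "zz ` F \<subseteq> {z \<in> carrier N. y \<odot>\<^bsub>N\<^esub> z \<in> U}"
        proof
          fix z assume "z \<in> zz ` F"
          then obtain Q where Q: "Q \<in> F" "z = zz Q" by blast
          have QM: "Q \<in> \<M>" using Q F(3) by blast
          have "y \<in> ann (zz Q)" using y(3) Q(1) zz(2)[OF QM] by simp
          then show "z \<in> {z \<in> carrier N. y \<odot>\<^bsub>N\<^esub> z \<in> U}" using zz(1)[OF QM] Q(2) by (simp add: ann_def)
        qed
      qed
      then have "y \<in> ann (zz P)" using zW y(1) by (auto simp: ann_def)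
      then show False using y(2) zz(2)[OF P] by simp
    qed
  qed
  then have "finite \<M>" using F(2) finite_subset by blast
  moreover have "\<exists>P\<in>\<M>. x \<in> P" if x: "x \<in> carrier A" "\<not> reg N U x" for x
  proof -
    obtain z where z: "z \<in> carrier N - U" "x \<odot>\<^bsub>N\<^esub> z \<in> U" using x(2) by (auto simp: reg_def)
    then have "ann z \<in> \<A>" "x \<in> ann z" using x(1) by (auto simp: \<A>_def ann_def)
    then show ?thesis using maxi by blast
  qed
  moreover have "\<exists>z\<in>carrier N - U. P = {a \<in> carrier A. a \<odot>\<^bsub>N\<^esub> z \<in> U}" if "P \<in> \<M>" for P
    using zz(1)[OF that] zz(2)[OF that] unfolding ann_def by blast
  ultimately show ?thesis using prime by (intro exI[of _ \<M>]) blast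
qed

text \<open>If an associated prime contained the maximal ideal, its witness would be a nonzero
  element of the socle.\<close>

lemma zero_divisors_mm:
  assumes "fg_module A N" "submodule U A N" "\<not> soc N U"
  shows "\<exists>Ps. finite Ps \<and> (\<forall>P\<in>Ps. primeideal P A) \<and> (\<forall>P\<in>Ps. \<not> \<mm> \<subseteq> P) \<and>
    (\<forall>x\<in>carrier A. (\<forall>P\<in>Ps. x \<notin> P) \<longrightarrow> reg N U x)"
proof -
  from zero_divisors_in_associated_primes[OF assms(1,2)] obtain Ps where Ps: "finite Ps"
     "\<forall>P\<in>Ps. primeideal P A \<and> (\<exists>z\<in>carrier N - U. P = {a \<in> carrier A. a \<odot>\<^bsub>N\<^esub> z \<in> U})"
     "\<forall>x\<in>carrier A. \<not> reg N U x \<longrightarrow> (\<exists>P\<in>Ps. x \<in> P)" by blast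
  have "\<not> \<mm> \<subseteq> P" if P: "P \<in> Ps" for P
  proof
    assume m: "\<mm> \<subseteq> P"
    obtain z where "z \<in> carrier N - U" "P = {a \<in> carrier A. a \<odot>\<^bsub>N\<^esub> z \<in> U}" using Ps(2) P by blast
    then show False using m assms(3) unfolding soc_def by blast
  qed
  moreover have "\<forall>P\<in>Ps. primeideal P A" using Ps(2) by blast
  moreover have "reg N U x" if "x \<in> carrier A" "\<forall>P\<in>Ps. x \<notin> P" for x using Ps(3) that by blast
  ultimately show ?thesis using Ps(1) by (intro exI[of _ Ps] conjI ballI impI) simp_all
qed

lemma mm_ideal: "ideal \<mm> A" using mm_sub ideal_iff_sub by simp

text \<open>One use of prime avoidance for both sets of associated primes gives an element regular
  on both quotients; this is what allows the ring and a module to be divided simultaneously.\<close>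

lemma common_regular:
  assumes "fg_module A N" "submodule U A N" "\<not> soc N U"
    and "fg_module A X" "submodule V A X" "\<not> soc X V"
  obtains x where "x \<in> \<mm>" "reg N U x" "reg X V x"
proof -
  from zero_divisors_mm[OF assms(1-3)] obtain Ps where Ps: "finite Ps" "\<forall>P\<in>Ps. primeideal P A"
     "\<forall>P\<in>Ps. \<not> \<mm> \<subseteq> P" "\<forall>x\<in>carrier A. (\<forall>P\<in>Ps. x \<notin> P) \<longrightarrow> reg N U x" by blast
  from zero_divisors_mm[OF assms(4-6)] obtain Qs where Qs: "finite Qs" "\<forall>P\<in>Qs. primeideal P A"
     "\<forall>P\<in>Qs. \<not> \<mm> \<subseteq> P" "\<forall>x\<in>carrier A. (\<forall>P\<in>Qs. x \<notin> P) \<longrightarrow> reg X V x" by blast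
  obtain x where x: "x \<in> \<mm>" "\<forall>P\<in>Ps \<union> Qs. x \<notin> P"
    using prime_avoidance[OF mm_ideal, of "Ps \<union> Qs"] Ps(1-3) Qs(1-3) by blast
  have "x \<in> carrier A" by (rule mm_in[OF x(1)])
  then show ?thesis using x Ps(4) Qs(4) by (intro that[OF x(1)]) blast+
qed

lemma common_regular3:
  assumes fg: "fg_module A N" and "submodule U A N" "\<not> soc N U"
    and "submodule V A N" "\<not> soc N V" and "submodule W A N" "\<not> soc N W"
  obtains x where "x \<in> \<mm>" "reg N U x" "reg N V x" "reg N W x"
proof -
  from zero_divisors_mm[OF assms(1-3)] obtain Ps where Ps: "finite Ps" "\<forall>P\<in>Ps. primeideal P A"
     "\<forall>P\<in>Ps. \<not> \<mm> \<subseteq> P" "\<forall>x\<in>carrier A. (\<forall>P\<in>Ps. x \<notin> P) \<longrightarrow> reg N U x" by blast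
  from zero_divisors_mm[OF fg assms(4,5)] obtain Qs where Qs: "finite Qs" "\<forall>P\<in>Qs. primeideal P A"
     "\<forall>P\<in>Qs. \<not> \<mm> \<subseteq> P" "\<forall>x\<in>carrier A. (\<forall>P\<in>Qs. x \<notin> P) \<longrightarrow> reg N V x" by blast
  from zero_divisors_mm[OF fg assms(6,7)] obtain Rs where Rs: "finite Rs" "\<forall>P\<in>Rs. primeideal P A"
     "\<forall>P\<in>Rs. \<not> \<mm> \<subseteq> P" "\<forall>x\<in>carrier A. (\<forall>P\<in>Rs. x \<notin> P) \<longrightarrow> reg N W x" by blast
  obtain x where x: "x \<in> \<mm>" "\<forall>P\<in>Ps \<union> Qs \<union> Rs. x \<notin> P"
    using prime_avoidance[OF mm_ideal, of "Ps \<union> Qs \<union> Rs"] Ps(1-3) Qs(1-3) Rs(1-3) by blast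
  have "x \<in> carrier A" by (rule mm_in[OF x(1)])
  then show ?thesis using x Ps(4) Qs(4) Rs(4) by (intro that[OF x(1)]) blast+
qed

lemma reg_not_soc: "x \<in> \<mm> \<Longrightarrow> reg N U x \<Longrightarrow> \<not> soc N U"
  by (auto simp: reg_def soc_def)

section \<open>The submodule U + xN and the exchange of regular elements\<close>

lemma add_mult_iff: "w \<in> add_mult N U x \<longleftrightarrow> w \<in> carrier N \<and> (\<exists>n\<in>carrier N. w \<ominus>\<^bsub>N\<^esub> x \<odot>\<^bsub>N\<^esub> n \<in> U)"
  by (simp add: add_mult_def)

lemma add_mult_I:
  assumes "module A N" "submodule U A N" "x \<in> carrier A" "u \<in> U" "n \<in> carrier N"
  shows "u \<oplus>\<^bsub>N\<^esub> x \<odot>\<^bsub>N\<^esub> n \<in> add_mult N U x"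
proof -
  interpret N: module A N by fact
  have "(u \<oplus>\<^bsub>N\<^esub> x \<odot>\<^bsub>N\<^esub> n) \<ominus>\<^bsub>N\<^esub> x \<odot>\<^bsub>N\<^esub> n = u"
    using assms sub_in[OF assms(2,4)] by (simp add: a_minus_def N.a_assoc N.r_neg)
  then show ?thesis using assms sub_in[OF assms(2,4)] unfolding add_mult_iff
    by (intro conjI bexI[of _ n]) simp_all
qed

lemma add_mult_E:
  assumes "module A N" "submodule U A N" "x \<in> carrier A" "w \<in> add_mult N U x"
  obtains u n where "u \<in> U" "n \<in> carrier N" "w = u \<oplus>\<^bsub>N\<^esub> x \<odot>\<^bsub>N\<^esub> n"
proof -
  interpret N: module A N by fact
  obtain n where n: "w \<in> carrier N" "n \<in> carrier N" "w \<ominus>\<^bsub>N\<^esub> x \<odot>\<^bsub>N\<^esub> n \<in> U" using assms(4) unfolding add_mult_iff by blast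
  then have "w = (w \<ominus>\<^bsub>N\<^esub> x \<odot>\<^bsub>N\<^esub> n) \<oplus>\<^bsub>N\<^esub> x \<odot>\<^bsub>N\<^esub> n" using assms(3) by (simp add: minus_add_cancel[OF assms(1)])
  then show ?thesis using n that by blast
qed

lemma add_mult_incl:
  assumes "module A N" "submodule U A N" "x \<in> carrier A" shows "U \<subseteq> add_mult N U x"
proof
  interpret N: module A N by fact
  fix u assume u: "u \<in> U"
  then show "u \<in> add_mult N U x" using add_mult_I[OF assms u N.zero_closed] assms sub_in[OF assms(2) u] by simp
qed

lemma add_mult_mult:
  assumes "module A N" "submodule U A N" "x \<in> carrier A" "n \<in> carrier N"
  shows "x \<odot>\<^bsub>N\<^esub> n \<in> add_mult N U x"
proof -
  interpret N: module A N by fact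
  show ?thesis using add_mult_I[OF assms(1-3) sub_zero[OF assms(2)] assms(4)] assms by simp
qed

lemma add_mult_least:
  assumes "module A N" "submodule U A N" "x \<in> carrier A" "submodule V A N" "U \<subseteq> V"
    "\<And>n. n \<in> carrier N \<Longrightarrow> x \<odot>\<^bsub>N\<^esub> n \<in> V"
  shows "add_mult N U x \<subseteq> V"
proof
  fix w assume "w \<in> add_mult N U x"
  then obtain u n where *: "u \<in> U" "n \<in> carrier N" "w = u \<oplus>\<^bsub>N\<^esub> x \<odot>\<^bsub>N\<^esub> n" by (rule add_mult_E[OF assms(1-3)])
  then show "w \<in> V" using assms(5) assms(6) sub_add[OF assms(4)] by blast
qed

lemma add_mult_sub:
  assumes "module A N" "submodule U A N" "x \<in> carrier A" shows "submodule (add_mult N U x) A N"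
proof -
  interpret N: module A N by fact
  note I = add_mult_I[OF assms] and E = add_mult_E[OF assms]
  show ?thesis
  proof (rule subI[OF assms(1)])
    show "add_mult N U x \<subseteq> carrier N" by (auto simp: add_mult_def)
    show "\<zero>\<^bsub>N\<^esub> \<in> add_mult N U x" using add_mult_incl[OF assms] sub_zero[OF assms(2)] by blast
  next
    fix v w assume vw: "v \<in> add_mult N U x" "w \<in> add_mult N U x"
    from E[OF vw(1)] obtain u n where 1: "u \<in> U" "n \<in> carrier N" "v = u \<oplus>\<^bsub>N\<^esub> x \<odot>\<^bsub>N\<^esub> n" .
    from E[OF vw(2)] obtain u' n' where 2: "u' \<in> U" "n' \<in> carrier N" "w = u' \<oplus>\<^bsub>N\<^esub> x \<odot>\<^bsub>N\<^esub> n'" .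
    have "v \<oplus>\<^bsub>N\<^esub> w = (u \<oplus>\<^bsub>N\<^esub> u') \<oplus>\<^bsub>N\<^esub> x \<odot>\<^bsub>N\<^esub> (n \<oplus>\<^bsub>N\<^esub> n')"
      using 1 2 assms(3) sub_in[OF assms(2) 1(1)] sub_in[OF assms(2) 2(1)] by (simp add: N.smult_r_distr N.a_ac)
    then show "v \<oplus>\<^bsub>N\<^esub> w \<in> add_mult N U x" using I[OF sub_add[OF assms(2) 1(1) 2(1)] N.a_closed[OF 1(2) 2(2)]] by simp
  next
    fix a w assume a: "a \<in> carrier A" and w: "w \<in> add_mult N U x"
    from E[OF w] obtain u n where 1: "u \<in> U" "n \<in> carrier N" "w = u \<oplus>\<^bsub>N\<^esub> x \<odot>\<^bsub>N\<^esub> n" .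
    have "a \<odot>\<^bsub>N\<^esub> w = a \<odot>\<^bsub>N\<^esub> u \<oplus>\<^bsub>N\<^esub> x \<odot>\<^bsub>N\<^esub> (a \<odot>\<^bsub>N\<^esub> n)"
      using 1 a assms(3) sub_in[OF assms(2) 1(1)] by (simp add: N.smult_r_distr smult_lcomm[OF assms(1) a assms(3)])
    then show "a \<odot>\<^bsub>N\<^esub> w \<in> add_mult N U x" using I[OF sub_smult[OF assms(2) a 1(1)] N.smult_closed[OF a 1(2)]] by simp
  qed
qed

lemma add_mult_comm_le:
  assumes "module A N" "submodule U A N" "x \<in> carrier A" "y \<in> carrier A"
  shows "add_mult N (add_mult N U x) y \<subseteq> add_mult N (add_mult N U y) x"
proof -
  note Ux = add_mult_sub[OF assms(1-3)] and Uy = add_mult_sub[OF assms(1,2,4)]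
  note Uyx = add_mult_sub[OF assms(1) Uy assms(3)]
  have i: "add_mult N U y \<subseteq> add_mult N (add_mult N U y) x" by (rule add_mult_incl[OF assms(1) Uy assms(3)])
  show ?thesis
  proof (rule add_mult_least[OF assms(1) Ux assms(4) Uyx])
    show "add_mult N U x \<subseteq> add_mult N (add_mult N U y) x"
      using i add_mult_incl[OF assms(1,2,4)] add_mult_mult[OF assms(1) Uy assms(3)]
      by (intro add_mult_least[OF assms(1,2,3) Uyx]) auto
    show "y \<odot>\<^bsub>N\<^esub> n \<in> add_mult N (add_mult N U y) x" if "n \<in> carrier N" for n
      using i add_mult_mult[OF assms(1,2,4) that] by blast
  qed
qed

lemma add_mult_comm:
  assumes "module A N" "submodule U A N" "x \<in> carrier A" "y \<in> carrier A"
  shows "add_mult N (add_mult N U x) y = add_mult N (add_mult N U y) x"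
  using add_mult_comm_le[OF assms] add_mult_comm_le[OF assms(1,2,4,3)] by blast

lemma sub_minus_swap:
  assumes "module A N" "submodule U A N" "x \<in> carrier N" "y \<in> carrier N" "x \<ominus>\<^bsub>N\<^esub> y \<in> U"
  shows "y \<ominus>\<^bsub>N\<^esub> x \<in> U"
proof -
  interpret N: module A N by fact
  have "y \<ominus>\<^bsub>N\<^esub> x = \<ominus>\<^bsub>N\<^esub> (x \<ominus>\<^bsub>N\<^esub> y)" using assms by (simp add: a_minus_def N.minus_add N.a_ac)
  then show ?thesis using sub_neg[OF assms(2,5)] by simp
qed

text \<open>From x n = z w modulo \<open>U\<close>, regularity of \<open>z\<close> modulo
  \<open>x\<close> gives w = x v up to \<open>U\<close>, and \<open>x\<close> can be cancelled from
  x (n - z v).\<close>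

lemma reg_swap:
  assumes N: "module A N" and U: "submodule U A N" and xz: "x \<in> carrier A" "z \<in> carrier A"
    and rx: "reg N U x" and rzx: "reg N (add_mult N U x) z"
  shows "reg N (add_mult N U z) x"
  unfolding reg_def
proof (intro ballI impI)
  interpret N: module A N by fact
  fix n assume n: "n \<in> carrier N" "x \<odot>\<^bsub>N\<^esub> n \<in> add_mult N U z"
  then obtain w where w: "w \<in> carrier N" "x \<odot>\<^bsub>N\<^esub> n \<ominus>\<^bsub>N\<^esub> z \<odot>\<^bsub>N\<^esub> w \<in> U" unfolding add_mult_iff by blast
  have "z \<odot>\<^bsub>N\<^esub> w \<ominus>\<^bsub>N\<^esub> x \<odot>\<^bsub>N\<^esub> n \<in> U" by (rule sub_minus_swap[OF N U _ _ w(2)]) (use n w xz in auto)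
  then have "z \<odot>\<^bsub>N\<^esub> w \<in> add_mult N U x" unfolding add_mult_iff using n w xz by auto
  then have "w \<in> add_mult N U x" using rzx w(1) unfolding reg_def by blast
  then obtain v where v: "v \<in> carrier N" "w \<ominus>\<^bsub>N\<^esub> x \<odot>\<^bsub>N\<^esub> v \<in> U" unfolding add_mult_iff by blast
  have "x \<odot>\<^bsub>N\<^esub> (n \<ominus>\<^bsub>N\<^esub> z \<odot>\<^bsub>N\<^esub> v) = (x \<odot>\<^bsub>N\<^esub> n \<ominus>\<^bsub>N\<^esub> z \<odot>\<^bsub>N\<^esub> w) \<oplus>\<^bsub>N\<^esub> z \<odot>\<^bsub>N\<^esub> (w \<ominus>\<^bsub>N\<^esub> x \<odot>\<^bsub>N\<^esub> v)"
    using n w v xz by (simp add: a_minus_def N.smult_r_distr N.smult_r_minus N.a_ac N.r_neg N.l_neg N.r_neg1 N.r_neg2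
      smult_lcomm[OF N xz v(1)])
  also have "\<dots> \<in> U" by (rule sub_add[OF U w(2) sub_smult[OF U xz(2) v(2)]])
  finally have "n \<ominus>\<^bsub>N\<^esub> z \<odot>\<^bsub>N\<^esub> v \<in> U" using rx n(1) v(1) xz unfolding reg_def by simp
  then show "n \<in> add_mult N U z" unfolding add_mult_iff using n(1) v(1) by blast
qed

text \<open>For \<open>x\<close> regular on N/U, the socle of N/(U + xN) is isomorphic to Ext^1(k,
  N/U), in which \<open>x\<close> no longer occurs. Explicitly, a socle element \<open>z\<close>
  modulo \<open>x\<close> is sent to the \<open>w\<close> with y z = x w modulo
  \<open>U\<close>.\<close>

lemma soc_swap:
  assumes N: "module A N" and U: "submodule U A N" and xm: "x \<in> \<mm>" "y \<in> \<mm>"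
    and rx: "reg N U x" and ry: "reg N U y" and s: "soc N (add_mult N U x)"
  shows "soc N (add_mult N U y)"
proof -
  interpret N: module A N by fact
  have x: "x \<in> carrier A" and y: "y \<in> carrier A" using xm mm_in by auto
  note ms = add_cancel[OF N] a_minus_def N.smult_r_distr N.smult_r_minus N.minus_add N.a_ac N.r_neg N.l_neg N.r_neg1 N.r_neg2
  obtain z where z: "z \<in> carrier N" "z \<notin> add_mult N U x" "\<And>a. a \<in> \<mm> \<Longrightarrow> a \<odot>\<^bsub>N\<^esub> z \<in> add_mult N U x"
    using s unfolding soc_def by blast
  obtain w where w: "w \<in> carrier N" "y \<odot>\<^bsub>N\<^esub> z \<ominus>\<^bsub>N\<^esub> x \<odot>\<^bsub>N\<^esub> w \<in> U" using z(3)[OF xm(2)] unfolding add_mult_iff by blast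
  have "w \<notin> add_mult N U y"
  proof
    assume "w \<in> add_mult N U y"
    then obtain v where v: "v \<in> carrier N" "w \<ominus>\<^bsub>N\<^esub> y \<odot>\<^bsub>N\<^esub> v \<in> U" unfolding add_mult_iff by blast
    have "y \<odot>\<^bsub>N\<^esub> (z \<ominus>\<^bsub>N\<^esub> x \<odot>\<^bsub>N\<^esub> v) = (y \<odot>\<^bsub>N\<^esub> z \<ominus>\<^bsub>N\<^esub> x \<odot>\<^bsub>N\<^esub> w) \<oplus>\<^bsub>N\<^esub> x \<odot>\<^bsub>N\<^esub> (w \<ominus>\<^bsub>N\<^esub> y \<odot>\<^bsub>N\<^esub> v)"
      using z(1) w(1) v(1) x y by (simp add: ms smult_lcomm[OF N x y v(1)])
    also have "\<dots> \<in> U" by (rule sub_add[OF U w(2) sub_smult[OF U x v(2)]])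
    finally have "z \<ominus>\<^bsub>N\<^esub> x \<odot>\<^bsub>N\<^esub> v \<in> U" using ry z(1) v(1) x unfolding reg_def by simp
    then show False using z(1,2) v(1) unfolding add_mult_iff by blast
  qed
  moreover have "a \<odot>\<^bsub>N\<^esub> w \<in> add_mult N U y" if am: "a \<in> \<mm>" for a
  proof -
    have a: "a \<in> carrier A" using am mm_in by auto
    obtain v where v: "v \<in> carrier N" "a \<odot>\<^bsub>N\<^esub> z \<ominus>\<^bsub>N\<^esub> x \<odot>\<^bsub>N\<^esub> v \<in> U" using z(3)[OF am] unfolding add_mult_iff by blast
    have "x \<odot>\<^bsub>N\<^esub> (a \<odot>\<^bsub>N\<^esub> w \<ominus>\<^bsub>N\<^esub> y \<odot>\<^bsub>N\<^esub> v) =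
        y \<odot>\<^bsub>N\<^esub> (a \<odot>\<^bsub>N\<^esub> z \<ominus>\<^bsub>N\<^esub> x \<odot>\<^bsub>N\<^esub> v) \<ominus>\<^bsub>N\<^esub> a \<odot>\<^bsub>N\<^esub> (y \<odot>\<^bsub>N\<^esub> z \<ominus>\<^bsub>N\<^esub> x \<odot>\<^bsub>N\<^esub> w)"
      using z(1) w(1) v(1) x y a
      by (simp add: ms smult_lcomm[OF N x y v(1)] smult_lcomm[OF N a y z(1)] smult_lcomm[OF N a x w(1)])
    also have "\<dots> \<in> U" by (rule sub_minus[OF U sub_smult[OF U y v(2)] sub_smult[OF U a w(2)]])
    finally have "a \<odot>\<^bsub>N\<^esub> w \<ominus>\<^bsub>N\<^esub> y \<odot>\<^bsub>N\<^esub> v \<in> U" using rx w(1) v(1) a y unfolding reg_def by simp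
    then show ?thesis using w(1) v(1) a unfolding add_mult_iff by blast
  qed
  ultimately show ?thesis using w(1) unfolding soc_def by blast
qed

text \<open>\<open>N/U\<close> has a regular sequence of length \<open>n\<close> in the maximal ideal modulo which the socle is nonzero,
  so that the sequence cannot be prolonged.\<close>

primrec rel_depth :: "nat \<Rightarrow> ('a, 'n) module \<Rightarrow> 'n set \<Rightarrow> bool" where
  "rel_depth 0 N U = soc N U"
| "rel_depth (Suc n) N U = (\<exists>x\<in>\<mm>. reg N U x \<and> rel_depth n N (add_mult N U x))"

text \<open>To exchange the first element \<open>x\<close> of the sequence for \<open>y\<close>, go through a \<open>z\<close> that is regular
  on \<open>N/U\<close>, \<open>N/(U + xN)\<close> and \<open>N/(U + yN)\<close>; it can be swapped with both.\<close>

lemma rel_depth_drop: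
  assumes fg: "fg_module A N"
  shows "submodule U A N \<Longrightarrow> rel_depth n N U \<Longrightarrow> y \<in> \<mm> \<Longrightarrow> reg N U y \<Longrightarrow> \<exists>k. n = Suc k \<and> rel_depth k N (add_mult N U y)"
proof (induction n arbitrary: U y)
  case 0
  then show ?case using reg_not_soc by auto
next
  case (Suc n)
  have N: "module A N" by (rule fg_module_D[OF fg])
  note U = Suc.prems(1) and ym = Suc.prems(3) and ry = Suc.prems(4)
  obtain x where x: "x \<in> \<mm>" "reg N U x" "rel_depth n N (add_mult N U x)" using Suc.prems(2) by auto
  have xA: "x \<in> carrier A" and yA: "y \<in> carrier A" using x ym mm_in by auto
  note Ux = add_mult_sub[OF N U xA] and Uy = add_mult_sub[OF N U yA]
  show ?case
  proof (cases n)
    case 0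
    then show ?thesis using x soc_swap[OF N U x(1) ym x(2) ry] by auto
  next
    case (Suc k)
    \<comment> \<open>The sequence goes on after \<open>x\<close>, so the quotient by
      \<open>x\<close> has a regular element and hence no socle; \<open>soc_swap\<close> carries
      this over to \<open>y\<close>.\<close>
    have nx: "\<not> soc N (add_mult N U x)" using x(3) Suc reg_not_soc by auto
    have ny: "\<not> soc N (add_mult N U y)" using nx soc_swap[OF N U ym x(1) ry x(2)] by blast
    obtain z where z: "z \<in> \<mm>" "reg N U z" "reg N (add_mult N U x) z" "reg N (add_mult N U y) z"
      using common_regular3[OF fg U reg_not_soc[OF ym ry] Ux nx Uy ny] .
    have zA: "z \<in> carrier A" using z mm_in by auto
    note Uz = add_mult_sub[OF N U zA]
    have "rel_depth k N (add_mult N (add_mult N U x) z)" using Suc.IH[OF Ux x(3) z(1,3)] Suc by auto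
    then have "rel_depth k N (add_mult N (add_mult N U z) x)" unfolding add_mult_comm[OF N U xA zA] .
    \<comment> \<open>Modulo \<open>z\<close> the element \<open>x\<close> is still regular, so this
      quotient has relative depth \<open>n\<close>, and the induction hypothesis can exchange its
      first element for \<open>y\<close>.\<close>
    then have "rel_depth n N (add_mult N U z)" using x(1) reg_swap[OF N U xA zA x(2) z(3)] Suc by auto
    from Suc.IH[OF Uz this ym reg_swap[OF N U yA zA ry z(4)]] Suc
    have "rel_depth k N (add_mult N (add_mult N U z) y)" by auto
    then have "rel_depth k N (add_mult N (add_mult N U y) z)" unfolding add_mult_comm[OF N U zA yA] .
    then have "rel_depth (Suc k) N (add_mult N U y)" using z by auto
    then show ?thesis using Suc by blast
  qed
qed

lemma add_mult_proper:
  assumes fg: "fg_module A N" and U: "submodule U A N" "U \<noteq> carrier N" and x: "x \<in> \<mm>"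
  shows "add_mult N U x \<noteq> carrier N"
proof
  assume eq: "add_mult N U x = carrier N"
  have "U = carrier N"
  proof (rule Nakayama[OF fg U(1)])
    fix n assume "n \<in> carrier N"
    then obtain m where m: "m \<in> carrier N" "n \<ominus>\<^bsub>N\<^esub> x \<odot>\<^bsub>N\<^esub> m \<in> U" using eq unfolding add_mult_def by blast
    have "x \<odot>\<^bsub>N\<^esub> m \<in> ideal_smult A \<mm> N" unfolding ideal_smult_def
      by (rule subsetD[OF span_incl]) (use x m in blast)
    then show "\<exists>w\<in>ideal_smult A \<mm> N. n \<ominus>\<^bsub>N\<^esub> w \<in> U" using m(2) by blast
  qed
  then show False using U(2) by simp
qed

text \<open>A maximal counterexample has no socle, hence a regular element in the maximal ideal. By
  maximality adding its multiples does not enlarge the submodule, which contradicts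
  regularity.\<close>

lemma rel_depth_exists:
  assumes fg: "fg_module A N" and U: "submodule U A N" "U \<noteq> carrier N"
  shows "\<exists>n. rel_depth n N U"
proof (rule ccontr)
  assume no: "\<nexists>n. rel_depth n N U"
  have N: "module A N" by (rule fg_module_D[OF fg])
  let ?\<F> = "{V. submodule V A N \<and> V \<noteq> carrier N \<and> (\<nexists>n. rel_depth n N V)}"
  have "?\<F> \<noteq> {}" using U no by blast
  moreover have "submodule V A N" if "V \<in> ?\<F>" for V using that by blast
  ultimately have "\<exists>W\<in>?\<F>. \<forall>V\<in>?\<F>. W \<subseteq> V \<longrightarrow> V = W" by (rule maximal_submodule_exists[OF fg])
  then obtain W where W: "submodule W A N" "W \<noteq> carrier N" "\<And>n. \<not> rel_depth n N W"
     "\<And>V. V \<in> ?\<F> \<Longrightarrow> W \<subseteq> V \<Longrightarrow> V = W" by blast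
  have ns: "\<not> soc N W" using W(3)[of 0] by simp
  obtain x where x: "x \<in> \<mm>" "reg N W x" using common_regular[OF fg W(1) ns fg W(1) ns] by blast
  have xA: "x \<in> carrier A" using x mm_in by auto
  have "\<not> rel_depth n N (add_mult N W x)" for n using W(3)[of "Suc n"] x by auto
  then have "add_mult N W x \<in> ?\<F>" using add_mult_sub[OF N W(1) xA] add_mult_proper[OF fg W(1,2) x(1)] by blast
  then have eq: "add_mult N W x = W" using W(4) add_mult_incl[OF N W(1) xA] by blast
  have "carrier N \<subseteq> W"
  proof
    fix n assume n: "n \<in> carrier N"
    then have "x \<odot>\<^bsub>N\<^esub> n \<in> W" using add_mult_mult[OF N W(1) xA n] eq by simp
    then show "n \<in> W" using x(2) n unfolding reg_def by blast
  qed
  then show False using W(2) sub_subset[OF W(1)] by blast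
qed

section \<open>Regular sequences and the depth of a module\<close>

primrec rel_regular_seq :: "('a, 'n) module \<Rightarrow> 'a list \<Rightarrow> 'n set \<Rightarrow> bool" where
  "rel_regular_seq N [] U = (U \<noteq> carrier N)"
| "rel_regular_seq N (x # xs) U = (reg N U x \<and> rel_regular_seq N xs (add_mult N U x))"

text \<open>By the exchange lemma any regular first element lowers the relative depth by exactly
  one, whichever sequence the depth was computed from.\<close>

lemma rel_regular_seq_le:
  assumes fg: "fg_module A N"
  shows "submodule U A N \<Longrightarrow> rel_depth n N U \<Longrightarrow> set xs \<subseteq> \<mm> \<Longrightarrow> rel_regular_seq N xs U \<Longrightarrow> length xs \<le> n"
proof (induction xs arbitrary: U n)
  case (Cons x xs)
  have N: "module A N" by (rule fg_module_D[OF fg])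
  obtain k where k: "n = Suc k" "rel_depth k N (add_mult N U x)"
    using rel_depth_drop[OF fg Cons.prems(1,2), of x] Cons.prems(3,4) by auto
  have xA: "x \<in> carrier A" using Cons.prems(3) mm_in by auto
  show ?case using Cons.IH[OF add_mult_sub[OF N Cons.prems(1) xA] k(2)] Cons.prems(3,4) k(1) by simp
qed simp

lemma rel_regular_seq_ex: "rel_depth n N U \<Longrightarrow> \<exists>xs. set xs \<subseteq> \<mm> \<and> rel_regular_seq N xs U \<and> length xs = n"
proof (induction n arbitrary: U)
  case 0
  then have "rel_regular_seq N [] U" by (auto simp: soc_def)
  then show ?case by (intro exI[of _ "[]"]) auto
next
  case (Suc n)
  then obtain x where x: "x \<in> \<mm>" "reg N U x" "rel_depth n N (add_mult N U x)" by auto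
  then obtain xs where "set xs \<subseteq> \<mm>" "rel_regular_seq N xs (add_mult N U x)" "length xs = n" using Suc.IH by blast
  then show ?case using x by (intro exI[of _ "x # xs"]) auto
qed

lemma ideal_smult_sub:
  assumes "module A N" "I \<subseteq> carrier A" shows "submodule (ideal_smult A I N) A N"
  unfolding ideal_smult_def using assms module.smult_closed[OF assms(1)] by (intro span_sub) blast+

lemma ideal_smult_insert:
  assumes N: "module A N" and I: "I \<subseteq> carrier A" and x: "x \<in> carrier A"
  shows "ideal_smult A (insert x I) N = add_mult N (ideal_smult A I N) x"
proof
  interpret N: module A N by fact
  note S = ideal_smult_sub[OF N I]
  have res_idx: "submodule (ideal_smult A (insert x I) N) A N" using I x by (intro ideal_smult_sub[OF N]) auto
  have 1: "a \<odot>\<^bsub>N\<^esub> n \<in> ideal_smult A J N" if "a \<in> J" "n \<in> carrier N" for a n J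
    unfolding ideal_smult_def by (rule subsetD[OF span_incl]) (use that in blast)
  show "ideal_smult A (insert x I) N \<subseteq> add_mult N (ideal_smult A I N) x"
    unfolding ideal_smult_def[of _ "insert x I"]
  proof (rule span_least[OF add_mult_sub[OF N S x]], safe)
    fix a n assume an: "a \<in> I" "n \<in> carrier N"
    show "a \<odot>\<^bsub>N\<^esub> n \<in> add_mult N (ideal_smult A I N) x" by (rule subsetD[OF add_mult_incl[OF N S x] 1[OF an]])
  next
    fix a n assume an: "n \<in> carrier N"
    show "x \<odot>\<^bsub>N\<^esub> n \<in> add_mult N (ideal_smult A I N) x" by (rule add_mult_mult[OF N S x an])
  qed
  show "add_mult N (ideal_smult A I N) x \<subseteq> ideal_smult A (insert x I) N"
  proof (rule add_mult_least[OF N S x res_idx])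
    show "ideal_smult A I N \<subseteq> ideal_smult A (insert x I) N"
      unfolding ideal_smult_def by (rule span_mono) blast
  qed (auto intro: 1)
qed

lemma ideal_smult_empty: "module A N \<Longrightarrow> ideal_smult A {} N = {\<zero>\<^bsub>N\<^esub>}"
proof -
  assume N: "module A N"
  have "ideal_smult A {} N \<subseteq> {\<zero>\<^bsub>N\<^esub>}" unfolding ideal_smult_def by (rule span_least[OF sub_triv[OF N]]) simp
  then show ?thesis using sub_zero[OF ideal_smult_sub[OF N, of "{}"]] by blast
qed

lemma rel_regular_seq_iff:
  assumes N: "module A N"
  shows "I \<subseteq> carrier A \<Longrightarrow> set xs \<subseteq> carrier A \<Longrightarrow>
    rel_regular_seq N xs (ideal_smult A I N) \<longleftrightarrow>
     (\<forall>i<length xs. reg N (ideal_smult A (I \<union> set (take i xs)) N) (xs ! i)) \<and>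
     ideal_smult A (I \<union> set xs) N \<noteq> carrier N"
proof (induction xs arbitrary: I)
  case (Cons x xs)
  have "rel_regular_seq N (x # xs) (ideal_smult A I N) \<longleftrightarrow> reg N (ideal_smult A I N) x \<and> rel_regular_seq N xs (ideal_smult A (insert x I) N)"
    using ideal_smult_insert[OF N Cons.prems(1)] Cons.prems(2) by simp
  also have "rel_regular_seq N xs (ideal_smult A (insert x I) N) \<longleftrightarrow>
     (\<forall>i<length xs. reg N (ideal_smult A (insert x I \<union> set (take i xs)) N) (xs ! i)) \<and>
     ideal_smult A (insert x I \<union> set xs) N \<noteq> carrier N"
    using Cons.prems by (intro Cons.IH) auto
  finally show ?case by (simp add: All_less_Suc2)
qed simp

lemma regular_seq_iff:
  assumes N: "module A N" and xs: "set xs \<subseteq> \<mm>"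
  shows "regular_seq A N xs \<longleftrightarrow> rel_regular_seq N xs {\<zero>\<^bsub>N\<^esub>}"
proof -
  have "set xs \<subseteq> carrier A" using xs mm_in by blast
  then show ?thesis using rel_regular_seq_iff[OF N, of "{}" xs]
    by (simp add: regular_seq_def reg_def ideal_smult_empty[OF N])
qed

text \<open>The supremum in \<open>depth\<close> is attained by the sequence behind
  \<open>rel_depth\<close>. The zero module, of infinite depth by convention, has no relative depth
  at all and is thereby excluded.\<close>

lemma depth_eq_rel_depth:
  assumes fg: "fg_module A N" and rel_depth: "rel_depth n N {\<zero>\<^bsub>N\<^esub>}"
  shows "depth A N = enat n"
proof -
  have N: "module A N" by (rule fg_module_D[OF fg])
  obtain xs where xs: "set xs \<subseteq> \<mm>" "rel_regular_seq N xs {\<zero>\<^bsub>N\<^esub>}" "length xs = n" using rel_regular_seq_ex[OF rel_depth] by blast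
  have nz: "\<not> is_zero_mod N"
  proof
    assume z: "is_zero_mod N"
    have "\<not> rel_depth k N (carrier N)" for k
    proof (induction k)
      case 0 show ?case by (simp add: soc_def)
    next
      case (Suc k)
      have "add_mult N (carrier N) x = carrier N" if "x \<in> \<mm>" for x
        using add_mult_incl[OF N sub_carrier[OF N] mm_in[OF that]] by (auto simp: add_mult_def)
      then show ?case using Suc by auto
    qed
    then show False using rel_depth z unfolding is_zero_mod_def by metis
  qed
  have "Sup {enat (length xs) | xs. set xs \<subseteq> \<mm> \<and> regular_seq A N xs} = enat n"
  proof (rule antisym)
    show "Sup {enat (length xs) | xs. set xs \<subseteq> \<mm> \<and> regular_seq A N xs} \<le> enat n"
      using rel_regular_seq_le[OF fg sub_triv[OF N] rel_depth] regular_seq_iff[OF N] by (intro Sup_least) auto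
    show "enat n \<le> Sup {enat (length xs) | xs. set xs \<subseteq> \<mm> \<and> regular_seq A N xs}"
      using xs regular_seq_iff[OF N xs(1)] by (intro Sup_upper) auto
  qed
  then show ?thesis using nz by (simp add: depth_def)
qed

lemma depth_obtain:
  assumes fg: "fg_module A N" and nz: "\<not> is_zero_mod N"
  obtains n where "rel_depth n N {\<zero>\<^bsub>N\<^esub>}" "depth A N = enat n"
proof -
  have N: "module A N" by (rule fg_module_D[OF fg])
  have "{\<zero>\<^bsub>N\<^esub>} \<noteq> carrier N" using nz by (auto simp: is_zero_mod_def)
  from rel_depth_exists[OF fg sub_triv[OF N] this] obtain n where "rel_depth n N {\<zero>\<^bsub>N\<^esub>}" by blast
  then show ?thesis using depth_eq_rel_depth[OF fg] that by blast
qed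

subsection \<open>Complexes modulo a subcomplex\<close>

definition pair_cx :: "(nat \<Rightarrow> ('a, 'c) module) \<Rightarrow> (nat \<Rightarrow> 'c \<Rightarrow> 'c) \<Rightarrow> (nat \<Rightarrow> 'c set) \<Rightarrow> bool" where
  "pair_cx C d V \<longleftrightarrow> (\<forall>j. module A (C j) \<and> lin (C (Suc j)) (C j) (d j) \<and> submodule (V j) A (C j) \<and>
     (\<forall>x\<in>V (Suc j). d j x \<in> V j) \<and> (\<forall>x\<in>carrier (C (Suc (Suc j))). d j (d (Suc j) x) = \<zero>\<^bsub>C j\<^esub>))"

text \<open>The boundaries and the exactness in degree \<open>j + 1\<close> of the quotient complex \<open>C/V\<close>. The differential
  \<open>d j\<close> always runs from degree \<open>j + 1\<close> to degree \<open>j\<close>.\<close>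

definition rel_bd :: "(nat \<Rightarrow> ('a, 'c) module) \<Rightarrow> (nat \<Rightarrow> 'c \<Rightarrow> 'c) \<Rightarrow> (nat \<Rightarrow> 'c set) \<Rightarrow> nat \<Rightarrow> 'c set" where
  "rel_bd C d V j = {z \<in> carrier (C j). \<exists>w\<in>carrier (C (Suc j)). z \<ominus>\<^bsub>C j\<^esub> d j w \<in> V j}"

definition rel_exact :: "(nat \<Rightarrow> ('a, 'c) module) \<Rightarrow> (nat \<Rightarrow> 'c \<Rightarrow> 'c) \<Rightarrow> (nat \<Rightarrow> 'c set) \<Rightarrow> nat \<Rightarrow> bool" where
  "rel_exact C d V j \<longleftrightarrow> (\<forall>z\<in>carrier (C (Suc j)). d j z \<in> V j \<longrightarrow> z \<in> rel_bd C d V (Suc j))"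

lemma pair_cxD:
  assumes "pair_cx C d V"
  shows "module A (C j)" "lin (C (Suc j)) (C j) (d j)" "submodule (V j) A (C j)"
    "x \<in> V (Suc j) \<Longrightarrow> d j x \<in> V j" "x \<in> carrier (C (Suc (Suc j))) \<Longrightarrow> d j (d (Suc j) x) = \<zero>\<^bsub>C j\<^esub>"
  using assms unfolding pair_cx_def by blast+

text \<open>The long exact sequence of 0 -> C/V -> C/V -> C/(V + xC) -> 0 in degree k + 1: a cycle
  \<open>z\<close> modulo \<open>x\<close> has d z = x w, and \<open>H\<close> says that the class
  of \<open>w\<close>, its image under the connecting map, vanishes. \<open>H\<close> is a
  hypothesis because its justification differs between degree 0 and positive degrees.\<close>

lemma rel_exact_add_mult_gen:
  assumes C: "pair_cx C d V" and x: "x \<in> carrier A" and ex: "rel_exact C d V k"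
    and H: "\<And>z w. z \<in> carrier (C (Suc k)) \<Longrightarrow> w \<in> carrier (C k) \<Longrightarrow> d k z \<ominus>\<^bsub>C k\<^esub> x \<odot>\<^bsub>C k\<^esub> w \<in> V k \<Longrightarrow> w \<in> rel_bd C d V k"
  shows "rel_exact C d (\<lambda>j. add_mult (C j) (V j) x) k"
  unfolding rel_exact_def
proof (intro ballI impI)
  interpret M: module A "C k" by (rule pair_cxD(1)[OF C])
  interpret M': module A "C (Suc k)" by (rule pair_cxD(1)[OF C])
  note L = pair_cxD(2)[OF C, of k]
  fix z assume z: "z \<in> carrier (C (Suc k))" and "d k z \<in> add_mult (C k) (V k) x"
  then obtain w where w: "w \<in> carrier (C k)" "d k z \<ominus>\<^bsub>C k\<^esub> x \<odot>\<^bsub>C k\<^esub> w \<in> V k" unfolding add_mult_iff by blast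
  then obtain y where y: "y \<in> carrier (C (Suc k))" "w \<ominus>\<^bsub>C k\<^esub> d k y \<in> V k" using H[OF z] unfolding rel_bd_def by blast
  have xy: "x \<odot>\<^bsub>C (Suc k)\<^esub> y \<in> carrier (C (Suc k))" using x y(1) by blast
  have "d k (z \<ominus>\<^bsub>C (Suc k)\<^esub> x \<odot>\<^bsub>C (Suc k)\<^esub> y) =
      (d k z \<ominus>\<^bsub>C k\<^esub> x \<odot>\<^bsub>C k\<^esub> w) \<oplus>\<^bsub>C k\<^esub> x \<odot>\<^bsub>C k\<^esub> (w \<ominus>\<^bsub>C k\<^esub> d k y)"
    using lin_closed[OF L z] lin_closed[OF L y(1)] w(1) x
    unfolding lin_minus[OF L M'.module_axioms M.module_axioms z xy] lin_smult[OF L x y(1)]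
    by (simp add: a_minus_def M.smult_r_distr M.smult_r_minus M.a_ac M.r_neg M.l_neg M.r_neg1 M.r_neg2
       add_cancel[OF M.module_axioms])
  also have "\<dots> \<in> V k" by (rule sub_add[OF pair_cxD(3)[OF C] w(2) sub_smult[OF pair_cxD(3)[OF C] x y(2)]])
  finally obtain v where v: "v \<in> carrier (C (Suc (Suc k)))"
      "(z \<ominus>\<^bsub>C (Suc k)\<^esub> x \<odot>\<^bsub>C (Suc k)\<^esub> y) \<ominus>\<^bsub>C (Suc k)\<^esub> d (Suc k) v \<in> V (Suc k)"
    using ex M'.minus_closed[OF z xy] unfolding rel_exact_def rel_bd_def by blast
  have dv: "d (Suc k) v \<in> carrier (C (Suc k))" by (rule lin_closed[OF pair_cxD(2)[OF C] v(1)])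
  have "(z \<ominus>\<^bsub>C (Suc k)\<^esub> x \<odot>\<^bsub>C (Suc k)\<^esub> y) \<ominus>\<^bsub>C (Suc k)\<^esub> d (Suc k) v =
     (z \<ominus>\<^bsub>C (Suc k)\<^esub> d (Suc k) v) \<ominus>\<^bsub>C (Suc k)\<^esub> x \<odot>\<^bsub>C (Suc k)\<^esub> y"
    using z xy dv by (simp add: a_minus_def M'.a_ac)
  then have "z \<ominus>\<^bsub>C (Suc k)\<^esub> d (Suc k) v \<in> add_mult (C (Suc k)) (V (Suc k)) x"
    using v(2) z dv y(1) unfolding add_mult_iff by auto
  then show "z \<in> rel_bd C d (\<lambda>j. add_mult (C j) (V j) x) (Suc k)" using z v(1) unfolding rel_bd_def by blast
qed

text \<open>Applying d to d z = x w shows that \<open>x\<close> kills d w in degree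
  \<open>j\<close>; by regularity \<open>w\<close> is a cycle, and by exactness a boundary. One
  degree of exactness is lost at the bottom of the range.\<close>

lemma rel_exact_add_mult:
  assumes C: "pair_cx C d V" and x: "x \<in> carrier A" and ex: "rel_exact C d V j" "rel_exact C d V (Suc j)"
    and r: "reg (C j) (V j) x"
  shows "rel_exact C d (\<lambda>j. add_mult (C j) (V j) x) (Suc j)"
proof (rule rel_exact_add_mult_gen[OF C x ex(2)])
  interpret M: module A "C j" by (rule pair_cxD(1)[OF C])
  interpret M': module A "C (Suc j)" by (rule pair_cxD(1)[OF C])
  note L = pair_cxD(2)[OF C, of j] and V = pair_cxD(3)[OF C]
  fix z w assume z: "z \<in> carrier (C (Suc (Suc j)))" and w: "w \<in> carrier (C (Suc j))"
    and v: "d (Suc j) z \<ominus>\<^bsub>C (Suc j)\<^esub> x \<odot>\<^bsub>C (Suc j)\<^esub> w \<in> V (Suc j)"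
  have dz: "d (Suc j) z \<in> carrier (C (Suc j))" by (rule lin_closed[OF pair_cxD(2)[OF C] z])
  have xw: "x \<odot>\<^bsub>C (Suc j)\<^esub> w \<in> carrier (C (Suc j))" using x w by blast
  have dw: "d j w \<in> carrier (C j)" by (rule lin_closed[OF L w])
  have "d j (d (Suc j) z \<ominus>\<^bsub>C (Suc j)\<^esub> x \<odot>\<^bsub>C (Suc j)\<^esub> w) = \<zero>\<^bsub>C j\<^esub> \<ominus>\<^bsub>C j\<^esub> x \<odot>\<^bsub>C j\<^esub> d j w"
    unfolding lin_minus[OF L M'.module_axioms M.module_axioms dz xw] lin_smult[OF L x w] pair_cxD(5)[OF C z] ..
  then have 1: "\<zero>\<^bsub>C j\<^esub> \<ominus>\<^bsub>C j\<^esub> x \<odot>\<^bsub>C j\<^esub> d j w \<in> V j" using pair_cxD(4)[OF C v] by simp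
  have xd: "x \<odot>\<^bsub>C j\<^esub> d j w \<in> carrier (C j)" using x dw by blast
  have "x \<odot>\<^bsub>C j\<^esub> d j w \<ominus>\<^bsub>C j\<^esub> \<zero>\<^bsub>C j\<^esub> \<in> V j"
    by (rule sub_minus_swap[OF M.module_axioms V M.zero_closed xd 1])
  then have "x \<odot>\<^bsub>C j\<^esub> d j w \<in> V j" using minus_zero_right[OF M.module_axioms xd] by simp
  then have "d j w \<in> V j" using r dw unfolding reg_def by blast
  then show "w \<in> rel_bd C d V (Suc j)" using ex(1) w unfolding rel_exact_def by blast
qed

text \<open>The homology of \<open>C/V\<close> in degree \<open>q\<close> has a nonzero socle.\<close>

definition soc_homology :: "(nat \<Rightarrow> ('a, 'c) module) \<Rightarrow> (nat \<Rightarrow> 'c \<Rightarrow> 'c) \<Rightarrow> (nat \<Rightarrow> 'c set) \<Rightarrow> nat \<Rightarrow> bool" where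
  "soc_homology C d V q \<longleftrightarrow> (\<exists>z\<in>carrier (C q). z \<notin> rel_bd C d V q \<and> (\<forall>j. q = Suc j \<longrightarrow> d j z \<in> V j) \<and>
     (\<forall>a\<in>\<mm>. a \<odot>\<^bsub>C q\<^esub> z \<in> rel_bd C d V q))"

text \<open>The connecting map of \<open>0 \<rightarrow> C/V \<rightarrow> C/V \<rightarrow> C/(V + xC) \<rightarrow> 0\<close> lifts a socle element by one degree.\<close>

lemma soc_homology_add_mult:
  assumes C: "pair_cx C d V" and xm: "x \<in> \<mm>" and ex: "rel_exact C d V q"
    and r: "reg (C q) (V q) x" and s: "soc_homology C d V q"
  shows "soc_homology C d (\<lambda>j. add_mult (C j) (V j) x) (Suc q)"
proof -
  have x: "x \<in> carrier A" by (rule mm_in[OF xm])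
  interpret M: module A "C q" by (rule pair_cxD(1)[OF C])
  interpret M': module A "C (Suc q)" by (rule pair_cxD(1)[OF C])
  note L = pair_cxD(2)[OF C, of q] and V = pair_cxD(3)[OF C]
  note ms = add_cancel[OF M.module_axioms] a_minus_def M.smult_r_distr M.smult_r_minus M.minus_add M.a_ac
    M.r_neg M.l_neg M.r_neg1 M.r_neg2
  obtain z where z: "z \<in> carrier (C q)" "z \<notin> rel_bd C d V q" "\<And>a. a \<in> \<mm> \<Longrightarrow> a \<odot>\<^bsub>C q\<^esub> z \<in> rel_bd C d V q"
    using s unfolding soc_homology_def by blast
  \<comment> \<open>\<open>x\<close> lies in the maximal ideal, so x z is a boundary;
    \<open>w\<close> represents the lifted class.\<close>
  obtain w where w: "w \<in> carrier (C (Suc q))" "x \<odot>\<^bsub>C q\<^esub> z \<ominus>\<^bsub>C q\<^esub> d q w \<in> V q"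
    using z(3)[OF xm] unfolding rel_bd_def by blast
  have xz: "x \<odot>\<^bsub>C q\<^esub> z \<in> carrier (C q)" using x z(1) by blast
  have dw: "d q w \<in> carrier (C q)" by (rule lin_closed[OF L w(1)])
  have "d q w \<ominus>\<^bsub>C q\<^esub> x \<odot>\<^bsub>C q\<^esub> z \<in> V q" by (rule sub_minus_swap[OF M.module_axioms V xz dw w(2)])
  then have 1: "d q w \<in> add_mult (C q) (V q) x" using dw z(1) unfolding add_mult_iff by blast
  have 2: "w \<notin> rel_bd C d (\<lambda>j. add_mult (C j) (V j) x) (Suc q)"
  proof
    assume "w \<in> rel_bd C d (\<lambda>j. add_mult (C j) (V j) x) (Suc q)"
    then obtain v where v: "v \<in> carrier (C (Suc (Suc q)))"
      "w \<ominus>\<^bsub>C (Suc q)\<^esub> d (Suc q) v \<in> add_mult (C (Suc q)) (V (Suc q)) x" unfolding rel_bd_def by blast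
    then obtain y where y: "y \<in> carrier (C (Suc q))"
      "(w \<ominus>\<^bsub>C (Suc q)\<^esub> d (Suc q) v) \<ominus>\<^bsub>C (Suc q)\<^esub> x \<odot>\<^bsub>C (Suc q)\<^esub> y \<in> V (Suc q)" unfolding add_mult_iff by blast
    have dv: "d (Suc q) v \<in> carrier (C (Suc q))" by (rule lin_closed[OF pair_cxD(2)[OF C] v(1)])
    have dy: "d q y \<in> carrier (C q)" by (rule lin_closed[OF L y(1)])
    have xy: "x \<odot>\<^bsub>C (Suc q)\<^esub> y \<in> carrier (C (Suc q))" using x y(1) by blast
    have "d q ((w \<ominus>\<^bsub>C (Suc q)\<^esub> d (Suc q) v) \<ominus>\<^bsub>C (Suc q)\<^esub> x \<odot>\<^bsub>C (Suc q)\<^esub> y)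
       = (d q w \<ominus>\<^bsub>C q\<^esub> \<zero>\<^bsub>C q\<^esub>) \<ominus>\<^bsub>C q\<^esub> x \<odot>\<^bsub>C q\<^esub> d q y"
      unfolding lin_minus[OF L M'.module_axioms M.module_axioms M'.minus_closed[OF w(1) dv] xy]
        lin_minus[OF L M'.module_axioms M.module_axioms w(1) dv] lin_smult[OF L x y(1)] pair_cxD(5)[OF C v(1)] ..
    then have "d q w \<ominus>\<^bsub>C q\<^esub> x \<odot>\<^bsub>C q\<^esub> d q y \<in> V q"
      using pair_cxD(4)[OF C y(2)] minus_zero_right[OF M.module_axioms dw] by simp
    from sub_add[OF V w(2) this]
    have "(x \<odot>\<^bsub>C q\<^esub> z \<ominus>\<^bsub>C q\<^esub> d q w) \<oplus>\<^bsub>C q\<^esub> (d q w \<ominus>\<^bsub>C q\<^esub> x \<odot>\<^bsub>C q\<^esub> d q y) \<in> V q" .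
    also have "(x \<odot>\<^bsub>C q\<^esub> z \<ominus>\<^bsub>C q\<^esub> d q w) \<oplus>\<^bsub>C q\<^esub> (d q w \<ominus>\<^bsub>C q\<^esub> x \<odot>\<^bsub>C q\<^esub> d q y) = x \<odot>\<^bsub>C q\<^esub> (z \<ominus>\<^bsub>C q\<^esub> d q y)"
      using z(1) dw dy x by (simp add: ms)
    finally have "z \<ominus>\<^bsub>C q\<^esub> d q y \<in> V q" using r z(1) dy unfolding reg_def by simp
    then show False using z(1,2) y(1) unfolding rel_bd_def by blast
  qed
  have 3: "a \<odot>\<^bsub>C (Suc q)\<^esub> w \<in> rel_bd C d (\<lambda>j. add_mult (C j) (V j) x) (Suc q)" if am: "a \<in> \<mm>" for a
  proof -
    have a: "a \<in> carrier A" by (rule mm_in[OF am])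
    obtain v where v: "v \<in> carrier (C (Suc q))" "a \<odot>\<^bsub>C q\<^esub> z \<ominus>\<^bsub>C q\<^esub> d q v \<in> V q"
      using z(3)[OF am] unfolding rel_bd_def by blast
    have dv: "d q v \<in> carrier (C q)" by (rule lin_closed[OF L v(1)])
    have aw: "a \<odot>\<^bsub>C (Suc q)\<^esub> w \<in> carrier (C (Suc q))" and xv: "x \<odot>\<^bsub>C (Suc q)\<^esub> v \<in> carrier (C (Suc q))"
      using a x w v by blast+
    have "d q (a \<odot>\<^bsub>C (Suc q)\<^esub> w \<ominus>\<^bsub>C (Suc q)\<^esub> x \<odot>\<^bsub>C (Suc q)\<^esub> v) =
       x \<odot>\<^bsub>C q\<^esub> (a \<odot>\<^bsub>C q\<^esub> z \<ominus>\<^bsub>C q\<^esub> d q v) \<ominus>\<^bsub>C q\<^esub> a \<odot>\<^bsub>C q\<^esub> (x \<odot>\<^bsub>C q\<^esub> z \<ominus>\<^bsub>C q\<^esub> d q w)"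
      unfolding lin_minus[OF L M'.module_axioms M.module_axioms aw xv] lin_smult[OF L x v(1)] lin_smult[OF L a w(1)]
      using z(1) dw dv a x by (simp add: ms smult_lcomm[OF M.module_axioms a x z(1)])
    also have "\<dots> \<in> V q" by (rule sub_minus[OF V sub_smult[OF V x v(2)] sub_smult[OF V a w(2)]])
    finally obtain u where u: "u \<in> carrier (C (Suc (Suc q)))"
      "(a \<odot>\<^bsub>C (Suc q)\<^esub> w \<ominus>\<^bsub>C (Suc q)\<^esub> x \<odot>\<^bsub>C (Suc q)\<^esub> v) \<ominus>\<^bsub>C (Suc q)\<^esub> d (Suc q) u \<in> V (Suc q)"
      using ex M'.minus_closed[OF aw xv] unfolding rel_exact_def rel_bd_def by blast
    have du: "d (Suc q) u \<in> carrier (C (Suc q))" by (rule lin_closed[OF pair_cxD(2)[OF C] u(1)])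
    have "(a \<odot>\<^bsub>C (Suc q)\<^esub> w \<ominus>\<^bsub>C (Suc q)\<^esub> x \<odot>\<^bsub>C (Suc q)\<^esub> v) \<ominus>\<^bsub>C (Suc q)\<^esub> d (Suc q) u =
       (a \<odot>\<^bsub>C (Suc q)\<^esub> w \<ominus>\<^bsub>C (Suc q)\<^esub> d (Suc q) u) \<ominus>\<^bsub>C (Suc q)\<^esub> x \<odot>\<^bsub>C (Suc q)\<^esub> v"
      using aw xv du by (simp add: a_minus_def M'.a_ac)
    then have "a \<odot>\<^bsub>C (Suc q)\<^esub> w \<ominus>\<^bsub>C (Suc q)\<^esub> d (Suc q) u \<in> add_mult (C (Suc q)) (V (Suc q)) x"
      using u(2) M'.minus_closed[OF aw du] v(1) unfolding add_mult_iff by auto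
    then show ?thesis using aw u(1) unfolding rel_bd_def by blast
  qed
  show ?thesis unfolding soc_homology_def using w(1) 1 2 3 by blast
qed

section \<open>Free complexes with coefficients in N/U\<close>

definition pow_sub :: "('a, 'n) module \<Rightarrow> 'n set \<Rightarrow> 's set \<Rightarrow> ('s \<Rightarrow> 'n) set" where
  "pow_sub N U S = {v \<in> carrier (pow_mod N S). \<forall>s\<in>S. v s \<in> U}"

lemma pow_sub_sub: "module A N \<Longrightarrow> submodule U A N \<Longrightarrow> submodule (pow_sub N U S) A (pow_mod N S)"
proof -
  assume N: "module A N" and U: "submodule U A N"
  interpret P: module A "pow_mod N S" by (rule module_pow[OF N])
  show ?thesis
  proof (rule subI[OF P.module_axioms])
    show "\<zero>\<^bsub>pow_mod N S\<^esub> \<in> pow_sub N U S" using P.zero_closed sub_zero[OF U] by (simp add: pow_sub_def)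
    show "u \<oplus>\<^bsub>pow_mod N S\<^esub> v \<in> pow_sub N U S" if "u \<in> pow_sub N U S" "v \<in> pow_sub N U S" for u v
      using P.a_closed[of u v] that sub_add[OF U] by (simp add: pow_sub_def)
    show "a \<odot>\<^bsub>pow_mod N S\<^esub> v \<in> pow_sub N U S" if "a \<in> carrier A" "v \<in> pow_sub N U S" for a v
      using P.smult_closed[of a v] that sub_smult[OF U] by (simp add: pow_sub_def)
  qed (auto simp: pow_sub_def)
qed

lemma pow_sub_reg: "module A N \<Longrightarrow> reg N U x \<Longrightarrow> x \<in> carrier A \<Longrightarrow> reg (pow_mod N S) (pow_sub N U S) x"
  unfolding reg_def pow_sub_def using pow_at[of N] by fastforce

text \<open>Dividing the complex by \<open>x\<close> is the same as dividing its coefficients, so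
  that induction can run on the depth of the coefficients while the free complex stays
  fixed.\<close>

lemma pow_sub_add_mult:
  assumes N: "module A N" and U: "submodule U A N" and x: "x \<in> carrier A"
  shows "add_mult (pow_mod N S) (pow_sub N U S) x = pow_sub N (add_mult N U x) S"
proof
  interpret N: module A N by fact
  interpret P: module A "pow_mod N S" by (rule module_pow[OF N])
  show "add_mult (pow_mod N S) (pow_sub N U S) x \<subseteq> pow_sub N (add_mult N U x) S"
  proof
    fix w assume "w \<in> add_mult (pow_mod N S) (pow_sub N U S) x"
    then obtain u n where *: "u \<in> pow_sub N U S" "n \<in> carrier (pow_mod N S)" "w = u \<oplus>\<^bsub>pow_mod N S\<^esub> x \<odot>\<^bsub>pow_mod N S\<^esub> n"
      by (rule add_mult_E[OF P.module_axioms pow_sub_sub[OF N U] x])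
    have "w s \<in> add_mult N U x" if "s \<in> S" for s
      using * that add_mult_I[OF N U x, of "u s" "n s"] pow_at[OF N *(2)] by (simp add: pow_sub_def)
    moreover have "w \<in> carrier (pow_mod N S)" using * x P.a_closed P.smult_closed unfolding pow_sub_def by blast
    ultimately show "w \<in> pow_sub N (add_mult N U x) S" by (simp add: pow_sub_def)
  qed
  show "pow_sub N (add_mult N U x) S \<subseteq> add_mult (pow_mod N S) (pow_sub N U S) x"
  proof
    fix w assume "w \<in> pow_sub N (add_mult N U x) S"
    then have w: "w \<in> carrier (pow_mod N S)" "\<And>s. s \<in> S \<Longrightarrow> w s \<in> add_mult N U x" by (auto simp: pow_sub_def)
    then have "\<forall>s\<in>S. \<exists>n. n \<in> carrier N \<and> w s \<ominus>\<^bsub>N\<^esub> x \<odot>\<^bsub>N\<^esub> n \<in> U" unfolding add_mult_iff by blast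
    then obtain n where n: "\<forall>s\<in>S. n s \<in> carrier N \<and> w s \<ominus>\<^bsub>N\<^esub> x \<odot>\<^bsub>N\<^esub> n s \<in> U" by (rule bchoice[THEN exE])
    define n' where "n' = (\<lambda>s. if s \<in> S then n s else \<zero>\<^bsub>N\<^esub>)"
    have n': "n' \<in> carrier (pow_mod N S)" using n by (auto simp: n'_def pow_carrier)
    have xn: "x \<odot>\<^bsub>pow_mod N S\<^esub> n' \<in> carrier (pow_mod N S)" using n' x by blast
    have "(w \<ominus>\<^bsub>pow_mod N S\<^esub> x \<odot>\<^bsub>pow_mod N S\<^esub> n') s \<in> U" if "s \<in> S" for s
      unfolding pow_minus[OF N xn] unfolding pow_simps using n that by (simp add: n'_def)
    then have "w \<ominus>\<^bsub>pow_mod N S\<^esub> x \<odot>\<^bsub>pow_mod N S\<^esub> n' \<in> pow_sub N U S"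
      using P.minus_closed[OF w(1) xn] unfolding pow_sub_def by blast
    then show "w \<in> add_mult (pow_mod N S) (pow_sub N U S) x" using w(1) n' unfolding add_mult_iff by blast
  qed
qed

definition free_cx :: "(nat \<Rightarrow> 's set) \<Rightarrow> (nat \<Rightarrow> ('s \<Rightarrow> 'a) \<Rightarrow> ('s \<Rightarrow> 'a)) \<Rightarrow> bool" where
  "free_cx S D \<longleftrightarrow> (\<forall>j. finite (S j) \<and> lin (fr (S (Suc j))) (fr (S j)) (D j) \<and>
     (\<forall>x\<in>carrier (fr (S (Suc (Suc j)))). D j (D (Suc j) x) = (\<lambda>_. \<zero>)))"

abbreviation tC :: "('a, 'n) module \<Rightarrow> (nat \<Rightarrow> 's set) \<Rightarrow> nat \<Rightarrow> ('a, 's \<Rightarrow> 'n) module" where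
  "tC N S \<equiv> \<lambda>j. pow_mod N (S j)"

abbreviation tD :: "('a, 'n) module \<Rightarrow> (nat \<Rightarrow> 's set) \<Rightarrow> (nat \<Rightarrow> ('s \<Rightarrow> 'a) \<Rightarrow> ('s \<Rightarrow> 'a)) \<Rightarrow> nat \<Rightarrow> ('s \<Rightarrow> 'n) \<Rightarrow> ('s \<Rightarrow> 'n)" where
  "tD N S D \<equiv> \<lambda>j. act N (S (Suc j)) (D j)"

lemma act_zero_map:
  assumes "module A N" "v \<in> carrier (pow_mod N S)"
  shows "act N S (\<lambda>x. (\<lambda>_. \<zero>)) v = (\<lambda>_. \<zero>\<^bsub>N\<^esub>)"
proof -
  interpret N: module A N by fact
  show ?thesis unfolding act_def using pow_at[OF assms] by (intro ext N.add.finprod_one_eqI) simp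
qed

lemma act_sub:
  assumes N: "module A N" and U: "submodule U A N" and S: "finite S" and f: "lin (fr S) (fr S') f"
    and v: "v \<in> pow_sub N U S"
  shows "act N S f v \<in> pow_sub N U S'"
proof -
  interpret N: module A N by fact
  have vc: "v \<in> carrier (pow_mod N S)" using v by (simp add: pow_sub_def)
  have fc: "f (unit_vec A k) i \<in> carrier A" if "k \<in> S" for k i
    using pow_at[OF module_self lin_closed[OF f unit_vec_in[OF that]]] by simp
  have "(\<Oplus>\<^bsub>N\<^esub>k\<in>T. f (unit_vec A k) i \<odot>\<^bsub>N\<^esub> v k) \<in> U" if "finite T" "T \<subseteq> S" for i T
    using that
  proof (induction T rule: finite_induct)
    case empty then show ?case using sub_zero[OF U] by simp
  next
    case (insert k T)
    have vU: "v k \<in> U" using v insert.prems by (auto simp: pow_sub_def)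
    have "(\<Oplus>\<^bsub>N\<^esub>k\<in>insert k T. f (unit_vec A k) i \<odot>\<^bsub>N\<^esub> v k) =
       f (unit_vec A k) i \<odot>\<^bsub>N\<^esub> v k \<oplus>\<^bsub>N\<^esub> (\<Oplus>\<^bsub>N\<^esub>k\<in>T. f (unit_vec A k) i \<odot>\<^bsub>N\<^esub> v k)"
      using insert.hyps insert.prems fc pow_at[OF N vc] by (intro N.finsum_insert) auto
    then show ?case using insert sub_add[OF U sub_smult[OF U fc vU]] by auto
  qed
  then show ?thesis using lin_closed[OF act_lin[OF N S f] vc] S by (simp add: pow_sub_def act_def)
qed

lemma free_cx_D:
  assumes "free_cx S D"
  shows "finite (S j)" "lin (fr (S (Suc j))) (fr (S j)) (D j)"
     "x\<in>carrier (fr (S (Suc (Suc j)))) \<Longrightarrow> D j (D (Suc j) x) = (\<lambda>_. \<zero>)"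
  using assms unfolding free_cx_def by blast+

lemma free_cx_pair_cx:
  assumes F: "free_cx S D" and N: "module A N" and U: "submodule U A N"
  shows "pair_cx (tC N S) (tD N S D) (\<lambda>j. pow_sub N U (S j))"
  unfolding pair_cx_def
proof (intro allI conjI ballI)
  fix j
  note fin = free_cx_D(1)[OF F] and L = free_cx_D(2)[OF F]
  show "module A (pow_mod N (S j))" by (rule module_pow[OF N])
  show "lin (pow_mod N (S (Suc j))) (pow_mod N (S j)) (act N (S (Suc j)) (D j))" by (rule act_lin[OF N fin L])
  show "submodule (pow_sub N U (S j)) A (pow_mod N (S j))" by (rule pow_sub_sub[OF N U])
  show "act N (S (Suc j)) (D j) x \<in> pow_sub N U (S j)" if "x \<in> pow_sub N U (S (Suc j))" for x
    by (rule act_sub[OF N U fin L that])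
  fix x assume x: "x \<in> carrier (pow_mod N (S (Suc (Suc j))))"
  have "act N (S (Suc j)) (D j) (act N (S (Suc (Suc j))) (D (Suc j)) x) = act N (S (Suc (Suc j))) (\<lambda>x. D j (D (Suc j) x)) x"
    by (rule act_comp[OF N fin fin L L x, symmetric])
  also have "\<dots> = act N (S (Suc (Suc j))) (\<lambda>x. (\<lambda>_. \<zero>)) x"
    by (rule act_cong[OF N lin_comp[OF L L] free_cx_D(3)[OF F] x])
  also have "\<dots> = (\<lambda>_. \<zero>\<^bsub>N\<^esub>)" by (rule act_zero_map[OF N x])
  finally show "act N (S (Suc j)) (D j) (act N (S (Suc (Suc j))) (D (Suc j)) x) = \<zero>\<^bsub>pow_mod N (S j)\<^esub>" by simp
qed

text \<open>Vanishing of the homology in degree j + 1 of the free complex tensored with N/U.\<close>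

definition exact_mod :: "('a, 'n) module \<Rightarrow> 'n set \<Rightarrow> (nat \<Rightarrow> 's set) \<Rightarrow> (nat \<Rightarrow> ('s \<Rightarrow> 'a) \<Rightarrow> ('s \<Rightarrow> 'a)) \<Rightarrow> nat \<Rightarrow> bool" where
  "exact_mod N U S D j = rel_exact (tC N S) (tD N S D) (\<lambda>j. pow_sub N U (S j)) j"

lemma exact_mod_add_mult:
  assumes F: "free_cx S D" and N: "module A N" and U: "submodule U A N" and x: "x \<in> carrier A" "reg N U x"
    and ex: "exact_mod N U S D j" "exact_mod N U S D (Suc j)"
  shows "exact_mod N (add_mult N U x) S D (Suc j)"
  using rel_exact_add_mult[OF free_cx_pair_cx[OF F N U] x(1) ex[unfolded exact_mod_def] pow_sub_reg[OF N x(2,1)]]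
  unfolding exact_mod_def pow_sub_add_mult[OF N U x(1)] .

text \<open>For a minimal resolution, \<open>g\<close> is the projective dimension of the module
  resolved.\<close>

definition min_cx :: "(nat \<Rightarrow> 's set) \<Rightarrow> (nat \<Rightarrow> ('s \<Rightarrow> 'a) \<Rightarrow> ('s \<Rightarrow> 'a)) \<Rightarrow> nat \<Rightarrow> bool" where
  "min_cx S D g \<longleftrightarrow> free_cx S D \<and> (\<forall>j. \<forall>k\<in>S (Suc j). \<forall>i. D j (unit_vec A k) i \<in> \<mm>) \<and> S g \<noteq> {} \<and> (\<forall>j>g. S j = {})"

lemma pow_empty: "v \<in> carrier (pow_mod N {}) \<Longrightarrow> v = (\<lambda>_. \<zero>\<^bsub>N\<^esub>)"
  by (auto simp: pow_carrier)

lemma rel_bd_top: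
  assumes F: "free_cx S D" and N: "module A N" and U: "submodule U A N" and S: "S (Suc g) = {}"
  shows "rel_bd (tC N S) (tD N S D) (\<lambda>j. pow_sub N U (S j)) g = pow_sub N U (S g)"
proof -
  interpret P: module A "pow_mod N (S g)" by (rule module_pow[OF N])
  have 0: "tD N S D g w = \<zero>\<^bsub>pow_mod N (S g)\<^esub>" if w: "w \<in> carrier (pow_mod N (S (Suc g)))" for w
  proof -
    have "w = \<zero>\<^bsub>pow_mod N (S (Suc g))\<^esub>" using pow_empty[of w N] w S by simp
    then show ?thesis
      using lin_zero[OF act_lin[OF N free_cx_D(1)[OF F] free_cx_D(2)[OF F]] module_pow[OF N] module_pow[OF N]] by metis
  qed
  interpret P': module A "pow_mod N (S (Suc g))" by (rule module_pow[OF N])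
  show ?thesis
    unfolding rel_bd_def using 0 P'.zero_closed minus_zero_right[OF P.module_axioms]
    by (auto simp: pow_sub_def simp del: pow_simps)
qed

text \<open>Each division by a regular element shifts the range of exactness by one; after \<open>n\<close> divisions the
  coefficients have a socle, which by minimality is a nonzero top homology class.\<close>

lemma length_le:
  assumes F: "min_cx S D g" and N: "module A N"
  shows "submodule U A N \<Longrightarrow> rel_depth n N U \<Longrightarrow> (\<And>j. j \<ge> q \<Longrightarrow> exact_mod N U S D j) \<Longrightarrow> g \<le> n + q"
proof (induction n arbitrary: U q)
  case 0
  note Fc = F[unfolded min_cx_def, THEN conjunct1]
  show ?case
  proof (rule ccontr)
    assume "\<not> g \<le> 0 + q"
    then obtain p where p: "g = Suc p" "p \<ge> q" by (cases g) auto
    obtain z where z: "z \<in> carrier N" "z \<notin> U" "\<And>a. a \<in> \<mm> \<Longrightarrow> a \<odot>\<^bsub>N\<^esub> z \<in> U"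
      using "0.prems"(2) by (auto simp: soc_def)
    obtain k where k: "k \<in> S g" using F by (auto simp: min_cx_def)
    \<comment> \<open>A socle element placed in one coordinate of the top degree is a cycle, since
      the matrix of the differential has entries in the maximal ideal; it is no boundary, as nothing
      lies above.\<close>
    have w: "single N k z \<in> carrier (pow_mod N (S (Suc p)))" using single_in[OF N k z(1)] p by simp
    have m: "D p (unit_vec A k) i \<in> \<mm>" for i using F k p by (auto simp: min_cx_def)
    have "tD N S D p (single N k z) \<in> pow_sub N U (S p)"
      using act_single[OF N free_cx_D(1)[OF Fc] free_cx_D(2)[OF Fc] k[unfolded p(1)] z(1)] z(3)[OF m]
        lin_closed[OF act_lin[OF N free_cx_D(1)[OF Fc] free_cx_D(2)[OF Fc]] w] by (simp add: pow_sub_def)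
    then have "single N k z \<in> rel_bd (tC N S) (tD N S D) (\<lambda>j. pow_sub N U (S j)) g"
      using "0.prems"(3)[OF p(2)] w p(1) unfolding exact_mod_def rel_exact_def by blast
    moreover have "S (Suc g) = {}" using F by (auto simp: min_cx_def)
    ultimately have "single N k z \<in> pow_sub N U (S g)" using rel_bd_top[where g=g, OF Fc N "0.prems"(1)] by blast
    then show False using z(2) k by (auto simp: pow_sub_def single_def)
  qed
next
  case (Suc n)
  obtain x where x: "x \<in> \<mm>" "reg N U x" "rel_depth n N (add_mult N U x)" using Suc.prems(2) by auto
  have xA: "x \<in> carrier A" by (rule mm_in[OF x(1)])
  note Fc = F[unfolded min_cx_def, THEN conjunct1]
  \<comment> \<open>The relative depth falls by one and the range of exactness starts one degree
    later, so the sum in the claim is unchanged.\<close>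
  have "exact_mod N (add_mult N U x) S D j" if "j \<ge> Suc q" for j
  proof -
    obtain i where i: "j = Suc i" "i \<ge> q" using \<open>j \<ge> Suc q\<close> by (cases j) auto
    show ?thesis unfolding i(1)
      using Suc.prems(3)[of i] Suc.prems(3)[of "Suc i"] i(2) by (intro exact_mod_add_mult[OF Fc N Suc.prems(1) xA x(2)]) auto
  qed
  note ex = this
  have "g \<le> n + Suc q" by (rule Suc.IH[OF add_mult_sub[OF N Suc.prems(1) xA] x(3) ex])
  then show ?case by simp
qed

text \<open>Each division lowers the relative depth by one and lifts the socle class by one degree,
  keeping n + q. At relative depth zero \<open>length_le\<close> gives g <= q, while a nonzero class
  in degree \<open>q\<close> forces q <= g.\<close>

lemma soc_length_eq:
  assumes F: "min_cx S D g" and N: "module A N"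
  shows "submodule U A N \<Longrightarrow> rel_depth n N U \<Longrightarrow> (\<And>j. j \<ge> q \<Longrightarrow> exact_mod N U S D j) \<Longrightarrow>
     soc_homology (tC N S) (tD N S D) (\<lambda>j. pow_sub N U (S j)) q \<Longrightarrow> n + q = g"
proof (induction n arbitrary: U q)
  case 0
  note Fc = F[unfolded min_cx_def, THEN conjunct1]
  obtain z where z: "z \<in> carrier (pow_mod N (S q))" "z \<notin> rel_bd (tC N S) (tD N S D) (\<lambda>j. pow_sub N U (S j)) q"
    using "0.prems"(4) unfolding soc_homology_def by blast
  have "q \<le> g"
  proof (rule ccontr)
    assume "\<not> q \<le> g"
    then have e: "S q = {}" "S (Suc q) = {}" using F by (auto simp: min_cx_def)
    then have "z \<in> pow_sub N U (S q)" using z(1) by (simp add: pow_sub_def)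
    then show False using z(2) rel_bd_top[where g=q, OF Fc N "0.prems"(1) e(2)] by simp
  qed
  moreover have "g \<le> 0 + q" by (rule length_le[OF F N "0.prems"(1-3)])
  ultimately show ?case by simp
next
  case (Suc n)
  note Fc = F[unfolded min_cx_def, THEN conjunct1] and U = Suc.prems(1)
  obtain x where x: "x \<in> \<mm>" "reg N U x" "rel_depth n N (add_mult N U x)" using Suc.prems(2) by auto
  have xA: "x \<in> carrier A" by (rule mm_in[OF x(1)])
  have "exact_mod N (add_mult N U x) S D j" if "j \<ge> Suc q" for j
  proof -
    obtain i where i: "j = Suc i" "i \<ge> q" using \<open>j \<ge> Suc q\<close> by (cases j) auto
    show ?thesis unfolding i(1)
      using Suc.prems(3)[of i] Suc.prems(3)[of "Suc i"] i(2) by (intro exact_mod_add_mult[OF Fc N Suc.prems(1) xA x(2)]) auto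
  qed
  note ex = this
  have s: "soc_homology (tC N S) (tD N S D) (\<lambda>j. pow_sub N (add_mult N U x) (S j)) (Suc q)"
    using soc_homology_add_mult[OF free_cx_pair_cx[OF Fc N U] x(1) Suc.prems(3)[of q, unfolded exact_mod_def] pow_sub_reg[OF N x(2) xA] Suc.prems(4)]
    unfolding pow_sub_add_mult[OF N U xA] by simp
  have "n + Suc q = g" by (rule Suc.IH[OF add_mult_sub[OF N U xA] x(3) ex s])
  then show ?case by simp
qed

lemma rel_bd_lin:
  assumes C: "pair_cx C d V" and x: "x \<in> carrier A" and z: "z \<in> carrier (C 0)" and y: "y \<in> carrier (C 0)"
  shows "z \<ominus>\<^bsub>C 0\<^esub> x \<odot>\<^bsub>C 0\<^esub> y \<in> rel_bd C d V 0 \<Longrightarrow> z \<in> rel_bd C d (\<lambda>j. add_mult (C j) (V j) x) 0"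
proof -
  interpret M: module A "C 0" by (rule pair_cxD(1)[OF C])
  assume "z \<ominus>\<^bsub>C 0\<^esub> x \<odot>\<^bsub>C 0\<^esub> y \<in> rel_bd C d V 0"
  then obtain w where w: "w \<in> carrier (C (Suc 0))" "(z \<ominus>\<^bsub>C 0\<^esub> x \<odot>\<^bsub>C 0\<^esub> y) \<ominus>\<^bsub>C 0\<^esub> d 0 w \<in> V 0"
    unfolding rel_bd_def by blast
  have dw: "d 0 w \<in> carrier (C 0)" by (rule lin_closed[OF pair_cxD(2)[OF C] w(1)])
  have "(z \<ominus>\<^bsub>C 0\<^esub> x \<odot>\<^bsub>C 0\<^esub> y) \<ominus>\<^bsub>C 0\<^esub> d 0 w = (z \<ominus>\<^bsub>C 0\<^esub> d 0 w) \<ominus>\<^bsub>C 0\<^esub> x \<odot>\<^bsub>C 0\<^esub> y"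
    using z y x dw by (simp add: a_minus_def M.a_ac)
  then have "z \<ominus>\<^bsub>C 0\<^esub> d 0 w \<in> add_mult (C 0) (V 0) x" using w(2) z dw y unfolding add_mult_iff by auto
  then show ?thesis using z w(1) unfolding rel_bd_def by blast
qed

lemma rel_bd_add_mult_E:
  assumes C: "pair_cx C d V" and x: "x \<in> carrier A" and z: "z \<in> rel_bd C d (\<lambda>j. add_mult (C j) (V j) x) 0"
  obtains y where "y \<in> carrier (C 0)" "z \<ominus>\<^bsub>C 0\<^esub> x \<odot>\<^bsub>C 0\<^esub> y \<in> rel_bd C d V 0"
proof -
  interpret M: module A "C 0" by (rule pair_cxD(1)[OF C])
  from z obtain w where w: "z \<in> carrier (C 0)" "w \<in> carrier (C (Suc 0))" "z \<ominus>\<^bsub>C 0\<^esub> d 0 w \<in> add_mult (C 0) (V 0) x"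
    unfolding rel_bd_def by blast
  then obtain y where y: "y \<in> carrier (C 0)" "(z \<ominus>\<^bsub>C 0\<^esub> d 0 w) \<ominus>\<^bsub>C 0\<^esub> x \<odot>\<^bsub>C 0\<^esub> y \<in> V 0" unfolding add_mult_iff by blast
  have dw: "d 0 w \<in> carrier (C 0)" by (rule lin_closed[OF pair_cxD(2)[OF C] w(2)])
  have "(z \<ominus>\<^bsub>C 0\<^esub> d 0 w) \<ominus>\<^bsub>C 0\<^esub> x \<odot>\<^bsub>C 0\<^esub> y = (z \<ominus>\<^bsub>C 0\<^esub> x \<odot>\<^bsub>C 0\<^esub> y) \<ominus>\<^bsub>C 0\<^esub> d 0 w"
    using w(1) y x dw by (simp add: a_minus_def M.a_ac)
  then have "z \<ominus>\<^bsub>C 0\<^esub> x \<odot>\<^bsub>C 0\<^esub> y \<in> rel_bd C d V 0" using y w(1,2) x unfolding rel_bd_def by auto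
  with y(1) show ?thesis by (rule that)
qed

text \<open>Here \<open>S\<close> and \<open>D\<close> form a resolution of \<open>X/V\<close> by free \<open>A/U\<close>-modules. The induction divides both sides
  by an element regular on \<open>A/U\<close> and \<open>X/V\<close>, until \<open>X/V\<close> has a nonzero socle.\<close>

lemma rel_Auslander_Buchsbaum:
  assumes F: "min_cx S D g" and X: "fg_module A X" and e: "lin (fr (S 0)) X e" "e ` carrier (fr (S 0)) = carrier X"
  shows "submodule U A (self_mod A) \<Longrightarrow> submodule V A X \<Longrightarrow> rel_depth n (self_mod A) U \<Longrightarrow> rel_depth k X V \<Longrightarrow>
    (\<And>j. exact_mod (self_mod A) U S D j) \<Longrightarrow>
    (\<And>z. z \<in> carrier (fr (S 0)) \<Longrightarrow>
        e z \<in> V \<longleftrightarrow> z \<in> rel_bd (tC (self_mod A) S) (tD (self_mod A) S D) (\<lambda>j. pow_sub (self_mod A) U (S j)) 0) \<Longrightarrow>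
    n = k + g"
proof (induction k arbitrary: U V n)
  case 0
  have XM: "module A X" by (rule fg_module_D[OF X])
  let ?B = "rel_bd (tC (self_mod A) S) (tD (self_mod A) S D) (\<lambda>j. pow_sub (self_mod A) U (S j)) 0"
  obtain y where y: "y \<in> carrier X" "y \<notin> V" "\<And>a. a \<in> \<mm> \<Longrightarrow> a \<odot>\<^bsub>X\<^esub> y \<in> V"
    using "0.prems"(4) by (auto simp: soc_def)
  obtain z where z: "z \<in> carrier (fr (S 0))" "e z = y" using y(1) e(2) by (metis imageE)
  interpret P: module A "fr (S 0)" by (rule module_fr)
  have "z \<notin> ?B" using "0.prems"(6)[OF z(1)] z(2) y(2) by simp
  moreover have "a \<odot>\<^bsub>fr (S 0)\<^esub> z \<in> ?B" if a: "a \<in> \<mm>" for a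
    using "0.prems"(6)[OF P.smult_closed[OF mm_in[OF a] z(1)]] y(3)[OF a] lin_smult[OF e(1) mm_in[OF a] z(1)] z(2) by simp
  \<comment> \<open>The homology in degree 0 is X/V, which has a nonzero socle at relative depth
    zero; exactness in all positive degrees then gives n = g.\<close>
  ultimately have "soc_homology (tC (self_mod A) S) (tD (self_mod A) S D) (\<lambda>j. pow_sub (self_mod A) U (S j)) 0"
    unfolding soc_homology_def using z(1) by blast
  from soc_length_eq[OF F module_self "0.prems"(1,3) "0.prems"(5) this] show ?case by simp
next
  case (Suc k)
  have XM: "module A X" by (rule fg_module_D[OF X])
  note Fc = F[unfolded min_cx_def, THEN conjunct1] and U = Suc.prems(1) and V = Suc.prems(2)
  note C = free_cx_pair_cx[OF Fc module_self U]
  let ?C = "tC (self_mod A) S" and ?d = "tD (self_mod A) S D" and ?V = "\<lambda>j. pow_sub (self_mod A) U (S j)"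
  interpret P: module A "fr (S 0)" by (rule module_fr)
  interpret XM: module A X by (rule XM)
  note eV = Suc.prems(6)
  have pwB: "z \<in> rel_bd ?C ?d ?V 0" if z: "z \<in> ?V 0" for z
  proof -
    interpret P': module A "fr (S (Suc 0))" by (rule module_fr)
    have zc: "z \<in> carrier (fr (S 0))" using z by (simp add: pow_sub_def)
    have "?d 0 \<zero>\<^bsub>fr (S (Suc 0))\<^esub> = \<zero>\<^bsub>fr (S 0)\<^esub>" by (rule lin_zero[OF pair_cxD(2)[OF C] pair_cxD(1)[OF C] pair_cxD(1)[OF C]])
    then have "z \<ominus>\<^bsub>fr (S 0)\<^esub> ?d 0 \<zero>\<^bsub>fr (S (Suc 0))\<^esub> \<in> ?V 0"
      using z minus_zero_right[OF P.module_axioms zc] by simp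
    then show ?thesis using zc P'.zero_closed unfolding rel_bd_def by blast
  qed
  obtain x0 where x0: "x0 \<in> \<mm>" "reg X V x0" using Suc.prems(4) by auto
  have nsX: "\<not> soc X V" by (rule reg_not_soc[OF x0])
  \<comment> \<open>If A/U had a nonzero socle, the resolution would have length 0 and X/V would be
    a nonzero free A/U-module; a socle element in one coordinate would then contradict the regular
    element on X/V.\<close>
  have nsA: "\<not> soc (self_mod A) U"
  proof
    assume s: "soc (self_mod A) U"
    then have "rel_depth 0 (self_mod A) U" by simp
    from length_le[where q=0, OF F module_self U this Suc.prems(5)] have g: "g = 0" by simp
    obtain z where z: "z \<in> carrier A" "z \<notin> U" "\<And>a. a \<in> \<mm> \<Longrightarrow> a \<otimes> z \<in> U"
      using s by (auto simp: soc_def)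
    obtain t where t: "t \<in> S 0" using F g by (auto simp: min_cx_def)
    have S1: "S (Suc 0) = {}" using F g by (auto simp: min_cx_def)
    let ?z = "single (self_mod A) t z"
    have zc: "?z \<in> carrier (fr (S 0))" using single_in[OF module_self t] z(1) by simp
    have "?z \<notin> ?V 0" using t z(2) by (auto simp: pow_sub_def single_def)
    then have "e ?z \<notin> V" using rel_bd_top[where g=0, OF Fc module_self U S1] eV[OF zc] by simp
    moreover have "a \<odot>\<^bsub>X\<^esub> e ?z \<in> V" if a: "a \<in> \<mm>" for a
    proof -
      have aA: "a \<in> carrier A" by (rule mm_in[OF a])
      have ac: "a \<odot>\<^bsub>fr (S 0)\<^esub> ?z \<in> carrier (fr (S 0))" by (rule P.smult_closed[OF aA zc])
      have "a \<odot>\<^bsub>fr (S 0)\<^esub> ?z \<in> ?V 0"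
        unfolding pow_sub_def using ac z(3)[OF a] sub_zero[OF U] aA by (auto simp: single_def)
      then have "e (a \<odot>\<^bsub>fr (S 0)\<^esub> ?z) \<in> V" using eV[OF ac] pwB by blast
      then show ?thesis using lin_smult[OF e(1) aA zc] by simp
    qed
    ultimately show False using nsX lin_closed[OF e(1) zc] unfolding soc_def by blast
  qed
  obtain x where x: "x \<in> \<mm>" "reg (self_mod A) U x" "reg X V x"
    using common_regular[OF fg_self U nsA X V nsX] by blast
  have xA: "x \<in> carrier A" by (rule mm_in[OF x(1)])
  obtain n' where n': "n = Suc n'" "rel_depth n' (self_mod A) (add_mult (self_mod A) U x)"
    using rel_depth_drop[OF fg_self U Suc.prems(3) x(1,2)] by blast
  have k': "rel_depth k X (add_mult X V x)" using rel_depth_drop[OF X V Suc.prems(4) x(1,3)] by simp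
  have pwx: "add_mult (?C j) (?V j) x = pow_sub (self_mod A) (add_mult (self_mod A) U x) (S j)" for j
    by (rule pow_sub_add_mult[OF module_self U xA])
  have key: "e (z \<ominus>\<^bsub>fr (S 0)\<^esub> x \<odot>\<^bsub>fr (S 0)\<^esub> w) = e z \<ominus>\<^bsub>X\<^esub> x \<odot>\<^bsub>X\<^esub> e w"
    if "z \<in> carrier (fr (S 0))" "w \<in> carrier (fr (S 0))" for z w
    using lin_minus[OF e(1) module_fr XM that(1) P.smult_closed[OF xA that(2)]] lin_smult[OF e(1) xA that(2)] by simp
  have ex: "exact_mod (self_mod A) (add_mult (self_mod A) U x) S D j" for j
  proof (cases j)
    case (Suc i)
    show ?thesis unfolding Suc by (rule exact_mod_add_mult[OF Fc module_self U xA x(2) Suc.prems(5) Suc.prems(5)])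
  next
    case 0
    \<comment> \<open>In the lowest degree there is no earlier exactness to appeal to; the
      augmentation \<open>e\<close> and the regularity of \<open>x\<close> on X/V take its
      place.\<close>
    have "rel_exact ?C ?d (\<lambda>j. add_mult (?C j) (?V j) x) 0"
    proof (rule rel_exact_add_mult_gen[OF C xA Suc.prems(5)[unfolded exact_mod_def]])
      fix z w assume z: "z \<in> carrier (fr (S (Suc 0)))" and w: "w \<in> carrier (fr (S 0))"
        and v: "?d 0 z \<ominus>\<^bsub>fr (S 0)\<^esub> x \<odot>\<^bsub>fr (S 0)\<^esub> w \<in> ?V 0"
      have dz: "?d 0 z \<in> carrier (fr (S 0))" by (rule lin_closed[OF pair_cxD(2)[OF C] z])
      have xw: "x \<odot>\<^bsub>fr (S 0)\<^esub> w \<in> carrier (fr (S 0))" by (rule P.smult_closed[OF xA w])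
      have "?d 0 z \<ominus>\<^bsub>fr (S 0)\<^esub> ?d 0 z = \<zero>\<^bsub>fr (S 0)\<^esub>" using dz by (simp add: a_minus_def P.r_neg del: pow_simps)
      also have "\<dots> \<in> ?V 0" by (rule sub_zero[OF pair_cxD(3)[OF C]])
      finally have "?d 0 z \<in> rel_bd ?C ?d ?V 0" using z dz unfolding rel_bd_def by blast
      then have 1: "e (?d 0 z) \<in> V" using eV[OF dz] by blast
      have 2: "e (?d 0 z) \<ominus>\<^bsub>X\<^esub> x \<odot>\<^bsub>X\<^esub> e w \<in> V"
        using eV[OF P.minus_closed[OF dz xw]] pwB[OF v] key[OF dz w] by simp
      have ed: "e (?d 0 z) \<in> carrier X" and ew: "e w \<in> carrier X" using lin_closed[OF e(1)] dz w by blast+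
      have "(x \<odot>\<^bsub>X\<^esub> e w \<ominus>\<^bsub>X\<^esub> e (?d 0 z)) \<oplus>\<^bsub>X\<^esub> e (?d 0 z) \<in> V"
        using sub_add[OF V sub_minus_swap[OF XM V ed XM.smult_closed[OF xA ew] 2] 1] .
      then have "x \<odot>\<^bsub>X\<^esub> e w \<in> V" using minus_add_cancel[OF XM XM.smult_closed[OF xA ew] ed] by simp
      then have "e w \<in> V" using x(3) ew unfolding reg_def by blast
      then show "w \<in> rel_bd ?C ?d ?V 0" using eV[OF w] by blast
    qed
    then show ?thesis unfolding exact_mod_def pwx 0 .
  qed
  have eV': "e z \<in> add_mult X V x \<longleftrightarrow> z \<in> rel_bd ?C ?d (\<lambda>j. pow_sub (self_mod A) (add_mult (self_mod A) U x) (S j)) 0"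
    if z: "z \<in> carrier (fr (S 0))" for z
    unfolding pwx[symmetric]
  proof
    assume "e z \<in> add_mult X V x"
    then obtain y where y: "y \<in> carrier X" "e z \<ominus>\<^bsub>X\<^esub> x \<odot>\<^bsub>X\<^esub> y \<in> V" unfolding add_mult_iff by blast
    obtain w where w: "w \<in> carrier (fr (S 0))" "e w = y" using y(1) e(2) by (metis imageE)
    have xw: "x \<odot>\<^bsub>fr (S 0)\<^esub> w \<in> carrier (fr (S 0))" by (rule P.smult_closed[OF xA w(1)])
    have "z \<ominus>\<^bsub>fr (S 0)\<^esub> x \<odot>\<^bsub>fr (S 0)\<^esub> w \<in> rel_bd ?C ?d ?V 0"
      using eV[OF P.minus_closed[OF z xw]] y(2) key[OF z w(1)] w(2) by simp
    then show "z \<in> rel_bd ?C ?d (\<lambda>j. add_mult (?C j) (?V j) x) 0" by (rule rel_bd_lin[OF C xA z w(1)])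
  next
    assume "z \<in> rel_bd ?C ?d (\<lambda>j. add_mult (?C j) (?V j) x) 0"
    then obtain y where y: "y \<in> carrier (fr (S 0))" "z \<ominus>\<^bsub>fr (S 0)\<^esub> x \<odot>\<^bsub>fr (S 0)\<^esub> y \<in> rel_bd ?C ?d ?V 0"
      by (rule rel_bd_add_mult_E[OF C xA])
    have "e z \<ominus>\<^bsub>X\<^esub> x \<odot>\<^bsub>X\<^esub> e y \<in> V"
      using eV[OF P.minus_closed[OF z P.smult_closed[OF xA y(1)]]] y(2) key[OF z y(1)] by simp
    then show "e z \<in> add_mult X V x" using lin_closed[OF e(1)] z y(1) unfolding add_mult_iff by blast
  qed
  from Suc.IH[OF add_mult_sub[OF module_self U xA] add_mult_sub[OF XM V xA] n'(2) k' ex eV']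
  show ?case using n'(1) by simp
qed

subsection \<open>Minimal free resolutions\<close>

lemma fg_fr: "fg_module A (fr {..<n::nat})"
  using noetherian_free[OF sub_carrier[OF module_fr]] module_fr unfolding fg_module_def by blast

text \<open>Stated for submodules because the next cover in a resolution is that of a kernel inside
  the previous free module. \<open>min_gens\<close> yields a subset of the basis, which is then
  renumbered to an initial segment.\<close>

lemma cover_ex:
  assumes X: "fg_module A X" and W: "submodule W A X"
  shows "\<exists>(r :: nat) e. e \<in> mod_hom A (fr {..<r}) X \<and> e ` carrier (fr {..<r}) = W \<and>
    (\<forall>x\<in>carrier (fr {..<r}). e x = \<zero>\<^bsub>X\<^esub> \<longrightarrow> (\<forall>k. x k \<in> \<mm>))"
proof -
  have XM: "module A X" by (rule fg_module_D[OF X])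
  interpret X: module A X by (rule XM)
  obtain B where B: "finite B" "B \<subseteq> W" "mod_span A X B = W" using noetherian_fg[OF X W] by blast
  have BX: "B \<subseteq> carrier X" using B(2) sub_subset[OF W] by blast
  obtain r0 :: nat and e where e: "lin (fr {..<r0}) X e" "e ` carrier (fr {..<r0}) = W"
    using span_lin_ex[OF XM B(1) BX] unfolding B(3) by blast
  from min_gens[OF XM sub_triv[OF XM] _ e(1)] obtain S where S: "S \<subseteq> {..<r0}"
    "\<And>x. x\<in>carrier (fr {..<r0}) \<Longrightarrow> \<exists>y\<in>carrier (fr S). e x \<ominus>\<^bsub>X\<^esub> e y \<in> {\<zero>\<^bsub>X\<^esub>}"
    "\<And>x k. x\<in>carrier (fr S) \<Longrightarrow> e x \<in> {\<zero>\<^bsub>X\<^esub>} \<Longrightarrow> x k \<in> \<mm>" by blast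
  have eS: "lin (fr S) X e" by (rule lin_mono[OF module_self S(1) e(1)])
  have SF: "carrier (fr S) \<subseteq> carrier (fr {..<r0})" by (rule pow_mono[OF module_self S(1)])
  have finS: "finite S" using S(1) finite_subset by blast
  obtain r :: nat and h where h: "bij_betw h {..<r} S"
    using ex_bij_betw_nat_finite[OF finS] by (metis atLeast0LessThan)
  define \<rho> where "\<rho> = (\<lambda>(x::nat \<Rightarrow> 'a) s. if s \<in> S then x (inv_into {..<r} h s) else \<zero>)"
  have hi: "inv_into {..<r} h s \<in> {..<r}" "h (inv_into {..<r} h s) = s" if "s \<in> S" for s
    using h that by (auto simp: bij_betw_def inv_into_into f_inv_into_f)
  have hk: "h k \<in> S" "inv_into {..<r} h (h k) = k" if "k < r" for k
    using h that by (auto simp: bij_betw_def)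
  have \<rho>: "lin (fr {..<r}) (fr S) \<rho>"
    unfolding lin_def
  proof (intro conjI funcsetI ballI)
    fix x assume x: "x \<in> carrier (fr {..<r})"
    show "\<rho> x \<in> carrier (fr S)" using hi x by (auto simp: \<rho>_def pow_carrier)
  qed (auto simp: \<rho>_def fun_eq_iff)
  have e': "lin (fr {..<r}) X (\<lambda>x. e (\<rho> x))" by (rule lin_comp[OF \<rho> eS])
  have 1: "e (\<rho> x) \<in> W" if "x \<in> carrier (fr {..<r})" for x
    using lin_closed[OF \<rho> that] SF e(2) by blast
  have 2: "\<exists>x\<in>carrier (fr {..<r}). w = e (\<rho> x)" if w: "w \<in> W" for w
  proof -
    have "w \<in> e ` carrier (fr {..<r0})" unfolding e(2) by (rule w)
    then obtain x where x: "x \<in> carrier (fr {..<r0})" "w = e x" by blast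
    then obtain y where y: "y \<in> carrier (fr S)" "e x \<ominus>\<^bsub>X\<^esub> e y = \<zero>\<^bsub>X\<^esub>" using S(2) by blast
    have ex: "e x \<in> carrier X" "e y \<in> carrier X" using lin_closed[OF e(1) x(1)] lin_closed[OF eS y(1)] by blast+
    have "e x = (e x \<ominus>\<^bsub>X\<^esub> e y) \<oplus>\<^bsub>X\<^esub> e y" using minus_add_cancel[OF XM ex] by simp
    then have "w = e y" using x(2) y(2) ex by simp
    define x' where "x' = (\<lambda>k. if k < r then y (h k) else \<zero>)"
    have "x' \<in> carrier (fr {..<r})" using y(1) hk by (auto simp: x'_def pow_carrier)
    moreover have "\<rho> x' = y" using hi y(1) by (auto simp: \<rho>_def x'_def pow_carrier fun_eq_iff)
    ultimately show ?thesis using \<open>w = e y\<close> by blast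
  qed
  have 3: "x k \<in> \<mm>" if x: "x \<in> carrier (fr {..<r})" "e (\<rho> x) = \<zero>\<^bsub>X\<^esub>" for x k
  proof (cases "k < r")
    case True
    have "\<rho> x (h k) \<in> \<mm>" using S(3)[OF lin_closed[OF \<rho> x(1)]] x(2) by blast
    then show ?thesis using hk[OF True] by (simp add: \<rho>_def)
  next
    case False
    then show ?thesis using x(1) mm_zero by (simp add: pow_carrier)
  qed
  show ?thesis
  proof (intro exI conjI ballI impI allI)
    show "restrict (\<lambda>x. e (\<rho> x)) (carrier (fr {..<r})) \<in> mod_hom A (fr {..<r}) X"
      by (rule lin_restrict[OF e' module_fr])
    show "restrict (\<lambda>x. e (\<rho> x)) (carrier (fr {..<r})) ` carrier (fr {..<r}) = W" using 1 2 by force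
    show "x k \<in> \<mm>" if "x \<in> carrier (fr {..<r})" "restrict (\<lambda>x. e (\<rho> x)) (carrier (fr {..<r})) x = \<zero>\<^bsub>X\<^esub>" for x k
      using 3 that by simp
  qed
qed

text \<open>Such vectors form a power of the maximal ideal regarded as a module, so the induction
  principle for powers applies to them.\<close>

lemma mm_coords:
  assumes S: "finite S" and v: "v \<in> carrier (fr S)" "\<And>k. v k \<in> \<mm>"
  shows "v \<in> ideal_smult A \<mm> (fr S)"
proof -
  let ?M = "(self_mod A)\<lparr>carrier := \<mm>\<rparr>"
  have M: "module A ?M" by (rule submodule.submodule_is_module[OF mm_sub module_self])
  have z: "\<zero>\<^bsub>?M\<^esub> = \<zero>" and p: "x \<oplus>\<^bsub>pow_mod ?M S\<^esub> y = x \<oplus>\<^bsub>fr S\<^esub> y" for x y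
    by (simp_all add: self_mod_def pow_mod_def)
  have sb: "submodule (ideal_smult A \<mm> (fr S)) A (fr S)"
    by (rule ideal_smult_sub[OF module_fr]) (use mm_in in blast)
  have v': "v \<in> carrier (pow_mod ?M S)" using v z by (simp add: pow_carrier)
  show ?thesis using M S v'
  proof (induction rule: pow_induct)
    case zero show ?case using sub_zero[OF sb] z by simp
  next
    case (single s n)
    have nA: "n \<in> carrier A" using single mm_in by simp
    have "single ?M s n = single (self_mod A) s n" by (auto simp: single_def z fun_eq_iff)
    also have "\<dots> = n \<odot>\<^bsub>fr S\<^esub> unit_vec A s" by (rule single_smult_unit[OF nA])
    also have "\<dots> \<in> ideal_smult A \<mm> (fr S)" unfolding ideal_smult_def
      by (rule subsetD[OF span_incl]) (use single unit_vec_in[OF single(1)] in auto)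
    finally show ?case .
  next
    case (add x y) then show ?case unfolding p using sub_add[OF sb] by blast
  qed
qed

lemma fr_mm_sub: "submodule {v \<in> carrier (fr S). \<forall>k. v k \<in> \<mm>} A (fr S)"
proof -
  interpret P: module A "fr S" by (rule module_fr)
  show ?thesis
  proof (rule subI[OF module_fr])
    show "\<zero>\<^bsub>fr S\<^esub> \<in> {v \<in> carrier (fr S). \<forall>k. v k \<in> \<mm>}" using P.zero_closed mm_zero by simp
    show "u \<oplus>\<^bsub>fr S\<^esub> v \<in> {v \<in> carrier (fr S). \<forall>k. v k \<in> \<mm>}"
      if "u \<in> {v \<in> carrier (fr S). \<forall>k. v k \<in> \<mm>}" "v \<in> {v \<in> carrier (fr S). \<forall>k. v k \<in> \<mm>}" for u v
      using P.a_closed[of u v] that mm_add by simp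
    show "a \<odot>\<^bsub>fr S\<^esub> v \<in> {v \<in> carrier (fr S). \<forall>k. v k \<in> \<mm>}"
      if "a \<in> carrier A" "v \<in> {v \<in> carrier (fr S). \<forall>k. v k \<in> \<mm>}" for a v
      using P.smult_closed[of a v] that mm_mult by simp
  qed auto
qed

lemma coords_mm:
  assumes v: "v \<in> ideal_smult A \<mm> (fr S)" shows "v k \<in> \<mm>"
proof -
  have "ideal_smult A \<mm> (fr S) \<subseteq> {v \<in> carrier (fr S). \<forall>k. v k \<in> \<mm>}" unfolding ideal_smult_def
  proof (rule span_least[OF fr_mm_sub])
    interpret P: module A "fr S" by (rule module_fr)
    show "{a \<odot>\<^bsub>fr S\<^esub> x | a x. a \<in> \<mm> \<and> x \<in> carrier (fr S)} \<subseteq> {v \<in> carrier (fr S). \<forall>k. v k \<in> \<mm>}"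
    proof safe
      fix a x assume a: "a \<in> \<mm>" and x: "x \<in> carrier (fr S)"
      show "a \<odot>\<^bsub>fr S\<^esub> x \<in> carrier (fr S)" by (rule P.smult_closed[OF mm_in[OF a] x])
      fix k
      have "x k \<in> carrier A" using pow_at[OF module_self x] by simp
      then show "(a \<odot>\<^bsub>fr S\<^esub> x) k \<in> \<mm>" using mm_mult[of "x k" a] a mm_in[OF a] by (simp add: m_comm)
    qed
  qed
  then show ?thesis using v by blast
qed

lemma zero_fr: "is_zero_mod (fr {..<(0::nat)})"
  by (auto simp: is_zero_mod_def pow_mod_def)

lemma kernel_sub:
  assumes "module A M" "module A N" "lin M N f" shows "submodule (a_kernel M N f) A M"
  using sub_preimage[OF assms sub_triv[OF assms(2)]] by (simp add: a_kernel_def')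

text \<open>Covers are iterated by dependent choice; a stage is a triple of target rank, source rank
  and differential. Entries of the differentials are in the maximal ideal because their images are
  kernels of minimal covers.\<close>

lemma min_res_exists:
  assumes X: "fg_module A X"
  shows "\<exists>r d e. min_free_resolution A X r d e"
proof -
  have XM: "module A X" by (rule fg_module_D[OF X])
  let ?hom = "\<lambda>r r'. mod_hom A (fr {..<r::nat}) (fr {..<r'::nat})"
  from cover_ex[OF X sub_carrier[OF XM]]
  obtain r0 :: nat and e where e: "e \<in> mod_hom A (fr {..<r0}) X" "e ` carrier (fr {..<r0}) = carrier X"
    "\<forall>x\<in>carrier (fr {..<r0}). e x = \<zero>\<^bsub>X\<^esub> \<longrightarrow> (\<forall>k. x k \<in> \<mm>)" by blast
  define P where "P = (\<lambda>(n::nat) (r, r', D). D \<in> ?hom r' r \<and>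
     (\<forall>x\<in>carrier (fr {..<r'}). D x = (\<lambda>_. \<zero>) \<longrightarrow> (\<forall>k. x k \<in> \<mm>)) \<and>
     (n = 0 \<longrightarrow> r = r0 \<and> D ` carrier (fr {..<r'}) = a_kernel (fr {..<r0}) X e))"
  define Q where "Q = (\<lambda>(n::nat) (r::nat, r'::nat, D) (s, s'::nat, E). s = r' \<and>
      E ` carrier (fr {..<s'}) = a_kernel (fr {..<r'}) (fr {..<r}) D)"
  obtain f where f: "\<And>n. P n (f n)" "\<And>n. Q n (f n) (f (Suc n))"
  proof -
    have "\<exists>x. P 0 x"
    proof -
      from cover_ex[OF fg_fr kernel_sub[OF module_fr XM mod_hom_lin[OF e(1)]]]
      obtain r1 :: nat and D where "D \<in> ?hom r1 r0" "D ` carrier (fr {..<r1}) = a_kernel (fr {..<r0}) X e"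
        "\<forall>x\<in>carrier (fr {..<r1}). D x = \<zero>\<^bsub>fr {..<r0}\<^esub> \<longrightarrow> (\<forall>k. x k \<in> \<mm>)" by blast
      then have "P 0 (r0, r1, D)" unfolding P_def by simp
      then show ?thesis by blast
    qed
    moreover have "\<exists>y. P (Suc n) y \<and> Q n x y" if Px: "P n x" for x n
    proof -
      obtain r r' D where x: "x = (r, r', D)" by (cases x)
      have D: "D \<in> ?hom r' r" using Px x by (simp add: P_def)
      from cover_ex[OF fg_fr kernel_sub[OF module_fr module_fr mod_hom_lin[OF D]]]
      obtain s :: nat and E where "E \<in> ?hom s r'" "E ` carrier (fr {..<s}) = a_kernel (fr {..<r'}) (fr {..<r}) D"
        "\<forall>x\<in>carrier (fr {..<s}). E x = \<zero>\<^bsub>fr {..<r'}\<^esub> \<longrightarrow> (\<forall>k. x k \<in> \<mm>)" by blast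
      then have "P (Suc n) (r', s, E) \<and> Q n x (r', s, E)" unfolding P_def Q_def x by simp
      then show ?thesis by blast
    qed
    ultimately show ?thesis using dependent_nat_choice[of P Q] that by blast
  qed
  define R where "R n = fst (f n)" for n
  define D where "D n = snd (snd (f n))" for n
  have R0: "R 0 = r0" using f(1)[of 0] by (auto simp: P_def R_def split: prod.splits)
  have RS: "fst (snd (f n)) = R (Suc n)" for n using f(2)[of n] by (auto simp: Q_def R_def split: prod.splits)
  have fn: "f n = (R n, R (Suc n), D n)" for n using RS[of n] by (simp add: R_def D_def prod_eq_iff)
  have D: "D n \<in> ?hom (R (Suc n)) (R n)" for n using f(1)[of n] by (simp add: fn P_def)
  have Dm: "x k \<in> \<mm>" if "x \<in> carrier (fr {..<R (Suc n)})" "D n x = (\<lambda>_. \<zero>)" for n x k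
    using f(1)[of n] that by (simp add: fn P_def)
  have D0: "D 0 ` carrier (fr {..<R (Suc 0)}) = a_kernel (fr {..<R 0}) X e"
    using f(1)[of 0] R0 by (simp add: fn P_def)
  have DS: "D (Suc n) ` carrier (fr {..<R (Suc (Suc n))}) = a_kernel (fr {..<R (Suc n)}) (fr {..<R n}) (D n)" for n
    using f(2)[of n] by (simp add: fn Q_def)
  define r where "r n = (if n < 0 then 0 else R (nat n))" for n :: int
  \<comment> \<open>Zero in degrees up to 0; stage i of the construction supplies the differential
    out of degree i + 1.\<close>
  define d where "d n = (if n \<le> 0 then restrict (\<lambda>x _. \<zero>) (carrier (fr {..<r n})) else D (nat (n - 1)))" for n :: int
  have FM: "free_mod A {..<k} = fr {..<k}" for k :: nat by (rule free_mod_eq) simp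
  have dpos: "d (int n + 1) = D n" "r (int n) = R n" "r (int n + 1) = R (Suc n)" "r (int n + 1 + 1) = R (Suc (Suc n))" for n
    by (auto simp: d_def r_def nat_add_distrib)
  have dn: "d n \<in> mod_hom A (fr {..<r n}) (fr {..<r (n - 1)})" for n
  proof (cases "n \<le> 0")
    case True
    have "lin (fr {..<r n}) (fr {..<r (n - 1)}) (\<lambda>x _. \<zero>)" using lin_const_zero[OF module_fr, of "fr {..<r n}" "{..<r (n - 1)}"] by simp
    from lin_restrict[OF this module_fr] show ?thesis using True by (simp add: d_def)
  next
    case False
    then obtain m where "n = int m + 1" by (metis nonneg_int_cases not_le zle_diff1_eq diff_add_cancel zero_le_imp_eq_int)
    then show ?thesis using D[of m] dpos[of m] by simp
  qed
  have "resolution A X (\<lambda>n. free_mod A {..<r n}) d e"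
    unfolding resolution_def FM
  proof (intro conjI allI impI)
    show "module A (fr {..<r n})" for n by (rule module_fr)
    show "is_zero_mod (fr {..<r n})" if "n < 0" for n using that zero_fr by (simp add: r_def)
    show "d n \<in> mod_hom A (fr {..<r n}) (fr {..<r (n - 1)})" for n by (rule dn)
    show "e \<in> mod_hom A (fr {..<r 0}) X" "e ` carrier (fr {..<r 0}) = carrier X" using e R0 by (simp_all add: r_def)
    show "a_kernel (fr {..<r 0}) X e = d 1 ` carrier (fr {..<r 1})" using D0 dpos[of 0] by simp
    fix n :: int assume "n > 0"
    then obtain m where "n = int m + 1" by (metis nonneg_int_cases not_le zle_diff1_eq diff_add_cancel zero_le_imp_eq_int)
    then show "a_kernel (fr {..<r n}) (fr {..<r (n - 1)}) (d n) = d (n + 1) ` carrier (fr {..<r (n + 1)})"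
      using DS[of m] dpos[of m] dpos[of "Suc m"] by (simp add: add.commute add.left_commute)
  qed
  moreover have "d n ` carrier (fr {..<r n}) \<subseteq> ideal_smult A \<mm> (fr {..<r (n - 1)})" for n
  proof
    fix y assume "y \<in> d n ` carrier (fr {..<r n})"
    then obtain x where x: "x \<in> carrier (fr {..<r n})" "y = d n x" by blast
    have y: "y \<in> carrier (fr {..<r (n - 1)})" using lin_closed[OF mod_hom_lin[OF dn] x(1)] x(2) by simp
    have "y k \<in> \<mm>" for k
    proof (cases "n \<le> 0")
      case True then show ?thesis using x mm_zero by (simp add: d_def)
    next
      case False
      then obtain m where m: "n = int m + 1" by (metis nonneg_int_cases not_le zle_diff1_eq diff_add_cancel zero_le_imp_eq_int)
      have x': "x \<in> carrier (fr {..<R (Suc m)})" "y = D m x" using x dpos[of m] m by simp_all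
      show ?thesis
      proof (cases m)
        case 0
        then have "y \<in> a_kernel (fr {..<r0}) X e" using x' D0 R0 by blast
        then show ?thesis using e(3) by (simp add: a_kernel_def')
      next
        case (Suc i)
        then have "y \<in> a_kernel (fr {..<R (Suc i)}) (fr {..<R i}) (D i)" using x' DS[of i] by blast
        then show ?thesis using Dm[of y i] by (simp add: a_kernel_def')
      qed
    qed
    then show "y \<in> ideal_smult A \<mm> (fr {..<r (n - 1)})" by (intro mm_coords y) auto
  qed
  ultimately show ?thesis unfolding min_free_resolution_def FM by blast
qed

definition res_idx :: "('a, 'x) module \<Rightarrow> nat \<Rightarrow> nat set" where
  "res_idx X j = {..<fst (min_res A X) (int j)}"

(* Indexed by the degree of the target, in contrast to res_diff. *)

definition res_d :: "('a, 'x) module \<Rightarrow> nat \<Rightarrow> (nat \<Rightarrow> 'a) \<Rightarrow> (nat \<Rightarrow> 'a)" where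
  "res_d X j = snd (min_res A X) (int j + 1)"

lemma min_res_is_resolution:
  assumes "fg_module A X"
  shows "\<exists>e. min_free_resolution A X (fst (min_res A X)) (snd (min_res A X)) e"
proof -
  from min_res_exists[OF assms] have "\<exists>p. case p of (r, d) \<Rightarrow> \<exists>e. min_free_resolution A X r d e" by simp
  from someI_ex[OF this] show ?thesis unfolding min_res_def[symmetric] by (simp add: case_prod_beta)
qed

lemma min_res_props:
  assumes X: "fg_module A X"
  shows "\<exists>e. lin (fr (res_idx X 0)) X e \<and> e ` carrier (fr (res_idx X 0)) = carrier X \<and>
     a_kernel (fr (res_idx X 0)) X e = res_d X 0 ` carrier (fr (res_idx X (Suc 0)))"
     "free_cx (res_idx X) (res_d X)" "a_kernel (fr (res_idx X (Suc j))) (fr (res_idx X j)) (res_d X j) = res_d X (Suc j) ` carrier (fr (res_idx X (Suc (Suc j))))"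
     "k \<in> res_idx X (Suc j) \<Longrightarrow> res_d X j (unit_vec A k) i \<in> \<mm>"
proof -
  let ?r = "fst (min_res A X)" and ?d = "snd (min_res A X)"
  have FM: "free_mod A {..<k} = fr {..<k}" for k :: nat by (rule free_mod_eq) simp
  obtain e where "min_free_resolution A X ?r ?d e" using min_res_is_resolution[OF X] by blast
  note mfr = this[unfolded min_free_resolution_def resolution_def FM]
  have d: "lin (fr (res_idx X (Suc j))) (fr (res_idx X j)) (res_d X j)" for j
  proof -
    have "?d (int j + 1) \<in> mod_hom A (fr {..<?r (int j + 1)}) (fr {..<?r (int j + 1 - 1)})" using mfr by blast
    then show ?thesis using mod_hom_lin by (simp add: res_idx_def res_d_def add.commute)
  qed
  show k: "a_kernel (fr (res_idx X (Suc j))) (fr (res_idx X j)) (res_d X j) = res_d X (Suc j) ` carrier (fr (res_idx X (Suc (Suc j))))" for j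
  proof -
    have "int j + 1 > 0" by simp
    then have "a_kernel (fr {..<?r (int j + 1)}) (fr {..<?r (int j + 1 - 1)}) (?d (int j + 1)) =
      ?d (int j + 1 + 1) ` carrier (fr {..<?r (int j + 1 + 1)})" using mfr by blast
    then show ?thesis by (simp add: res_idx_def res_d_def add.commute add.left_commute)
  qed
  show "free_cx (res_idx X) (res_d X)" unfolding free_cx_def
  proof (intro allI conjI ballI)
    show "finite (res_idx X j)" for j by (simp add: res_idx_def)
    show "lin (fr (res_idx X (Suc j))) (fr (res_idx X j)) (res_d X j)" for j by (rule d)
    fix j x assume "x \<in> carrier (fr (res_idx X (Suc (Suc j))))"
    then have "res_d X (Suc j) x \<in> a_kernel (fr (res_idx X (Suc j))) (fr (res_idx X j)) (res_d X j)" unfolding k by blast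
    then show "res_d X j (res_d X (Suc j) x) = (\<lambda>_. \<zero>)" by (simp add: a_kernel_def')
  qed
  show "res_d X j (unit_vec A k) i \<in> \<mm>" if "k \<in> res_idx X (Suc j)" for j k i
  proof -
    have "?d (int j + 1) ` carrier (fr {..<?r (int j + 1)}) \<subseteq> ideal_smult A \<mm> (fr {..<?r (int j + 1 - 1)})"
      by (rule mfr[THEN conjunct2, THEN spec])
    moreover have "unit_vec A k \<in> carrier (fr {..<?r (int j + 1)})"
      using unit_vec_in[OF that] by (simp add: res_idx_def add.commute)
    ultimately have "?d (int j + 1) (unit_vec A k) \<in> ideal_smult A \<mm> (fr {..<?r (int j + 1 - 1)})" by blast
    then have "res_d X j (unit_vec A k) \<in> ideal_smult A \<mm> (fr (res_idx X j))"
      by (simp add: res_idx_def res_d_def)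
    then show ?thesis by (rule coords_mm)
  qed
  have "lin (fr (res_idx X 0)) X e" "e ` carrier (fr (res_idx X 0)) = carrier X"
    "a_kernel (fr (res_idx X 0)) X e = res_d X 0 ` carrier (fr (res_idx X (Suc 0)))"
  proof -
    have "e \<in> mod_hom A (fr {..<?r 0}) X" using mfr by (elim conjE)
    then show "lin (fr (res_idx X 0)) X e" using mod_hom_lin by (simp add: res_idx_def)
    have "e ` carrier (fr {..<?r 0}) = carrier X" using mfr by (elim conjE)
    then show "e ` carrier (fr (res_idx X 0)) = carrier X" by (simp add: res_idx_def)
    have "a_kernel (fr {..<?r 0}) X e = ?d 1 ` carrier (fr {..<?r 1})" using mfr by (elim conjE)
    then show "a_kernel (fr (res_idx X 0)) X e = res_d X 0 ` carrier (fr (res_idx X (Suc 0)))" by (simp add: res_idx_def res_d_def)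
  qed
  then show "\<exists>e. lin (fr (res_idx X 0)) X e \<and> e ` carrier (fr (res_idx X 0)) = carrier X \<and>
     a_kernel (fr (res_idx X 0)) X e = res_d X 0 ` carrier (fr (res_idx X (Suc 0)))" by blast
qed

section \<open>Isomorphic modules have equal chosen resolutions\<close>

lemma mod_iso_inv:
  assumes "module A X" "module A Y" "f \<in> mod_hom A X Y" "bij_betw f (carrier X) (carrier Y)"
  shows "lin Y X (inv_into (carrier X) f)"
proof -
  interpret X: module A X by fact
  let ?g = "inv_into (carrier X) f"
  note f = mod_hom_lin[OF assms(3)]
  have g: "?g y \<in> carrier X" "f (?g y) = y" if "y \<in> carrier Y" for y
    using assms(4) that by (auto simp: bij_betw_def inv_into_into f_inv_into_f)
  have gf: "?g (f x) = x" if "x \<in> carrier X" for x using assms(4) that by (simp add: bij_betw_def)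
  show ?thesis unfolding lin_def
  proof (intro conjI ballI funcsetI)
    fix y assume y: "y \<in> carrier Y"
    show "?g y \<in> carrier X" by (rule g(1)[OF y])
    show "?g (y \<oplus>\<^bsub>Y\<^esub> z) = ?g y \<oplus>\<^bsub>X\<^esub> ?g z" if z: "z \<in> carrier Y" for z
      using gf[of "?g y \<oplus>\<^bsub>X\<^esub> ?g z"] g[OF y] g[OF z] by (simp add: lin_add[OF f])
    show "?g (a \<odot>\<^bsub>Y\<^esub> y) = a \<odot>\<^bsub>X\<^esub> ?g y" if a: "a \<in> carrier A" for a
      using gf[of "a \<odot>\<^bsub>X\<^esub> ?g y"] g[OF y] a by (simp add: lin_smult[OF f])
  qed
qed

lemma mod_iso_sym:
  assumes "module A X" "module A Y" "mod_iso A X Y" shows "mod_iso A Y X"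
proof -
  obtain f where f: "f \<in> mod_hom A X Y" "bij_betw f (carrier X) (carrier Y)" using assms(3) by (auto simp: mod_iso_def)
  let ?g = "inv_into (carrier X) f"
  have "restrict ?g (carrier Y) \<in> mod_hom A Y X" by (rule lin_restrict[OF mod_iso_inv[OF assms(1,2) f] assms(2)])
  moreover have "bij_betw (restrict ?g (carrier Y)) (carrier Y) (carrier X)"
    using bij_betw_inv_into[OF f(2)] by (simp cong: bij_betw_cong)
  ultimately show ?thesis unfolding mod_iso_def by blast
qed

lemma min_res_iso_aux:
  assumes X: "module A X" and Y: "module A Y" and iso: "mod_iso A X Y" and m: "min_free_resolution A X r d e"
  shows "\<exists>e. min_free_resolution A Y r d e"
proof -
  obtain f where f: "f \<in> mod_hom A X Y" "bij_betw f (carrier X) (carrier Y)" using iso by (auto simp: mod_iso_def)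
  have FM: "free_mod A {..<k} = fr {..<k}" for k :: nat by (rule free_mod_eq) simp
  let ?F = "fr {..<r 0}"
  let ?e = "restrict (\<lambda>x. f (e x)) (carrier ?F)"
  have e: "e \<in> mod_hom A ?F X" "e ` carrier ?F = carrier X" "a_kernel ?F X e = d 1 ` carrier (fr {..<r 1})"
    using m unfolding min_free_resolution_def resolution_def FM by blast+
  have 1: "?e \<in> mod_hom A ?F Y"
    by (rule lin_restrict[OF lin_comp[OF mod_hom_lin[OF e(1)] mod_hom_lin[OF f(1)]] module_fr])
  have 2: "?e ` carrier ?F = carrier Y"
    using e(2) f(2) by (simp add: bij_betw_def image_image[symmetric] cong: image_cong)
  have "f (e x) = \<zero>\<^bsub>Y\<^esub> \<longleftrightarrow> e x = \<zero>\<^bsub>X\<^esub>" if "x \<in> carrier ?F" for x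
  proof -
    interpret X: module A X by (rule X)
    have "e x \<in> carrier X" by (rule lin_closed[OF mod_hom_lin[OF e(1)] that])
    then show ?thesis using lin_zero[OF mod_hom_lin[OF f(1)] X Y] f(2) X.zero_closed
      unfolding bij_betw_def inj_on_def by metis
  qed
  then have 3: "a_kernel ?F Y ?e = d 1 ` carrier (fr {..<r 1})"
    unfolding e(3)[symmetric] by (auto simp: a_kernel_def')
  have "min_free_resolution A Y r d ?e"
    using m 1 2 3 unfolding min_free_resolution_def resolution_def FM by (elim conjE) (intro conjI)
  then show ?thesis by blast
qed

text \<open>The choice in \<open>min_res\<close> depends only on the set of admissible pairs of
  ranks and differentials, the augmentation being quantified away. This set is the same for
  isomorphic modules, so the resolutions are literally equal, even across carrier types.\<close>

lemma min_res_iso: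
  assumes X: "module A X" and Y: "module A Y" and iso: "mod_iso A X Y"
  shows "min_res A X = min_res A Y"
proof -
  have "(\<lambda>(r, d). \<exists>e. min_free_resolution A X r d e) = (\<lambda>(r, d). \<exists>e. min_free_resolution A Y r d e)"
    using min_res_iso_aux[OF X Y iso] min_res_iso_aux[OF Y X mod_iso_sym[OF X Y iso]]
    by (intro ext) (auto simp: split_beta)
  then show ?thesis unfolding min_res_def by simp
qed

subsection \<open>Quotients, tensor products and Tor\<close>

lemma submodule_abelian_subgroup:
  assumes "module A M" "submodule U A M" shows "abelian_subgroup U M"
proof -
  interpret M: module A M by fact
  have "subgroup U (add_monoid M)" using assms(2) by (simp add: submodule_def)
  then show ?thesis by (intro abelian_subgroupI3 additive_subgroup.intro M.abelian_group_axioms)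
qed

lemma rcos_def': "U +>\<^bsub>M\<^esub> x = {u \<oplus>\<^bsub>M\<^esub> x | u. u \<in> U}"
  by (auto simp: a_r_coset_def')

lemma rcos_eq:
  assumes M: "module A M" and U: "submodule U A M" and x: "x \<in> carrier M" and y: "y \<in> carrier M"
  shows "U +>\<^bsub>M\<^esub> x = U +>\<^bsub>M\<^esub> y \<longleftrightarrow> x \<ominus>\<^bsub>M\<^esub> y \<in> U"
proof
  interpret M: module A M by fact
  interpret U: abelian_subgroup U M by (rule submodule_abelian_subgroup[OF M U])
  show "x \<ominus>\<^bsub>M\<^esub> y \<in> U" if "U +>\<^bsub>M\<^esub> x = U +>\<^bsub>M\<^esub> y"
  proof -
    have "x \<in> U +>\<^bsub>M\<^esub> y" using U.a_rcos_self[OF x] that by simp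
    then obtain u where u: "u \<in> U" "x = u \<oplus>\<^bsub>M\<^esub> y" unfolding rcos_def' by blast
    then show ?thesis using y sub_in[OF U u(1)] by (simp add: a_minus_def M.a_assoc M.r_neg)
  qed
  show "U +>\<^bsub>M\<^esub> x = U +>\<^bsub>M\<^esub> y" if "x \<ominus>\<^bsub>M\<^esub> y \<in> U"
  proof -
    have "x \<in> U +>\<^bsub>M\<^esub> y" unfolding rcos_def' using that minus_add_cancel[OF M x y] by force
    then show ?thesis using U.a_repr_independence'[OF _ y] by simp
  qed
qed

lemma rcos_zero_iff:
  assumes M: "module A M" and U: "submodule U A M" and x: "x \<in> carrier M"
  shows "U +>\<^bsub>M\<^esub> x = U \<longleftrightarrow> x \<in> U"
proof -
  interpret M: module A M by fact
  have "U +>\<^bsub>M\<^esub> \<zero>\<^bsub>M\<^esub> = U" using sub_in[OF U] unfolding rcos_def' by force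
  then show ?thesis using rcos_eq[OF M U x M.zero_closed] minus_zero_right[OF M x] by simp
qed

lemma quot_carrier: "X \<in> carrier (quot_mod M U) \<longleftrightarrow> (\<exists>x\<in>carrier M. X = U +>\<^bsub>M\<^esub> x)"
  by (auto simp: quot_mod_def A_RCOSETS_def')

lemma quot_add:
  assumes M: "module A M" and U: "submodule U A M" and x: "x \<in> carrier M" and y: "y \<in> carrier M"
  shows "(U +>\<^bsub>M\<^esub> x) \<oplus>\<^bsub>quot_mod M U\<^esub> (U +>\<^bsub>M\<^esub> y) = U +>\<^bsub>M\<^esub> (x \<oplus>\<^bsub>M\<^esub> y)"
proof -
  interpret U: abelian_subgroup U M by (rule submodule_abelian_subgroup[OF M U])
  show ?thesis using U.a_rcos_sum[OF x y] by (simp add: quot_mod_def)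
qed

lemma quot_smult:
  assumes M: "module A M" and U: "submodule U A M" and x: "x \<in> carrier M" and a: "a \<in> carrier A"
  shows "a \<odot>\<^bsub>quot_mod M U\<^esub> (U +>\<^bsub>M\<^esub> x) = U +>\<^bsub>M\<^esub> (a \<odot>\<^bsub>M\<^esub> x)"
proof -
  interpret M: module A M by fact
  interpret U: abelian_subgroup U M by (rule submodule_abelian_subgroup[OF M U])
  have "U +>\<^bsub>M\<^esub> (a \<odot>\<^bsub>M\<^esub> z) = U +>\<^bsub>M\<^esub> (a \<odot>\<^bsub>M\<^esub> x)" if z: "z \<in> U +>\<^bsub>M\<^esub> x" for z
  proof -
    obtain u where u: "u \<in> U" "z = u \<oplus>\<^bsub>M\<^esub> x" using z unfolding rcos_def' by blast
    have uM: "u \<in> carrier M" by (rule sub_in[OF U u(1)])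
    have "a \<odot>\<^bsub>M\<^esub> z \<ominus>\<^bsub>M\<^esub> a \<odot>\<^bsub>M\<^esub> x = a \<odot>\<^bsub>M\<^esub> u"
      using u(2) uM x a by (simp add: a_minus_def M.smult_r_distr M.a_assoc M.r_neg)
    then show ?thesis using rcos_eq[OF M U, of "a \<odot>\<^bsub>M\<^esub> z" "a \<odot>\<^bsub>M\<^esub> x"] sub_smult[OF U a u(1)] u(2) uM x a by simp
  qed
  moreover have "x \<in> U +>\<^bsub>M\<^esub> x" by (rule U.a_rcos_self[OF x])
  ultimately have "(\<Union>z\<in>U +>\<^bsub>M\<^esub> x. U +>\<^bsub>M\<^esub> (a \<odot>\<^bsub>M\<^esub> z)) = U +>\<^bsub>M\<^esub> (a \<odot>\<^bsub>M\<^esub> x)"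
    by (intro SUP_eq_const) blast+
  then show ?thesis by (simp add: quot_mod_def)
qed

lemma quot_zero: "\<zero>\<^bsub>quot_mod M U\<^esub> = U" by (simp add: quot_mod_def)

lemma module_quot:
  assumes M: "module A M" and U: "submodule U A M" shows "module A (quot_mod M U)"
proof -
  interpret M: module A M by fact
  let ?Q = "quot_mod M U"
  note qa = quot_add[OF M U] and qs = quot_smult[OF M U]
  have z: "\<zero>\<^bsub>?Q\<^esub> = U +>\<^bsub>M\<^esub> \<zero>\<^bsub>M\<^esub>" using rcos_zero_iff[OF M U M.zero_closed] sub_zero[OF U] quot_zero by metis
  show ?thesis
  proof (rule moduleI)
    show "abelian_group ?Q"
    proof (rule abelian_groupI)
      fix X Y assume "X \<in> carrier ?Q" "Y \<in> carrier ?Q"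
      then obtain x y where xy: "x \<in> carrier M" "y \<in> carrier M" "X = U +>\<^bsub>M\<^esub> x" "Y = U +>\<^bsub>M\<^esub> y"
        unfolding quot_carrier by blast
      show "X \<oplus>\<^bsub>?Q\<^esub> Y \<in> carrier ?Q" using xy M.a_closed[OF xy(1,2)] unfolding quot_carrier by (auto simp: qa)
      show "X \<oplus>\<^bsub>?Q\<^esub> Y = Y \<oplus>\<^bsub>?Q\<^esub> X" using xy by (simp add: qa M.a_comm)
      fix Z assume "Z \<in> carrier ?Q"
      then obtain z where "z \<in> carrier M" "Z = U +>\<^bsub>M\<^esub> z" unfolding quot_carrier by blast
      then show "X \<oplus>\<^bsub>?Q\<^esub> Y \<oplus>\<^bsub>?Q\<^esub> Z = X \<oplus>\<^bsub>?Q\<^esub> (Y \<oplus>\<^bsub>?Q\<^esub> Z)" using xy by (simp add: qa M.a_assoc)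
    next
      show "\<zero>\<^bsub>?Q\<^esub> \<in> carrier ?Q" unfolding quot_carrier z by blast
    next
      fix X assume "X \<in> carrier ?Q"
      then obtain x where x: "x \<in> carrier M" "X = U +>\<^bsub>M\<^esub> x" unfolding quot_carrier by blast
      show "\<zero>\<^bsub>?Q\<^esub> \<oplus>\<^bsub>?Q\<^esub> X = X" unfolding z using x by (simp add: qa)
      have "(U +>\<^bsub>M\<^esub> (\<ominus>\<^bsub>M\<^esub> x)) \<oplus>\<^bsub>?Q\<^esub> X = \<zero>\<^bsub>?Q\<^esub>" unfolding z using x by (simp add: qa M.l_neg)
      moreover have "U +>\<^bsub>M\<^esub> (\<ominus>\<^bsub>M\<^esub> x) \<in> carrier ?Q" using x unfolding quot_carrier by blast
      ultimately show "\<exists>Y\<in>carrier ?Q. Y \<oplus>\<^bsub>?Q\<^esub> X = \<zero>\<^bsub>?Q\<^esub>" by blast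
    qed
  next
    fix a X assume a: "a \<in> carrier A" and "X \<in> carrier ?Q"
    then obtain x where x: "x \<in> carrier M" "X = U +>\<^bsub>M\<^esub> x" unfolding quot_carrier by blast
    show "a \<odot>\<^bsub>?Q\<^esub> X \<in> carrier ?Q" using x a M.smult_closed[OF a x(1)] unfolding quot_carrier by (auto simp: qs)
    show "(a \<oplus> b) \<odot>\<^bsub>?Q\<^esub> X = a \<odot>\<^bsub>?Q\<^esub> X \<oplus>\<^bsub>?Q\<^esub> b \<odot>\<^bsub>?Q\<^esub> X" if "b \<in> carrier A" for b
      using x a that by (simp add: qs qa M.smult_l_distr)
    show "(a \<otimes> b) \<odot>\<^bsub>?Q\<^esub> X = a \<odot>\<^bsub>?Q\<^esub> (b \<odot>\<^bsub>?Q\<^esub> X)" if "b \<in> carrier A" for b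
      using x a that by (simp add: qs M.smult_assoc1)
    fix Y assume "Y \<in> carrier ?Q"
    then obtain y where y: "y \<in> carrier M" "Y = U +>\<^bsub>M\<^esub> y" unfolding quot_carrier by blast
    show "a \<odot>\<^bsub>?Q\<^esub> (X \<oplus>\<^bsub>?Q\<^esub> Y) = a \<odot>\<^bsub>?Q\<^esub> X \<oplus>\<^bsub>?Q\<^esub> a \<odot>\<^bsub>?Q\<^esub> Y"
      using x y a by (simp add: qs qa M.smult_r_distr)
  next
    fix X assume "X \<in> carrier ?Q"
    then obtain x where x: "x \<in> carrier M" "X = U +>\<^bsub>M\<^esub> x" unfolding quot_carrier by blast
    then show "\<one> \<odot>\<^bsub>?Q\<^esub> X = X" by (simp add: qs)
  qed (rule is_cring)
qed

lemma quot_proj_lin: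
  assumes M: "module A M" and U: "submodule U A M"
  shows "lin M (quot_mod M U) (\<lambda>x. U +>\<^bsub>M\<^esub> x)"
  unfolding lin_def using quot_add[OF M U] quot_smult[OF M U] by (auto simp: quot_carrier)

lemma quot_lift:
  assumes M: "module A M" and P: "module A P" and U: "submodule U A M" and f: "lin M P f" and f0: "\<And>u. u \<in> U \<Longrightarrow> f u = \<zero>\<^bsub>P\<^esub>"
  shows "\<exists>h. lin (quot_mod M U) P h \<and> (\<forall>x\<in>carrier M. h (U +>\<^bsub>M\<^esub> x) = f x)"
proof -
  interpret P: module A P by fact
  interpret M: module A M by fact
  define h where "h X = the_elem (f ` X)" for X
  have h: "h (U +>\<^bsub>M\<^esub> v) = f v" if v: "v \<in> carrier M" for v
  proof -
    have "f w = f v" if w: "w \<in> U +>\<^bsub>M\<^esub> v" for w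
    proof -
      obtain u where u: "u \<in> U" "w = u \<oplus>\<^bsub>M\<^esub> v" using w unfolding rcos_def' by blast
      then show ?thesis using lin_add[OF f sub_in[OF U u(1)] v] f0[OF u(1)] lin_closed[OF f v] by simp
    qed
    moreover have "v \<in> U +>\<^bsub>M\<^esub> v" using abelian_subgroup.a_rcos_self[OF submodule_abelian_subgroup[OF M U] v] .
    ultimately have "f ` (U +>\<^bsub>M\<^esub> v) = {f v}" by blast
    then show ?thesis by (simp add: h_def)
  qed
  have "lin (quot_mod M U) P h" unfolding lin_def
  proof (intro conjI ballI funcsetI)
    fix X assume "X \<in> carrier (quot_mod M U)"
    then obtain x where x: "x \<in> carrier M" "X = U +>\<^bsub>M\<^esub> x" unfolding quot_carrier by blast
    show "h X \<in> carrier P" using x h lin_closed[OF f] by simp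
    show "h (a \<odot>\<^bsub>quot_mod M U\<^esub> X) = a \<odot>\<^bsub>P\<^esub> h X" if a: "a \<in> carrier A" for a
      using x h[OF x(1)] h[OF M.smult_closed[OF a x(1)]] quot_smult[OF M U x(1) a] lin_smult[OF f a x(1)] by simp
    fix Y assume "Y \<in> carrier (quot_mod M U)"
    then obtain y where y: "y \<in> carrier M" "Y = U +>\<^bsub>M\<^esub> y" unfolding quot_carrier by blast
    show "h (X \<oplus>\<^bsub>quot_mod M U\<^esub> Y) = h X \<oplus>\<^bsub>P\<^esub> h Y"
      using x y h[OF x(1)] h[OF y(1)] h[OF M.a_closed[OF x(1) y(1)]] quot_add[OF M U x(1) y(1)] lin_add[OF f x(1) y(1)] by simp
  qed
  then show ?thesis using h by blast
qed

section \<open>Free modules on arbitrary sets and tensor products\<close>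

lemma module_free: "module A (free_mod A S)"
proof -
  let ?H = "{v \<in> carrier (fr S). finite {s. v s \<noteq> \<zero>}}"
  have eq: "free_mod A S = (fr S)\<lparr>carrier := ?H\<rparr>"
    by (auto simp: free_mod_def pow_mod_def)
  interpret P: module A "fr S" by (rule module_fr)
  have "submodule ?H A (fr S)"
  proof (rule subI[OF module_fr])
    show "\<zero>\<^bsub>fr S\<^esub> \<in> ?H" using P.zero_closed by simp
    fix u v assume uv: "u \<in> ?H" "v \<in> ?H"
    have "{s. (u \<oplus>\<^bsub>fr S\<^esub> v) s \<noteq> \<zero>} \<subseteq> {s. u s \<noteq> \<zero>} \<union> {s. v s \<noteq> \<zero>}" by auto
    then show "u \<oplus>\<^bsub>fr S\<^esub> v \<in> ?H" using uv P.a_closed[of u v] finite_subset by fastforce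
  next
    fix a v assume av: "a \<in> carrier A" "v \<in> ?H"
    have "{s. (a \<odot>\<^bsub>fr S\<^esub> v) s \<noteq> \<zero>} \<subseteq> {s. v s \<noteq> \<zero>}" using av by auto
    then show "a \<odot>\<^bsub>fr S\<^esub> v \<in> ?H" using av P.smult_closed[of a v] finite_subset by fastforce
  qed auto
  from submodule.submodule_is_module[OF this module_fr] show ?thesis unfolding eq .
qed

lemma free_simps [simp]:
  "\<zero>\<^bsub>free_mod A S\<^esub> = (\<lambda>_. \<zero>)" "u \<oplus>\<^bsub>free_mod A S\<^esub> v = (\<lambda>s. u s \<oplus> v s)"
  "a \<odot>\<^bsub>free_mod A S\<^esub> v = (\<lambda>s. a \<otimes> v s)"
  by (simp_all add: free_mod_def)

lemma free_carrier:
  "v \<in> carrier (free_mod A S) \<longleftrightarrow> v \<in> carrier (fr S) \<and> finite {s. v s \<noteq> \<zero>}"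
  by (auto simp: free_mod_def pow_carrier)

lemma free_unit: "s \<in> S \<Longrightarrow> unit_vec A s \<in> carrier (free_mod A S)"
proof -
  have "finite {t. unit_vec A s t \<noteq> \<zero>}" by (rule finite_subset[of _ "{s}"]) (auto simp: unit_vec_def)
  then show "s \<in> S \<Longrightarrow> unit_vec A s \<in> carrier (free_mod A S)" using unit_vec_in[of s S] by (simp add: free_carrier)
qed

lemma free_gen:
  assumes W: "submodule W A (free_mod A S)" and u: "\<And>s. s \<in> S \<Longrightarrow> unit_vec A s \<in> W"
    and v: "v \<in> carrier (free_mod A S)"
  shows "v \<in> W"
proof -
  let ?T = "{s. v s \<noteq> \<zero>}"
  have T: "finite ?T" "?T \<subseteq> S" "v \<in> carrier (fr ?T)" using v by (auto simp: free_carrier pow_carrier)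
  show ?thesis using module_self T(1,3)
  proof (induction rule: pow_induct)
    case zero show ?case using sub_zero[OF W] by simp
  next
    case (single s n)
    then have "s \<in> S" using T(2) by blast
    then have "n \<odot>\<^bsub>free_mod A S\<^esub> unit_vec A s \<in> W" using single by (intro sub_smult[OF W] u) simp_all
    then show ?case using single_smult_unit[of n s S] single by simp
  next
    case (add x y) then show ?case using sub_add[OF W, of x y] by simp
  qed
qed

text \<open>On an infinite basis the sum runs over the support of \<open>v\<close>, which varies
  with \<open>v\<close>; \<open>free_ext_eq\<close> passes to a common finite set when two vectors
  are compared.\<close>

definition free_ext :: "('a, 'p) module \<Rightarrow> ('s \<Rightarrow> 'p) \<Rightarrow> ('s \<Rightarrow> 'a) \<Rightarrow> 'p" where
  "free_ext P b v = lin_comb P {s. v s \<noteq> \<zero>} b v"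

lemma free_ext_eq:
  assumes P: "module A P" and b: "b \<in> S \<rightarrow> carrier P" and v: "v \<in> carrier (free_mod A S)"
    and T: "finite T" "{s. v s \<noteq> \<zero>} \<subseteq> T" "T \<subseteq> S"
  shows "free_ext P b v = lin_comb P T b v"
proof -
  interpret P: module A P by fact
  have vs: "v s \<in> carrier A" for s using v pow_at[OF module_self, of v S] by (simp add: free_carrier)
  show ?thesis unfolding free_ext_def lin_comb_def
    using T b vs by (intro P.add.finprod_mono_neutral_cong_left) (auto simp: Pi_def)
qed

lemma free_ext_lin:
  assumes P: "module A P" and b: "b \<in> S \<rightarrow> carrier P"
  shows "lin (free_mod A S) P (free_ext P b)"
  unfolding lin_def
proof (intro conjI ballI funcsetI)
  interpret F: module A "free_mod A S" by (rule module_free)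
  let ?T = "\<lambda>v. {s. v s \<noteq> \<zero>}"
  have vT: "v \<in> carrier (fr T)" if "v \<in> carrier (free_mod A S)" "?T v \<subseteq> T" "T \<subseteq> S" for v T
    using that by (auto simp: free_carrier pow_carrier)
  have sT: "?T v \<subseteq> S" "finite (?T v)" if "v \<in> carrier (free_mod A S)" for v
    using that by (auto simp: free_carrier pow_carrier)
  have l: "lin (fr T) P (lin_comb P T b)" if "T \<subseteq> S" "finite T" for T using lin_comb_lin[OF P that(2), of b] b that(1) by blast
  show "free_ext P b v \<in> carrier P" if v: "v \<in> carrier (free_mod A S)" for v
    unfolding free_ext_def using sT[OF v] by (intro lin_closed[OF l] vT[OF v]) auto
  show "free_ext P b (u \<oplus>\<^bsub>free_mod A S\<^esub> v) = free_ext P b u \<oplus>\<^bsub>P\<^esub> free_ext P b v"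
    if u: "u \<in> carrier (free_mod A S)" and v: "v \<in> carrier (free_mod A S)" for u v
  proof -
    let ?R = "?T u \<union> ?T v"
    have R: "?R \<subseteq> S" "finite ?R" using sT[OF u] sT[OF v] by auto
    have uv: "u \<oplus>\<^bsub>free_mod A S\<^esub> v \<in> carrier (free_mod A S)" by (rule F.a_closed[OF u v])
    have "{s. (u \<oplus>\<^bsub>free_mod A S\<^esub> v) s \<noteq> \<zero>} \<subseteq> ?R" by auto
    from free_ext_eq[OF P b uv R(2) this R(1)]
    have "free_ext P b (u \<oplus>\<^bsub>free_mod A S\<^esub> v) = lin_comb P ?R b (u \<oplus>\<^bsub>fr ?R\<^esub> v)" by simp
    also have "\<dots> = lin_comb P ?R b u \<oplus>\<^bsub>P\<^esub> lin_comb P ?R b v"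
      by (rule lin_add[OF l[OF R]]) (use vT[OF u _ R(1)] vT[OF v _ R(1)] in auto)
    also have "\<dots> = free_ext P b u \<oplus>\<^bsub>P\<^esub> free_ext P b v"
      using free_ext_eq[OF P b u R(2) _ R(1)] free_ext_eq[OF P b v R(2) _ R(1)] by auto
    finally show ?thesis .
  qed
  show "free_ext P b (a \<odot>\<^bsub>free_mod A S\<^esub> v) = a \<odot>\<^bsub>P\<^esub> free_ext P b v"
    if a: "a \<in> carrier A" and v: "v \<in> carrier (free_mod A S)" for a v
  proof -
    note R = sT[OF v]
    have av: "a \<odot>\<^bsub>free_mod A S\<^esub> v \<in> carrier (free_mod A S)" by (rule F.smult_closed[OF a v])
    have "{s. (a \<odot>\<^bsub>free_mod A S\<^esub> v) s \<noteq> \<zero>} \<subseteq> ?T v" using a by auto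
    from free_ext_eq[OF P b av R(2) this R(1)]
    have "free_ext P b (a \<odot>\<^bsub>free_mod A S\<^esub> v) = lin_comb P (?T v) b (a \<odot>\<^bsub>fr (?T v)\<^esub> v)" by simp
    also have "\<dots> = a \<odot>\<^bsub>P\<^esub> lin_comb P (?T v) b v"
      by (rule lin_smult[OF l[OF R] a]) (use vT[OF v _ R(1)] in auto)
    finally show ?thesis by (simp add: free_ext_def)
  qed
qed

lemma free_ext_unit:
  assumes P: "module A P" and b: "b \<in> S \<rightarrow> carrier P" and s: "s \<in> S"
  shows "free_ext P b (unit_vec A s) = b s"
proof -
  have "free_ext P b (unit_vec A s) = lin_comb P {s} b (unit_vec A s)"
    using s by (intro free_ext_eq[OF P b free_unit[OF s]]) (auto simp: unit_vec_def)
  also have "\<dots> = b s" using b s by (intro lin_comb_unit[OF P]) auto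
  finally show ?thesis .
qed

lemma bilin_sub:
  assumes M: "module A M" and N: "module A N"
  shows "submodule (bilinear_relations A M N) A (free_mod A (carrier M \<times> carrier N))"
proof -
  interpret M: module A M by fact
  interpret N: module A N by fact
  interpret F: module A "free_mod A (carrier M \<times> carrier N)" by (rule module_free)
  have u: "unit_vec A (x, y) \<in> carrier (free_mod A (carrier M \<times> carrier N))" if "x \<in> carrier M" "y \<in> carrier N" for x y
    using that by (intro free_unit) auto
  show ?thesis unfolding bilinear_relations_def Let_def
    by (rule span_sub[OF module_free]) (auto intro!: F.minus_closed F.a_closed F.smult_closed u simp del: free_simps)
qed

lemma bilin_least:
  assumes M: "module A M" and N: "module A N"
    and W: "submodule W A (free_mod A (carrier M \<times> carrier N))" and P: "module A P"
    and f: "lin (free_mod A (carrier M \<times> carrier N)) P f" and b: "\<And>x y. x \<in> carrier M \<Longrightarrow> y \<in> carrier N \<Longrightarrow> f (unit_vec A (x, y)) = b x y"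
    and bl: "\<And>x x' y. x \<in> carrier M \<Longrightarrow> x' \<in> carrier M \<Longrightarrow> y \<in> carrier N \<Longrightarrow> b (x \<oplus>\<^bsub>M\<^esub> x') y = b x y \<oplus>\<^bsub>P\<^esub> b x' y"
     "\<And>x y y'. x \<in> carrier M \<Longrightarrow> y \<in> carrier N \<Longrightarrow> y' \<in> carrier N \<Longrightarrow> b x (y \<oplus>\<^bsub>N\<^esub> y') = b x y \<oplus>\<^bsub>P\<^esub> b x y'"
     "\<And>a x y. a \<in> carrier A \<Longrightarrow> x \<in> carrier M \<Longrightarrow> y \<in> carrier N \<Longrightarrow> b (a \<odot>\<^bsub>M\<^esub> x) y = a \<odot>\<^bsub>P\<^esub> b x y"
     "\<And>a x y. a \<in> carrier A \<Longrightarrow> x \<in> carrier M \<Longrightarrow> y \<in> carrier N \<Longrightarrow> b x (a \<odot>\<^bsub>N\<^esub> y) = a \<odot>\<^bsub>P\<^esub> b x y"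
  shows "v \<in> bilinear_relations A M N \<Longrightarrow> f v = \<zero>\<^bsub>P\<^esub>"
proof -
  let ?F = "free_mod A (carrier M \<times> carrier N)"
  interpret M: module A M by fact
  interpret N: module A N by fact
  interpret P: module A P by fact
  interpret F: module A ?F by (rule module_free)
  have u: "unit_vec A (x, y) \<in> carrier ?F" if "x \<in> carrier M" "y \<in> carrier N" for x y
    using that by (intro free_unit) auto
  have bP: "b x y \<in> carrier P" if "x \<in> carrier M" "y \<in> carrier N" for x y
    using lin_closed[OF f u[OF that]] b[OF that] by simp
  have "bilinear_relations A M N \<subseteq> {v \<in> carrier ?F. f v \<in> {\<zero>\<^bsub>P\<^esub>}}"
    unfolding bilinear_relations_def Let_def
    apply (rule span_least[OF sub_preimage[OF module_free P f sub_triv[OF P]]])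
    using u bP
    by (auto simp del: free_simps simp: lin_minus[OF f module_free P] lin_add[OF f] lin_smult[OF f] b bl a_minus_def[of P] P.r_neg)
  then show "v \<in> bilinear_relations A M N \<Longrightarrow> f v = \<zero>\<^bsub>P\<^esub>" by blast
qed

context
  fixes M :: "('a, 'm) module" and N :: "('a, 'n) module"
  assumes M: "module A M" and N: "module A N"
begin

lemma module_tensor: "module A (tensor_mod A M N)"
  unfolding tensor_mod_def by (rule module_quot[OF module_free bilin_sub[OF M N]])

lemma tensor_elt_in: "x \<in> carrier M \<Longrightarrow> y \<in> carrier N \<Longrightarrow> tensor_elt A M N x y \<in> carrier (tensor_mod A M N)"
  unfolding tensor_elt_def tensor_mod_def quot_carrier
  by (rule bexI[where x = "unit_vec A (x, y)"]) (simp, rule free_unit, simp)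

lemma tensor_elt_rel:
  assumes "x \<in> carrier M" "y \<in> carrier N"
  shows "x' \<in> carrier M \<Longrightarrow> tensor_elt A M N (x \<oplus>\<^bsub>M\<^esub> x') y = tensor_elt A M N x y \<oplus>\<^bsub>tensor_mod A M N\<^esub> tensor_elt A M N x' y"
    "y' \<in> carrier N \<Longrightarrow> tensor_elt A M N x (y \<oplus>\<^bsub>N\<^esub> y') = tensor_elt A M N x y \<oplus>\<^bsub>tensor_mod A M N\<^esub> tensor_elt A M N x y'"
    "a \<in> carrier A \<Longrightarrow> tensor_elt A M N (a \<odot>\<^bsub>M\<^esub> x) y = a \<odot>\<^bsub>tensor_mod A M N\<^esub> tensor_elt A M N x y"
    "a \<in> carrier A \<Longrightarrow> tensor_elt A M N x (a \<odot>\<^bsub>N\<^esub> y) = a \<odot>\<^bsub>tensor_mod A M N\<^esub> tensor_elt A M N x y"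
proof -
  let ?F = "free_mod A (carrier M \<times> carrier N)"
  interpret M: module A M by (rule M)
  interpret N: module A N by (rule N)
  interpret F: module A ?F by (rule module_free)
  note B = bilin_sub[OF M N]
  have u: "unit_vec A (x, y) \<in> carrier ?F" if "x \<in> carrier M" "y \<in> carrier N" for x y
    using that by (intro free_unit) auto
  note qa = quot_add[OF module_free B, symmetric] and qs = quot_smult[OF module_free B, symmetric]
  note eq = rcos_eq[OF module_free B, THEN iffD2]
  show "tensor_elt A M N (x \<oplus>\<^bsub>M\<^esub> x') y = tensor_elt A M N x y \<oplus>\<^bsub>tensor_mod A M N\<^esub> tensor_elt A M N x' y"
    if "x' \<in> carrier M"
    unfolding tensor_elt_def tensor_mod_def quot_add[OF module_free B u[OF assms] u[OF that assms(2)]]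
    by (rule eq, intro u M.a_closed assms that, intro F.a_closed u assms that,
      unfold bilinear_relations_def Let_def, rule subsetD[OF span_incl])
      (use assms that in blast)
  show "tensor_elt A M N x (y \<oplus>\<^bsub>N\<^esub> y') = tensor_elt A M N x y \<oplus>\<^bsub>tensor_mod A M N\<^esub> tensor_elt A M N x y'"
    if "y' \<in> carrier N"
    unfolding tensor_elt_def tensor_mod_def quot_add[OF module_free B u[OF assms] u[OF assms(1) that]]
    by (rule eq, intro u N.a_closed assms that, intro F.a_closed u assms that,
      unfold bilinear_relations_def Let_def, rule subsetD[OF span_incl])
      (use assms that in blast)
  show "tensor_elt A M N (a \<odot>\<^bsub>M\<^esub> x) y = a \<odot>\<^bsub>tensor_mod A M N\<^esub> tensor_elt A M N x y"
    if "a \<in> carrier A"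
    unfolding tensor_elt_def tensor_mod_def quot_smult[OF module_free B u[OF assms] that]
    by (rule eq, intro u M.smult_closed assms that, intro F.smult_closed u assms that,
      unfold bilinear_relations_def Let_def, rule subsetD[OF span_incl])
      (use assms that in blast)
  show "tensor_elt A M N x (a \<odot>\<^bsub>N\<^esub> y) = a \<odot>\<^bsub>tensor_mod A M N\<^esub> tensor_elt A M N x y"
    if "a \<in> carrier A"
    unfolding tensor_elt_def tensor_mod_def quot_smult[OF module_free B u[OF assms] that]
    by (rule eq, intro u N.smult_closed assms that, intro F.smult_closed u assms that,
      unfold bilinear_relations_def Let_def, rule subsetD[OF span_incl])
      (use assms that in blast)
qed

lemma tensor_gen:
  assumes W: "submodule W A (tensor_mod A M N)"
    and e: "\<And>x y. x \<in> carrier M \<Longrightarrow> y \<in> carrier N \<Longrightarrow> tensor_elt A M N x y \<in> W"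
    and t: "t \<in> carrier (tensor_mod A M N)"
  shows "t \<in> W"
proof -
  let ?F = "free_mod A (carrier M \<times> carrier N)" and ?B = "bilinear_relations A M N"
  let ?V = "{v \<in> carrier ?F. ?B +>\<^bsub>?F\<^esub> v \<in> W}"
  have V: "submodule ?V A ?F"
    using sub_preimage[OF module_free module_tensor[unfolded tensor_mod_def] quot_proj_lin[OF module_free bilin_sub[OF M N]]
      W[unfolded tensor_mod_def]] .
  obtain v where v: "v \<in> carrier ?F" "t = ?B +>\<^bsub>?F\<^esub> v" using t unfolding tensor_mod_def quot_carrier by blast
  have "v \<in> ?V"
  proof (rule free_gen[OF V _ v(1)])
    fix s assume s: "s \<in> carrier M \<times> carrier N"
    then show "unit_vec A s \<in> ?V" using free_unit[OF s] e unfolding tensor_elt_def by (cases s) auto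
  qed
  then show ?thesis using v(2) by blast
qed

lemma tensor_lin_ext:
  assumes P: "module A P" and f: "lin (tensor_mod A M N) P f" and g: "lin (tensor_mod A M N) P g"
    and e: "\<And>x y. x \<in> carrier M \<Longrightarrow> y \<in> carrier N \<Longrightarrow> f (tensor_elt A M N x y) = g (tensor_elt A M N x y)"
    and t: "t \<in> carrier (tensor_mod A M N)"
  shows "f t = g t"
proof -
  let ?T = "tensor_mod A M N"
  interpret P: module A P by fact
  have fg: "lin ?T P (\<lambda>t. f t \<oplus>\<^bsub>P\<^esub> (\<ominus>\<^bsub>P\<^esub> g t))"
    by (rule lin_plus[OF f lin_uminus[OF g P] module_tensor P])
  have c: "f t \<in> carrier P" "g t \<in> carrier P" if "t \<in> carrier ?T" for t using lin_closed[OF f that] lin_closed[OF g that] .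
  have "t \<in> {t \<in> carrier ?T. f t \<oplus>\<^bsub>P\<^esub> (\<ominus>\<^bsub>P\<^esub> g t) \<in> {\<zero>\<^bsub>P\<^esub>}}"
    using e tensor_elt_in c by (intro tensor_gen[OF sub_preimage[OF module_tensor P fg sub_triv[OF P]] _ t]) (auto simp: P.r_neg)
  then have 1: "f t \<oplus>\<^bsub>P\<^esub> \<ominus>\<^bsub>P\<^esub> g t = \<zero>\<^bsub>P\<^esub>" by blast
  have "f t = (f t \<ominus>\<^bsub>P\<^esub> g t) \<oplus>\<^bsub>P\<^esub> g t" using minus_add_cancel[OF P c[OF t]] by simp
  then show ?thesis using 1 c[OF t] by (simp add: a_minus_def)
qed

text \<open>The universal property: \<open>b\<close> is extended linearly to the free module on
  pairs, and bilinearity makes the extension vanish on the relations.\<close>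

lemma tensor_lift:
  assumes P: "module A P" and bP: "\<And>x y. x \<in> carrier M \<Longrightarrow> y \<in> carrier N \<Longrightarrow> b x y \<in> carrier P"
    and bl: "\<And>x x' y. x \<in> carrier M \<Longrightarrow> x' \<in> carrier M \<Longrightarrow> y \<in> carrier N \<Longrightarrow> b (x \<oplus>\<^bsub>M\<^esub> x') y = b x y \<oplus>\<^bsub>P\<^esub> b x' y"
     "\<And>x y y'. x \<in> carrier M \<Longrightarrow> y \<in> carrier N \<Longrightarrow> y' \<in> carrier N \<Longrightarrow> b x (y \<oplus>\<^bsub>N\<^esub> y') = b x y \<oplus>\<^bsub>P\<^esub> b x y'"
     "\<And>a x y. a \<in> carrier A \<Longrightarrow> x \<in> carrier M \<Longrightarrow> y \<in> carrier N \<Longrightarrow> b (a \<odot>\<^bsub>M\<^esub> x) y = a \<odot>\<^bsub>P\<^esub> b x y"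
     "\<And>a x y. a \<in> carrier A \<Longrightarrow> x \<in> carrier M \<Longrightarrow> y \<in> carrier N \<Longrightarrow> b x (a \<odot>\<^bsub>N\<^esub> y) = a \<odot>\<^bsub>P\<^esub> b x y"
  shows "\<exists>h. lin (tensor_mod A M N) P h \<and> (\<forall>x\<in>carrier M. \<forall>y\<in>carrier N. h (tensor_elt A M N x y) = b x y)"
proof -
  let ?F = "free_mod A (carrier M \<times> carrier N)" and ?B = "bilinear_relations A M N"
  interpret P: module A P by fact
  interpret F: module A ?F by (rule module_free)
  note B = bilin_sub[OF M N]
  let ?b = "\<lambda>(x, y). b x y"
  have b: "?b \<in> carrier M \<times> carrier N \<rightarrow> carrier P" using bP by auto
  define f where "f = free_ext P ?b"
  have f: "lin ?F P f" unfolding f_def by (rule free_ext_lin[OF P b])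
  have fu: "f (unit_vec A (x, y)) = b x y" if "x \<in> carrier M" "y \<in> carrier N" for x y
    using free_ext_unit[OF P b, of "(x, y)"] that by (simp add: f_def)
  have f0: "f v = \<zero>\<^bsub>P\<^esub>" if "v \<in> ?B" for v
    by (rule bilin_least[OF M N B P f fu bl that])
  obtain h where h: "lin (quot_mod ?F ?B) P h" "\<forall>v\<in>carrier ?F. h (?B +>\<^bsub>?F\<^esub> v) = f v"
    using quot_lift[OF module_free P B f f0] by blast
  have "h (tensor_elt A M N x y) = b x y" if xy: "x \<in> carrier M" "y \<in> carrier N" for x y
    unfolding tensor_elt_def fu[OF xy, symmetric] by (rule h(2)[rule_format], rule free_unit) (use xy in simp)
  then show ?thesis using h(1) unfolding tensor_mod_def by blast
qed

end

section \<open>Tensor products with finite free modules\<close>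

lemma pure_tens_bilin:
  assumes N: "module A N"
  shows "x \<in> carrier (fr S) \<Longrightarrow> y \<in> carrier N \<Longrightarrow> pure_tens N y x \<in> carrier (pow_mod N S)"
     "x \<in> carrier (fr S) \<Longrightarrow> y \<in> carrier N \<Longrightarrow> y' \<in> carrier N \<Longrightarrow> pure_tens N (y \<oplus>\<^bsub>N\<^esub> y') x = pure_tens N y x \<oplus>\<^bsub>pow_mod N S\<^esub> pure_tens N y' x"
     "a \<in> carrier A \<Longrightarrow> x \<in> carrier (fr S) \<Longrightarrow> y \<in> carrier N \<Longrightarrow> pure_tens N (a \<odot>\<^bsub>N\<^esub> y) x = a \<odot>\<^bsub>pow_mod N S\<^esub> pure_tens N y x"
proof -
  interpret N: module A N by fact
  show "pure_tens N y x \<in> carrier (pow_mod N S)" if "x \<in> carrier (fr S)" "y \<in> carrier N"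
    by (rule lin_closed[OF pure_tens_lin[OF N that(2)] that(1)])
  have xs: "x s \<in> carrier A" if "x \<in> carrier (fr S)" for s using pow_at[OF module_self that] by simp
  show "x \<in> carrier (fr S) \<Longrightarrow> y \<in> carrier N \<Longrightarrow> y' \<in> carrier N \<Longrightarrow> pure_tens N (y \<oplus>\<^bsub>N\<^esub> y') x = pure_tens N y x \<oplus>\<^bsub>pow_mod N S\<^esub> pure_tens N y' x"
    using xs by (simp add: pure_tens_def N.smult_r_distr)
  show "a \<in> carrier A \<Longrightarrow> x \<in> carrier (fr S) \<Longrightarrow> y \<in> carrier N \<Longrightarrow> pure_tens N (a \<odot>\<^bsub>N\<^esub> y) x = a \<odot>\<^bsub>pow_mod N S\<^esub> pure_tens N y x"
    using xs by (simp add: pure_tens_def smult_lcomm[OF N])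
qed

text \<open>The map out of the tensor product comes from the universal property applied to pure
  tensors; its inverse sends w to the sum of the e_s tensor w_s. Both composites are checked on
  generators.\<close>

lemma tensor_fr_iso:
  assumes N: "module A N" and S: "finite S"
  shows "\<exists>\<tau> \<sigma>. lin (tensor_mod A (fr S) N) (pow_mod N S) \<tau> \<and> lin (pow_mod N S) (tensor_mod A (fr S) N) \<sigma> \<and>
    (\<forall>v\<in>carrier (fr S). \<forall>y\<in>carrier N. \<tau> (tensor_elt A (fr S) N v y) = pure_tens N y v) \<and>
    (\<forall>v\<in>carrier (fr S). \<forall>y\<in>carrier N. \<sigma> (pure_tens N y v) = tensor_elt A (fr S) N v y) \<and>
    (\<forall>w\<in>carrier (pow_mod N S). \<tau> (\<sigma> w) = w) \<and>
    (\<forall>t\<in>carrier (tensor_mod A (fr S) N). \<sigma> (\<tau> t) = t)"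
proof -
  interpret N: module A N by fact
  let ?T = "tensor_mod A (fr S) N"
  have T: "module A ?T" by (rule module_tensor[OF module_fr N])
  interpret T: module A ?T by (rule T)
  have P: "module A (pow_mod N S)" by (rule module_pow[OF N])
  note te = tensor_elt_in[OF module_fr N] and tr = tensor_elt_rel[OF module_fr N]
  have "\<exists>h. lin ?T (pow_mod N S) h \<and> (\<forall>v\<in>carrier (fr S). \<forall>y\<in>carrier N. h (tensor_elt A (fr S) N v y) = pure_tens N y v)"
    by (rule tensor_lift[OF module_fr N P];
      simp only: pure_tens_bilin[OF N] lin_add[OF pure_tens_lin[OF N]] lin_smult[OF pure_tens_lin[OF N]])
  then obtain \<tau> where \<tau>: "lin ?T (pow_mod N S) \<tau>" "\<forall>v\<in>carrier (fr S). \<forall>y\<in>carrier N. \<tau> (tensor_elt A (fr S) N v y) = pure_tens N y v"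
    by blast
  define \<sigma> where "\<sigma> w = (\<Oplus>\<^bsub>?T\<^esub>s\<in>S. tensor_elt A (fr S) N (unit_vec A s) (w s))" for w
  have tc: "(\<lambda>s. tensor_elt A (fr S) N (unit_vec A s) (w s)) \<in> S \<rightarrow> carrier ?T" if "w \<in> carrier (pow_mod N S)" for w
    by (intro funcsetI te unit_vec_in pow_at[OF N that])
  have \<sigma>: "lin (pow_mod N S) ?T \<sigma>" unfolding lin_def
  proof (intro conjI ballI funcsetI)
    fix w assume w: "w \<in> carrier (pow_mod N S)"
    show "\<sigma> w \<in> carrier ?T" unfolding \<sigma>_def by (rule T.finsum_closed[OF tc[OF w]])
    show "\<sigma> (w \<oplus>\<^bsub>pow_mod N S\<^esub> v) = \<sigma> w \<oplus>\<^bsub>?T\<^esub> \<sigma> v" if v: "v \<in> carrier (pow_mod N S)" for v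
      unfolding \<sigma>_def T.finsum_addf[symmetric, OF tc[OF w] tc[OF v]]
    proof (rule T.finsum_cong'[OF refl])
      show "(\<lambda>s. tensor_elt A (fr S) N (unit_vec A s) (w s) \<oplus>\<^bsub>?T\<^esub> tensor_elt A (fr S) N (unit_vec A s) (v s)) \<in> S \<rightarrow> carrier ?T"
        using tc[OF w] tc[OF v] by auto
      show "tensor_elt A (fr S) N (unit_vec A s) ((w \<oplus>\<^bsub>pow_mod N S\<^esub> v) s) =
        tensor_elt A (fr S) N (unit_vec A s) (w s) \<oplus>\<^bsub>?T\<^esub> tensor_elt A (fr S) N (unit_vec A s) (v s)" if "s \<in> S" for s
        unfolding pow_simps by (rule tr(2)[OF unit_vec_in[OF that] pow_at[OF N w] pow_at[OF N v]])
    qed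
    show "\<sigma> (a \<odot>\<^bsub>pow_mod N S\<^esub> w) = a \<odot>\<^bsub>?T\<^esub> \<sigma> w" if a: "a \<in> carrier A" for a
      unfolding \<sigma>_def T.finsum_smult_ldistr[OF S a tc[OF w]]
    proof (rule T.finsum_cong'[OF refl])
      show "(\<lambda>s. a \<odot>\<^bsub>?T\<^esub> tensor_elt A (fr S) N (unit_vec A s) (w s)) \<in> S \<rightarrow> carrier ?T"
        using tc[OF w] a by auto
      show "tensor_elt A (fr S) N (unit_vec A s) ((a \<odot>\<^bsub>pow_mod N S\<^esub> w) s) =
        a \<odot>\<^bsub>?T\<^esub> tensor_elt A (fr S) N (unit_vec A s) (w s)" if "s \<in> S" for s
        unfolding pow_simps by (rule tr(4)[OF unit_vec_in[OF that] pow_at[OF N w] a])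
    qed
  qed
  have tz: "tensor_elt A (fr S) N x \<zero>\<^bsub>N\<^esub> = \<zero>\<^bsub>?T\<^esub>" if "x \<in> carrier (fr S)" for x
    using tr(4)[OF that N.zero_closed zero_closed] te[OF that N.zero_closed] by simp
  have \<sigma>s: "\<sigma> (single N s y) = tensor_elt A (fr S) N (unit_vec A s) y" if s: "s \<in> S" and y: "y \<in> carrier N" for s y
  proof -
    have "\<sigma> (single N s y) = (\<Oplus>\<^bsub>?T\<^esub>t\<in>S. if s = t then tensor_elt A (fr S) N (unit_vec A t) y else \<zero>\<^bsub>?T\<^esub>)"
      unfolding \<sigma>_def by (rule T.finsum_cong') (use te[OF unit_vec_in[of _ S] y] tz[OF unit_vec_in[of _ S]] in \<open>auto simp: single_def\<close>)
    also have "\<dots> = tensor_elt A (fr S) N (unit_vec A s) y"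
      by (intro T.finsum_singleton[OF s S] funcsetI te unit_vec_in y)
    finally show ?thesis .
  qed
  have tl: "lin (fr S) ?T (\<lambda>x. tensor_elt A (fr S) N x y)" if "y \<in> carrier N" for y
    unfolding lin_def by (intro conjI ballI funcsetI te tr(1) tr(3) that)
  have \<sigma>o: "\<sigma> (pure_tens N y v) = tensor_elt A (fr S) N v y" if v: "v \<in> carrier (fr S)" and y: "y \<in> carrier N" for v y
  proof (rule fr_lin_ext[OF S T lin_comp[OF pure_tens_lin[OF N y] \<sigma>] tl[OF y] _ v])
    fix s assume s: "s \<in> S"
    have "pure_tens N y (unit_vec A s) = single N s y" using pure_tens_single[OF N y, of s \<one>] y by (simp add: unit_vec_single)
    then show "\<sigma> (pure_tens N y (unit_vec A s)) = tensor_elt A (fr S) N (unit_vec A s) y" using \<sigma>s[OF s y] by simp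
  qed
  have st: "\<sigma> (\<tau> t) = t" if t: "t \<in> carrier ?T" for t
    by (rule tensor_lin_ext[OF module_fr N T lin_comp[OF \<tau>(1) \<sigma>] lin_id _ t]) (use \<tau>(2) \<sigma>o in simp)
  have ts: "\<tau> (\<sigma> w) = w" if w: "w \<in> carrier (pow_mod N S)" for w
  proof (rule pow_lin_ext[OF N S P lin_comp[OF \<sigma> \<tau>(1)] lin_id _ w])
    fix s n assume s: "s \<in> S" and n: "n \<in> carrier N"
    have "\<tau> (\<sigma> (single N s n)) = pure_tens N n (unit_vec A s)" using \<sigma>s[OF s n] \<tau>(2) unit_vec_in[OF s] n by simp
    also have "\<dots> = single N s n" using pure_tens_single[OF N n, of s \<one>] n by (simp add: unit_vec_single)
    finally show "\<tau> (\<sigma> (single N s n)) = single N s n" .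
  qed
  show ?thesis using \<tau>(2) by (intro exI[of _ \<tau>] exI[of _ \<sigma>] conjI ballI \<tau>(1) \<sigma> \<sigma>o ts st) blast+
qed

text \<open>The definite description in \<open>tensor_map\<close> is met by exactly one extensional
  map, because elementary tensors generate; so any linear \<open>h\<close> with the right values
  computes it on the carrier.\<close>

lemma tensor_map_eq:
  assumes M: "module A M" and M': "module A M'" and N: "module A N"
    and h: "lin (tensor_mod A M N) (tensor_mod A M' N) h"
      "\<And>x y. x \<in> carrier M \<Longrightarrow> y \<in> carrier N \<Longrightarrow> h (tensor_elt A M N x y) = tensor_elt A M' N (f x) y"
    and t: "t \<in> carrier (tensor_mod A M N)"
  shows "tensor_map A M M' N f t = h t"
proof -
  note T = module_tensor[OF M N] and T' = module_tensor[OF M' N]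
  let ?h = "restrict h (carrier (tensor_mod A M N))"
  have "tensor_map A M M' N f = ?h" unfolding tensor_map_def
  proof (rule the_equality)
    show "?h \<in> mod_hom A (tensor_mod A M N) (tensor_mod A M' N) \<and>
      (\<forall>x\<in>carrier M. \<forall>y\<in>carrier N. ?h (tensor_elt A M N x y) = tensor_elt A M' N (f x) y)"
      using lin_restrict[OF h(1) T] h(2) tensor_elt_in[OF M N] by simp
    fix g assume g: "g \<in> mod_hom A (tensor_mod A M N) (tensor_mod A M' N) \<and>
      (\<forall>x\<in>carrier M. \<forall>y\<in>carrier N. g (tensor_elt A M N x y) = tensor_elt A M' N (f x) y)"
    have "g t = h t" if "t \<in> carrier (tensor_mod A M N)" for t
      by (rule tensor_lin_ext[OF M N T' mod_hom_lin h(1) _ that]) (use g h(2) in auto)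
    then show "g = ?h" using g unfolding mod_hom_iff extensional_def by (intro ext) auto
  qed
  then show ?thesis using t by simp
qed

text \<open>Naturality of the identification with powers of \<open>N\<close>. Any linear maps with
  the prescribed values on elementary tensors may be taken as \<tau> and \<tau>', since these values
  determine them.\<close>

lemma tensor_map_fr:
  assumes N: "module A N" and S: "finite S" "finite S'" and f: "lin (fr S) (fr S') f"
    and \<tau>: "lin (tensor_mod A (fr S) N) (pow_mod N S) \<tau>"
      "\<forall>v\<in>carrier (fr S). \<forall>y\<in>carrier N. \<tau> (tensor_elt A (fr S) N v y) = pure_tens N y v"
    and \<tau>': "lin (tensor_mod A (fr S') N) (pow_mod N S') \<tau>'"
      "\<forall>v\<in>carrier (fr S'). \<forall>y\<in>carrier N. \<tau>' (tensor_elt A (fr S') N v y) = pure_tens N y v"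
    and t: "t \<in> carrier (tensor_mod A (fr S) N)"
  shows "tensor_map A (fr S) (fr S') N f t \<in> carrier (tensor_mod A (fr S') N)"
    "\<tau>' (tensor_map A (fr S) (fr S') N f t) = act N S f (\<tau> t)"
proof -
  from tensor_fr_iso[OF N S(2)]
  obtain \<tau>2 \<sigma>2 where two: "lin (tensor_mod A (fr S') N) (pow_mod N S') \<tau>2 \<and> lin (pow_mod N S') (tensor_mod A (fr S') N) \<sigma>2 \<and>
    (\<forall>v\<in>carrier (fr S'). \<forall>y\<in>carrier N. \<tau>2 (tensor_elt A (fr S') N v y) = pure_tens N y v) \<and>
    (\<forall>v\<in>carrier (fr S'). \<forall>y\<in>carrier N. \<sigma>2 (pure_tens N y v) = tensor_elt A (fr S') N v y) \<and>
    (\<forall>w\<in>carrier (pow_mod N S'). \<tau>2 (\<sigma>2 w) = w) \<and>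
    (\<forall>t\<in>carrier (tensor_mod A (fr S') N). \<sigma>2 (\<tau>2 t) = t)" by (elim exE)
  note 2 = two[THEN conjunct1] two[THEN conjunct2, THEN conjunct1] two[THEN conjunct2, THEN conjunct2, THEN conjunct1]
    two[THEN conjunct2, THEN conjunct2, THEN conjunct2, THEN conjunct1]
    two[THEN conjunct2, THEN conjunct2, THEN conjunct2, THEN conjunct2, THEN conjunct1]
  let ?h = "\<lambda>t. \<sigma>2 (act N S f (\<tau> t))"
  have h: "lin (tensor_mod A (fr S) N) (tensor_mod A (fr S') N) ?h"
    by (rule lin_comp[OF lin_comp[OF \<tau>(1) act_lin[OF N S(1) f]] 2(2)])
  have eq: "tensor_map A (fr S) (fr S') N f t = ?h t" if "t \<in> carrier (tensor_mod A (fr S) N)" for t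
  proof (rule tensor_map_eq[OF module_fr module_fr N h _ that])
    fix x y assume *: "x \<in> carrier (fr S)" "y \<in> carrier N"
    show "\<sigma>2 (act N S f (\<tau> (tensor_elt A (fr S) N x y))) = tensor_elt A (fr S') N (f x) y"
      using * by (simp add: \<tau>(2) act_pure_tens[OF N S(1) f] 2(4) lin_closed[OF f])
  qed
  show "tensor_map A (fr S) (fr S') N f t \<in> carrier (tensor_mod A (fr S') N)"
    using lin_closed[OF h t] eq[OF t] by simp
  have "\<tau>' u = \<tau>2 u" if "u \<in> carrier (tensor_mod A (fr S') N)" for u
    by (rule tensor_lin_ext[OF module_fr N module_pow[OF N] \<tau>'(1) 2(1) _ that]) (simp add: \<tau>'(2) 2(3))
  then show "\<tau>' (tensor_map A (fr S) (fr S') N f t) = act N S f (\<tau> t)"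
    using lin_closed[OF h t] eq[OF t] 2(5) lin_closed[OF act_lin[OF N S(1) f] lin_closed[OF \<tau>(1) t]] by simp
qed

section \<open>Tor computed with powers of N\<close>

lemma image_eq_singleton_iff: "K \<noteq> {} \<Longrightarrow> f ` K = {c} \<longleftrightarrow> (\<forall>x\<in>K. f x = c)"
  by auto

lemma is_zero_quot: "is_zero_mod (quot_mod (M\<lparr>carrier := K\<rparr>) U) \<longleftrightarrow> (\<lambda>x. U +>\<^bsub>M\<^esub> x) ` K = {U}"
proof -
  have "U +>\<^bsub>M\<lparr>carrier := K\<rparr>\<^esub> x = U +>\<^bsub>M\<^esub> x" for x by (simp add: a_r_coset_def')
  then show ?thesis by (simp add: is_zero_mod_def quot_mod_def A_RCOSETS_def' UNION_singleton_eq_range)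
qed

text \<open>The tensor complex of the definition is carried, degree by degree, to the complex of
  powers of \<open>N\<close> with differentials \<open>act\<close>, so that cycles and boundaries
  correspond. It is stated in every integer degree, to be available in degree 0 and below.\<close>

lemma tor_zero_iff:
  assumes N: "module A N"
    and d: "\<And>n. lin (fr {..<fst (min_res A M) n}) (fr {..<fst (min_res A M) (n - 1)}) (snd (min_res A M) n)"
  shows "is_zero_mod (tor_mod A n M N) \<longleftrightarrow>
    (\<forall>w\<in>carrier (pow_mod N {..<fst (min_res A M) n}). act N {..<fst (min_res A M) n} (snd (min_res A M) n) w = (\<lambda>_. \<zero>\<^bsub>N\<^esub>) \<longrightarrow>
       (\<exists>u\<in>carrier (pow_mod N {..<fst (min_res A M) (n + 1)}). w = act N {..<fst (min_res A M) (n + 1)} (snd (min_res A M) (n + 1)) u))"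
proof -
  let ?r = "fst (min_res A M)" and ?d = "snd (min_res A M)"
  let ?S = "\<lambda>n. {..<?r n}"
  have FM: "free_mod A {..<k} = fr {..<k}" for k :: nat by (rule free_mod_eq) simp
  let ?C = "\<lambda>i. tensor_mod A (fr (?S i)) N"
  let ?D = "\<lambda>n. tensor_map A (fr (?S n)) (fr (?S (n - 1))) N (?d n)"
  have C: "module A (?C i)" for i by (rule module_tensor[OF module_fr N])
  have "\<forall>i. \<exists>p. lin (?C i) (pow_mod N (?S i)) (fst p) \<and> lin (pow_mod N (?S i)) (?C i) (snd p) \<and>
    (\<forall>v\<in>carrier (fr (?S i)). \<forall>y\<in>carrier N. fst p (tensor_elt A (fr (?S i)) N v y) = pure_tens N y v) \<and>
    (\<forall>w\<in>carrier (pow_mod N (?S i)). fst p (snd p w) = w) \<and> (\<forall>t\<in>carrier (?C i). snd p (fst p t) = t)"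
    using tensor_fr_iso[OF N finite_lessThan] by (metis fst_conv snd_conv)
  from choice[OF this] obtain p where p: "\<forall>i. lin (?C i) (pow_mod N (?S i)) (fst (p i)) \<and> lin (pow_mod N (?S i)) (?C i) (snd (p i)) \<and>
    (\<forall>v\<in>carrier (fr (?S i)). \<forall>y\<in>carrier N. fst (p i) (tensor_elt A (fr (?S i)) N v y) = pure_tens N y v) \<and>
    (\<forall>w\<in>carrier (pow_mod N (?S i)). fst (p i) (snd (p i) w) = w) \<and> (\<forall>t\<in>carrier (?C i). snd (p i) (fst (p i) t) = t)" ..
  define \<tau> where "\<tau> i = fst (p i)" for i
  define \<sigma> where "\<sigma> i = snd (p i)" for i
  have ts: "lin (?C i) (pow_mod N (?S i)) (\<tau> i)" "lin (pow_mod N (?S i)) (?C i) (\<sigma> i)"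
    "\<forall>v\<in>carrier (fr (?S i)). \<forall>y\<in>carrier N. \<tau> i (tensor_elt A (fr (?S i)) N v y) = pure_tens N y v"
    "w \<in> carrier (pow_mod N (?S i)) \<Longrightarrow> \<tau> i (\<sigma> i w) = w" "t \<in> carrier (?C i) \<Longrightarrow> \<sigma> i (\<tau> i t) = t" for i w t
    using p unfolding \<tau>_def \<sigma>_def by blast+
  have D: "?D n t \<in> carrier (?C (n - 1))" "\<tau> (n - 1) (?D n t) = act N (?S n) (?d n) (\<tau> n t)" if "t \<in> carrier (?C n)" for n t
    using tensor_map_fr[OF N finite_lessThan finite_lessThan d ts(1,3) ts(1,3) that] .
  let ?K = "a_kernel (?C n) (?C (n - 1)) (?D n)"
  let ?I = "?D (n + 1) ` carrier (?C (n + 1))"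
  have I: "submodule ?I A (?C n)"
  proof -
    have "lin (?C (n + 1)) (?C n) (\<lambda>t. \<sigma> n (act N (?S (n + 1)) (?d (n + 1)) (\<tau> (n + 1) t)))"
      using lin_comp[OF lin_comp[OF ts(1)[of "n + 1"] act_lin[OF N finite_lessThan d[of "n + 1"]]] ts(2)[of "n + 1 - 1"]] by simp
    from sub_image[OF C C this sub_carrier[OF C]]
    have *: "submodule ((\<lambda>t. \<sigma> n (act N (?S (n + 1)) (?d (n + 1)) (\<tau> (n + 1) t))) ` carrier (?C (n + 1))) A (?C n)" .
    have "\<sigma> n (act N (?S (n + 1)) (?d (n + 1)) (\<tau> (n + 1) t)) = ?D (n + 1) t" if t: "t \<in> carrier (?C (n + 1))" for t
      using D[OF t] ts(5)[of "?D (n + 1) t" "n + 1 - 1"] by simp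
    then have "(\<lambda>t. \<sigma> n (act N (?S (n + 1)) (?d (n + 1)) (\<tau> (n + 1) t))) ` carrier (?C (n + 1)) = ?I"
      by (intro image_cong refl)
    then show ?thesis using * by simp
  qed
  have D0: "?D n t = \<zero>\<^bsub>?C (n - 1)\<^esub> \<longleftrightarrow> act N (?S n) (?d n) (\<tau> n t) = (\<lambda>_. \<zero>\<^bsub>N\<^esub>)" if t: "t \<in> carrier (?C n)" for t
  proof
    have z: "\<sigma> (n - 1) (\<lambda>_. \<zero>\<^bsub>N\<^esub>) = \<zero>\<^bsub>?C (n - 1)\<^esub>" "\<tau> (n - 1) \<zero>\<^bsub>?C (n - 1)\<^esub> = (\<lambda>_. \<zero>\<^bsub>N\<^esub>)"
      using lin_zero[OF ts(2)[of "n - 1"] module_pow[OF N] C] lin_zero[OF ts(1)[of "n - 1"] C module_pow[OF N]]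
      by (simp_all only: pow_simps)
    show "act N (?S n) (?d n) (\<tau> n t) = (\<lambda>_. \<zero>\<^bsub>N\<^esub>)" if "?D n t = \<zero>\<^bsub>?C (n - 1)\<^esub>"
      using D(2)[OF t] z(2) that by simp
    show "?D n t = \<zero>\<^bsub>?C (n - 1)\<^esub>" if "act N (?S n) (?d n) (\<tau> n t) = (\<lambda>_. \<zero>\<^bsub>N\<^esub>)"
      using D(2)[OF t] z(1) that ts(5)[OF D(1)[OF t]] by simp
  qed
  have "is_zero_mod (tor_mod A n M N) \<longleftrightarrow> (\<lambda>x. ?I +>\<^bsub>?C n\<^esub> x) ` ?K = {?I}"
    by (simp add: tor_mod_def Let_def tor_diff_def res_mod_def res_diff_def FM is_zero_quot)
  also have "\<dots> \<longleftrightarrow> (\<forall>x\<in>?K. x \<in> ?I)"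
  proof -
    interpret C: module A "?C n" by (rule C)
    have "act N (?S n) (?d n) (\<tau> n \<zero>\<^bsub>?C n\<^esub>) = (\<lambda>_. \<zero>\<^bsub>N\<^esub>)"
      using lin_zero[OF lin_comp[OF ts(1)[of n] act_lin[OF N finite_lessThan d[of n]]] C module_pow[OF N]] by simp
    then have "\<zero>\<^bsub>?C n\<^esub> \<in> ?K" using D0[OF C.zero_closed] by (simp add: a_kernel_def')
    then have ne: "?K \<noteq> {}" by (metis empty_iff)
    have "?I +>\<^bsub>?C n\<^esub> x = ?I \<longleftrightarrow> x \<in> ?I" if "x \<in> ?K" for x
      by (rule rcos_zero_iff[OF C I]) (use that in \<open>simp add: a_kernel_def'\<close>)
    then show ?thesis unfolding image_eq_singleton_iff[OF ne] by (intro ball_cong refl)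
  qed
  also have "\<dots> \<longleftrightarrow> (\<forall>w\<in>carrier (pow_mod N (?S n)). act N (?S n) (?d n) w = (\<lambda>_. \<zero>\<^bsub>N\<^esub>) \<longrightarrow>
       (\<exists>u\<in>carrier (pow_mod N (?S (n + 1))). w = act N (?S (n + 1)) (?d (n + 1)) u))" (is "?L \<longleftrightarrow> ?R")
  proof
    assume L: ?L
    show ?R
    proof (intro ballI impI)
      fix w assume w: "w \<in> carrier (pow_mod N (?S n))" "act N (?S n) (?d n) w = (\<lambda>_. \<zero>\<^bsub>N\<^esub>)"
      have c: "\<sigma> n w \<in> carrier (?C n)" by (rule lin_closed[OF ts(2) w(1)])
      then have "\<sigma> n w \<in> ?K" using D0[OF c] w ts(4)[OF w(1)] by (simp add: a_kernel_def')
      then obtain t where t: "t \<in> carrier (?C (n + 1))" "\<sigma> n w = ?D (n + 1) t" using L by blast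
      have "w = \<tau> n (?D (n + 1) t)" using ts(4)[OF w(1)] t(2) by simp
      also have "\<dots> = act N (?S (n + 1)) (?d (n + 1)) (\<tau> (n + 1) t)" using D(2)[OF t(1)] by simp
      finally show "\<exists>u\<in>carrier (pow_mod N (?S (n + 1))). w = act N (?S (n + 1)) (?d (n + 1)) u"
        using lin_closed[OF ts(1) t(1)] by blast
    qed
  next
    assume R: ?R
    show ?L
    proof
      fix x assume x: "x \<in> ?K"
      then have xc: "x \<in> carrier (?C n)" "?D n x = \<zero>\<^bsub>?C (n - 1)\<^esub>" by (auto simp: a_kernel_def')
      then have "act N (?S n) (?d n) (\<tau> n x) = (\<lambda>_. \<zero>\<^bsub>N\<^esub>)" using D0 by blast
      then obtain u where u: "u \<in> carrier (pow_mod N (?S (n + 1)))" "\<tau> n x = act N (?S (n + 1)) (?d (n + 1)) u"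
        using R lin_closed[OF ts(1) xc(1)] by blast
      have c: "\<sigma> (n + 1) u \<in> carrier (?C (n + 1))" by (rule lin_closed[OF ts(2) u(1)])
      have "\<tau> n (?D (n + 1) (\<sigma> (n + 1) u)) = \<tau> n x" using D(2)[OF c] ts(4)[OF u(1)] u(2) by simp
      then have "?D (n + 1) (\<sigma> (n + 1) u) = x" using D(1)[OF c] ts(5) xc(1) by (metis add_diff_cancel_right')
      then show "x \<in> ?I" using c by blast
    qed
  qed
  finally show ?thesis .
qed

subsection \<open>Betti numbers\<close>

lemma fr_sub_all:
  assumes S: "finite S" and W: "submodule W A (fr S)" and u: "\<And>s. s \<in> S \<Longrightarrow> unit_vec A s \<in> W" and v: "v \<in> carrier (fr S)"
  shows "v \<in> W"
  using module_self S v
proof (induction rule: pow_induct)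
  case zero show ?case using sub_zero[OF W] by simp
next
  case (single s n)
  then show ?case using sub_smult[OF W _ u[OF single(1)], of n] by (simp only: single_smult_unit[of n s S] self_simps)
next
  case (add x y) then show ?case using sub_add[OF W] by blast
qed

lemma lin_coord: "lin (fr S) (self_mod A) (\<lambda>x. x i)"
  using pow_at[OF module_self, of _ S i] unfolding lin_def by simp

text \<open>A linear system with fewer equations than unknowns over the residue field, solved by Gaussian elimination.\<close>

lemma underdetermined:
  assumes "finite I"
  shows "finite J \<Longrightarrow> card I < card J \<Longrightarrow> lin (fr J) (fr I) g \<Longrightarrow>
     \<exists>x\<in>carrier (fr J). (\<exists>k. x k \<notin> \<mm>) \<and> (\<forall>i. g x i \<in> \<mm>)"
  using assms
proof (induction I arbitrary: J g rule: finite_induct)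
  case empty
  then obtain j where j: "j \<in> J" by fastforce
  have "unit_vec A j j \<notin> \<mm>" using mm_one by (simp add: unit_vec_def)
  moreover have "g (unit_vec A j) i \<in> \<mm>" for i
    using lin_closed[OF empty(3) unit_vec_in[OF j]] mm_zero by (simp add: pow_carrier)
  ultimately show ?case using unit_vec_in[OF j] by blast
next
  case (insert i I)
  note g = insert.prems(3)
  have J: "finite J" by (rule insert.prems(1))
  define pr where "pr = (\<lambda>(v::'b \<Rightarrow> 'a) k. if k = i then \<zero> else v k)"
  have pr: "lin (fr (insert i I)) (fr I) pr"
    unfolding lin_def pr_def by (auto simp: pow_carrier fun_eq_iff)
  have gi: "lin (fr J) (self_mod A) (\<lambda>x. g x i)" by (rule lin_comp[OF g lin_coord])
  show ?case
  proof (cases "\<forall>j\<in>J. g (unit_vec A j) i \<in> \<mm>")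
    \<comment> \<open>Equation \<open>i\<close> is trivial modulo the maximal ideal and can be
      discarded.\<close>
    case True
    have gm: "g x i \<in> \<mm>" if x: "x \<in> carrier (fr J)" for x
    proof -
      have "x \<in> {x \<in> carrier (fr J). g x i \<in> \<mm>}"
        by (rule fr_sub_all[OF J sub_preimage[OF module_fr module_self gi mm_sub] _ x]) (use True unit_vec_in in auto)
      then show ?thesis by blast
    qed
    have "card I < card J" using insert.prems(2) insert.hyps by simp
    from insert.IH[OF J this lin_comp[OF g pr]]
    obtain x k where x: "x \<in> carrier (fr J)" "x k \<notin> \<mm>" "\<forall>l. pr (g x) l \<in> \<mm>" by blast
    have "g x l \<in> \<mm>" for l using x(3)[rule_format, of l] gm[OF x(1)] by (cases "l = i") (auto simp: pr_def)
    then show ?thesis using x by blast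
  next
    case False
    then obtain j where j: "j \<in> J" "g (unit_vec A j) i \<notin> \<mm>" by blast
    define u where "u = g (unit_vec A j) i"
    have uA: "u \<in> carrier A" using lin_closed[OF gi unit_vec_in[OF j(1)]] by (simp add: u_def)
    have un: "u \<in> Units A" by (rule mm_unit[OF uA]) (use j in \<open>simp add: u_def\<close>)
    let ?J = "J - {j}"
    have sub: "?J \<subseteq> J" by blast
    \<comment> \<open>The unit \<open>u\<close>, the coefficient of the unknown \<open>j\<close> in
      equation \<open>i\<close>, is the pivot: \<open>h\<close> fills in the value of
      \<open>j\<close> that solves equation \<open>i\<close> exactly, for arbitrary values of the
      other unknowns.\<close>
    define h where "h = (\<lambda>y. y \<oplus>\<^bsub>fr J\<^esub> (\<ominus> (inv u \<otimes> g y i)) \<odot>\<^bsub>fr J\<^esub> unit_vec A j)"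
    have c: "lin (fr ?J) (self_mod A) (\<lambda>y. \<ominus> (inv u \<otimes> g y i))"
      using lin_uminus[OF lin_scale[OF lin_mono[OF module_self sub gi] module_self, of "inv u"] module_self] un by simp
    have incl: "lin (fr ?J) (fr J) (\<lambda>y. y)" by (rule lin_mono[OF module_self sub lin_id])
    have h: "lin (fr ?J) (fr J) h" unfolding h_def
      by (rule lin_plus[OF incl lin_comp[OF c lin_smult_right[OF module_fr unit_vec_in[OF j(1)]]] module_fr module_fr])
    have gh: "g (h y) i = \<zero>" if y: "y \<in> carrier (fr ?J)" for y
    proof -
      have yJ: "y \<in> carrier (fr J)" by (rule lin_closed[OF incl y])
      have cA: "\<ominus> (inv u \<otimes> g y i) \<in> carrier A" using lin_closed[OF c y] by simp
      have gy: "g y i \<in> carrier A" using lin_closed[OF gi yJ] by simp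
      interpret P: module A "fr J" by (rule module_fr)
      have "g (h y) i = g y i \<oplus> \<ominus> (inv u \<otimes> g y i) \<otimes> u"
        unfolding h_def u_def
        using lin_add[OF gi yJ P.smult_closed[OF cA unit_vec_in[OF j(1)]]] lin_smult[OF gi cA unit_vec_in[OF j(1)]]
        unfolding u_def by (simp del: pow_simps)
      also have "inv u \<otimes> g y i = g y i \<otimes> inv u" using un gy by (simp add: m_comm)
      also have "\<ominus> (g y i \<otimes> inv u) \<otimes> u = \<ominus> g y i" using uA un gy by (simp add: l_minus m_assoc)
      also have "g y i \<oplus> \<ominus> g y i = \<zero>" using gy by (simp add: r_neg)
      finally show ?thesis .
    qed
    have "card I < card ?J" using insert.prems(2) insert.hyps j(1) J by simp
    from insert.IH[OF _ this lin_comp[OF lin_comp[OF h g] pr]] J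
    obtain y k where y: "y \<in> carrier (fr ?J)" "y k \<notin> \<mm>" "\<forall>l. pr (g (h y)) l \<in> \<mm>" by blast
    \<comment> \<open>The unit coordinate found by induction is not the pivot, so it survives in
      \<open>h y\<close>.\<close>
    have "k \<noteq> j" using y mm_zero by (auto simp: pow_carrier)
    have cA: "\<ominus> (inv u \<otimes> g y i) \<in> carrier A" using lin_closed[OF c y(1)] by simp
    have "h y k = y k" using \<open>k \<noteq> j\<close> cA pow_at[OF module_self y(1), of k] by (simp add: h_def unit_vec_def)
    moreover have "g (h y) l \<in> \<mm>" for l using y(3)[rule_format, of l] gh[OF y(1)] mm_zero by (cases "l = i") (auto simp: pr_def)
    ultimately show ?thesis using lin_closed[OF h y(1)] y(2) by (intro bexI[of _ "h y"] conjI exI[of _ k] allI) simp_all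
  qed
qed

text \<open>Projectivity of free modules: lifts of the basis vectors suffice.\<close>

lemma lift_through:
  assumes S: "finite S" and P: "module A P" and u: "lin (fr S) P u" and Q: "module A Q" and g: "lin Q P g"
    and im: "\<And>s. s \<in> S \<Longrightarrow> \<exists>y\<in>carrier Q. g y = u (unit_vec A s)"
  shows "\<exists>h. lin (fr S) Q h \<and> (\<forall>x\<in>carrier (fr S). g (h x) = u x)"
proof -
  have "\<forall>s\<in>S. \<exists>y. y \<in> carrier Q \<and> g y = u (unit_vec A s)" using im by blast
  from bchoice[OF this] obtain b where b: "\<forall>s\<in>S. b s \<in> carrier Q \<and> g (b s) = u (unit_vec A s)" ..
  then obtain h where h: "lin (fr S) Q h" "\<And>s. s \<in> S \<Longrightarrow> h (unit_vec A s) = b s"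
    using lin_ex[OF Q S, of b] by auto
  have "g (h x) = u x" if "x \<in> carrier (fr S)" for x
    by (rule fr_lin_ext[OF S P lin_comp[OF h(1) g] u _ that]) (use h(2) b in auto)
  then show ?thesis using h(1) by blast
qed

section \<open>Dimension over the residue field\<close>

lemma lin_zero_on_mm_coords:
  assumes V: "module A V" and k: "\<And>a v. a \<in> \<mm> \<Longrightarrow> v \<in> carrier V \<Longrightarrow> a \<odot>\<^bsub>V\<^esub> v = \<zero>\<^bsub>V\<^esub>"
    and e: "lin (fr S) V e" and S: "finite S" and x: "x \<in> carrier (fr S)" "\<And>i. x i \<in> \<mm>"
  shows "e x = \<zero>\<^bsub>V\<^esub>"
proof -
  have "ideal_smult A \<mm> (fr S) \<subseteq> {x \<in> carrier (fr S). e x \<in> {\<zero>\<^bsub>V\<^esub>}}"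
    unfolding ideal_smult_def
  proof (rule span_least[OF sub_preimage[OF module_fr V e sub_triv[OF V]]], safe)
    interpret P: module A "fr S" by (rule module_fr)
    fix a x assume a: "a \<in> \<mm>" and x: "x \<in> carrier (fr S)"
    show "a \<odot>\<^bsub>fr S\<^esub> x \<in> carrier (fr S)" by (rule P.smult_closed[OF mm_in[OF a] x])
    show "e (a \<odot>\<^bsub>fr S\<^esub> x) = \<zero>\<^bsub>V\<^esub>" unfolding lin_smult[OF e mm_in[OF a] x] by (rule k[OF a lin_closed[OF e x]])
  qed
  then show ?thesis using mm_coords[OF S x] by blast
qed

text \<open>If \<open>T\<close> were larger, lift \<open>e'\<close> along \<open>e\<close> to a
  linear map of free modules; a solution of the underdetermined system has a unit coordinate but is
  sent to zero by \<open>e'\<close>, against the assumption on its kernel.\<close>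

lemma gens_card_le:
  assumes V: "module A V" and k: "\<And>a v. a \<in> \<mm> \<Longrightarrow> v \<in> carrier V \<Longrightarrow> a \<odot>\<^bsub>V\<^esub> v = \<zero>\<^bsub>V\<^esub>"
    and S: "finite S" and e: "lin (fr S) V e" "e ` carrier (fr S) = carrier V"
    and T: "finite T" and e': "lin (fr T) V e'" "\<forall>x\<in>carrier (fr T). e' x = \<zero>\<^bsub>V\<^esub> \<longrightarrow> (\<forall>k. x k \<in> \<mm>)"
  shows "card T \<le> card S"
proof (rule ccontr)
  assume "\<not> card T \<le> card S"
  then have c: "card S < card T" by simp
  have "\<exists>y\<in>carrier (fr S). e y = e' (unit_vec A t)" if t: "t \<in> T" for t
  proof -
    have "e' (unit_vec A t) \<in> e ` carrier (fr S)" unfolding e(2) by (rule lin_closed[OF e'(1) unit_vec_in[OF t]])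
    then show ?thesis by (metis imageE)
  qed
  from lift_through[OF T V e'(1) module_fr e(1) this]
  obtain g where g: "lin (fr T) (fr S) g" "\<forall>x\<in>carrier (fr T). e (g x) = e' x" by blast
  from underdetermined[OF S T c g(1)] obtain x k' where x: "x \<in> carrier (fr T)" "x k' \<notin> \<mm>" "\<forall>i. g x i \<in> \<mm>" by blast
  have "e (g x) = \<zero>\<^bsub>V\<^esub>" by (rule lin_zero_on_mm_coords[OF V k e(1) S lin_closed[OF g(1) x(1)]]) (use x(3) in auto)
  then have "e' x = \<zero>\<^bsub>V\<^esub>" using g(2) x(1) by simp
  then show False using e'(2) x(1,2) by blast
qed

lemma k_basis_gens:
  assumes V: "module A V" and B: "k_basis A V B"
  shows "lin (fr B) V (lin_comb V B (\<lambda>b. b))" "lin_comb V B (\<lambda>b. b) ` carrier (fr B) = carrier V"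
    "\<forall>x\<in>carrier (fr B). lin_comb V B (\<lambda>b. b) x = \<zero>\<^bsub>V\<^esub> \<longrightarrow> (\<forall>k. x k \<in> \<mm>)"
proof -
  have b: "finite B" "B \<subseteq> carrier V" "mod_span A V B = carrier V" using B by (auto simp: k_basis_def)
  show l: "lin (fr B) V (lin_comb V B (\<lambda>b. b))" by (rule lin_comb_lin[OF V b(1)]) (use b in auto)
  have "B \<subseteq> lin_comb V B (\<lambda>b. b) ` carrier (fr B)"
  proof
    fix x assume x: "x \<in> B"
    have "lin_comb V B (\<lambda>b. b) (unit_vec A x) = x" by (rule lin_comb_unit[OF V b(1) _ x]) (use b in auto)
    then show "x \<in> lin_comb V B (\<lambda>b. b) ` carrier (fr B)" using unit_vec_in[OF x] by force
  qed
  from span_least[OF sub_image[OF module_fr V l sub_carrier[OF module_fr]] this]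
  show "lin_comb V B (\<lambda>b. b) ` carrier (fr B) = carrier V" unfolding b(3) using lin_closed[OF l] by blast
  have "x k \<in> \<mm>" if x: "x \<in> carrier (fr B)" "lin_comb V B (\<lambda>b. b) x = \<zero>\<^bsub>V\<^esub>" for x k
  proof (cases "k \<in> B")
    case True
    have "x \<in> B \<rightarrow> carrier A" using pow_at[OF module_self x(1)] by auto
    then show ?thesis using B x(2) True unfolding k_basis_def lin_comb_def by blast
  next
    case False then show ?thesis using x mm_zero by (simp add: pow_carrier)
  qed
  then show "\<forall>x\<in>carrier (fr B). lin_comb V B (\<lambda>b. b) x = \<zero>\<^bsub>V\<^esub> \<longrightarrow> (\<forall>k. x k \<in> \<mm>)" by blast
qed

text \<open>A surjection from a free module whose kernel has coordinates in the maximal ideal makes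
  the images of the unit vectors a basis. The definite description in \<open>k_dim\<close> is
  legitimate because \<open>gens_card_le\<close> compares any two bases in both directions.\<close>

lemma k_dim_eq:
  assumes V: "module A V" and k: "\<And>a v. a \<in> \<mm> \<Longrightarrow> v \<in> carrier V \<Longrightarrow> a \<odot>\<^bsub>V\<^esub> v = \<zero>\<^bsub>V\<^esub>"
    and S: "finite S" and e: "lin (fr S) V e" "e ` carrier (fr S) = carrier V"
      and e3: "\<forall>x\<in>carrier (fr S). e x = \<zero>\<^bsub>V\<^esub> \<longrightarrow> (\<forall>k. x k \<in> \<mm>)"
  shows "k_dim A V = card S"
proof -
  interpret V: module A V by fact
  let ?b = "\<lambda>s. e (unit_vec A s)"
  let ?B = "?b ` S"
  have bV: "?b \<in> S \<rightarrow> carrier V" using lin_closed[OF e(1) unit_vec_in] by blast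
  \<comment> \<open>Two equal images would give a relation with a coefficient one.\<close>
  have inj: "inj_on ?b S"
  proof (rule inj_onI, rule ccontr)
    fix s t assume st: "s \<in> S" "t \<in> S" "?b s = ?b t" "s \<noteq> t"
    interpret P: module A "fr S" by (rule module_fr)
    note us = unit_vec_in[OF st(1)] and ut = unit_vec_in[OF st(2)]
    have "e (unit_vec A s \<ominus>\<^bsub>fr S\<^esub> unit_vec A t) = \<zero>\<^bsub>V\<^esub>"
      using lin_minus[OF e(1) module_fr V us ut] st(3) lin_closed[OF e(1) ut] by (simp add: a_minus_def V.r_neg)
    then have "(unit_vec A s \<ominus>\<^bsub>fr S\<^esub> unit_vec A t) s \<in> \<mm>" using e3 P.minus_closed[OF us ut] by blast
    then have "unit_vec A s s \<ominus> unit_vec A t s \<in> \<mm>" unfolding pow_minus[OF module_self ut] by simp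
    then have "\<one> \<ominus> \<zero> \<in> \<mm>" using st(4) by (simp add: unit_vec_def)
    moreover have "\<one> \<ominus> \<zero> = \<one>" using minus_zero_right[OF module_self, of \<one>] by simp
    ultimately show False using mm_one by simp
  qed
  have eq: "e x = lin_comb V S ?b x" if "x \<in> carrier (fr S)" for x
    by (rule fr_lin_ext[OF S V e(1) lin_comb_lin[OF V S bV] _ that]) (simp add: lin_comb_unit[OF V S bV])
  have BV: "?B \<subseteq> carrier V" using bV by blast
  have spB: "submodule (mod_span A V ?B) A V" by (rule span_sub[OF V BV])
  have basis: "k_basis A V ?B" unfolding k_basis_def
  proof (intro conjI ballI impI)
    show "finite ?B" using S by simp
    show "?B \<subseteq> carrier V" by (rule BV)
    show "mod_span A V ?B = carrier V"
    proof
      show "mod_span A V ?B \<subseteq> carrier V" by (rule sub_subset[OF spB])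
      show "carrier V \<subseteq> mod_span A V ?B"
      proof
        fix v assume "v \<in> carrier V"
        then obtain x where x: "x \<in> carrier (fr S)" "v = e x" using e(2) by blast
        have "x \<in> {x \<in> carrier (fr S). e x \<in> mod_span A V ?B}"
        proof (rule fr_sub_all[OF S sub_preimage[OF module_fr V e(1) spB] _ x(1)])
          fix s assume s: "s \<in> S"
          have "?b s \<in> mod_span A V ?B" by (rule subsetD[OF span_incl]) (use s in blast)
          then show "unit_vec A s \<in> {x \<in> carrier (fr S). e x \<in> mod_span A V ?B}" using unit_vec_in[OF s] by blast
        qed
        then show "v \<in> mod_span A V ?B" using x by blast
      qed
    qed
    fix a v assume a: "a \<in> ?B \<rightarrow> carrier A" and z: "(\<Oplus>\<^bsub>V\<^esub>v\<in>?B. a v \<odot>\<^bsub>V\<^esub> v) = \<zero>\<^bsub>V\<^esub>" and v: "v \<in> ?B"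
    define x where "x = (\<lambda>s. if s \<in> S then a (?b s) else \<zero>)"
    have x: "x \<in> carrier (fr S)" using a by (auto simp: x_def pow_carrier)
    have "(\<Oplus>\<^bsub>V\<^esub>v\<in>?B. a v \<odot>\<^bsub>V\<^esub> v) = (\<Oplus>\<^bsub>V\<^esub>s\<in>S. a (?b s) \<odot>\<^bsub>V\<^esub> ?b s)"
      by (rule V.finsum_reindex[OF _ inj]) (use a BV in auto)
    also have "\<dots> = e x" unfolding eq[OF x] lin_comb_def
      by (rule V.finsum_cong'[OF refl]) (use a bV in \<open>auto simp: x_def Pi_def\<close>)
    finally have "e x = \<zero>\<^bsub>V\<^esub>" using z by simp
    then have xm: "\<And>k. x k \<in> \<mm>" using e3 x by blast
    obtain s where s: "s \<in> S" "v = ?b s" using v by blast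
    show "a v \<in> \<mm>" using xm[of s] s by (simp add: x_def)
  qed
  have cB: "card ?B = card S" by (rule card_image[OF inj])
  show ?thesis unfolding k_dim_def
  proof (rule the_equality)
    show "\<exists>B. k_basis A V B \<and> card B = card S" using basis cB by blast
    fix n assume "\<exists>B. k_basis A V B \<and> card B = n"
    then obtain B where B: "k_basis A V B" "card B = n" by blast
    have fB: "finite B" using B by (simp add: k_basis_def)
    note kb = k_basis_gens[OF V B(1)]
    have "card B \<le> card S" using gens_card_le[OF V k S e(1,2) fB kb(1,3)] .
    moreover have "card S \<le> card B" using gens_card_le[OF V k fB kb(1,2) S e(1) e3] .
    ultimately show "n = card S" using B(2) by simp
  qed
qed

section \<open>Betti numbers as ranks in the minimal resolution\<close>

lemma hom_mod_simps:
  "carrier (hom_mod A M N) = mod_hom A M N" "\<zero>\<^bsub>hom_mod A M N\<^esub> = (\<lambda>x\<in>carrier M. \<zero>\<^bsub>N\<^esub>)"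
  "f \<oplus>\<^bsub>hom_mod A M N\<^esub> g = (\<lambda>x\<in>carrier M. f x \<oplus>\<^bsub>N\<^esub> g x)"
  "a \<odot>\<^bsub>hom_mod A M N\<^esub> f = (\<lambda>x\<in>carrier M. a \<odot>\<^bsub>N\<^esub> f x)"
  by (simp_all add: hom_mod_def)

lemma hom_ext: "f \<in> mod_hom A M N \<Longrightarrow> g \<in> mod_hom A M N \<Longrightarrow> (\<And>x. x \<in> carrier M \<Longrightarrow> f x = g x) \<Longrightarrow> f = g"
  unfolding mod_hom_iff by (metis extensionalityI)

lemma module_hom_mod:
  assumes M: "module A M" and N: "module A N" shows "module A (hom_mod A M N)"
proof -
  interpret N: module A N by fact
  let ?H = "hom_mod A M N"
  have cl: "f x \<in> carrier N" if "f \<in> mod_hom A M N" "x \<in> carrier M" for f x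
    by (rule lin_closed[OF mod_hom_lin[OF that(1)] that(2)])
  have z: "\<zero>\<^bsub>?H\<^esub> \<in> carrier ?H" unfolding hom_mod_simps by (rule lin_restrict[OF lin_const_zero[OF N] M])
  have a: "f \<oplus>\<^bsub>?H\<^esub> g \<in> carrier ?H" if "f \<in> carrier ?H" "g \<in> carrier ?H" for f g
    using that unfolding hom_mod_simps by (intro lin_restrict lin_plus M N mod_hom_lin)
  have s: "c \<odot>\<^bsub>?H\<^esub> f \<in> carrier ?H" if "c \<in> carrier A" "f \<in> carrier ?H" for c f
    using that unfolding hom_mod_simps by (intro lin_restrict lin_scale M N mod_hom_lin)
  have ext: "f = g" if "f \<in> carrier ?H" "g \<in> carrier ?H" "\<And>x. x \<in> carrier M \<Longrightarrow> f x = g x" for f g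
    using that hom_ext unfolding hom_mod_simps by blast
  have v: "f x \<in> carrier N" if "f \<in> carrier ?H" "x \<in> carrier M" for f x using that cl unfolding hom_mod_simps by blast
  show ?thesis
  proof (rule moduleI)
    show "abelian_group ?H"
    proof (rule abelian_groupI)
      show "x \<oplus>\<^bsub>?H\<^esub> y \<in> carrier ?H" if "x \<in> carrier ?H" "y \<in> carrier ?H" for x y using a that .
      show "\<zero>\<^bsub>?H\<^esub> \<in> carrier ?H" by (rule z)
      show "x \<oplus>\<^bsub>?H\<^esub> y \<oplus>\<^bsub>?H\<^esub> w = x \<oplus>\<^bsub>?H\<^esub> (y \<oplus>\<^bsub>?H\<^esub> w)" if "x \<in> carrier ?H" "y \<in> carrier ?H" "w \<in> carrier ?H" for x y w
        by (intro ext a that) (simp add: hom_mod_simps v[OF that(1)] v[OF that(2)] v[OF that(3)] N.a_assoc)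
      show "x \<oplus>\<^bsub>?H\<^esub> y = y \<oplus>\<^bsub>?H\<^esub> x" if "x \<in> carrier ?H" "y \<in> carrier ?H" for x y
        by (intro ext a that) (simp add: hom_mod_simps v[OF that(1)] v[OF that(2)] N.a_comm)
      show "\<zero>\<^bsub>?H\<^esub> \<oplus>\<^bsub>?H\<^esub> x = x" if "x \<in> carrier ?H" for x
        by (intro ext a z that) (simp add: hom_mod_simps v[OF that])
      show "\<exists>y\<in>carrier ?H. y \<oplus>\<^bsub>?H\<^esub> x = \<zero>\<^bsub>?H\<^esub>" if x: "x \<in> carrier ?H" for x
      proof
        show m: "(\<ominus> \<one>) \<odot>\<^bsub>?H\<^esub> x \<in> carrier ?H" by (rule s[OF _ x]) simp
        show "(\<ominus> \<one>) \<odot>\<^bsub>?H\<^esub> x \<oplus>\<^bsub>?H\<^esub> x = \<zero>\<^bsub>?H\<^esub>"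
          by (intro ext a z x m) (simp add: hom_mod_simps v[OF x] N.smult_l_minus N.l_neg)
      qed
    qed
    show "c \<odot>\<^bsub>?H\<^esub> x \<in> carrier ?H" if "c \<in> carrier A" "x \<in> carrier ?H" for c x using s that .
    show "(c \<oplus> d) \<odot>\<^bsub>?H\<^esub> x = c \<odot>\<^bsub>?H\<^esub> x \<oplus>\<^bsub>?H\<^esub> d \<odot>\<^bsub>?H\<^esub> x" if "c \<in> carrier A" "d \<in> carrier A" "x \<in> carrier ?H" for c d x
      by (intro ext a s a_closed that) (simp add: hom_mod_simps v[OF that(3)] that N.smult_l_distr)
    show "c \<odot>\<^bsub>?H\<^esub> (x \<oplus>\<^bsub>?H\<^esub> y) = c \<odot>\<^bsub>?H\<^esub> x \<oplus>\<^bsub>?H\<^esub> c \<odot>\<^bsub>?H\<^esub> y" if "c \<in> carrier A" "x \<in> carrier ?H" "y \<in> carrier ?H" for c x y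
      by (intro ext a s that) (simp add: hom_mod_simps v[OF that(2)] v[OF that(3)] that N.smult_r_distr)
    show "(c \<otimes> d) \<odot>\<^bsub>?H\<^esub> x = c \<odot>\<^bsub>?H\<^esub> (d \<odot>\<^bsub>?H\<^esub> x)" if "c \<in> carrier A" "d \<in> carrier A" "x \<in> carrier ?H" for c d x
      by (intro ext a s m_closed that) (simp add: hom_mod_simps v[OF that(3)] that N.smult_assoc1)
    show "\<one> \<odot>\<^bsub>?H\<^esub> x = x" if "x \<in> carrier ?H" for x
      by (intro ext s one_closed that) (simp add: hom_mod_simps v[OF that])
  qed (rule is_cring)
qed

lemma residue_module: "module A (residue_mod A)"
  unfolding residue_mod_def by (rule module_quot[OF module_self mm_sub])

lemma residue_kill:
  assumes "a \<in> \<mm>" "v \<in> carrier (residue_mod A)" shows "a \<odot>\<^bsub>residue_mod A\<^esub> v = \<zero>\<^bsub>residue_mod A\<^esub>"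
proof -
  obtain x where x: "x \<in> carrier (self_mod A)" "v = \<mm> +>\<^bsub>self_mod A\<^esub> x"
    using assms(2) unfolding residue_mod_def quot_carrier by blast
  have "a \<otimes> x \<in> \<mm>" using mm_mult[of x a] assms(1) x(1) mm_in[OF assms(1)] by (simp add: m_comm)
  then have "\<mm> +>\<^bsub>self_mod A\<^esub> (a \<odot>\<^bsub>self_mod A\<^esub> x) = \<mm>"
    using rcos_zero_iff[OF module_self mm_sub, of "a \<otimes> x"] mm_in by simp
  then show ?thesis unfolding residue_mod_def x(2) quot_smult[OF module_self mm_sub x(1) mm_in[OF assms(1)]] quot_zero .
qed

text \<open>By minimality every map from the resolution to the residue field vanishes on the images
  of the differentials. So Ext^n(X, k) is all of Hom(P_n, k), whose dimension is the rank of
  P_n.\<close>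

lemma betti_rank:
  assumes X: "fg_module A X"
  shows "betti A X (Suc j) = card (res_idx X (Suc j))"
proof -
  let ?k = "residue_mod A" and ?S = "res_idx X (Suc j)" and ?n = "int (Suc j)"
  let ?F = "fr ?S"
  note mp = min_res_props(2-4)[OF X]
  note fin = free_cx_D(1)[OF mp(1)] and L = free_cx_D(2)[OF mp(1)]
  have FM: "free_mod A {..<k} = fr {..<k}" for k :: nat by (rule free_mod_eq) simp
  have R: "res_mod A X ?n = ?F" "res_mod A X (?n - 1) = fr (res_idx X j)" "res_mod A X (?n + 1) = fr (res_idx X (Suc (Suc j)))"
    by (simp_all add: res_mod_def FM res_idx_def add.commute)
  have d: "res_diff A X ?n = res_d X j" "res_diff A X (?n + 1) = res_d X (Suc j)"
    by (simp_all add: res_diff_def res_d_def add.commute)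
  have dm: "res_d X i x l \<in> \<mm>" if x: "x \<in> carrier (fr (res_idx X (Suc i)))" for i x l
  proof -
    have "x \<in> {x \<in> carrier (fr (res_idx X (Suc i))). res_d X i x l \<in> \<mm>}"
      by (rule fr_sub_all[OF fin sub_preimage[OF module_fr module_self lin_comp[OF L lin_coord] mm_sub] _ x])
        (use mp(3) unit_vec_in in auto)
    then show ?thesis by blast
  qed
  have kill: "g (res_d X i x) = \<zero>\<^bsub>?k\<^esub>" if "x \<in> carrier (fr (res_idx X (Suc i)))" "g \<in> mod_hom A (fr (res_idx X i)) ?k" for g i x
    by (rule lin_zero_on_mm_coords[OF residue_module residue_kill mod_hom_lin[OF that(2)] fin lin_closed[OF L that(1)] dm[OF that(1)]])
  let ?H = "hom_mod A ?F ?k"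
  have H: "module A ?H" by (rule module_hom_mod[OF module_fr residue_module])
  have Z: "ext_cocycles A ?n X ?k = carrier ?H"
    unfolding ext_cocycles_def R d hom_mod_simps using kill by blast
  have z: "(\<lambda>x\<in>carrier (fr (res_idx X j)). \<zero>\<^bsub>?k\<^esub>) \<in> mod_hom A (fr (res_idx X j)) ?k"
    by (rule lin_restrict[OF lin_const_zero[OF residue_module] module_fr])
  have Bd: "ext_coboundaries A ?n X ?k = {\<zero>\<^bsub>?H\<^esub>}"
  proof -
    have "(\<lambda>p\<in>carrier ?F. g (res_d X j p)) = \<zero>\<^bsub>?H\<^esub>" if "g \<in> mod_hom A (fr (res_idx X j)) ?k" for g
      unfolding hom_mod_simps by (rule restrict_ext) (rule kill[OF _ that])
    moreover have "mod_hom A (fr (res_idx X j)) ?k \<noteq> {}" using z by (metis empty_iff)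
    ultimately show ?thesis unfolding ext_coboundaries_def R d Setcompr_eq_image
      by (intro image_eq_singleton_iff[THEN iffD2] ballI)
  qed
  have "?H\<lparr>carrier := carrier ?H\<rparr> = ?H" by simp
  then have E: "ext_mod A ?n X ?k = quot_mod ?H {\<zero>\<^bsub>?H\<^esub>}" unfolding ext_mod_def Bd Z R by simp
  let ?V = "quot_mod ?H {\<zero>\<^bsub>?H\<^esub>}"
  note T = sub_triv[OF H]
  have V: "module A ?V" by (rule module_quot[OF H T])
  have qk: "a \<odot>\<^bsub>?V\<^esub> v = \<zero>\<^bsub>?V\<^esub>" if a: "a \<in> \<mm>" and v: "v \<in> carrier ?V" for a v
  proof -
    obtain f where f: "f \<in> carrier ?H" "v = {\<zero>\<^bsub>?H\<^esub>} +>\<^bsub>?H\<^esub> f" using v unfolding quot_carrier by blast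
    interpret H: module A ?H by (rule H)
    have "a \<odot>\<^bsub>?H\<^esub> f = \<zero>\<^bsub>?H\<^esub>"
      unfolding hom_mod_simps using residue_kill[OF a] lin_closed[OF mod_hom_lin[OF f(1)[unfolded hom_mod_simps]]]
      by (intro restrict_ext) blast
    then have "{\<zero>\<^bsub>?H\<^esub>} +>\<^bsub>?H\<^esub> (a \<odot>\<^bsub>?H\<^esub> f) = {\<zero>\<^bsub>?H\<^esub>}" using rcos_zero_iff[OF H T H.zero_closed] by simp
    then show ?thesis unfolding f(2) quot_smult[OF H T f(1) mm_in[OF a]] quot_zero .
  qed
  let ?\<pi> = "\<lambda>a. \<mm> +>\<^bsub>self_mod A\<^esub> a"
  have \<pi>: "lin (self_mod A) ?k ?\<pi>" unfolding residue_mod_def by (rule quot_proj_lin[OF module_self mm_sub])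
  \<comment> \<open>The dot product. Followed by the projection to the residue field it turns
    vectors into functionals, and the vectors giving the zero functional are those with all
    coordinates in the maximal ideal.\<close>
  define \<beta> where "\<beta> x = lin_comb (self_mod A) ?S x" for x :: "nat \<Rightarrow> 'a"
  have \<beta>1: "lin ?F (self_mod A) (\<beta> x)" if "x \<in> carrier ?F" for x
    unfolding \<beta>_def using pow_at[OF module_self that] by (intro lin_comb_lin[OF module_self fin]) auto
  have \<beta>s: "\<beta> x p = \<beta> p x" if "x \<in> carrier ?F" "p \<in> carrier ?F" for x p
  proof -
    have "(\<Oplus>k\<in>?S. p k \<otimes> x k) = (\<Oplus>k\<in>?S. x k \<otimes> p k)"
      using pow_at[OF module_self that(1)] pow_at[OF module_self that(2)] by (intro finsum_cong'[OF refl]) (auto simp: m_comm)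
    then show ?thesis by (simp add: \<beta>_def lin_comb_def)
  qed
  define h where "h x = (\<lambda>p\<in>carrier ?F. ?\<pi> (\<beta> x p))" for x
  have hH: "h x \<in> carrier ?H" if "x \<in> carrier ?F" for x
    unfolding h_def hom_mod_simps by (rule lin_restrict[OF lin_comp[OF \<beta>1[OF that] \<pi>] module_fr])
  have h: "lin ?F ?H h" unfolding lin_def
  proof (intro conjI ballI funcsetI)
    interpret P: module A ?F by (rule module_fr)
    fix x assume x: "x \<in> carrier ?F"
    show "h x \<in> carrier ?H" by (rule hH[OF x])
    have c: "\<beta> p x \<in> carrier (self_mod A)" if "p \<in> carrier ?F" for p by (rule lin_closed[OF \<beta>1[OF that] x])
    show "h (x \<oplus>\<^bsub>?F\<^esub> y) = h x \<oplus>\<^bsub>?H\<^esub> h y" if y: "y \<in> carrier ?F" for y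
    proof -
      have "?\<pi> (\<beta> (x \<oplus>\<^bsub>?F\<^esub> y) p) = ?\<pi> (\<beta> x p) \<oplus>\<^bsub>?k\<^esub> ?\<pi> (\<beta> y p)" if p: "p \<in> carrier ?F" for p
        unfolding \<beta>s[OF P.a_closed[OF x y] p] \<beta>s[OF x p] \<beta>s[OF y p] lin_add[OF \<beta>1[OF p] x y]
        by (rule lin_add[OF \<pi> c[OF p] lin_closed[OF \<beta>1[OF p] y]])
      then show ?thesis unfolding h_def hom_mod_simps by (intro restrict_ext) (simp del: pow_simps)
    qed
    show "h (a \<odot>\<^bsub>?F\<^esub> x) = a \<odot>\<^bsub>?H\<^esub> h x" if a: "a \<in> carrier A" for a
    proof -
      have "?\<pi> (\<beta> (a \<odot>\<^bsub>?F\<^esub> x) p) = a \<odot>\<^bsub>?k\<^esub> ?\<pi> (\<beta> x p)" if p: "p \<in> carrier ?F" for p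
        unfolding \<beta>s[OF P.smult_closed[OF a x] p] \<beta>s[OF x p] lin_smult[OF \<beta>1[OF p] a x]
        by (rule lin_smult[OF \<pi> a c[OF p]])
      then show ?thesis unfolding h_def hom_mod_simps by (intro restrict_ext) (simp del: pow_simps)
    qed
  qed
  have hu: "h x (unit_vec A s) = ?\<pi> (x s)" if x: "x \<in> carrier ?F" and s: "s \<in> ?S" for x s
    using lin_comb_unit[OF module_self fin _ s, of x] pow_at[OF module_self x] unit_vec_in[OF s] by (simp add: h_def \<beta>_def)
  let ?q = "\<lambda>f. {\<zero>\<^bsub>?H\<^esub>} +>\<^bsub>?H\<^esub> f"
  have e: "lin ?F ?V (\<lambda>x. ?q (h x))" by (rule lin_comp[OF h quot_proj_lin[OF H T]])
  have surj: "(\<lambda>x. ?q (h x)) ` carrier ?F = carrier ?V"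
  proof
    show "(\<lambda>x. ?q (h x)) ` carrier ?F \<subseteq> carrier ?V" using lin_closed[OF e] by blast
    show "carrier ?V \<subseteq> (\<lambda>x. ?q (h x)) ` carrier ?F"
    proof
      fix v assume "v \<in> carrier ?V"
      then obtain f where f: "f \<in> carrier ?H" "v = ?q f" unfolding quot_carrier by blast
      have fl: "lin ?F ?k f" using f(1) mod_hom_lin unfolding hom_mod_simps by blast
      have "\<forall>s\<in>?S. \<exists>a. a \<in> carrier A \<and> f (unit_vec A s) = ?\<pi> a"
        using lin_closed[OF fl unit_vec_in[of _ ?S]] unfolding residue_mod_def quot_carrier by auto
      from bchoice[OF this] obtain x where x: "\<forall>s\<in>?S. x s \<in> carrier A \<and> f (unit_vec A s) = ?\<pi> (x s)" ..
      define x' where "x' s = (if s \<in> ?S then x s else \<zero>)" for s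
      have x': "x' \<in> carrier ?F" using x by (simp add: x'_def pow_carrier)
      have hx: "lin ?F ?k (h x')" using hH[OF x'] mod_hom_lin unfolding hom_mod_simps by blast
      have "h x' p = f p" if "p \<in> carrier ?F" for p
        by (rule fr_lin_ext[OF fin residue_module hx fl _ that]) (use x hu[OF x'] in \<open>auto simp: x'_def\<close>)
      then have "h x' = f" using hH[OF x'] f(1) hom_ext unfolding hom_mod_simps by blast
      then show "v \<in> (\<lambda>x. ?q (h x)) ` carrier ?F" using x' f(2) by blast
    qed
  qed
  have ker: "x l \<in> \<mm>" if x: "x \<in> carrier ?F" and z: "?q (h x) = \<zero>\<^bsub>?V\<^esub>" for x l
  proof (cases "l \<in> ?S")
    case True
    have "h x = \<zero>\<^bsub>?H\<^esub>" using z rcos_zero_iff[OF H T hH[OF x]] unfolding quot_zero by blast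
    then have "h x (unit_vec A l) = \<zero>\<^bsub>?k\<^esub>" unfolding hom_mod_simps using unit_vec_in[OF True] by simp
    then have "?\<pi> (x l) = \<mm>" unfolding hu[OF x True] by (simp add: residue_mod_def quot_zero)
    then show ?thesis using rcos_zero_iff[OF module_self mm_sub pow_at[OF module_self x]] by blast
  next
    case False then show ?thesis using x mm_zero by (simp add: pow_carrier)
  qed
  have ker': "\<forall>x\<in>carrier ?F. ?q (h x) = \<zero>\<^bsub>?V\<^esub> \<longrightarrow> (\<forall>l. x l \<in> \<mm>)" using ker by blast
  show ?thesis unfolding betti_def E by (rule k_dim_eq[OF V qk fin e surj ker'])
qed

text \<open>For \<open>t\<close> = 0 the growth bound reads a / n, which is eventually less than
  one, and Betti numbers are natural numbers.\<close>

lemma cx_zero_finite: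
  assumes X: "fg_module A X" and c: "cx A X = 0"
  shows "\<exists>J. \<forall>j\<ge>J. res_idx X j = {}"
proof -
  let ?T = "{enat t | t. \<exists>a::real. \<forall>\<^sub>F n in sequentially. real (betti A X n) \<le> a * real n powr (real t - 1)}"
  have I: "Inf ?T = 0" using c by (simp add: cx_def)
  have "?T \<noteq> {}"
  proof
    assume "?T = {}"
    then have "Inf ?T = Inf {}" by (rule arg_cong)
    then have "Inf ?T = \<infinity>" by (simp add: Inf_enat_def)
    then show False using I by simp
  qed
  \<comment> \<open>A nonempty set of extended naturals attains its infimum, so the bound holds for
    \<open>t\<close> = 0 itself.\<close>
  then have "Inf ?T \<in> ?T" unfolding Inf_enat_def using LeastI[of "\<lambda>x. x \<in> ?T"] by auto
  then have "enat 0 \<in> ?T" using I by (simp add: zero_enat_def)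
  then obtain a :: real where "\<forall>\<^sub>F n in sequentially. real (betti A X n) \<le> a * real n powr (real 0 - 1)" by auto
  then obtain N where N: "\<And>n. n \<ge> N \<Longrightarrow> real (betti A X n) \<le> a * real n powr (real 0 - 1)"
    unfolding eventually_sequentially by blast
  obtain K :: nat where K: "a < real K" using reals_Archimedean2 by blast
  have "res_idx X j = {}" if j: "j \<ge> Suc (max N K)" for j
  proof -
    obtain i where i: "j = Suc i" using j by (cases j) auto
    have pos: "real j > 0" using i by simp
    have "real (betti A X j) \<le> a * real j powr (real 0 - 1)" using N j by simp
    also have "\<dots> = a / real j" using pos by (simp add: powr_minus divide_inverse)
    also have "\<dots> < 1" using K j pos by simp
    finally have "betti A X j = 0" by simp
    then have "card (res_idx X j) = 0" using betti_rank[OF X, of i] i by simp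
    then show ?thesis by (simp add: res_idx_def)
  qed
  then show ?thesis by blast
qed

text \<open>The length is the last degree of nonzero rank; such a degree exists because rank zero in
  degree 0 would force \<open>X\<close> to vanish.\<close>

lemma cx_zero_min_cx:
  assumes X: "fg_module A X" and nz: "\<not> is_zero_mod X" and c: "cx A X = 0"
  shows "\<exists>g. min_cx (res_idx X) (res_d X) g"
proof -
  obtain J where J: "\<And>j. j \<ge> J \<Longrightarrow> res_idx X j = {}" using cx_zero_finite[OF X c] by blast
  have XM: "module A X" by (rule fg_module_D[OF X])
  obtain e where e: "lin (fr (res_idx X 0)) X e" "e ` carrier (fr (res_idx X 0)) = carrier X" using min_res_props(1)[OF X] by blast
  have S0: "res_idx X 0 \<noteq> {}"
  proof
    assume S: "res_idx X 0 = {}"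
    have "carrier (fr (res_idx X 0)) = {\<zero>\<^bsub>fr (res_idx X 0)\<^esub>}" unfolding S by (auto simp: pow_carrier)
    then have "carrier X = {\<zero>\<^bsub>X\<^esub>}" using e(2) lin_zero[OF e(1) module_fr XM] by auto
    then show False using nz by (simp add: is_zero_mod_def)
  qed
  let ?G = "{j. res_idx X j \<noteq> {}}"
  have fin: "finite ?G" by (rule finite_subset[of _ "{..<J}"]) (use J not_le in auto)
  have "Max ?G \<in> ?G" by (rule Max_in[OF fin]) (use S0 in blast)
  moreover have "res_idx X j = {}" if "j > Max ?G" for j using Max_ge[OF fin, of j] that by fastforce
  ultimately have "min_cx (res_idx X) (res_d X) (Max ?G)" unfolding min_cx_def using min_res_props(2,4)[OF X] by blast
  then show ?thesis by blast
qed

subsection \<open>Comparison of resolutions\<close>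

text \<open>If \<open>S\<close> and \<open>D\<close> form a free resolution of \<open>X\<close>, this says \<open>Tor\<^sub>j\<^sub>+\<^sub>1(X, N) = 0\<close>; note the shift.\<close>

definition tor_exact :: "('a, 'n) module \<Rightarrow> (nat \<Rightarrow> 's set) \<Rightarrow> (nat \<Rightarrow> ('s \<Rightarrow> 'a) \<Rightarrow> ('s \<Rightarrow> 'a)) \<Rightarrow> nat \<Rightarrow> bool" where
  "tor_exact N S D j \<longleftrightarrow> (\<forall>z\<in>carrier (pow_mod N (S (Suc j))). act N (S (Suc j)) (D j) z = (\<lambda>_. \<zero>\<^bsub>N\<^esub>) \<longrightarrow>
     (\<exists>w\<in>carrier (pow_mod N (S (Suc (Suc j)))). z = act N (S (Suc (Suc j))) (D (Suc j)) w))"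

lemma tor_exact_self:
  assumes F: "free_cx S D"
  shows "tor_exact (self_mod A) S D j \<longleftrightarrow>
    (\<forall>z\<in>carrier (fr (S (Suc j))). D j z = (\<lambda>_. \<zero>) \<longrightarrow> (\<exists>w\<in>carrier (fr (S (Suc (Suc j)))). z = D (Suc j) w))"
  unfolding tor_exact_def using act_self[OF free_cx_D(1)[OF F] free_cx_D(2)[OF F]] by simp

lemma tor_exact_exact_mod:
  assumes F: "free_cx S D" and N: "module A N"
  shows "tor_exact N S D j \<longleftrightarrow> exact_mod N {\<zero>\<^bsub>N\<^esub>} S D j"
proof -
  note fin = free_cx_D(1)[OF F] and L = free_cx_D(2)[OF F]
  have pw0: "v \<in> pow_sub N {\<zero>\<^bsub>N\<^esub>} T \<longleftrightarrow> v = (\<lambda>_. \<zero>\<^bsub>N\<^esub>)" for T :: "'s set" and v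
  proof -
    interpret N: module A N by fact
    show ?thesis by (auto simp: pow_sub_def pow_carrier)
  qed
  have eq: "z \<ominus>\<^bsub>pow_mod N T\<^esub> w = (\<lambda>_. \<zero>\<^bsub>N\<^esub>) \<longleftrightarrow> z = w"
    if z: "z \<in> carrier (pow_mod N T)" and w: "w \<in> carrier (pow_mod N T)" for z w and T :: "'s set"
  proof -
    interpret P: module A "pow_mod N T" by (rule module_pow[OF N])
    have "z \<ominus>\<^bsub>pow_mod N T\<^esub> w = \<zero>\<^bsub>pow_mod N T\<^esub> \<longleftrightarrow> z = w"
      using minus_add_cancel[OF P.module_axioms z w] z w by (metis P.l_zero P.r_neg a_minus_def)
    then show ?thesis by simp
  qed
  have c: "act N (S (Suc j)) (D j) w \<in> carrier (pow_mod N (S j))" if "w \<in> carrier (pow_mod N (S (Suc j)))" for w j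
    by (rule lin_closed[OF act_lin[OF N fin L] that])
  have E: "z \<ominus>\<^bsub>pow_mod N (S (Suc j))\<^esub> act N (S (Suc (Suc j))) (D (Suc j)) w = (\<lambda>_. \<zero>\<^bsub>N\<^esub>) \<longleftrightarrow>
      z = act N (S (Suc (Suc j))) (D (Suc j)) w"
    if "z \<in> carrier (pow_mod N (S (Suc j)))" "w \<in> carrier (pow_mod N (S (Suc (Suc j))))" for z w
    by (rule eq[OF that(1) c[OF that(2)]])
  show ?thesis unfolding tor_exact_def exact_mod_def rel_exact_def rel_bd_def pw0 by (simp add: E cong: ball_cong bex_cong)
qed

text \<open>Exactness in positive degrees is put as vanishing of homology with coefficients in A, so
  that results on \<open>tor_exact\<close> also serve to produce resolutions.\<close>

definition free_resol :: "(nat \<Rightarrow> 's set) \<Rightarrow> (nat \<Rightarrow> ('s \<Rightarrow> 'a) \<Rightarrow> ('s \<Rightarrow> 'a)) \<Rightarrow> ('a, 'y) module \<Rightarrow> (('s \<Rightarrow> 'a) \<Rightarrow> 'y) \<Rightarrow> bool" where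
  "free_resol S D Y e \<longleftrightarrow> free_cx S D \<and> module A Y \<and> lin (fr (S 0)) Y e \<and> e ` carrier (fr (S 0)) = carrier Y \<and>
     (\<forall>z\<in>carrier (fr (S 0)). e z = \<zero>\<^bsub>Y\<^esub> \<longleftrightarrow> (\<exists>w\<in>carrier (fr (S (Suc 0))). z = D 0 w)) \<and>
     (\<forall>j. tor_exact (self_mod A) S D j)"

lemma free_resolD:
  assumes "free_resol S D Y e"
  shows "free_cx S D" "module A Y" "lin (fr (S 0)) Y e" "e ` carrier (fr (S 0)) = carrier Y"
    "z \<in> carrier (fr (S 0)) \<Longrightarrow> e z = \<zero>\<^bsub>Y\<^esub> \<Longrightarrow> \<exists>w\<in>carrier (fr (S (Suc 0))). D 0 w = z"
    "w \<in> carrier (fr (S (Suc 0))) \<Longrightarrow> e (D 0 w) = \<zero>\<^bsub>Y\<^esub>"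
    "z \<in> carrier (fr (S (Suc j))) \<Longrightarrow> D j z = (\<lambda>_. \<zero>) \<Longrightarrow> \<exists>w\<in>carrier (fr (S (Suc (Suc j)))). D (Suc j) w = z"
proof -
  show F: "free_cx S D" "module A Y" "lin (fr (S 0)) Y e" "e ` carrier (fr (S 0)) = carrier Y"
    using assms unfolding free_resol_def by blast+
  show "\<exists>w\<in>carrier (fr (S (Suc 0))). D 0 w = z" if "z \<in> carrier (fr (S 0))" "e z = \<zero>\<^bsub>Y\<^esub>"
    using assms that unfolding free_resol_def by metis
  show "e (D 0 w) = \<zero>\<^bsub>Y\<^esub>" if "w \<in> carrier (fr (S (Suc 0)))"
    using assms that lin_closed[OF free_cx_D(2)[OF F(1)] that] unfolding free_resol_def by blast
  show "\<exists>w\<in>carrier (fr (S (Suc (Suc j)))). D (Suc j) w = z" if "z \<in> carrier (fr (S (Suc j)))" "D j z = (\<lambda>_. \<zero>)"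
  proof -
    have "tor_exact (self_mod A) S D j" using assms unfolding free_resol_def by blast
    then show ?thesis unfolding tor_exact_self[OF F(1)] using that by metis
  qed
qed

lemma min_res_free_resol:
  assumes X: "fg_module A X" shows "\<exists>e. free_resol (res_idx X) (res_d X) X e"
proof -
  obtain e where e: "lin (fr (res_idx X 0)) X e" "e ` carrier (fr (res_idx X 0)) = carrier X"
     "a_kernel (fr (res_idx X 0)) X e = res_d X 0 ` carrier (fr (res_idx X (Suc 0)))" using min_res_props(1)[OF X] by blast
  note F = min_res_props(2)[OF X] and k = min_res_props(3)[OF X]
  have "tor_exact (self_mod A) (res_idx X) (res_d X) j" for j
    unfolding tor_exact_self[OF F]
  proof (intro ballI impI)
    fix z assume "z \<in> carrier (fr (res_idx X (Suc j)))" "res_d X j z = (\<lambda>_. \<zero>)"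
    then have "z \<in> a_kernel (fr (res_idx X (Suc j))) (fr (res_idx X j)) (res_d X j)" by (simp add: a_kernel_def')
    then show "\<exists>w\<in>carrier (fr (res_idx X (Suc (Suc j)))). z = res_d X (Suc j) w" unfolding k by blast
  qed
  moreover have "e z = \<zero>\<^bsub>X\<^esub> \<longleftrightarrow> (\<exists>w\<in>carrier (fr (res_idx X (Suc 0))). z = res_d X 0 w)" if "z \<in> carrier (fr (res_idx X 0))" for z
  proof -
    have "e z = \<zero>\<^bsub>X\<^esub> \<longleftrightarrow> z \<in> a_kernel (fr (res_idx X 0)) X e" using that by (simp add: a_kernel_def')
    then show ?thesis unfolding e(3) by blast
  qed
  ultimately show ?thesis unfolding free_resol_def using F e(1,2) fg_module_D[OF X] by blast
qed

lemma lift_map: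
  assumes S: "finite S" and P: "module A P" and u: "lin (fr S) P u" and Q: "module A Q" and g: "lin Q P g"
    and im: "\<And>x. x \<in> carrier (fr S) \<Longrightarrow> \<exists>y\<in>carrier Q. g y = u x"
  shows "\<exists>h. lin (fr S) Q h \<and> (\<forall>x\<in>carrier (fr S). g (h x) = u x)"
  by (rule lift_through[OF S P u Q g im[OF unit_vec_in]])

text \<open>The source is any complex of free modules with an augmentation killing boundaries;
  exactness is asked of the target alone. This covers the tail of a resolution augmented by a
  cocycle.\<close>

lemma chain_map_exists:
  assumes F: "free_cx S D" and \<epsilon>: "lin (fr (S 0)) Y \<epsilon>" "\<And>x. x \<in> carrier (fr (S (Suc 0))) \<Longrightarrow> \<epsilon> (D 0 x) = \<zero>\<^bsub>Y\<^esub>"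
    and R: "free_resol S' D' Y e"
  shows "\<exists>\<alpha>. (\<forall>j. lin (fr (S j)) (fr (S' j)) (\<alpha> j)) \<and> (\<forall>x\<in>carrier (fr (S 0)). e (\<alpha> 0 x) = \<epsilon> x) \<and>
     (\<forall>j. \<forall>x\<in>carrier (fr (S (Suc j))). D' j (\<alpha> (Suc j) x) = \<alpha> j (D j x))"
proof -
  note fin = free_cx_D(1)[OF F] and L = free_cx_D(2)[OF F] and DD = free_cx_D(3)[OF F]
  note r = free_resolD[OF R]
  note L' = free_cx_D(2)[OF r(1)]
  \<comment> \<open>\<open>P\<close> records that the next lifting problem is solvable, which
    dependent choice has to carry along.\<close>
  define P where "P = (\<lambda>n a. lin (fr (S n)) (fr (S' n)) a \<and>
     (\<forall>x\<in>carrier (fr (S (Suc n))). \<exists>y\<in>carrier (fr (S' (Suc n))). D' n y = a (D n x)) \<and>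
     (n = 0 \<longrightarrow> (\<forall>x\<in>carrier (fr (S 0)). e (a x) = \<epsilon> x)))"
  define Q where "Q = (\<lambda>n a b. \<forall>x\<in>carrier (fr (S (Suc n))). D' n (b x) = a (D n x))"
  have "\<exists>a. P 0 a"
  proof -
    have "\<exists>y\<in>carrier (fr (S' 0)). e y = \<epsilon> x" if x: "x \<in> carrier (fr (S 0))" for x
    proof -
      have "\<epsilon> x \<in> e ` carrier (fr (S' 0))" unfolding r(4) by (rule lin_closed[OF \<epsilon>(1) x])
      then show ?thesis by (metis imageE)
    qed
    from lift_map[OF fin r(2) \<epsilon>(1) module_fr r(3) this]
    obtain a where a: "lin (fr (S 0)) (fr (S' 0)) a" "\<forall>x\<in>carrier (fr (S 0)). e (a x) = \<epsilon> x" by blast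
    have "\<exists>y\<in>carrier (fr (S' (Suc 0))). D' 0 y = a (D 0 x)" if x: "x \<in> carrier (fr (S (Suc 0)))" for x
    proof (rule r(5))
      have res_d: "D 0 x \<in> carrier (fr (S 0))" by (rule lin_closed[OF L x])
      show "a (D 0 x) \<in> carrier (fr (S' 0))" by (rule lin_closed[OF a(1) res_d])
      show "e (a (D 0 x)) = \<zero>\<^bsub>Y\<^esub>" using a(2) res_d \<epsilon>(2)[OF x] by simp
    qed
    then have "P 0 a" unfolding P_def using a by blast
    then show ?thesis by blast
  qed
  moreover have "\<exists>b. P (Suc n) b \<and> Q n a b" if Pa: "P n a" for a n
  proof -
    have a: "lin (fr (S n)) (fr (S' n)) a" "\<And>x. x \<in> carrier (fr (S (Suc n))) \<Longrightarrow> \<exists>y\<in>carrier (fr (S' (Suc n))). D' n y = a (D n x)"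
      using Pa unfolding P_def by blast+
    from lift_map[OF fin module_fr lin_comp[OF L a(1)] module_fr L' a(2)]
    obtain b where b: "lin (fr (S (Suc n))) (fr (S' (Suc n))) b" "\<forall>x\<in>carrier (fr (S (Suc n))). D' n (b x) = a (D n x)" by blast
    have "\<exists>y\<in>carrier (fr (S' (Suc (Suc n)))). D' (Suc n) y = b (D (Suc n) x)" if x: "x \<in> carrier (fr (S (Suc (Suc n))))" for x
    proof (rule r(7))
      have res_d: "D (Suc n) x \<in> carrier (fr (S (Suc n)))" by (rule lin_closed[OF L x])
      show "b (D (Suc n) x) \<in> carrier (fr (S' (Suc n)))" by (rule lin_closed[OF b(1) res_d])
      have "D' n (b (D (Suc n) x)) = a (\<lambda>_. \<zero>)" using b(2) res_d DD[OF x] by simp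
      also have "\<dots> = (\<lambda>_. \<zero>)" using lin_zero[OF a(1) module_fr module_fr] by simp
      finally show "D' n (b (D (Suc n) x)) = (\<lambda>_. \<zero>)" .
    qed
    then show ?thesis unfolding P_def Q_def using b by blast
  qed
  ultimately obtain \<alpha> where \<alpha>: "\<And>n. P n (\<alpha> n)" "\<And>n. Q n (\<alpha> n) (\<alpha> (Suc n))"
    using dependent_nat_choice[of P Q] by blast
  show ?thesis using \<alpha> unfolding P_def Q_def by (intro exI[of _ \<alpha>]) blast
qed

text \<open>At each stage \<gamma> - h d is a cycle by the previous stage, and so lifts along
  \<open>D'\<close>. The homotopy identity is recorded in positive degrees, those that
  \<open>tor_exact\<close> speaks of.\<close>

lemma null_homotopy_exists:
  assumes F: "free_cx S D" and R: "free_resol S' D' Y e" and \<gamma>: "\<And>j. lin (fr (S j)) (fr (S' j)) (\<gamma> j)"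
    "\<And>x. x \<in> carrier (fr (S 0)) \<Longrightarrow> e (\<gamma> 0 x) = \<zero>\<^bsub>Y\<^esub>"
    "\<And>j x. x \<in> carrier (fr (S (Suc j))) \<Longrightarrow> D' j (\<gamma> (Suc j) x) = \<gamma> j (D j x)"
  shows "\<exists>h. (\<forall>j. lin (fr (S j)) (fr (S' (Suc j))) (h j)) \<and>
     (\<forall>j. \<forall>x\<in>carrier (fr (S (Suc j))). D' (Suc j) (h (Suc j) x) = \<gamma> (Suc j) x \<ominus>\<^bsub>fr (S' (Suc j))\<^esub> h j (D j x))"
proof -
  note fin = free_cx_D(1)[OF F] and L = free_cx_D(2)[OF F] and DD = free_cx_D(3)[OF F]
  note r = free_resolD[OF R]
  note L' = free_cx_D(2)[OF r(1)]
  define P where "P = (\<lambda>n h. lin (fr (S n)) (fr (S' (Suc n))) h \<and>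
     (\<forall>x\<in>carrier (fr (S (Suc n))). D' n (h (D n x)) = \<gamma> n (D n x)))"
  define Q where "Q = (\<lambda>n h h'. \<forall>x\<in>carrier (fr (S (Suc n))). D' (Suc n) (h' x) = \<gamma> (Suc n) x \<ominus>\<^bsub>fr (S' (Suc n))\<^esub> h (D n x))"
  have "\<exists>h. P 0 h"
  proof -
    have "\<exists>y\<in>carrier (fr (S' (Suc 0))). D' 0 y = \<gamma> 0 x" if x: "x \<in> carrier (fr (S 0))" for x
      by (rule r(5)[OF lin_closed[OF \<gamma>(1) x] \<gamma>(2)[OF x]])
    from lift_map[OF fin module_fr \<gamma>(1) module_fr L' this]
    obtain h where h: "lin (fr (S 0)) (fr (S' (Suc 0))) h" "\<forall>x\<in>carrier (fr (S 0)). D' 0 (h x) = \<gamma> 0 x" by blast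
    then have "P 0 h" unfolding P_def using lin_closed[OF L] by blast
    then show ?thesis by blast
  qed
  moreover have "\<exists>h'. P (Suc n) h' \<and> Q n h h'" if Ph: "P n h" for h n
  proof -
    let ?G = "fr (S' (Suc n))"
    interpret G: module A ?G by (rule module_fr)
    have h: "lin (fr (S n)) ?G h" "\<And>x. x \<in> carrier (fr (S (Suc n))) \<Longrightarrow> D' n (h (D n x)) = \<gamma> n (D n x)"
      using Ph unfolding P_def by blast+
    let ?u = "\<lambda>x. \<gamma> (Suc n) x \<ominus>\<^bsub>?G\<^esub> h (D n x)"
    have u: "lin (fr (S (Suc n))) ?G ?u"
      unfolding a_minus_def by (intro lin_plus \<gamma>(1) lin_uminus lin_comp[OF L h(1)] module_fr)
    have "\<exists>y\<in>carrier (fr (S' (Suc (Suc n)))). D' (Suc n) y = ?u x" if x: "x \<in> carrier (fr (S (Suc n)))" for x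
    proof (rule r(7)[OF lin_closed[OF u x]])
      interpret K: module A "fr (S' n)" by (rule module_fr)
      have res_d: "D n x \<in> carrier (fr (S n))" by (rule lin_closed[OF L x])
      have "D' n (?u x) = D' n (\<gamma> (Suc n) x) \<ominus>\<^bsub>fr (S' n)\<^esub> D' n (h (D n x))"
        by (rule lin_minus[OF L' module_fr module_fr lin_closed[OF \<gamma>(1) x] lin_closed[OF h(1) res_d]])
      also have "\<dots> = \<zero>\<^bsub>fr (S' n)\<^esub>"
        unfolding \<gamma>(3)[OF x] h(2)[OF x] a_minus_def by (rule K.r_neg[OF lin_closed[OF \<gamma>(1) res_d]])
      finally show "D' n (?u x) = (\<lambda>_. \<zero>)" by simp
    qed
    from lift_map[OF fin module_fr u module_fr L' this]
    obtain h' where h': "lin (fr (S (Suc n))) (fr (S' (Suc (Suc n)))) h'" "\<forall>x\<in>carrier (fr (S (Suc n))). D' (Suc n) (h' x) = ?u x" by blast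
    have "D' (Suc n) (h' (D (Suc n) x)) = \<gamma> (Suc n) (D (Suc n) x)" if x: "x \<in> carrier (fr (S (Suc (Suc n))))" for x
    proof -
      have res_d: "D (Suc n) x \<in> carrier (fr (S (Suc n)))" by (rule lin_closed[OF L x])
      have "h (D n (D (Suc n) x)) = \<zero>\<^bsub>?G\<^esub>" using DD[OF x] lin_zero[OF h(1) module_fr module_fr] by simp
      then have "D' (Suc n) (h' (D (Suc n) x)) = \<gamma> (Suc n) (D (Suc n) x) \<ominus>\<^bsub>?G\<^esub> \<zero>\<^bsub>?G\<^esub>" using h'(2) res_d by (simp del: pow_simps)
      then show ?thesis using minus_zero_right[OF module_fr lin_closed[OF \<gamma>(1) res_d]] by (simp only:)
    qed
    then have "P (Suc n) h' \<and> Q n h h'" unfolding P_def Q_def using h' by blast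
    then show ?thesis by blast
  qed
  ultimately obtain h where h: "\<And>n. P n (h n)" "\<And>n. Q n (h n) (h (Suc n))"
    using dependent_nat_choice[of P Q] by blast
  show ?thesis using h unfolding P_def Q_def by (intro exI[of _ h]) blast
qed

text \<open>The composite of the comparison maps is homotopic to the identity, and the homotopy
  survives tensoring with \<open>N\<close>: if \<open>w\<close> bounds the image of a cycle
  \<open>z\<close>, then \<open>z\<close> is the boundary of \<beta> w - h z. This carries vanishing
  between the cone, which need not be minimal, and the chosen minimal resolution.\<close>

lemma tor_exact_independent:
  assumes R: "free_resol S D Y e" and R': "free_resol S' D' Y e'" and N: "module A N" and ex: "tor_exact N S D j"
  shows "tor_exact N S' D' j"
proof -
  note r = free_resolD[OF R] and r' = free_resolD[OF R']
  note fin = free_cx_D(1)[OF r(1)] and L = free_cx_D(2)[OF r(1)]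
  note fin' = free_cx_D(1)[OF r'(1)] and L' = free_cx_D(2)[OF r'(1)] and DD' = free_cx_D(3)[OF r'(1)]
  from chain_map_exists[OF r'(1) r'(3,6) R] obtain \<alpha> where \<alpha>: "\<And>j. lin (fr (S' j)) (fr (S j)) (\<alpha> j)"
    "\<And>x. x\<in>carrier (fr (S' 0)) \<Longrightarrow> e (\<alpha> 0 x) = e' x" "\<And>j x. x\<in>carrier (fr (S' (Suc j))) \<Longrightarrow> D j (\<alpha> (Suc j) x) = \<alpha> j (D' j x)"
    by blast
  from chain_map_exists[OF r(1) r(3,6) R'] obtain \<beta> where \<beta>: "\<And>j. lin (fr (S j)) (fr (S' j)) (\<beta> j)"
    "\<And>x. x\<in>carrier (fr (S 0)) \<Longrightarrow> e' (\<beta> 0 x) = e x" "\<And>j x. x\<in>carrier (fr (S (Suc j))) \<Longrightarrow> D' j (\<beta> (Suc j) x) = \<beta> j (D j x)"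
    by blast
  define \<gamma> where "\<gamma> j x = \<beta> j (\<alpha> j x) \<ominus>\<^bsub>fr (S' j)\<^esub> x" for j x
  have \<gamma>: "lin (fr (S' j)) (fr (S' j)) (\<gamma> j)" for j
    unfolding \<gamma>_def a_minus_def by (intro lin_plus lin_uminus lin_comp[OF \<alpha>(1) \<beta>(1)] lin_id module_fr)
  have \<gamma>0: "e' (\<gamma> 0 x) = \<zero>\<^bsub>Y\<^esub>" if x: "x \<in> carrier (fr (S' 0))" for x
  proof -
    interpret Y: module A Y by (rule r(2))
    have ax: "\<alpha> 0 x \<in> carrier (fr (S 0))" by (rule lin_closed[OF \<alpha>(1) x])
    have "e' (\<gamma> 0 x) = e' (\<beta> 0 (\<alpha> 0 x)) \<ominus>\<^bsub>Y\<^esub> e' x"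
      unfolding \<gamma>_def by (rule lin_minus[OF r'(3) module_fr r(2) lin_closed[OF \<beta>(1) ax] x])
    then show ?thesis using \<beta>(2)[OF ax] \<alpha>(2)[OF x] Y.r_neg[OF lin_closed[OF r'(3) x]] by (simp add: a_minus_def)
  qed
  have \<gamma>D: "D' j (\<gamma> (Suc j) x) = \<gamma> j (D' j x)" if x: "x \<in> carrier (fr (S' (Suc j)))" for j x
  proof -
    have ax: "\<alpha> (Suc j) x \<in> carrier (fr (S (Suc j)))" by (rule lin_closed[OF \<alpha>(1) x])
    have "D' j (\<gamma> (Suc j) x) = D' j (\<beta> (Suc j) (\<alpha> (Suc j) x)) \<ominus>\<^bsub>fr (S' j)\<^esub> D' j x"
      unfolding \<gamma>_def by (rule lin_minus[OF L' module_fr module_fr lin_closed[OF \<beta>(1) ax] x])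
    then show ?thesis using \<beta>(3)[OF ax] \<alpha>(3)[OF x] by (simp add: \<gamma>_def)
  qed
  from null_homotopy_exists[OF r'(1) R' \<gamma> \<gamma>0 \<gamma>D] obtain h where h: "\<And>j. lin (fr (S' j)) (fr (S' (Suc j))) (h j)"
    "\<And>j x. x\<in>carrier (fr (S' (Suc j))) \<Longrightarrow> D' (Suc j) (h (Suc j) x) = \<gamma> (Suc j) x \<ominus>\<^bsub>fr (S' (Suc j))\<^esub> h j (D' j x)" by blast
  let ?F' = "fr (S' (Suc j))"
  interpret F': module A ?F' by (rule module_fr)
  have ba: "\<beta> (Suc j) (\<alpha> (Suc j) x) = (D' (Suc j) (h (Suc j) x) \<oplus>\<^bsub>?F'\<^esub> h j (D' j x)) \<oplus>\<^bsub>?F'\<^esub> x"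
    if x: "x \<in> carrier ?F'" for x
  proof -
    have c: "\<beta> (Suc j) (\<alpha> (Suc j) x) \<in> carrier ?F'" by (rule lin_closed[OF \<beta>(1) lin_closed[OF \<alpha>(1) x]])
    have c2: "h j (D' j x) \<in> carrier ?F'" by (rule lin_closed[OF h(1) lin_closed[OF L' x]])
    show ?thesis unfolding h(2)[OF x] minus_add_cancel[OF module_fr lin_closed[OF \<gamma> x] c2] unfolding \<gamma>_def
      by (rule minus_add_cancel[OF module_fr c x, symmetric])
  qed
  show ?thesis unfolding tor_exact_def
  proof (intro ballI impI)
    let ?P = "pow_mod N (S' (Suc j))"
    interpret P: module A ?P by (rule module_pow[OF N])
    fix z assume z: "z \<in> carrier ?P" and z0: "act N (S' (Suc j)) (D' j) z = (\<lambda>_. \<zero>\<^bsub>N\<^esub>)"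
    note c = act_comp[OF N]
    let ?az = "act N (S' (Suc j)) (\<alpha> (Suc j)) z"
    have az: "?az \<in> carrier (pow_mod N (S (Suc j)))" by (rule lin_closed[OF act_lin[OF N fin' \<alpha>(1)] z])
    have "act N (S (Suc j)) (D j) ?az = act N (S' (Suc j)) (\<lambda>x. D j (\<alpha> (Suc j) x)) z"
      by (rule c[OF fin' fin \<alpha>(1) L z, symmetric])
    also have "\<dots> = act N (S' (Suc j)) (\<lambda>x. \<alpha> j (D' j x)) z"
      by (rule act_cong[OF N lin_comp[OF \<alpha>(1) L] \<alpha>(3) z])
    also have "\<dots> = act N (S' j) (\<alpha> j) (act N (S' (Suc j)) (D' j) z)" by (rule c[OF fin' fin' L' \<alpha>(1) z])
    also have "\<dots> = (\<lambda>_. \<zero>\<^bsub>N\<^esub>)" unfolding z0 using lin_zero[OF act_lin[OF N fin' \<alpha>(1)] module_pow[OF N] module_pow[OF N]] by simp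
    finally obtain w where w: "w \<in> carrier (pow_mod N (S (Suc (Suc j))))" "?az = act N (S (Suc (Suc j))) (D (Suc j)) w"
      using ex az unfolding tor_exact_def by blast
    let ?bw = "act N (S (Suc (Suc j))) (\<beta> (Suc (Suc j))) w"
    let ?hz = "act N (S' (Suc j)) (h (Suc j)) z"
    let ?D = "act N (S' (Suc (Suc j))) (D' (Suc j))"
    have Dl: "lin (pow_mod N (S' (Suc (Suc j)))) ?P ?D" by (rule act_lin[OF N fin' L'])
    have bw: "?bw \<in> carrier (pow_mod N (S' (Suc (Suc j))))" by (rule lin_closed[OF act_lin[OF N fin \<beta>(1)] w(1)])
    have hz: "?hz \<in> carrier (pow_mod N (S' (Suc (Suc j))))" by (rule lin_closed[OF act_lin[OF N fin' h(1)] z])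
    have "act N (S' (Suc j)) (\<lambda>x. \<beta> (Suc j) (\<alpha> (Suc j) x)) z = act N (S (Suc j)) (\<beta> (Suc j)) ?az"
      by (rule c[OF fin' fin \<alpha>(1) \<beta>(1) z])
    also have "\<dots> = act N (S (Suc (Suc j))) (\<lambda>x. \<beta> (Suc j) (D (Suc j) x)) w"
      unfolding w(2) by (rule c[OF fin fin L \<beta>(1) w(1), symmetric])
    also have "\<dots> = act N (S (Suc (Suc j))) (\<lambda>x. D' (Suc j) (\<beta> (Suc (Suc j)) x)) w"
      by (rule act_cong[OF N lin_comp[OF L \<beta>(1)] \<beta>(3)[symmetric] w(1)])
    also have "\<dots> = ?D ?bw" by (rule c[OF fin fin' \<beta>(1) L' w(1)])
    finally have 1: "act N (S' (Suc j)) (\<lambda>x. \<beta> (Suc j) (\<alpha> (Suc j) x)) z = ?D ?bw" .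
    note l1 = lin_comp[OF h(1)[of "Suc j"] L'[of "Suc j"]] and l2 = lin_comp[OF L'[of j] h(1)[of j]]
    have "act N (S' (Suc j)) (\<lambda>x. \<beta> (Suc j) (\<alpha> (Suc j) x)) z =
      act N (S' (Suc j)) (\<lambda>x. (D' (Suc j) (h (Suc j) x) \<oplus>\<^bsub>?F'\<^esub> h j (D' j x)) \<oplus>\<^bsub>?F'\<^esub> x) z"
      by (rule act_cong[OF N lin_comp[OF \<alpha>(1) \<beta>(1)] ba z])
    also have "\<dots> = act N (S' (Suc j)) (\<lambda>x. D' (Suc j) (h (Suc j) x) \<oplus>\<^bsub>?F'\<^esub> h j (D' j x)) z \<oplus>\<^bsub>?P\<^esub> act N (S' (Suc j)) (\<lambda>x. x) z"
      by (rule act_plus[OF N fin' lin_plus[OF l1 l2 module_fr module_fr] lin_id z])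
    also have "act N (S' (Suc j)) (\<lambda>x. x) z = z" by (rule act_id[OF N fin' z])
    also have "act N (S' (Suc j)) (\<lambda>x. D' (Suc j) (h (Suc j) x) \<oplus>\<^bsub>?F'\<^esub> h j (D' j x)) z =
      act N (S' (Suc j)) (\<lambda>x. D' (Suc j) (h (Suc j) x)) z \<oplus>\<^bsub>?P\<^esub> act N (S' (Suc j)) (\<lambda>x. h j (D' j x)) z"
      by (rule act_plus[OF N fin' l1 l2 z])
    also have "act N (S' (Suc j)) (\<lambda>x. D' (Suc j) (h (Suc j) x)) z = ?D ?hz" by (rule c[OF fin' fin' h(1) L' z])
    also have "act N (S' (Suc j)) (\<lambda>x. h j (D' j x)) z = act N (S' j) (h j) (act N (S' (Suc j)) (D' j) z)"
      by (rule c[OF fin' fin' L' h(1) z])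
    also have "\<dots> = \<zero>\<^bsub>?P\<^esub>" unfolding z0 using lin_zero[OF act_lin[OF N fin' h(1)] module_pow[OF N] module_pow[OF N]] by simp
    finally have 2: "?D ?bw = ?D ?hz \<oplus>\<^bsub>?P\<^esub> \<zero>\<^bsub>?P\<^esub> \<oplus>\<^bsub>?P\<^esub> z" unfolding 1 .
    have Dh: "?D ?hz \<in> carrier ?P" by (rule lin_closed[OF Dl hz])
    interpret P': module A "pow_mod N (S' (Suc (Suc j)))" by (rule module_pow[OF N])
    have "?D (?bw \<ominus>\<^bsub>pow_mod N (S' (Suc (Suc j)))\<^esub> ?hz) = ?D ?bw \<ominus>\<^bsub>?P\<^esub> ?D ?hz"
      by (rule lin_minus[OF Dl module_pow[OF N] module_pow[OF N] bw hz])
    also have "\<dots> = z" unfolding 2 using Dh z by (simp add: a_minus_def P.a_ac P.r_neg P.r_neg1 P.r_neg2 add_cancel[OF module_pow[OF N]] del: pow_simps)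
    finally have "z = ?D (?bw \<ominus>\<^bsub>pow_mod N (S' (Suc (Suc j)))\<^esub> ?hz)" by simp
    then show "\<exists>w\<in>carrier (pow_mod N (S' (Suc (Suc j)))). z = ?D w" using P'.minus_closed[OF bw hz] by blast
  qed
qed

subsection \<open>Mapping cones and the modules \<open>K\<^sub>\<eta>\<close>\<close>

text \<open>A direct sum of free modules is free on the disjoint union of the bases; hence the cone
  is again a complex of the form used throughout, now on a sum type.\<close>

abbreviation dsum_set :: "'s set \<Rightarrow> 't set \<Rightarrow> ('s + 't) set" (infixr "\<uplus>" 65) where
  "S \<uplus> T \<equiv> Sum_Type.Plus S T"

lemma pow_plus_iff:
  "v \<in> carrier (pow_mod N (S \<uplus> T)) \<longleftrightarrow> v \<circ> Inl \<in> carrier (pow_mod N S) \<and> v \<circ> Inr \<in> carrier (pow_mod N T)"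
proof
  assume v: "v \<in> carrier (pow_mod N (S \<uplus> T))"
  show "v \<circ> Inl \<in> carrier (pow_mod N S) \<and> v \<circ> Inr \<in> carrier (pow_mod N T)"
    using v unfolding pow_carrier by (auto simp: Plus_def)
next
  assume v: "v \<circ> Inl \<in> carrier (pow_mod N S) \<and> v \<circ> Inr \<in> carrier (pow_mod N T)"
  show "v \<in> carrier (pow_mod N (S \<uplus> T))" unfolding pow_carrier
  proof (intro conjI ballI allI impI)
    fix s assume "s \<in> S \<uplus> T" then show "v s \<in> carrier N" using v unfolding pow_carrier by auto
  next
    fix s assume "s \<notin> S \<uplus> T" then show "v s = \<zero>\<^bsub>N\<^esub>" using v unfolding pow_carrier by (cases s) auto
  qed
qed

lemma lin_inl: "lin (pow_mod N (S \<uplus> T)) (pow_mod N S) (\<lambda>v. v \<circ> Inl)"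
  unfolding lin_def by (auto simp: pow_plus_iff)

lemma lin_inr: "lin (pow_mod N (S \<uplus> T)) (pow_mod N T) (\<lambda>v. v \<circ> Inr)"
  unfolding lin_def by (auto simp: pow_plus_iff)

lemma lin_case_sum:
  assumes "lin M (pow_mod N S) f" "lin M (pow_mod N T) g"
  shows "lin M (pow_mod N (S \<uplus> T)) (\<lambda>x. case_sum (f x) (g x))"
  unfolding lin_def
proof (intro conjI ballI funcsetI)
  fix x assume x: "x \<in> carrier M"
  show "case_sum (f x) (g x) \<in> carrier (pow_mod N (S \<uplus> T))"
    unfolding pow_plus_iff case_sum_o_inj using lin_closed[OF assms(1) x] lin_closed[OF assms(2) x] by blast
  show "case_sum (f (x \<oplus>\<^bsub>M\<^esub> y)) (g (x \<oplus>\<^bsub>M\<^esub> y)) = case_sum (f x) (g x) \<oplus>\<^bsub>pow_mod N (S \<uplus> T)\<^esub> case_sum (f y) (g y)"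
    if "y \<in> carrier M" for y
    unfolding lin_add[OF assms(1) x that] lin_add[OF assms(2) x that] by (auto simp: fun_eq_iff split: sum.split)
  show "case_sum (f (a \<odot>\<^bsub>M\<^esub> x)) (g (a \<odot>\<^bsub>M\<^esub> x)) = a \<odot>\<^bsub>pow_mod N (S \<uplus> T)\<^esub> case_sum (f x) (g x)"
    if "a \<in> carrier A" for a
    unfolding lin_smult[OF assms(1) that x] lin_smult[OF assms(2) that x] by (auto simp: fun_eq_iff split: sum.split)
qed

text \<open>The block matrix with rows \<open>(p, q)\<close> and \<open>(0, -r)\<close>.\<close>

definition coneD :: "'t1 set \<Rightarrow> 't2 set \<Rightarrow> (('s1 \<Rightarrow> 'a) \<Rightarrow> ('t1 \<Rightarrow> 'a)) \<Rightarrow> (('s2 \<Rightarrow> 'a) \<Rightarrow> ('t1 \<Rightarrow> 'a)) \<Rightarrow>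
    (('s2 \<Rightarrow> 'a) \<Rightarrow> ('t2 \<Rightarrow> 'a)) \<Rightarrow> ('s1 + 's2 \<Rightarrow> 'a) \<Rightarrow> ('t1 + 't2 \<Rightarrow> 'a)" where
  "coneD S' T' p q r v = case_sum (p (v \<circ> Inl) \<oplus>\<^bsub>fr S'\<^esub> q (v \<circ> Inr)) (\<ominus>\<^bsub>fr T'\<^esub> r (v \<circ> Inr))"

lemma coneD_lin:
  assumes "lin (fr S) (fr S') p" "lin (fr T) (fr S') q" "lin (fr T) (fr T') r"
  shows "lin (fr (S \<uplus> T)) (fr (S' \<uplus> T')) (coneD S' T' p q r)"
  unfolding coneD_def
  by (intro lin_case_sum lin_plus lin_uminus lin_comp[OF lin_inl assms(1)] lin_comp[OF lin_inr assms(2)]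
      lin_comp[OF lin_inr assms(3)] module_fr)

lemma act_case_sum: "act N U (\<lambda>x. case_sum (f x) (g x)) w = case_sum (act N U f w) (act N U g w)"
  by (auto simp: act_def fun_eq_iff split: sum.split)

lemma act_inl:
  assumes N: "module A N" and S: "finite S" "finite T" and p: "lin (fr S) (fr S') p"
    and v: "v \<in> carrier (pow_mod N (S \<uplus> T))"
  shows "act N (S \<uplus> T) (\<lambda>v. p (v \<circ> Inl)) v = act N S p (v \<circ> Inl)"
proof -
  have f: "finite (S \<uplus> T)" using S by simp
  have "act N (S \<uplus> T) (\<lambda>v. v \<circ> Inl) v = act N (S \<uplus> T) (\<lambda>v. v) v \<circ> Inl" by (simp add: act_def fun_eq_iff)
  then show ?thesis using act_comp[OF N f S(1) lin_inl p v] act_id[OF N f v] by simp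
qed

lemma act_inr:
  assumes N: "module A N" and S: "finite S" "finite T" and p: "lin (fr T) (fr S') p"
    and v: "v \<in> carrier (pow_mod N (S \<uplus> T))"
  shows "act N (S \<uplus> T) (\<lambda>v. p (v \<circ> Inr)) v = act N T p (v \<circ> Inr)"
proof -
  have f: "finite (S \<uplus> T)" using S by simp
  have "act N (S \<uplus> T) (\<lambda>v. v \<circ> Inr) v = act N (S \<uplus> T) (\<lambda>v. v) v \<circ> Inr" by (simp add: act_def fun_eq_iff)
  then show ?thesis using act_comp[OF N f S(2) lin_inr p v] act_id[OF N f v] by simp
qed

lemma act_coneD:
  assumes N: "module A N" and S: "finite S" "finite T"
    and p: "lin (fr S) (fr S') p" and q: "lin (fr T) (fr S') q" and r: "lin (fr T) (fr T') r"
    and v: "v \<in> carrier (pow_mod N (S \<uplus> T))"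
  shows "act N (S \<uplus> T) (coneD S' T' p q r) v =
    case_sum (act N S p (v \<circ> Inl) \<oplus>\<^bsub>pow_mod N S'\<^esub> act N T q (v \<circ> Inr)) (\<ominus>\<^bsub>pow_mod N T'\<^esub> act N T r (v \<circ> Inr))"
proof -
  have f: "finite (S \<uplus> T)" using S by simp
  have "coneD S' T' p q r = (\<lambda>v. case_sum (p (v \<circ> Inl) \<oplus>\<^bsub>fr S'\<^esub> q (v \<circ> Inr)) (\<ominus>\<^bsub>fr T'\<^esub> r (v \<circ> Inr)))"
    by (simp only: coneD_def fun_eq_iff) simp
  then show ?thesis
    using act_case_sum[of N "S \<uplus> T" "\<lambda>v. p (v \<circ> Inl) \<oplus>\<^bsub>fr S'\<^esub> q (v \<circ> Inr)" "\<lambda>v. \<ominus>\<^bsub>fr T'\<^esub> r (v \<circ> Inr)" v]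
    unfolding act_plus[OF N f lin_comp[OF lin_inl p] lin_comp[OF lin_inr q] v] act_uminus[OF N f lin_comp[OF lin_inr r] v]
      act_inl[OF N S p v] act_inr[OF N S q v] act_inr[OF N S r v] by simp
qed

lemma neg_zero_iff:
  assumes "module A M" "x \<in> carrier M" shows "\<ominus>\<^bsub>M\<^esub> x = \<zero>\<^bsub>M\<^esub> \<longleftrightarrow> x = \<zero>\<^bsub>M\<^esub>"
proof -
  interpret M: module A M by fact
  show ?thesis using M.minus_minus[OF assms(2)] M.minus_equality[OF M.l_zero[OF M.zero_closed]] by auto
qed

context
  fixes S :: "nat \<Rightarrow> 's set" and D :: "nat \<Rightarrow> ('s \<Rightarrow> 'a) \<Rightarrow> ('s \<Rightarrow> 'a)" and m :: nat
    and \<phi> :: "nat \<Rightarrow> ('s \<Rightarrow> 'a) \<Rightarrow> ('s \<Rightarrow> 'a)"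
  assumes F: "free_cx S D" and \<phi>: "\<And>j. lin (fr (S (Suc (j + m)))) (fr (S j)) (\<phi> j)"
    and \<phi>D: "\<And>j x. x \<in> carrier (fr (S (Suc (Suc (j + m))))) \<Longrightarrow> D j (\<phi> (Suc j) x) = \<phi> j (D (Suc (j + m)) x)"
begin

text \<open>When \<open>S\<close> and \<open>D\<close> resolve X, this is the horseshoe sum for 0 ->
  X -> K -> Omega^m(X) -> 0: the resolution of X in the first summand, and in the second its tail
  from degree \<open>m\<close> on, which resolves the syzygy.\<close>

definition CS :: "nat \<Rightarrow> ('s + 's) set" where "CS j = S j \<uplus> S (j + m)"

definition CD :: "nat \<Rightarrow> ('s + 's \<Rightarrow> 'a) \<Rightarrow> ('s + 's \<Rightarrow> 'a)" where
  "CD j = coneD (S j) (S (j + m)) (D j) (\<phi> j) (D (j + m))"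

lemma CS_Suc: "CS (Suc j) = S (Suc j) \<uplus> S (Suc (j + m))" by (simp add: CS_def)

lemma act_CD:
  assumes N: "module A N" and v: "v \<in> carrier (pow_mod N (CS (Suc j)))"
  shows "act N (CS (Suc j)) (CD j) v = case_sum
     (act N (S (Suc j)) (D j) (v \<circ> Inl) \<oplus>\<^bsub>pow_mod N (S j)\<^esub> act N (S (Suc (j + m))) (\<phi> j) (v \<circ> Inr))
     (\<ominus>\<^bsub>pow_mod N (S (j + m))\<^esub> act N (S (Suc (j + m))) (D (j + m)) (v \<circ> Inr))"
  unfolding CS_Suc CD_def
  by (rule act_coneD[OF N free_cx_D(1)[OF F] free_cx_D(1)[OF F] free_cx_D(2)[OF F] \<phi> free_cx_D(2)[OF F] v[unfolded CS_Suc]])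

lemma cone_free_cx: "free_cx CS CD"
  unfolding free_cx_def
proof (intro allI conjI ballI)
  note L = free_cx_D(2)[OF F]
  show "finite (CS j)" for j by (simp add: CS_def free_cx_D(1)[OF F])
  show CL: "lin (fr (CS (Suc j))) (fr (CS j)) (CD j)" for j
    unfolding CS_Suc CD_def CS_def[of j] by (rule coneD_lin[OF L \<phi> L])
  fix j v assume "v \<in> carrier (fr (CS (Suc (Suc j))))"
  then have a: "v \<circ> Inl \<in> carrier (fr (S (Suc (Suc j))))" and b: "v \<circ> Inr \<in> carrier (fr (S (Suc (Suc (j + m)))))"
    unfolding CS_Suc pow_plus_iff by simp_all
  interpret P: module A "fr (S j)" by (rule module_fr)
  interpret P1: module A "fr (S (Suc j))" by (rule module_fr)
  interpret Q: module A "fr (S (j + m))" by (rule module_fr)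
  interpret Q1: module A "fr (S (Suc (j + m)))" by (rule module_fr)
  let ?a = "v \<circ> Inl" and ?b = "v \<circ> Inr"
  have c: "D (Suc j) ?a \<in> carrier (fr (S (Suc j)))" "\<phi> (Suc j) ?b \<in> carrier (fr (S (Suc j)))"
    "D (Suc (j + m)) ?b \<in> carrier (fr (S (Suc (j + m))))"
    using lin_closed[OF L a] lin_closed[OF \<phi>[of "Suc j"]] b lin_closed[OF L b] by simp_all
  have 1: "CD (Suc j) v = case_sum (D (Suc j) ?a \<oplus>\<^bsub>fr (S (Suc j))\<^esub> \<phi> (Suc j) ?b) (\<ominus>\<^bsub>fr (S (Suc (j + m)))\<^esub> D (Suc (j + m)) ?b)"
    by (simp add: CD_def coneD_def)
  have "D j (D (Suc j) ?a \<oplus>\<^bsub>fr (S (Suc j))\<^esub> \<phi> (Suc j) ?b) \<oplus>\<^bsub>fr (S j)\<^esub> \<phi> j (\<ominus>\<^bsub>fr (S (Suc (j + m)))\<^esub> D (Suc (j + m)) ?b)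
     = (\<zero>\<^bsub>fr (S j)\<^esub> \<oplus>\<^bsub>fr (S j)\<^esub> \<phi> j (D (Suc (j + m)) ?b)) \<oplus>\<^bsub>fr (S j)\<^esub> \<ominus>\<^bsub>fr (S j)\<^esub> \<phi> j (D (Suc (j + m)) ?b)"
    unfolding lin_add[OF L c(1,2)] lin_neg[OF \<phi> module_fr module_fr c(3)] \<phi>D[OF b] free_cx_D(3)[OF F a] by simp
  also have "\<dots> = \<zero>\<^bsub>fr (S j)\<^esub>" using lin_closed[OF \<phi> c(3)] by (simp add: P.r_neg del: pow_simps)
  finally have 2: "D j (D (Suc j) ?a \<oplus>\<^bsub>fr (S (Suc j))\<^esub> \<phi> (Suc j) ?b) \<oplus>\<^bsub>fr (S j)\<^esub> \<phi> j (\<ominus>\<^bsub>fr (S (Suc (j + m)))\<^esub> D (Suc (j + m)) ?b)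
     = \<zero>\<^bsub>fr (S j)\<^esub>" .
  have "D (j + m) (\<ominus>\<^bsub>fr (S (Suc (j + m)))\<^esub> D (Suc (j + m)) ?b) = \<ominus>\<^bsub>fr (S (j + m))\<^esub> \<zero>\<^bsub>fr (S (j + m))\<^esub>"
    unfolding lin_neg[OF L module_fr module_fr c(3)] free_cx_D(3)[OF F b] by simp
  also have "\<dots> = \<zero>\<^bsub>fr (S (j + m))\<^esub>" using neg_zero_iff[OF Q.module_axioms Q.zero_closed] by blast
  finally have 3: "D (j + m) (\<ominus>\<^bsub>fr (S (Suc (j + m)))\<^esub> D (Suc (j + m)) ?b) = \<zero>\<^bsub>fr (S (j + m))\<^esub>" .
  have "\<ominus>\<^bsub>fr (S (j + m))\<^esub> \<zero>\<^bsub>fr (S (j + m))\<^esub> = \<zero>\<^bsub>fr (S (j + m))\<^esub>" using neg_zero_iff[OF Q.module_axioms Q.zero_closed] by blast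
  then have "CD j (CD (Suc j) v) = case_sum (\<zero>\<^bsub>fr (S j)\<^esub>) (\<zero>\<^bsub>fr (S (j + m))\<^esub>)"
    unfolding 1 CD_def[of j] coneD_def case_sum_o_inj 2 3 by (simp only:)
  then show "CD j (CD (Suc j) v) = (\<lambda>_. \<zero>)" by (auto simp: fun_eq_iff split: sum.split)
qed

context
  fixes N :: "('a, 'n) module"
  assumes N: "module A N"
begin

abbreviation (input) tdd where "tdd j \<equiv> act N (S (Suc j)) (D j)"
abbreviation (input) tph where "tph j \<equiv> act N (S (Suc (j + m))) (\<phi> j)"

lemma tdd_lin: "lin (pow_mod N (S (Suc j))) (pow_mod N (S j)) (tdd j)"
  by (rule act_lin[OF N free_cx_D(1)[OF F] free_cx_D(2)[OF F]])

lemma tph_lin: "lin (pow_mod N (S (Suc (j + m)))) (pow_mod N (S j)) (tph j)"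
  by (rule act_lin[OF N free_cx_D(1)[OF F] \<phi>])

lemma tdd_tph:
  assumes x: "x \<in> carrier (pow_mod N (S (Suc (Suc (j + m)))))"
  shows "tdd j (act N (S (Suc (Suc (j + m)))) (\<phi> (Suc j)) x) = tph j (tdd (Suc (j + m)) x)"
proof -
  note fin = free_cx_D(1)[OF F] and L = free_cx_D(2)[OF F]
  have p: "lin (fr (S (Suc (Suc (j + m))))) (fr (S (Suc j))) (\<phi> (Suc j))" using \<phi>[of "Suc j"] by simp
  have "tdd j (act N (S (Suc (Suc (j + m)))) (\<phi> (Suc j)) x) = act N (S (Suc (Suc (j + m)))) (\<lambda>x. D j (\<phi> (Suc j) x)) x"
    by (rule act_comp[OF N fin fin p L x, symmetric])
  also have "\<dots> = act N (S (Suc (Suc (j + m)))) (\<lambda>x. \<phi> j (D (Suc (j + m)) x)) x"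
    by (rule act_cong[OF N lin_comp[OF p L] \<phi>D x])
  also have "\<dots> = tph j (tdd (Suc (j + m)) x)" by (rule act_comp[OF N fin fin L \<phi> x])
  finally show ?thesis .
qed

lemma tph_Suc_lin: "lin (pow_mod N (S (Suc (Suc (j + m))))) (pow_mod N (S (Suc j))) (act N (S (Suc (Suc (j + m)))) (\<phi> (Suc j)))"
  using tph_lin[of "Suc j"] by simp

lemma cone_cycle:
  assumes "z \<in> carrier (pow_mod N (CS (Suc j)))"
  shows "act N (CS (Suc j)) (CD j) z = (\<lambda>_. \<zero>\<^bsub>N\<^esub>) \<longleftrightarrow>
     tdd j (z \<circ> Inl) \<oplus>\<^bsub>pow_mod N (S j)\<^esub> tph j (z \<circ> Inr) = \<zero>\<^bsub>pow_mod N (S j)\<^esub> \<and>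
     tdd (j + m) (z \<circ> Inr) = \<zero>\<^bsub>pow_mod N (S (j + m))\<^esub>"
proof -
  have b: "z \<circ> Inr \<in> carrier (pow_mod N (S (Suc (j + m))))" using assms unfolding CS_Suc pow_plus_iff by blast
  have cs: "case_sum x y = (\<lambda>_. \<zero>\<^bsub>N\<^esub>) \<longleftrightarrow> x = (\<lambda>_. \<zero>\<^bsub>N\<^esub>) \<and> y = (\<lambda>_. \<zero>\<^bsub>N\<^esub>)" for x y :: "'s \<Rightarrow> 'n"
    by (auto simp: fun_eq_iff split: sum.split)
  show ?thesis unfolding act_CD[OF N assms] cs
    using neg_zero_iff[OF module_pow[OF N] lin_closed[OF tdd_lin b]] by simp
qed

text \<open>Exactness of Tor_(j+1)(X) -> Tor_(j+1)(K) -> Tor_(j+m+1)(X) in the middle: the second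
  component of a cycle is bounded first, and the image of the bounding element under \<phi> corrects
  the first component.\<close>

lemma cone_tor_exact:
  assumes 1: "tor_exact N S D j" and 2: "tor_exact N S D (j + m)"
  shows "tor_exact N CS CD j"
  unfolding tor_exact_def
proof (intro ballI impI)
  interpret P: module A "pow_mod N (S j)" by (rule module_pow[OF N])
  interpret P1: module A "pow_mod N (S (Suc j))" by (rule module_pow[OF N])
  fix z assume z: "z \<in> carrier (pow_mod N (CS (Suc j)))" and "act N (CS (Suc j)) (CD j) z = (\<lambda>_. \<zero>\<^bsub>N\<^esub>)"
  then have c: "tdd j (z \<circ> Inl) \<oplus>\<^bsub>pow_mod N (S j)\<^esub> tph j (z \<circ> Inr) = \<zero>\<^bsub>pow_mod N (S j)\<^esub>"
    "tdd (j + m) (z \<circ> Inr) = \<zero>\<^bsub>pow_mod N (S (j + m))\<^esub>" using cone_cycle by blast+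
  have a: "z \<circ> Inl \<in> carrier (pow_mod N (S (Suc j)))" and b: "z \<circ> Inr \<in> carrier (pow_mod N (S (Suc (j + m))))"
    using z unfolding CS_Suc pow_plus_iff by blast+
  obtain b' where b': "b' \<in> carrier (pow_mod N (S (Suc (Suc (j + m)))))" "z \<circ> Inr = tdd (Suc (j + m)) b'"
    using 2 b c(2) unfolding tor_exact_def by auto
  let ?f = "act N (S (Suc (Suc (j + m)))) (\<phi> (Suc j))"
  have fb: "?f b' \<in> carrier (pow_mod N (S (Suc j)))" by (rule lin_closed[OF tph_Suc_lin b'(1)])
  have "tdd j ((z \<circ> Inl) \<oplus>\<^bsub>pow_mod N (S (Suc j))\<^esub> ?f b') = \<zero>\<^bsub>pow_mod N (S j)\<^esub>"
    unfolding lin_add[OF tdd_lin a fb] tdd_tph[OF b'(1)] b'(2)[symmetric] by (rule c(1))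
  then obtain a' where a': "a' \<in> carrier (pow_mod N (S (Suc (Suc j))))"
    "(z \<circ> Inl) \<oplus>\<^bsub>pow_mod N (S (Suc j))\<^esub> ?f b' = tdd (Suc j) a'"
    using 1 P1.a_closed[OF a fb] unfolding tor_exact_def by auto
  interpret Q: module A "pow_mod N (S (Suc (Suc (j + m))))" by (rule module_pow[OF N])
  interpret Q1: module A "pow_mod N (S (Suc (j + m)))" by (rule module_pow[OF N])
  \<comment> \<open>The sign makes up for the minus in the second row of the cone
    differential.\<close>
  define w where "w = case_sum a' (\<ominus>\<^bsub>pow_mod N (S (Suc (Suc (j + m))))\<^esub> b')"
  have w: "w \<in> carrier (pow_mod N (CS (Suc (Suc j))))"
    unfolding CS_Suc pow_plus_iff w_def case_sum_o_inj using a'(1) Q.a_inv_closed[OF b'(1)] by simp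
  have "act N (CS (Suc (Suc j))) (CD (Suc j)) w = case_sum
     (tdd (Suc j) a' \<oplus>\<^bsub>pow_mod N (S (Suc j))\<^esub> ?f (\<ominus>\<^bsub>pow_mod N (S (Suc (Suc (j + m))))\<^esub> b'))
     (\<ominus>\<^bsub>pow_mod N (S (Suc (j + m)))\<^esub> tdd (Suc (j + m)) (\<ominus>\<^bsub>pow_mod N (S (Suc (Suc (j + m))))\<^esub> b'))"
    unfolding act_CD[OF N w] unfolding w_def case_sum_o_inj by simp
  also have "\<dots> = case_sum (z \<circ> Inl) (z \<circ> Inr)"
  proof -
    have 1: "tdd (Suc j) a' \<oplus>\<^bsub>pow_mod N (S (Suc j))\<^esub> ?f (\<ominus>\<^bsub>pow_mod N (S (Suc (Suc (j + m))))\<^esub> b') = z \<circ> Inl"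
      unfolding lin_neg[OF tph_Suc_lin module_pow[OF N] module_pow[OF N] b'(1)] a'(2)[symmetric]
      using a fb by (simp add: P1.a_assoc P1.r_neg del: pow_simps)
    have 2: "\<ominus>\<^bsub>pow_mod N (S (Suc (j + m)))\<^esub> tdd (Suc (j + m)) (\<ominus>\<^bsub>pow_mod N (S (Suc (Suc (j + m))))\<^esub> b') = z \<circ> Inr"
      unfolding lin_neg[OF tdd_lin module_pow[OF N] module_pow[OF N] b'(1)] b'(2)[symmetric]
      using b by (simp del: pow_simps)
    show ?thesis unfolding 1 2 ..
  qed
  also have "\<dots> = z" by (auto simp: fun_eq_iff split: sum.split)
  finally show "\<exists>w\<in>carrier (pow_mod N (CS (Suc (Suc j)))). z = act N (CS (Suc (Suc j))) (CD (Suc j)) w" using w by metis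
qed

text \<open>The connecting map Tor_(j+m+2)(X) -> Tor_(j+1)(X) induced by \<phi> is injective because
  Tor_(j+2) of the cone vanishes. A cycle \<open>z\<close> is completed to a cycle of the cone once
  its image under \<phi> is a boundary.\<close>

lemma cone_shift_up:
  assumes 1: "tor_exact N S D j" and 2: "tor_exact N CS CD (Suc j)"
  shows "tor_exact N S D (Suc (j + m))"
  unfolding tor_exact_def
proof (intro ballI impI)
  let ?f = "act N (S (Suc (Suc (j + m)))) (\<phi> (Suc j))"
  interpret P1: module A "pow_mod N (S (Suc j))" by (rule module_pow[OF N])
  interpret P2: module A "pow_mod N (S (Suc (Suc j)))" by (rule module_pow[OF N])
  interpret Q: module A "pow_mod N (S (Suc (Suc (j + m))))" by (rule module_pow[OF N])
  interpret Q1: module A "pow_mod N (S (Suc (Suc (Suc (j + m)))))" by (rule module_pow[OF N])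
  fix z assume z: "z \<in> carrier (pow_mod N (S (Suc (Suc (j + m)))))"
    and z0: "tdd (Suc (j + m)) z = (\<lambda>_. \<zero>\<^bsub>N\<^esub>)"
  have fz: "?f z \<in> carrier (pow_mod N (S (Suc j)))" by (rule lin_closed[OF tph_Suc_lin z])
  have "tdd j (?f z) = tph j (tdd (Suc (j + m)) z)" by (rule tdd_tph[OF z])
  also have "\<dots> = (\<lambda>_. \<zero>\<^bsub>N\<^esub>)" unfolding z0 using lin_zero[OF tph_lin module_pow[OF N] module_pow[OF N]] by simp
  finally obtain u where u: "u \<in> carrier (pow_mod N (S (Suc (Suc j))))" "?f z = tdd (Suc j) u"
    using 1 fz unfolding tor_exact_def by auto
  define y where "y = case_sum (\<ominus>\<^bsub>pow_mod N (S (Suc (Suc j)))\<^esub> u) z"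
  have y: "y \<in> carrier (pow_mod N (CS (Suc (Suc j))))"
    unfolding CS_Suc pow_plus_iff y_def case_sum_o_inj using P2.a_inv_closed[OF u(1)] z by simp
  have "tdd (Suc j) (\<ominus>\<^bsub>pow_mod N (S (Suc (Suc j)))\<^esub> u) \<oplus>\<^bsub>pow_mod N (S (Suc j))\<^esub> ?f z = \<zero>\<^bsub>pow_mod N (S (Suc j))\<^esub>"
    unfolding lin_neg[OF tdd_lin module_pow[OF N] module_pow[OF N] u(1)] u(2)[symmetric] by (rule P1.l_neg[OF fz])
  then have "act N (CS (Suc (Suc j))) (CD (Suc j)) y = (\<lambda>_. \<zero>\<^bsub>N\<^esub>)"
    unfolding cone_cycle[OF y] unfolding y_def case_sum_o_inj using z0 by simp
  then obtain w where w: "w \<in> carrier (pow_mod N (CS (Suc (Suc (Suc j)))))"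
    "y = act N (CS (Suc (Suc (Suc j)))) (CD (Suc (Suc j))) w" using 2 y unfolding tor_exact_def by blast
  have b: "w \<circ> Inr \<in> carrier (pow_mod N (S (Suc (Suc (Suc (j + m))))))" using w(1) unfolding CS_Suc pow_plus_iff by simp
  have "y \<circ> Inr = \<ominus>\<^bsub>pow_mod N (S (Suc (Suc (j + m))))\<^esub> tdd (Suc (Suc (j + m))) (w \<circ> Inr)"
    unfolding w(2) act_CD[OF N w(1)] case_sum_o_inj by simp
  then have "z = \<ominus>\<^bsub>pow_mod N (S (Suc (Suc (j + m))))\<^esub> tdd (Suc (Suc (j + m))) (w \<circ> Inr)"
    unfolding y_def case_sum_o_inj .
  also have "\<dots> = tdd (Suc (Suc (j + m))) (\<ominus>\<^bsub>pow_mod N (S (Suc (Suc (Suc (j + m)))))\<^esub> (w \<circ> Inr))"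
    by (rule lin_neg[OF tdd_lin module_pow[OF N] module_pow[OF N] b, symmetric])
  finally show "\<exists>w\<in>carrier (pow_mod N (S (Suc (Suc (Suc (j + m)))))). z = tdd (Suc (Suc (j + m))) w"
    using Q1.a_inv_closed[OF b] by blast
qed

text \<open>The same connecting map is surjective because Tor_(j+1) of the cone vanishes: a cycle
  \<open>z\<close> placed in the first component bounds there, which writes it as a boundary plus
  the image under \<phi> of a cycle.\<close>

lemma cone_shift_down:
  assumes 1: "tor_exact N S D (Suc (j + m))" and 2: "tor_exact N CS CD j"
  shows "tor_exact N S D j"
  unfolding tor_exact_def
proof (intro ballI impI)
  interpret P: module A "pow_mod N (S j)" by (rule module_pow[OF N])
  interpret P2: module A "pow_mod N (S (Suc (Suc j)))" by (rule module_pow[OF N])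
  interpret Q: module A "pow_mod N (S (Suc (j + m)))" by (rule module_pow[OF N])
  fix z assume z: "z \<in> carrier (pow_mod N (S (Suc j)))" and z0: "tdd j z = (\<lambda>_. \<zero>\<^bsub>N\<^esub>)"
  define y where "y = case_sum z \<zero>\<^bsub>pow_mod N (S (Suc (j + m)))\<^esub>"
  have y: "y \<in> carrier (pow_mod N (CS (Suc j)))"
    unfolding CS_Suc pow_plus_iff y_def case_sum_o_inj using z Q.zero_closed by blast
  have "act N (CS (Suc j)) (CD j) y = (\<lambda>_. \<zero>\<^bsub>N\<^esub>)"
    unfolding cone_cycle[OF y] unfolding y_def case_sum_o_inj
      lin_zero[OF tph_lin module_pow[OF N] module_pow[OF N]] lin_zero[OF tdd_lin module_pow[OF N] module_pow[OF N]] z0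
    using P.r_zero[OF P.zero_closed] by simp
  then obtain w where w: "w \<in> carrier (pow_mod N (CS (Suc (Suc j))))"
    "y = act N (CS (Suc (Suc j))) (CD (Suc j)) w" using 2 y unfolding tor_exact_def by blast
  have a: "w \<circ> Inl \<in> carrier (pow_mod N (S (Suc (Suc j))))" and b: "w \<circ> Inr \<in> carrier (pow_mod N (S (Suc (Suc (j + m)))))"
    using w(1) unfolding CS_Suc pow_plus_iff by simp_all
  let ?f = "act N (S (Suc (Suc (j + m)))) (\<phi> (Suc j))"
  have "y \<circ> Inl = tdd (Suc j) (w \<circ> Inl) \<oplus>\<^bsub>pow_mod N (S (Suc j))\<^esub> ?f (w \<circ> Inr)"
    unfolding w(2) act_CD[OF N w(1)] case_sum_o_inj by simp
  then have zz: "z = tdd (Suc j) (w \<circ> Inl) \<oplus>\<^bsub>pow_mod N (S (Suc j))\<^esub> ?f (w \<circ> Inr)" unfolding y_def case_sum_o_inj .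
  have "y \<circ> Inr = \<ominus>\<^bsub>pow_mod N (S (Suc (j + m)))\<^esub> tdd (Suc (j + m)) (w \<circ> Inr)"
    unfolding w(2) act_CD[OF N w(1)] case_sum_o_inj by simp
  then have "\<ominus>\<^bsub>pow_mod N (S (Suc (j + m)))\<^esub> tdd (Suc (j + m)) (w \<circ> Inr) = \<zero>\<^bsub>pow_mod N (S (Suc (j + m)))\<^esub>"
    unfolding y_def case_sum_o_inj by (rule sym)
  then have "tdd (Suc (j + m)) (w \<circ> Inr) = (\<lambda>_. \<zero>\<^bsub>N\<^esub>)"
    using neg_zero_iff[OF module_pow[OF N] lin_closed[OF tdd_lin b]] by simp
  then obtain b' where b': "b' \<in> carrier (pow_mod N (S (Suc (Suc (Suc (j + m))))))" "w \<circ> Inr = tdd (Suc (Suc (j + m))) b'"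
    using 1 b unfolding tor_exact_def by blast
  let ?f2 = "act N (S (Suc (Suc (Suc (j + m))))) (\<phi> (Suc (Suc j)))"
  have fb: "?f2 b' \<in> carrier (pow_mod N (S (Suc (Suc j))))" using lin_closed[OF tph_Suc_lin[of "Suc j"]] b'(1) by simp
  have "?f (w \<circ> Inr) = tdd (Suc j) (?f2 b')" unfolding b'(2) using tdd_tph[of b' "Suc j"] b'(1) by simp
  then have "z = tdd (Suc j) ((w \<circ> Inl) \<oplus>\<^bsub>pow_mod N (S (Suc (Suc j)))\<^esub> ?f2 b')"
    unfolding lin_add[OF tdd_lin a fb] using zz by simp
  then show "\<exists>w\<in>carrier (pow_mod N (S (Suc (Suc j)))). z = tdd (Suc j) w" using P2.a_closed[OF a fb] by blast
qed

end

end

text \<open>\<open>Y\<close> is the pushout of \<open>f\<close> and the differential \<open>P\<^sub>m\<^sub>+\<^sub>1 \<rightarrow> P\<^sub>m\<close>, where \<open>P\<close> is a resolution of \<open>X\<close>; the cone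
  of the lift of \<open>f\<close> to \<open>P\<^sub>j\<^sub>+\<^sub>m\<^sub>+\<^sub>1 \<rightarrow> P\<^sub>j\<close> resolves \<open>Y\<close>.\<close>

lemma extension_tor_exact:
  assumes R: "free_resol S D X e" and f: "lin (fr (S (Suc m))) X f" "\<And>x. x \<in> carrier (fr (S (Suc (Suc m)))) \<Longrightarrow> f (D (Suc m) x) = \<zero>\<^bsub>X\<^esub>"
    and pX: "lin X Y pX" and pF: "lin (fr (S m)) Y pF"
    and surj: "\<And>y. y \<in> carrier Y \<Longrightarrow> \<exists>x\<in>carrier X. \<exists>b\<in>carrier (fr (S m)). y = pX x \<oplus>\<^bsub>Y\<^esub> pF b"
    and ker: "\<And>x b. x \<in> carrier X \<Longrightarrow> b \<in> carrier (fr (S m)) \<Longrightarrow>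
        pX x \<oplus>\<^bsub>Y\<^esub> pF b = \<zero>\<^bsub>Y\<^esub> \<longleftrightarrow> (\<exists>p\<in>carrier (fr (S (Suc m))). x = f p \<and> b = \<ominus>\<^bsub>fr (S m)\<^esub> D m p)"
    and RY: "free_resol SY DY Y eY" and N: "module A N"
  shows "tor_exact N S D j \<Longrightarrow> tor_exact N S D (j + m) \<Longrightarrow> tor_exact N SY DY j"
    "tor_exact N SY DY j \<Longrightarrow> tor_exact N SY DY (Suc j) \<Longrightarrow> tor_exact N S D (Suc (j + m)) \<longleftrightarrow> tor_exact N S D j"
proof -
  note r = free_resolD[OF R]
  note F = r(1) and X = r(2) and e = r(3) and L = free_cx_D(2)[OF r(1)]
  have Y: "module A Y" by (rule free_resolD(2)[OF RY])
  \<comment> \<open>The tail from degree m + 1 on, renumbered from 0 and augmented by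
    \<open>f\<close>; lifting \<open>f\<close> along \<open>e\<close> produces \<phi>.\<close>
  have Fs: "free_cx (\<lambda>j. S (Suc (j + m))) (\<lambda>j. D (Suc (j + m)))" using F unfolding free_cx_def by simp
  have "\<exists>\<phi>. (\<forall>j. lin (fr (S (Suc (j + m)))) (fr (S j)) (\<phi> j)) \<and> (\<forall>x\<in>carrier (fr (S (Suc (0 + m)))). e (\<phi> 0 x) = f x) \<and>
     (\<forall>j. \<forall>x\<in>carrier (fr (S (Suc (Suc j + m)))). D j (\<phi> (Suc j) x) = \<phi> j (D (Suc (j + m)) x))"
    by (rule chain_map_exists[OF Fs _ _ R]) (use f in simp_all)
  then obtain \<phi> where \<phi>': "\<forall>j. lin (fr (S (Suc (j + m)))) (fr (S j)) (\<phi> j)"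
    "\<forall>x\<in>carrier (fr (S (Suc (0 + m)))). e (\<phi> 0 x) = f x"
    "\<forall>j. \<forall>x\<in>carrier (fr (S (Suc (Suc j + m)))). D j (\<phi> (Suc j) x) = \<phi> j (D (Suc (j + m)) x)" by blast
  have \<phi>: "\<And>j. lin (fr (S (Suc (j + m)))) (fr (S j)) (\<phi> j)"
    "\<And>x. x \<in> carrier (fr (S (Suc m))) \<Longrightarrow> e (\<phi> 0 x) = f x"
    "\<And>j x. x \<in> carrier (fr (S (Suc (Suc (j + m))))) \<Longrightarrow> D j (\<phi> (Suc j) x) = \<phi> j (D (Suc (j + m)) x)"
    using \<phi>' by auto
  let ?CS = "CS S m" and ?CD = "CD S D m \<phi>"
  note CF = cone_free_cx[OF F \<phi>(1,3)]
  let ?F0 = "fr (S 0)" and ?Fm = "fr (S m)"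
  interpret F0: module A ?F0 by (rule module_fr)
  interpret Fm: module A ?Fm by (rule module_fr)
  have CS0: "?CS 0 = S 0 \<uplus> S m" by (simp add: CS_def[OF F \<phi>(1,3)])
  have CD0: "?CD 0 = coneD (S 0) (S m) (D 0) (\<phi> 0) (D m)" by (simp add: CD_def[OF F \<phi>(1,3)])
  have CS1: "?CS (Suc 0) = S (Suc 0) \<uplus> S (Suc m)" by (simp add: CS_def[OF F \<phi>(1,3)])
  \<comment> \<open>The augmentation of the cone: P_0 + P_m -> X + P_m -> Y.\<close>
  define eC where "eC v = pX (e (v \<circ> Inl)) \<oplus>\<^bsub>Y\<^esub> pF (v \<circ> Inr)" for v :: "'b + 'b \<Rightarrow> 'a"
  have eC: "lin (fr (?CS 0)) Y eC" unfolding CS0 eC_def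
    by (intro lin_plus lin_comp[OF lin_comp[OF lin_inl e] pX] lin_comp[OF lin_inr pF] module_fr Y)
  have surjC: "eC ` carrier (fr (?CS 0)) = carrier Y"
  proof
    show "eC ` carrier (fr (?CS 0)) \<subseteq> carrier Y" using lin_closed[OF eC] by blast
    show "carrier Y \<subseteq> eC ` carrier (fr (?CS 0))"
    proof
      fix y assume "y \<in> carrier Y"
      then obtain x b where xb: "x \<in> carrier X" "b \<in> carrier ?Fm" "y = pX x \<oplus>\<^bsub>Y\<^esub> pF b" using surj by blast
      obtain a where a: "a \<in> carrier ?F0" "e a = x" using xb(1) r(4) by (metis imageE)
      have "case_sum a b \<in> carrier (fr (?CS 0))" unfolding CS0 pow_plus_iff case_sum_o_inj using a xb by blast
      moreover have "eC (case_sum a b) = y" unfolding eC_def case_sum_o_inj using a xb by simp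
      ultimately show "y \<in> eC ` carrier (fr (?CS 0))" by blast
    qed
  qed
  have kerC: "eC z = \<zero>\<^bsub>Y\<^esub> \<longleftrightarrow> (\<exists>w\<in>carrier (fr (?CS (Suc 0))). z = ?CD 0 w)" if z: "z \<in> carrier (fr (?CS 0))" for z
  proof
    have a: "z \<circ> Inl \<in> carrier ?F0" and b: "z \<circ> Inr \<in> carrier ?Fm" using z unfolding CS0 pow_plus_iff by blast+
    interpret X: module A X by (rule X)
    have \<phi>0: "lin (fr (S (Suc m))) ?F0 (\<phi> 0)" using \<phi>(1)[of 0] by simp
    assume "eC z = \<zero>\<^bsub>Y\<^esub>"
    then obtain p where p: "p \<in> carrier (fr (S (Suc m)))" "e (z \<circ> Inl) = f p" "z \<circ> Inr = \<ominus>\<^bsub>?Fm\<^esub> D m p"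
      using ker[OF lin_closed[OF e a] b] unfolding eC_def by blast
    have pc: "\<phi> 0 p \<in> carrier ?F0" by (rule lin_closed[OF \<phi>0 p(1)])
    have "e ((z \<circ> Inl) \<ominus>\<^bsub>?F0\<^esub> \<phi> 0 p) = \<zero>\<^bsub>X\<^esub>"
      unfolding lin_minus[OF e module_fr X a pc] p(2) \<phi>(2)[OF p(1)] unfolding a_minus_def by (rule X.r_neg[OF lin_closed[OF f(1) p(1)]])
    then obtain a' where a': "a' \<in> carrier (fr (S (Suc 0)))" "D 0 a' = (z \<circ> Inl) \<ominus>\<^bsub>?F0\<^esub> \<phi> 0 p"
      using r(5)[OF F0.minus_closed[OF a pc]] by blast
    have w: "case_sum a' p \<in> carrier (fr (?CS (Suc 0)))" unfolding CS1 pow_plus_iff case_sum_o_inj using a' p by blast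
    have "D 0 a' \<oplus>\<^bsub>?F0\<^esub> \<phi> 0 p = z \<circ> Inl" unfolding a'(2) by (rule minus_add_cancel[OF module_fr a pc])
    then have "?CD 0 (case_sum a' p) = case_sum (z \<circ> Inl) (z \<circ> Inr)"
      unfolding CD0 coneD_def case_sum_o_inj add_0 p(3)[symmetric] by (simp only:)
    also have "\<dots> = z" by (auto simp: fun_eq_iff split: sum.split)
    finally show "\<exists>w\<in>carrier (fr (?CS (Suc 0))). z = ?CD 0 w" using w by metis
  next
    have \<phi>0: "lin (fr (S (Suc m))) ?F0 (\<phi> 0)" using \<phi>(1)[of 0] by simp
    interpret X: module A X by (rule X)
    assume "\<exists>w\<in>carrier (fr (?CS (Suc 0))). z = ?CD 0 w"
    then obtain w where w: "w \<in> carrier (fr (?CS (Suc 0)))" "z = ?CD 0 w" by blast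
    have a: "w \<circ> Inl \<in> carrier (fr (S (Suc 0)))" and p: "w \<circ> Inr \<in> carrier (fr (S (Suc m)))"
      using w(1) unfolding CS1 pow_plus_iff by blast+
    have zz: "z \<circ> Inl = D 0 (w \<circ> Inl) \<oplus>\<^bsub>?F0\<^esub> \<phi> 0 (w \<circ> Inr)" "z \<circ> Inr = \<ominus>\<^bsub>?Fm\<^esub> D m (w \<circ> Inr)"
      unfolding w(2) CD0 coneD_def case_sum_o_inj add_0 by (rule refl)+
    have "e (z \<circ> Inl) = f (w \<circ> Inr)"
      unfolding zz(1) lin_add[OF e lin_closed[OF L a] lin_closed[OF \<phi>0 p]] r(6)[OF a] \<phi>(2)[OF p]
      by (rule X.l_zero[OF lin_closed[OF f(1) p]])
    moreover have zc: "z \<circ> Inl \<in> carrier ?F0" "z \<circ> Inr \<in> carrier ?Fm" using z unfolding CS0 pow_plus_iff by blast+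
    ultimately show "eC z = \<zero>\<^bsub>Y\<^esub>" unfolding eC_def using ker[OF lin_closed[OF e zc(1)] zc(2)] p zz(2) by blast
  qed
  have "tor_exact (self_mod A) S D i" for i using R unfolding free_resol_def by blast
  \<comment> \<open>Exactness of the cone is the same long exact sequence argument, with
    coefficients A.\<close>
  then have "tor_exact (self_mod A) ?CS ?CD i" for i using cone_tor_exact[OF F \<phi>(1,3) module_self] by blast
  then have RC: "free_resol ?CS ?CD Y eC" unfolding free_resol_def using CF Y eC surjC kerC by blast
  show "tor_exact N SY DY j" if "tor_exact N S D j" "tor_exact N S D (j + m)"
    by (rule tor_exact_independent[OF RC RY N cone_tor_exact[OF F \<phi>(1,3) N that]])
  assume "tor_exact N SY DY j" "tor_exact N SY DY (Suc j)"
  then have "tor_exact N ?CS ?CD j" "tor_exact N ?CS ?CD (Suc j)" using tor_exact_independent[OF RY RC N] by blast+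
  then show "tor_exact N S D (Suc (j + m)) \<longleftrightarrow> tor_exact N S D j"
    using cone_shift_up[OF F \<phi>(1,3) N] cone_shift_down[OF F \<phi>(1,3) N] by blast
qed

section \<open>The pushout defining K_eta\<close>

lemma dsum_simps:
  "carrier (dsum_mod M N) = carrier M \<times> carrier N" "\<zero>\<^bsub>dsum_mod M N\<^esub> = (\<zero>\<^bsub>M\<^esub>, \<zero>\<^bsub>N\<^esub>)"
  "(x, y) \<oplus>\<^bsub>dsum_mod M N\<^esub> (x', y') = (x \<oplus>\<^bsub>M\<^esub> x', y \<oplus>\<^bsub>N\<^esub> y')"
  "a \<odot>\<^bsub>dsum_mod M N\<^esub> (x, y) = (a \<odot>\<^bsub>M\<^esub> x, a \<odot>\<^bsub>N\<^esub> y)"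
  by (simp_all add: dsum_mod_def)

lemma module_dsum:
  assumes M: "module A M" and N: "module A N" shows "module A (dsum_mod M N)"
proof -
  interpret M: module A M by fact
  interpret N: module A N by fact
  show ?thesis
  proof (rule moduleI)
    show "abelian_group (dsum_mod M N)"
    proof (rule abelian_groupI)
      fix x assume "x \<in> carrier (dsum_mod M N)"
      then obtain a b where "x = (a, b)" "a \<in> carrier M" "b \<in> carrier N" by (auto simp: dsum_simps)
      then show "\<exists>y\<in>carrier (dsum_mod M N). y \<oplus>\<^bsub>dsum_mod M N\<^esub> x = \<zero>\<^bsub>dsum_mod M N\<^esub>"
        by (intro bexI[of _ "(\<ominus>\<^bsub>M\<^esub> a, \<ominus>\<^bsub>N\<^esub> b)"]) (simp_all add: dsum_simps M.l_neg N.l_neg)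
    qed (auto simp: dsum_simps M.a_ac N.a_ac)
  qed (auto simp: dsum_simps is_cring M.smult_l_distr N.smult_l_distr M.smult_r_distr N.smult_r_distr M.smult_assoc1 N.smult_assoc1)
qed

text \<open>\<open>K_mod\<close> is rewritten as X + P_m modulo the elements (f p, -d p), with m = n
  - 1 and f a cocycle on P_n; this is the shape treated by \<open>extension_tor_exact\<close>,
  whichever representative the choice operator picks.\<close>

lemma K_step:
  assumes X: "fg_module A X" and Y: "fg_module A Y" and n: "n > 0" and \<eta>: "\<eta> \<in> carrier (ext_mod A n X X)"
    and iso: "mod_iso A Y (K_mod A n X X \<eta>)" and N: "module A N"
  shows "tor_exact N (res_idx X) (res_d X) j \<Longrightarrow> tor_exact N (res_idx X) (res_d X) (j + nat (n - 1)) \<Longrightarrow> tor_exact N (res_idx Y) (res_d Y) j"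
    "tor_exact N (res_idx Y) (res_d Y) j \<Longrightarrow> tor_exact N (res_idx Y) (res_d Y) (Suc j) \<Longrightarrow>
      tor_exact N (res_idx X) (res_d X) (Suc (j + nat (n - 1))) \<longleftrightarrow> tor_exact N (res_idx X) (res_d X) j"
proof -
  define m where "m = nat (n - 1)"
  have nm: "n = int m + 1" using n by (simp add: m_def)
  have XM: "module A X" and YM: "module A Y" using X Y fg_module_D by blast+
  interpret XM: module A X by (rule XM)
  obtain e where R: "free_resol (res_idx X) (res_d X) X e" using min_res_free_resol[OF X] by blast
  obtain eY where RY: "free_resol (res_idx Y) (res_d Y) Y eY" using min_res_free_resol[OF Y] by blast
  note F = free_resolD(1)[OF R]
  note L = free_cx_D(2)[OF F] and DD = free_cx_D(3)[OF F]
  let ?Fm = "fr (res_idx X m)" and ?F = "fr (res_idx X (Suc m))" and ?F2 = "fr (res_idx X (Suc (Suc m)))"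
  interpret Fm: module A ?Fm by (rule module_fr)
  interpret F1: module A ?F by (rule module_fr)
  have FM: "free_mod A {..<k} = fr {..<k}" for k :: nat by (rule free_mod_eq) simp
  have rm: "res_mod A X n = ?F" "res_mod A X (n - 1) = ?Fm" "res_mod A X (n + 1) = ?F2"
    "res_diff A X n = res_d X m" "res_diff A X (n + 1) = res_d X (Suc m)"
    by (simp_all add: res_mod_def res_diff_def FM res_idx_def res_d_def nm add.commute add.left_commute)
  let ?U = "res_d X (Suc m) ` carrier ?F2"
  have U: "submodule ?U A ?F" by (rule sub_image[OF module_fr module_fr L sub_carrier[OF module_fr]])
  have syz: "syzygy A n X = quot_mod ?F ?U" "syzygy_proj A n X p = ?U +>\<^bsub>?F\<^esub> p" for p
    by (simp_all add: syzygy_def syzygy_proj_def rm)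
  let ?Q = "quot_mod ?F ?U"
  have Q: "module A ?Q" by (rule module_quot[OF module_fr U])
  \<comment> \<open>The choice in \<open>K_mod\<close> is meaningful only if a representative
    exists: a cocycle in the class vanishes on the image of the next differential and so factors
    through the syzygy.\<close>
  have ex: "\<exists>f. represents A n X X f \<eta>"
  proof -
    obtain c where c: "c \<in> ext_cocycles A n X X"
      "\<eta> = ext_coboundaries A n X X +>\<^bsub>(hom_mod A ?F X)\<lparr>carrier := ext_cocycles A n X X\<rparr>\<^esub> c"
      using \<eta> unfolding ext_mod_def quot_carrier rm by auto
    have ch: "c \<in> mod_hom A ?F X" "\<And>p. p \<in> carrier ?F2 \<Longrightarrow> c (res_d X (Suc m) p) = \<zero>\<^bsub>X\<^esub>"
      using c(1) unfolding ext_cocycles_def rm by blast+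
    have cl: "lin ?F X c" by (rule mod_hom_lin[OF ch(1)])
    let ?z = "\<lambda>p\<in>carrier ?F. \<zero>\<^bsub>X\<^esub>"
    have "(\<lambda>x\<in>carrier ?Fm. \<zero>\<^bsub>X\<^esub>) \<in> mod_hom A ?Fm X" by (rule lin_restrict[OF lin_const_zero[OF XM] module_fr])
    moreover have "?z = (\<lambda>p\<in>carrier ?F. (\<lambda>x\<in>carrier ?Fm. \<zero>\<^bsub>X\<^esub>) (res_d X m p))"
      by (rule restrict_ext) (simp add: lin_closed[OF L])
    ultimately have zB: "?z \<in> ext_coboundaries A n X X" unfolding ext_coboundaries_def rm
      by (intro CollectI exI[where x="\<lambda>x\<in>carrier ?Fm. \<zero>\<^bsub>X\<^esub>"] conjI)
    have "?z \<oplus>\<^bsub>(hom_mod A ?F X)\<lparr>carrier := ext_cocycles A n X X\<rparr>\<^esub> c = (\<lambda>p\<in>carrier ?F. \<zero>\<^bsub>X\<^esub> \<oplus>\<^bsub>X\<^esub> c p)"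
      by (auto simp: hom_mod_def intro!: restrict_ext)
    also have "\<dots> = restrict c (carrier ?F)" by (rule restrict_ext) (simp add: lin_closed[OF cl])
    also have "\<dots> = c" using ch(1) unfolding mod_hom_iff by (simp add: extensional_restrict)
    finally have c\<eta>: "c \<in> \<eta>" unfolding c(2) rcos_def' using zB by (metis (mono_tags, lifting) mem_Collect_eq)
    have "c u = \<zero>\<^bsub>X\<^esub>" if "u \<in> ?U" for u using that ch(2) by blast
    from quot_lift[OF module_fr XM U cl this] obtain h where h: "lin ?Q X h" "\<forall>x\<in>carrier ?F. h (?U +>\<^bsub>?F\<^esub> x) = c x" by blast
    have 1: "restrict h (carrier ?Q) \<in> mod_hom A ?Q X" by (rule lin_restrict[OF h(1) Q])
    have "(\<lambda>p\<in>carrier ?F. restrict h (carrier ?Q) (?U +>\<^bsub>?F\<^esub> p)) = restrict c (carrier ?F)"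
      by (rule restrict_ext) (use h(2) lin_closed[OF quot_proj_lin[OF module_fr U]] in simp)
    also have "\<dots> = c" using ch(1) unfolding mod_hom_iff by (simp add: extensional_restrict)
    finally have "represents A n X X (restrict h (carrier ?Q)) \<eta>" unfolding represents_def syz rm using 1 c\<eta> by simp
    then show ?thesis by blast
  qed
  define f0 where "f0 = (SOME f. represents A n X X f \<eta>)"
  have "represents A n X X f0 \<eta>" unfolding f0_def by (rule someI_ex[OF ex])
  then have f0: "lin ?Q X f0" unfolding represents_def syz using mod_hom_lin by blast
  define f where "f p = f0 (?U +>\<^bsub>?F\<^esub> p)" for p
  have f: "lin ?F X f" unfolding f_def by (rule lin_comp[OF quot_proj_lin[OF module_fr U] f0])
  have fD: "f (res_d X (Suc m) x) = \<zero>\<^bsub>X\<^esub>" if x: "x \<in> carrier ?F2" for x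
  proof -
    have "?U +>\<^bsub>?F\<^esub> res_d X (Suc m) x = ?U" using rcos_zero_iff[OF module_fr U lin_closed[OF L x]] x by blast
    then show ?thesis using lin_zero[OF f0 Q XM] by (simp add: f_def quot_zero)
  qed
  let ?S = "dsum_mod X ?Fm"
  have S: "module A ?S" by (rule module_dsum[OF XM module_fr])
  define g where "g p = (f p, \<ominus>\<^bsub>?Fm\<^esub> res_d X m p)" for p
  have nl: "lin ?F ?Fm (\<lambda>p. \<ominus>\<^bsub>?Fm\<^esub> res_d X m p)" by (rule lin_uminus[OF L module_fr])
  have g: "lin ?F ?S g" unfolding lin_def g_def
    using lin_closed[OF f] lin_closed[OF nl] lin_add[OF f] lin_add[OF nl] lin_smult[OF f] lin_smult[OF nl]
    by (auto simp: dsum_simps simp del: pow_simps)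
  let ?R = "g ` carrier ?F"
  have Rs: "submodule ?R A ?S" by (rule sub_image[OF module_fr S g sub_carrier[OF module_fr]])
  \<comment> \<open>The differential is constant on a coset, so \<open>syzygy_incl\<close> extracts
    the element of an actual singleton.\<close>
  have incl: "syzygy_incl A n X (?U +>\<^bsub>?F\<^esub> p) = res_d X m p" if p: "p \<in> carrier ?F" for p
  proof -
    have "res_d X m w = res_d X m p" if w: "w \<in> ?U +>\<^bsub>?F\<^esub> p" for w
    proof -
      obtain u where u: "u \<in> ?U" "w = u \<oplus>\<^bsub>?F\<^esub> p" using w unfolding rcos_def' by blast
      have "res_d X m u = \<zero>\<^bsub>?Fm\<^esub>" using u(1) DD by auto
      then show ?thesis unfolding u(2) lin_add[OF L sub_in[OF U u(1)] p] using Fm.l_zero[OF lin_closed[OF L p]] by (simp only:)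
    qed
    moreover have "p \<in> ?U +>\<^bsub>?F\<^esub> p" using abelian_subgroup.a_rcos_self[OF submodule_abelian_subgroup[OF module_fr U] p] .
    ultimately have "res_d X m ` (?U +>\<^bsub>?F\<^esub> p) = {res_d X m p}" by blast
    then show ?thesis unfolding syzygy_incl_def rm by simp
  qed
  have "carrier ?Q = (\<lambda>p. ?U +>\<^bsub>?F\<^esub> p) ` carrier ?F" by (rule Set.set_eqI) (simp only: quot_carrier image_iff)
  then have "(\<lambda>w. (f0 w, \<ominus>\<^bsub>?Fm\<^esub> syzygy_incl A n X w)) ` carrier ?Q = (\<lambda>p. (f0 (?U +>\<^bsub>?F\<^esub> p), \<ominus>\<^bsub>?Fm\<^esub> syzygy_incl A n X (?U +>\<^bsub>?F\<^esub> p))) ` carrier ?F"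
    by (simp only: image_image)
  also have "\<dots> = ?R" by (rule image_cong[OF refl]) (simp add: g_def f_def incl)
  finally have K: "K_mod A n X X \<eta> = quot_mod ?S ?R"
    unfolding K_mod_def syzygy_pushout_def f0_def[symmetric] syz rm by simp
  let ?E = "quot_mod ?S ?R"
  have E: "module A ?E" by (rule module_quot[OF S Rs])
  obtain i where i: "i \<in> mod_hom A Y ?E" "bij_betw i (carrier Y) (carrier ?E)" using iso unfolding K mod_iso_def by blast
  define gi where "gi = inv_into (carrier Y) i"
  have gi: "lin ?E Y gi" unfolding gi_def by (rule mod_iso_inv[OF YM E i])
  have igi: "i (gi w) = w" if "w \<in> carrier ?E" for w using that i(2) by (simp add: gi_def bij_betw_def f_inv_into_f)
  have gii: "gi (i y) = y" if "y \<in> carrier Y" for y using that i(2) by (simp add: gi_def bij_betw_def)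
  \<comment> \<open>The quotient map of X + P_m followed by the isomorphism onto \<open>Y\<close>;
    its two restrictions are the structure maps of the pushout.\<close>
  define \<pi> where "\<pi> x = gi (?R +>\<^bsub>?S\<^esub> x)" for x
  have \<pi>: "lin ?S Y \<pi>" unfolding \<pi>_def by (rule lin_comp[OF quot_proj_lin[OF S Rs] gi])
  have \<pi>0: "\<pi> x = \<zero>\<^bsub>Y\<^esub> \<longleftrightarrow> x \<in> ?R" if x: "x \<in> carrier ?S" for x
  proof -
    have xE: "?R +>\<^bsub>?S\<^esub> x \<in> carrier ?E" by (rule lin_closed[OF quot_proj_lin[OF S Rs] x])
    have "\<pi> x = \<zero>\<^bsub>Y\<^esub> \<longleftrightarrow> ?R +>\<^bsub>?S\<^esub> x = \<zero>\<^bsub>?E\<^esub>"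
      using igi[OF xE] lin_zero[OF mod_hom_lin[OF i(1)] YM E] lin_zero[OF gi E YM] unfolding \<pi>_def by metis
    then show ?thesis unfolding quot_zero using rcos_zero_iff[OF S Rs x] by blast
  qed
  define pX where "pX x = \<pi> (x, \<zero>\<^bsub>?Fm\<^esub>)" for x
  define pF where "pF b = \<pi> (\<zero>\<^bsub>X\<^esub>, b)" for b
  have iX: "lin X ?S (\<lambda>x. (x, \<zero>\<^bsub>?Fm\<^esub>))" unfolding lin_def using Fm.zero_closed Fm.l_zero[OF Fm.zero_closed] Fm.smult_r_null
    by (auto simp: dsum_simps simp del: pow_simps)
  have iF: "lin ?Fm ?S (\<lambda>b. (\<zero>\<^bsub>X\<^esub>, b))" unfolding lin_def by (auto simp: dsum_simps simp del: pow_simps)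
  have pX: "lin X Y pX" unfolding pX_def by (rule lin_comp[OF iX \<pi>])
  have pF: "lin ?Fm Y pF" unfolding pF_def by (rule lin_comp[OF iF \<pi>])
  have sum: "pX x \<oplus>\<^bsub>Y\<^esub> pF b = \<pi> (x, b)" if xb: "x \<in> carrier X" "b \<in> carrier ?Fm" for x b
    unfolding pX_def pF_def lin_add[OF \<pi> lin_closed[OF iX xb(1)] lin_closed[OF iF xb(2)], symmetric]
    using xb by (simp add: dsum_simps del: pow_simps)
  have surj: "\<exists>x\<in>carrier X. \<exists>b\<in>carrier ?Fm. y = pX x \<oplus>\<^bsub>Y\<^esub> pF b" if y: "y \<in> carrier Y" for y
  proof -
    obtain s where s: "s \<in> carrier ?S" "i y = ?R +>\<^bsub>?S\<^esub> s" using lin_closed[OF mod_hom_lin[OF i(1)] y] unfolding quot_carrier by blast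
    obtain x b where xb: "s = (x, b)" "x \<in> carrier X" "b \<in> carrier ?Fm" using s(1) by (auto simp: dsum_simps)
    have "y = \<pi> s" using gii[OF y] s(2) by (simp add: \<pi>_def)
    then have "y = pX x \<oplus>\<^bsub>Y\<^esub> pF b" unfolding sum[OF xb(2,3)] xb(1) .
    then show ?thesis using xb(2,3) by blast
  qed
  have ker: "pX x \<oplus>\<^bsub>Y\<^esub> pF b = \<zero>\<^bsub>Y\<^esub> \<longleftrightarrow> (\<exists>p\<in>carrier ?F. x = f p \<and> b = \<ominus>\<^bsub>?Fm\<^esub> res_d X m p)"
    if xb: "x \<in> carrier X" "b \<in> carrier ?Fm" for x b
  proof -
    have "(x, b) \<in> carrier ?S" using xb by (simp add: dsum_simps)
    then show ?thesis unfolding sum[OF xb] using \<pi>0 by (auto simp: g_def)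
  qed
  note T = extension_tor_exact[OF R f fD pX pF surj ker RY N]
  show "tor_exact N (res_idx X) (res_d X) j \<Longrightarrow> tor_exact N (res_idx X) (res_d X) (j + nat (n - 1)) \<Longrightarrow> tor_exact N (res_idx Y) (res_d Y) j"
    "tor_exact N (res_idx Y) (res_d Y) j \<Longrightarrow> tor_exact N (res_idx Y) (res_d Y) (Suc j) \<Longrightarrow>
      tor_exact N (res_idx X) (res_d X) (Suc (j + nat (n - 1))) \<longleftrightarrow> tor_exact N (res_idx X) (res_d X) j"
    unfolding m_def[symmetric] by (rule T; assumption)+
qed

end

subsection \<open>Propagation of vanishing\<close>

text \<open>The window has m + 1 consecutive places, a full period, and so meets every residue
  class.\<close>

lemma periodic_everywhere:
  fixes p :: "nat \<Rightarrow> bool"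
  assumes per: "\<And>j. j \<ge> g \<Longrightarrow> p (Suc (j + m)) = p j" and b: "b \<ge> g" and win: "\<And>j. b \<le> j \<Longrightarrow> j \<le> b + m \<Longrightarrow> p j"
  shows "j \<ge> g \<Longrightarrow> p j"
proof -
  have up: "p j" if "j \<ge> b" for j
    using that
  proof (induction j rule: less_induct)
    case (less j)
    show ?case
    proof (cases "j \<le> b + m")
      case False
      then have "p (j - Suc m)" using less by simp
      then show ?thesis using per[of "j - Suc m"] False b by simp
    qed (use win less.prems in simp)
  qed
  \<comment> \<open>Downward from the window. Subtraction is truncated, so all cases with
    \<open>i\<close> beyond \<open>b\<close> speak of place 0.\<close>
  have "p (b - i) \<or> b - i < g" for i
  proof (induction i rule: less_induct)
    case (less i)
    show ?case
    proof (cases "i \<ge> Suc m \<and> b - i \<ge> g \<and> i \<le> b")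
      case True
      then have "p (b - (i - Suc m))" using less[of "i - Suc m"] by fastforce
      then show ?thesis using per[of "b - i"] True by (simp add: Suc_diff_le)
    next
      case False
      then consider "i \<le> m" | "b - i < g" | "i > b" "i > m" by linarith
      then show ?thesis
      proof cases
        case 1
        have "p (Suc (b - i + m))" using up 1 by simp
        then show ?thesis using per[of "b - i"] by (cases "b - i < g") auto
      next
        case 3
        show ?thesis
        proof (cases "g = 0")
          case True
          then have "p (Suc (0 + m)) = p 0" by (intro per) simp
          moreover have "p (Suc m)"
          proof (cases "Suc m \<ge> b")
            case False
            then show ?thesis using less[of "b - Suc m"] True 3 by simp
          qed (use up in simp)
          ultimately show ?thesis using 3 by simp
        qed (use 3 in simp)
      qed simp
    qed
  qed
  from this[of "b - j"] show "j \<ge> g \<Longrightarrow> p j" using up[of j] by (cases "j \<ge> b") auto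
qed

text \<open>Here \<open>v i j\<close> stands for Tor_(j+1)(K_i, N) = 0 and \<open>m i\<close> for
  |eta_i| - 1. Induction on c - i: a window for stage i yields one for stage i + 1 that is shorter
  by \<open>m (Suc i)\<close>, so stage i + 1 vanishes from \<open>g\<close> on. Then stage i is
  periodic there, and its own window contains a full period.\<close>

lemma window_vanishing:
  fixes v :: "nat \<Rightarrow> nat \<Rightarrow> bool" and m :: "nat \<Rightarrow> nat"
  assumes push: "\<And>i j. i < c \<Longrightarrow> v i j \<Longrightarrow> v i (j + m (Suc i)) \<Longrightarrow> v (Suc i) j"
    and per: "\<And>i j. i < c \<Longrightarrow> v (Suc i) j \<Longrightarrow> v (Suc i) (Suc j) \<Longrightarrow> v i (Suc (j + m (Suc i))) = v i j"
    and last: "\<And>j. j \<ge> g \<Longrightarrow> v c j" and b: "b \<ge> g"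
  shows "i \<le> c \<Longrightarrow> (\<And>j. b \<le> j \<Longrightarrow> j \<le> b + (\<Sum>l=Suc i..c. m l) \<Longrightarrow> v i j) \<Longrightarrow> j \<ge> g \<Longrightarrow> v i j"
proof (induction "c - i" arbitrary: i j)
  case 0
  then show ?case using last by simp
next
  case (Suc d i j)
  have i: "i < c" using Suc.hyps(2) by simp
  have s: "(\<Sum>l=Suc i..c. m l) = m (Suc i) + (\<Sum>l=Suc (Suc i)..c. m l)" using i by (simp add: sum.atLeast_Suc_atMost)
  have v': "v (Suc i) j" if j: "j \<ge> g" for j
  proof (rule Suc.hyps(1))
    show "d = c - Suc i" using Suc.hyps(2) by simp
    show "Suc i \<le> c" using i by simp
    show "v (Suc i) j'" if "b \<le> j'" "j' \<le> b + (\<Sum>l=Suc (Suc i)..c. m l)" for j'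
      by (rule push[OF i]; rule Suc.prems(2)) (use that s in auto)
  qed (rule j)
  show ?case
  proof (rule periodic_everywhere[where p="v i" and g=g and m="m (Suc i)" and b=b])
    show "v i (Suc (j + m (Suc i))) = v i j" if "j \<ge> g" for j by (rule per[OF i]) (use v' that in auto)
    show "v i j" if "b \<le> j" "j \<le> b + m (Suc i)" for j by (rule Suc.prems(2)) (use that s in auto)
  qed (use b Suc.prems(3) in auto)
qed

lemma tail_vanishing:
  fixes v :: "nat \<Rightarrow> nat \<Rightarrow> bool" and m :: "nat \<Rightarrow> nat"
  assumes push: "\<And>i j. i < c \<Longrightarrow> v i j \<Longrightarrow> v i (j + m (Suc i)) \<Longrightarrow> v (Suc i) j"
    and first: "\<And>j. j \<ge> q \<Longrightarrow> v 0 j"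
  shows "i \<le> c \<Longrightarrow> j \<ge> q \<Longrightarrow> v i j"
proof (induction i arbitrary: j)
  case (Suc i)
  then show ?case by (intro push) auto
qed (use first in simp)

context local_noeth
begin

section \<open>Reading off the Tor modules in all integer degrees\<close>

lemma act_in_mm_smult:
  assumes N: "module A N" and u: "u \<in> carrier (pow_mod N S)" and f: "\<And>k. k \<in> S \<Longrightarrow> f (unit_vec A k) i \<in> \<mm>"
  shows "act N S f u i \<in> ideal_smult A \<mm> N"
proof -
  interpret N: module A N by (rule N)
  have sb: "submodule (ideal_smult A \<mm> N) A N" by (rule ideal_smult_sub[OF N]) (use mm_in in blast)
  have at: "u k \<in> carrier N" for k using pow_at[OF N u] .
  have t: "a \<odot>\<^bsub>N\<^esub> x \<in> ideal_smult A \<mm> N" if "a \<in> \<mm>" "x \<in> carrier N" for a x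
  proof -
    have "a \<odot>\<^bsub>N\<^esub> x \<in> {a \<odot>\<^bsub>N\<^esub> x | a x. a \<in> \<mm> \<and> x \<in> carrier N}" using that by blast
    then show ?thesis unfolding ideal_smult_def using span_incl by (rule subsetD[rotated])
  qed
  have "(\<Oplus>\<^bsub>N\<^esub>k\<in>T. f (unit_vec A k) i \<odot>\<^bsub>N\<^esub> u k) \<in> ideal_smult A \<mm> N" if "finite T" "T \<subseteq> S" for T
    using that
  proof (induction T rule: finite_induct)
    case empty
    then show ?case using sub_zero[OF sb] by simp
  next
    case (insert k T)
    have c: "f (unit_vec A k) i \<odot>\<^bsub>N\<^esub> u k \<in> carrier N" if "k \<in> S" for k using f[OF that] at mm_in by simp
    have "(\<Oplus>\<^bsub>N\<^esub>k\<in>insert k T. f (unit_vec A k) i \<odot>\<^bsub>N\<^esub> u k)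
      = f (unit_vec A k) i \<odot>\<^bsub>N\<^esub> u k \<oplus>\<^bsub>N\<^esub> (\<Oplus>\<^bsub>N\<^esub>k\<in>T. f (unit_vec A k) i \<odot>\<^bsub>N\<^esub> u k)"
      by (rule N.finsum_insert[OF insert(1,2)]) (use c insert.prems in auto)
    then show ?case using sub_add[OF sb t[OF f at] insert.IH] insert.prems by simp
  qed
  then show ?thesis unfolding act_def using sub_zero[OF sb] by (cases "finite S") (auto simp: N.finsum_infinite)
qed

lemma min_res_int_degrees:
  assumes X: "fg_module A X"
  shows "lin (fr {..<fst (min_res A X) n}) (fr {..<fst (min_res A X) (n - 1)}) (snd (min_res A X) n)"
    "n < 0 \<Longrightarrow> fst (min_res A X) n = 0"
proof -
  let ?r = "fst (min_res A X)" and ?d = "snd (min_res A X)"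
  have FM: "free_mod A {..<k} = fr {..<k}" for k :: nat by (rule free_mod_eq) simp
  obtain e where "min_free_resolution A X ?r ?d e" using min_res_is_resolution[OF X] by blast
  note mfr = this[unfolded min_free_resolution_def resolution_def FM]
  have "?d n \<in> mod_hom A (fr {..<?r n}) (fr {..<?r (n - 1)})" using mfr by blast
  then show "lin (fr {..<?r n}) (fr {..<?r (n - 1)}) (?d n)" by (rule mod_hom_lin)
  show "?r n = 0" if "n < 0"
  proof (rule ccontr)
    assume "?r n \<noteq> 0"
    then have "unit_vec A 0 \<in> carrier (fr {..<?r n})" by (intro unit_vec_in) simp
    moreover have "carrier (fr {..<?r n}) = {\<lambda>_. \<zero>}" using mfr that unfolding is_zero_mod_def by simp
    ultimately have "unit_vec A (0::nat) 0 = \<zero>" by (simp add: fun_eq_iff)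
    then have "\<one> = \<zero>" by (simp add: unit_vec_def)
    then show False using mm_one mm_zero by simp
  qed
qed

lemma tor_zero_iff_exact:
  assumes M: "fg_module A M" and N: "module A N" and t: "t > 0"
  shows "is_zero_mod (tor_mod A t M N) \<longleftrightarrow> tor_exact N (res_idx M) (res_d M) (nat (t - 1))"
proof -
  define j where "j = nat (t - 1)"
  have t: "t = int j + 1" "int j + 1 + 1 = int (Suc (Suc j))" "int j + 1 = int (Suc j)" using t by (auto simp: j_def)
  show ?thesis unfolding tor_zero_iff[OF N min_res_int_degrees(1)[OF M]] tor_exact_def j_def[symmetric] res_idx_def res_d_def
    unfolding t(1) by (simp add: add.commute add.left_commute)
qed

lemma tor_negative_zero:
  assumes M: "fg_module A M" and N: "module A N" and t: "t < 0"
  shows "is_zero_mod (tor_mod A t M N)"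
  unfolding tor_zero_iff[OF N min_res_int_degrees(1)[OF M]]
proof (intro ballI impI)
  fix w assume "w \<in> carrier (pow_mod N {..<fst (min_res A M) t})"
  then have w: "w = (\<lambda>_. \<zero>\<^bsub>N\<^esub>)" using min_res_int_degrees(2)[OF M t] by (intro pow_empty) simp
  interpret P: module A "pow_mod N {..<fst (min_res A M) (t + 1)}" by (rule module_pow[OF N])
  have "act N {..<fst (min_res A M) (t + 1)} (snd (min_res A M) (t + 1)) (\<lambda>_. \<zero>\<^bsub>N\<^esub>) = (\<lambda>_. \<zero>\<^bsub>N\<^esub>)"
    using lin_zero[OF act_lin[OF N _ min_res_int_degrees(1)[OF M, of "t + 1"]] module_pow[OF N] module_pow[OF N]] by simp
  then show "\<exists>u\<in>carrier (pow_mod N {..<fst (min_res A M) (t + 1)}).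
      w = act N {..<fst (min_res A M) (t + 1)} (snd (min_res A M) (t + 1)) u"
    unfolding w using P.zero_closed by (intro bexI[of _ "\<lambda>_. \<zero>\<^bsub>N\<^esub>"]) simp_all
qed

text \<open>If M tensor N vanished, P_1 tensor N -> P_0 tensor N would be surjective; by minimality
  its image has coordinates in mN, so N = mN and Nakayama's lemma applies.\<close>

lemma tor_0_nonzero:
  assumes M: "fg_module A M" "\<not> is_zero_mod M" and N: "fg_module A N" "\<not> is_zero_mod N"
  shows "\<not> is_zero_mod (tor_mod A 0 M N)"
proof
  assume z: "is_zero_mod (tor_mod A 0 M N)"
  have NM: "module A N" by (rule fg_module_D[OF N(1)])
  interpret N: module A N by (rule NM)
  have MM: "module A M" by (rule fg_module_D[OF M(1)])
  obtain e where e: "lin (fr (res_idx M 0)) M e" "e ` carrier (fr (res_idx M 0)) = carrier M" using min_res_props(1)[OF M(1)] by blast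
  have "res_idx M 0 \<noteq> {}"
  proof
    assume S: "res_idx M 0 = {}"
    have "carrier M \<subseteq> {\<zero>\<^bsub>M\<^esub>}"
    proof
      fix x assume "x \<in> carrier M"
      then obtain v where v: "v \<in> carrier (fr (res_idx M 0))" "x = e v" using e(2) by blast
      have "v = (\<lambda>_. \<zero>)" using pow_empty[of v "self_mod A"] v(1) unfolding S by simp
      then show "x \<in> {\<zero>\<^bsub>M\<^esub>}" using v(2) lin_zero[OF e(1) module_fr MM] by simp
    qed
    then show False using M(2) e(1) MM module_fr lin_closed[OF e(1)] unfolding is_zero_mod_def
      by (metis lin_zero module.axioms(2) abelian_group.axioms(1) abelian_monoid.zero_closed empty_subsetI insert_subset subset_antisym)
  qed
  then obtain s where s: "s \<in> res_idx M 0" by blast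
  have ex: "\<exists>u\<in>carrier (pow_mod N (res_idx M (Suc 0))). w = act N (res_idx M (Suc 0)) (res_d M 0) u" if w: "w \<in> carrier (pow_mod N (res_idx M 0))" for w
  proof -
    have "w \<in> carrier (pow_mod N {..<fst (min_res A M) 0})" using w by (simp add: res_idx_def)
    moreover have "act N {..<fst (min_res A M) 0} (snd (min_res A M) 0) w = (\<lambda>_. \<zero>\<^bsub>N\<^esub>)"
    proof (rule pow_empty)
      have "act N {..<fst (min_res A M) 0} (snd (min_res A M) 0) w \<in> carrier (pow_mod N {..<fst (min_res A M) (0 - 1)})"
        by (rule lin_closed[OF act_lin[OF NM _ min_res_int_degrees(1)[OF M(1), of 0]]]) (use w in \<open>simp_all add: res_idx_def del: pow_simps\<close>)
      then show "act N {..<fst (min_res A M) 0} (snd (min_res A M) 0) w \<in> carrier (pow_mod N {})"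
        using min_res_int_degrees(2)[OF M(1), of "-1"] by simp
    qed
    ultimately show ?thesis using z unfolding tor_zero_iff[OF NM min_res_int_degrees(1)[OF M(1)]] res_idx_def res_d_def by simp
  qed
  have "{\<zero>\<^bsub>N\<^esub>} = carrier N"
  proof (rule Nakayama[OF N(1) sub_triv[OF NM]])
    fix n assume n: "n \<in> carrier N"
    obtain u where u: "u \<in> carrier (pow_mod N (res_idx M (Suc 0)))" "single N s n = act N (res_idx M (Suc 0)) (res_d M 0) u"
      using ex[OF single_in[OF NM s n]] by blast
    have "act N (res_idx M (Suc 0)) (res_d M 0) u s \<in> ideal_smult A \<mm> N"
      by (rule act_in_mm_smult[OF NM u(1)]) (rule min_res_props(4)[OF M(1)])
    then have "n \<in> ideal_smult A \<mm> N" unfolding u(2)[symmetric] by (simp add: single_def)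
    moreover have "n \<ominus>\<^bsub>N\<^esub> n \<in> {\<zero>\<^bsub>N\<^esub>}" using n by (simp add: a_minus_def N.r_neg)
    ultimately show "\<exists>w\<in>ideal_smult A \<mm> N. n \<ominus>\<^bsub>N\<^esub> w \<in> {\<zero>\<^bsub>N\<^esub>}" by blast
  qed
  then show False using N(2) by (simp add: is_zero_mod_def)
qed

lemma tor_exact_empty:
  assumes F: "free_cx S D" and N: "module A N" and S: "S (Suc j) = {}" shows "tor_exact N S D j"
  unfolding tor_exact_def
proof (intro ballI impI)
  fix z assume "z \<in> carrier (pow_mod N (S (Suc j)))"
  then have z: "z = (\<lambda>_. \<zero>\<^bsub>N\<^esub>)" unfolding S by (rule pow_empty)
  interpret P: module A "pow_mod N (S (Suc (Suc j)))" by (rule module_pow[OF N])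
  have "act N (S (Suc (Suc j))) (D (Suc j)) (\<lambda>_. \<zero>\<^bsub>N\<^esub>) = (\<lambda>_. \<zero>\<^bsub>N\<^esub>)"
    using lin_zero[OF act_lin[OF N free_cx_D(1)[OF F] free_cx_D(2)[OF F]] module_pow[OF N] module_pow[OF N]] by simp
  then show "\<exists>w\<in>carrier (pow_mod N (S (Suc (Suc j)))). z = act N (S (Suc (Suc j))) (D (Suc j)) w"
    unfolding z using P.zero_closed by (intro bexI[of _ "\<lambda>_. \<zero>\<^bsub>N\<^esub>"]) simp_all
qed

lemma self_nonzero: "\<not> is_zero_mod (self_mod A)"
proof
  assume "is_zero_mod (self_mod A)"
  then have "\<one> = \<zero>" using one_closed unfolding is_zero_mod_def self_simps by blast
  then show False using mm_one mm_zero by simp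
qed

text \<open>The relative form with nothing divided out; what remains is to translate exactness of
  the resolution and the kernel of the augmentation.\<close>

lemma Auslander_Buchsbaum:
  assumes X: "fg_module A X" "\<not> is_zero_mod X" and F: "min_cx (res_idx X) (res_d X) g"
  shows "depth A (self_mod A) = depth A X + enat g"
proof -
  have XM: "module A X" by (rule fg_module_D[OF X(1)])
  obtain a where a: "rel_depth a (self_mod A) {\<zero>\<^bsub>self_mod A\<^esub>}" "depth A (self_mod A) = enat a" by (rule depth_obtain[OF fg_self self_nonzero])
  obtain k where k: "rel_depth k X {\<zero>\<^bsub>X\<^esub>}" "depth A X = enat k" by (rule depth_obtain[OF X])
  obtain e where R: "free_resol (res_idx X) (res_d X) X e" using min_res_free_resol[OF X(1)] by blast
  note r = free_resolD[OF R]
  interpret F0: module A "fr (res_idx X 0)" by (rule module_fr)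
  have ex: "exact_mod (self_mod A) {\<zero>\<^bsub>self_mod A\<^esub>} (res_idx X) (res_d X) j" for j
    using R unfolding tor_exact_exact_mod[OF r(1) module_self, symmetric] free_resol_def by blast
  have pw0: "v \<in> pow_sub (self_mod A) {\<zero>\<^bsub>self_mod A\<^esub>} T \<longleftrightarrow> v = (\<lambda>_. \<zero>)" for T :: "nat set" and v
    by (auto simp: pow_sub_def pow_carrier)
  have diff: "z \<ominus>\<^bsub>fr (res_idx X 0)\<^esub> y = (\<lambda>_. \<zero>) \<longleftrightarrow> z = y" if "z \<in> carrier (fr (res_idx X 0))" "y \<in> carrier (fr (res_idx X 0))" for z y
  proof
    assume "z \<ominus>\<^bsub>fr (res_idx X 0)\<^esub> y = (\<lambda>_. \<zero>)"
    then have "z = \<zero>\<^bsub>fr (res_idx X 0)\<^esub> \<oplus>\<^bsub>fr (res_idx X 0)\<^esub> y" using minus_add_cancel[OF module_fr that] by simp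
    then show "z = y" using F0.l_zero[OF that(2)] by (simp only:)
  next
    assume "z = y"
    then show "z \<ominus>\<^bsub>fr (res_idx X 0)\<^esub> y = (\<lambda>_. \<zero>)" using F0.r_neg[OF that(2)] by (simp add: a_minus_def)
  qed
  have "a = k + g"
  proof (rule rel_Auslander_Buchsbaum[OF F X(1) r(3,4) sub_triv[OF module_self] sub_triv[OF XM] a(1) k(1) ex])
    fix z assume z: "z \<in> carrier (fr (res_idx X 0))"
    have "z \<in> rel_bd (tC (self_mod A) (res_idx X)) (tD (self_mod A) (res_idx X) (res_d X)) (\<lambda>j. pow_sub (self_mod A) {\<zero>\<^bsub>self_mod A\<^esub>} (res_idx X j)) 0
      \<longleftrightarrow> (\<exists>w\<in>carrier (fr (res_idx X (Suc 0))). z \<ominus>\<^bsub>fr (res_idx X 0)\<^esub> res_d X 0 w = (\<lambda>_. \<zero>))"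
      unfolding rel_bd_def mem_Collect_eq pw0 using z act_self[OF free_cx_D(1)[OF r(1)] free_cx_D(2)[OF r(1)]] by (auto simp del: pow_simps)
    also have "\<dots> \<longleftrightarrow> (\<exists>w\<in>carrier (fr (res_idx X (Suc 0))). z = res_d X 0 w)"
      using diff[OF z lin_closed[OF free_cx_D(2)[OF r(1)]]] by blast
    also have "\<dots> \<longleftrightarrow> e z = \<zero>\<^bsub>X\<^esub>" using r(5)[OF z] r(6) by blast
    finally show "e z \<in> {\<zero>\<^bsub>X\<^esub>} \<longleftrightarrow> z \<in> rel_bd (tC (self_mod A) (res_idx X)) (tD (self_mod A) (res_idx X) (res_d X)) (\<lambda>j. pow_sub (self_mod A) {\<zero>\<^bsub>self_mod A\<^esub>} (res_idx X j)) 0"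
      by blast
  qed
  then show ?thesis unfolding a(2) k(2) by simp
qed

lemma cx_iso:
  assumes "module A X" "module A Y" "mod_iso A X Y" shows "cx A X = cx A Y"
  unfolding cx_def betti_def ext_mod_def ext_cocycles_def ext_coboundaries_def res_mod_def res_diff_def
    min_res_iso[OF assms] ..

text \<open>A nonzero finitely generated module has finite depth, the zero module infinite depth.
  Through the equality of depths this shows that the last module of the chain is nonzero.\<close>

lemma depth_nonzero: "depth A X = depth A M \<Longrightarrow> fg_module A M \<Longrightarrow> \<not> is_zero_mod M \<Longrightarrow> \<not> is_zero_mod X"
proof -
  assume e: "depth A X = depth A M" and M: "fg_module A M" "\<not> is_zero_mod M"
  obtain k where "depth A M = enat k" by (rule depth_obtain[OF M])
  then show ?thesis using e unfolding depth_def[of A X] by (auto split: if_splits)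
qed

text \<open>The number \<open>g\<close> is the projective dimension of the last module
  \<open>X\<close> and, by the Auslander-Buchsbaum formula and the equality of depths, equals depth
  A - depth M. The table \<open>v\<close> is left abstract so that the empty chain, with
  \<open>M\<close> itself as last module, is an instance.\<close>

lemma tor_bounds:
  fixes m :: "nat \<Rightarrow> nat"
  assumes M: "fg_module A M" "\<not> is_zero_mod M" and N: "fg_module A N" "\<not> is_zero_mod N"
    and X: "fg_module A X" "depth A X = depth A M" "cx A X = 0"
    and push: "\<And>i j. i < c \<Longrightarrow> v i j \<Longrightarrow> v i (j + m (Suc i)) \<Longrightarrow> v (Suc i) j"
    and per: "\<And>i j. i < c \<Longrightarrow> v (Suc i) j \<Longrightarrow> v (Suc i) (Suc j) \<Longrightarrow> v i (Suc (j + m (Suc i))) = v i j"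
    and first: "\<And>j. v 0 j = tor_exact N (res_idx M) (res_d M) j" and last: "\<And>j. v c j = tor_exact N (res_idx X) (res_d X) j"
  shows "\<exists>k n g. depth A (self_mod A) = enat (k + g) \<and> depth A M = enat k \<and> depth A N = enat n \<and>
    (\<forall>t>int g. (\<forall>i. 0 \<le> i \<and> i \<le> int (\<Sum>l=1..c. m l) \<longrightarrow> is_zero_mod (tor_mod A (t + i) M N)) \<longrightarrow>
       (\<forall>t>int g. is_zero_mod (tor_mod A t M N))) \<and>
    (\<forall>q. (\<forall>t>int q. is_zero_mod (tor_mod A t M N)) \<longrightarrow> g \<le> n + q)"
proof -
  have Xnz: "\<not> is_zero_mod X" by (rule depth_nonzero[OF X(2) M])
  have NM: "module A N" by (rule fg_module_D[OF N(1)])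
  obtain k where k: "depth A M = enat k" by (rule depth_obtain[OF M])
  obtain n where n: "rel_depth n N {\<zero>\<^bsub>N\<^esub>}" "depth A N = enat n" by (rule depth_obtain[OF N])
  obtain g where g: "min_cx (res_idx X) (res_d X) g" using cx_zero_min_cx[OF X(1) Xnz X(3)] by blast
  note F = g[unfolded min_cx_def, THEN conjunct1]
  have top: "v c j" if "j \<ge> g" for j
    unfolding last by (rule tor_exact_empty[OF F NM]) (use g that in \<open>simp add: min_cx_def\<close>)
  have tor: "is_zero_mod (tor_mod A t M N) \<longleftrightarrow> v 0 (nat (t - 1))" if "t > 0" for t
    unfolding first by (rule tor_zero_iff_exact[OF M(1) NM that])
  have 1: "is_zero_mod (tor_mod A s M N)"
    if t: "t > int g" and win: "\<And>i. 0 \<le> i \<Longrightarrow> i \<le> int (\<Sum>l=1..c. m l) \<Longrightarrow> is_zero_mod (tor_mod A (t + i) M N)"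
      and s: "s > int g" for t s
  proof -
    \<comment> \<open>Degree t is place t - 1 of the table, so t > g becomes a window starting at t
      - 1 >= g.\<close>
    have "v 0 (nat (s - 1))"
    proof (rule window_vanishing[where v=v and c=c and m=m and g=g and b="nat (t - 1)" and i=0, OF push per top])
      show "v 0 j" if j: "nat (t - 1) \<le> j" "j \<le> nat (t - 1) + (\<Sum>l=Suc 0..c. m l)" for j
      proof -
        have "is_zero_mod (tor_mod A (t + (int j + 1 - t)) M N)"
          by (rule win) (use j t in \<open>simp_all del: of_nat_sum\<close>)
        then show ?thesis using tor[of "int j + 1"] by simp
      qed
    qed (use t s in auto)
    then show ?thesis using tor[of s] s by simp
  qed
  have 2: "g \<le> n + q" if q: "\<And>t. t > int q \<Longrightarrow> is_zero_mod (tor_mod A t M N)" for q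
  proof (rule length_le[OF g NM sub_triv[OF NM] n(1)])
    fix j assume j: "q \<le> j"
    have "v c j"
    proof (rule tail_vanishing[where v=v and c=c and m=m and q=q, OF push])
      show "v 0 j" if "q \<le> j" for j using q[of "int j + 1"] tor[of "int j + 1"] that by simp
    qed (use j in auto)
    then show "exact_mod N {\<zero>\<^bsub>N\<^esub>} (res_idx X) (res_d X) j" unfolding last tor_exact_exact_mod[OF F NM] .
  qed
  have "depth A (self_mod A) = enat (k + g)" using Auslander_Buchsbaum[OF X(1) Xnz g] X(2) k by simp
  then show ?thesis using k n(2) 1 2 by blast
qed

text \<open>Proved in the cycle (i), (iii), (ii), (i). Tor of \<open>M\<close> and \<open>N\<close>
  is known here through the implications \<open>win\<close> and \<open>low\<close>, its vanishing
  below degree 0 and its nonvanishing in degree 0.\<close>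

lemma tor_equivalence:
  assumes M: "fg_module A M" "\<not> is_zero_mod M" and N: "fg_module A N" "\<not> is_zero_mod N"
    and d: "depth A (self_mod A) = enat (k + g)" "depth A M = enat k" "depth A N = enat n"
    and win: "\<And>t s. t > int g \<Longrightarrow> (\<And>i. 0 \<le> i \<Longrightarrow> i \<le> L \<Longrightarrow> is_zero_mod (tor_mod A (t + i) M N)) \<Longrightarrow>
       s > int g \<Longrightarrow> is_zero_mod (tor_mod A s M N)"
    and low: "\<And>q. (\<And>t. t > int q \<Longrightarrow> is_zero_mod (tor_mod A t M N)) \<Longrightarrow> g \<le> n + q"
  shows "((\<exists>t::int. ereal (real_of_int t) >
                      ereal_of_enat (depth A (self_mod A)) - ereal_of_enat (depth A M) \<and>
             (\<forall>i. 0 \<le> i \<and> i \<le> L \<longrightarrow> is_zero_mod (tor_mod A (t + i) M N)))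
          \<longleftrightarrow> q_tor A M N < \<infinity>)
       \<and> (q_tor A M N < \<infinity>
          \<longleftrightarrow>
            ereal_of_enat (depth A (self_mod A)) - ereal_of_enat (depth A M)
              - ereal_of_enat (depth A N) \<le> q_tor A M N \<and>
            q_tor A M N \<le> ereal_of_enat (depth A (self_mod A)) - ereal_of_enat (depth A M))"
    (is "(?i \<longleftrightarrow> ?ii) \<and> (?ii \<longleftrightarrow> ?iii)")
proof -
  have NM: "module A N" by (rule fg_module_D[OF N(1)])
  have e: "ereal_of_enat (depth A (self_mod A)) - ereal_of_enat (depth A M) = ereal (real g)"
    "ereal (real g) - ereal_of_enat (depth A N) = ereal (real g - real n)" unfolding d by simp_all
  have q: "ereal (real_of_int t) \<le> q_tor A M N" if "\<not> is_zero_mod (tor_mod A t M N)" for t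
    unfolding q_tor_def by (rule Sup_upper) (use that in blast)
  have "?i" if fin: ?ii
  proof -
    have "q_tor A M N \<noteq> \<infinity>" using fin by simp
    then obtain B :: nat where B: "q_tor A M N < ereal (real B)" unfolding less_PInf_Ex_of_nat by blast
    have z: "is_zero_mod (tor_mod A t M N)" if "t \<ge> int B" for t
    proof (rule ccontr)
      assume "\<not> is_zero_mod (tor_mod A t M N)"
      from le_less_trans[OF q[OF this] B] have "real_of_int t < real B" by simp
      then show False using that by linarith
    qed
    \<comment> \<open>Any start above both \<open>B\<close> and \<open>g\<close> serves: all Tor
      vanish from \<open>B\<close> on, so a window of any length is available.\<close>
    have "ereal (real_of_int (int B + int g + 1)) > ereal (real g)" by simp
    moreover have "is_zero_mod (tor_mod A (int B + int g + 1 + i) M N)" if "0 \<le> i" for i by (rule z) (use that in simp)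
    ultimately show ?i unfolding e by blast
  qed
  moreover have "?iii" if i: ?i
  proof -
    obtain t where t': "ereal (real g) < ereal (real_of_int t)" "\<forall>i. 0 \<le> i \<and> i \<le> L \<longrightarrow> is_zero_mod (tor_mod A (t + i) M N)"
      using i unfolding e by blast
    have "real g < real_of_int t" using t'(1) by simp
    then have t: "t > int g" "\<And>i. 0 \<le> i \<Longrightarrow> i \<le> L \<Longrightarrow> is_zero_mod (tor_mod A (t + i) M N)"
      using t'(2) by (linarith, blast)
    have hi: "is_zero_mod (tor_mod A s M N)" if "s > int g" for s by (rule win[OF t that])
    \<comment> \<open>The degrees of nonzero Tor lie between 0 and \<open>g\<close> and include 0,
      so the supremum is a maximum, a natural number to which \<open>low\<close> applies.\<close>
    define Z where "Z = {t. \<not> is_zero_mod (tor_mod A t M N)}"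
    have Z: "Z \<subseteq> {0..int g}" using tor_negative_zero[OF M(1) NM] hi by (force simp: Z_def)
    then have fZ: "finite Z" by (rule finite_subset) simp
    have "0 \<in> Z" using tor_0_nonzero[OF M N] by (simp add: Z_def)
    then have mZ: "Max Z \<in> Z" using Max_in[OF fZ] by blast
    have "g \<le> n + nat (Max Z)"
    proof (rule low)
      fix t assume "int (nat (Max Z)) < t"
      then have "t \<notin> Z" using Max_ge[OF fZ, of t] by linarith
      then show "is_zero_mod (tor_mod A t M N)" by (simp add: Z_def)
    qed
    moreover have "0 \<le> Max Z" using mZ Z by auto
    ultimately have "real g - real n \<le> real_of_int (Max Z)" by linarith
    then have "ereal (real g - real n) \<le> q_tor A M N" using q[of "Max Z"] mZ order_trans unfolding Z_def
      by (metis (mono_tags, lifting) ereal_less_eq(3) mem_Collect_eq)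
    moreover have "q_tor A M N \<le> ereal (real g)" unfolding q_tor_def
    proof (rule Sup_least)
      fix x assume "x \<in> {ereal (real_of_int n) |n. \<not> is_zero_mod (tor_mod A n M N)}"
      then obtain s where s: "x = ereal (real_of_int s)" "s \<in> Z" unfolding Z_def by blast
      have "s \<le> int g" using s(2) Z by auto
      then have "real_of_int s \<le> real g" by linarith
      then show "x \<le> ereal (real g)" unfolding s(1) by simp
    qed
    ultimately show ?iii unfolding e by blast
  qed
  moreover have "?ii" if ?iii using that unfolding e by (auto simp: less_top[symmetric] top_ereal_def)
  ultimately show ?thesis by blast
qed

end

theorem theorem3p3:
  fixes A :: "'a ring"
    and M :: "('a, 'm) module"
    and N :: "('a, 'n) module"
    and c :: nat
    and K :: "nat \<Rightarrow> ('a, 'k) module"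
    and deg :: "nat \<Rightarrow> int"
    and \<eta> :: "nat \<Rightarrow> ((nat \<Rightarrow> 'a) \<Rightarrow> 'k) set"
  assumes "noetherian_local_ring A"
    and "fg_module A M" and "\<not> is_zero_mod M" and "reducible_complexity A M"
    and "fg_module A N" and "\<not> is_zero_mod N"
    and "cx A M > 0 \<Longrightarrow>
           (\<forall>i\<le>c. fg_module A (K i)) \<and> mod_iso A M (K 0) \<and>
           (\<forall>i\<in>{1..c}.
              deg i > 0 \<and>
              \<eta> i \<in> carrier (ext_mod A (deg i) (K (i - 1)) (K (i - 1))) \<and>
              mod_iso A (K i) (K_mod A (deg i) (K (i - 1)) (K (i - 1)) (\<eta> i)) \<and>
              depth A (K i) = depth A M \<and>
              cx A (K i) < cx A (K (i - 1))) \<and>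
           cx A (K c) = 0"
    and "cx A M = 0 \<Longrightarrow> c = 0"
  shows "((\<exists>t::int. ereal (real_of_int t) >
                      ereal_of_enat (depth A (self_mod A)) - ereal_of_enat (depth A M) \<and>
             (\<forall>i. 0 \<le> i \<and> i \<le> (\<Sum>j=1..c. deg j) - int c \<longrightarrow>
                is_zero_mod (tor_mod A (t + i) M N)))
          \<longleftrightarrow> q_tor A M N < \<infinity>)
       \<and> (q_tor A M N < \<infinity>
          \<longleftrightarrow>
            ereal_of_enat (depth A (self_mod A)) - ereal_of_enat (depth A M)
              - ereal_of_enat (depth A N) \<le> q_tor A M N \<and>
            q_tor A M N \<le> ereal_of_enat (depth A (self_mod A)) - ereal_of_enat (depth A M))"
proof -
  interpret local_noeth A using assms(1) by (rule local_noeth.intro)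
  have N: "module A N" and M: "module A M" using assms(2,5) fg_module_D by blast+
  have "\<exists>k n g. depth A (self_mod A) = enat (k + g) \<and> depth A M = enat k \<and> depth A N = enat n \<and>
    (\<forall>t>int g. (\<forall>i. 0 \<le> i \<and> i \<le> (\<Sum>j=1..c. deg j) - int c \<longrightarrow> is_zero_mod (tor_mod A (t + i) M N)) \<longrightarrow>
       (\<forall>t>int g. is_zero_mod (tor_mod A t M N))) \<and>
    (\<forall>q. (\<forall>t>int q. is_zero_mod (tor_mod A t M N)) \<longrightarrow> g \<le> n + q)"
  proof (cases "cx A M = 0")
    case True
    then have c: "c = 0" by (rule assms(8))
    \<comment> \<open>The empty chain: \<open>M\<close> itself is the last module.\<close>
    show ?thesis
      using tor_bounds[OF assms(2,3,5,6) assms(2) refl True, where c=0 and v="\<lambda>_. tor_exact N (res_idx M) (res_d M)" and m="\<lambda>_. 0"]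
      by (simp add: c)
  next
    case False
    then have "cx A M > 0" by simp
    note h = assms(7)[OF this]
    have K: "fg_module A (K i)" if "i \<le> c" for i using h that by blast
    have iso: "mod_iso A M (K 0)" and c0: "cx A (K c) = 0" using h by blast+
    have K0: "module A (K 0)" using K[of 0] fg_module_D by blast
    have step: "deg (Suc i) > 0" "\<eta> (Suc i) \<in> carrier (ext_mod A (deg (Suc i)) (K i) (K i))"
      "mod_iso A (K (Suc i)) (K_mod A (deg (Suc i)) (K i) (K i) (\<eta> (Suc i)))"
      "depth A (K (Suc i)) = depth A M" if "i < c" for i
      using h[THEN conjunct2, THEN conjunct2, THEN conjunct1, rule_format, of "Suc i"] that by auto
    \<comment> \<open>The depth condition on the chain starts at K_1, so depth K_c = depth M can be
      read off only after excluding c = 0, where cx M would be zero.\<close>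
    have "c \<noteq> 0"
    proof
      assume "c = 0"
      then show False using c0 False cx_iso[OF M K0 iso] by simp
    qed
    then have dc: "depth A (K c) = depth A M" using step(4)[of "c - 1"] by simp
    \<comment> \<open>\<open>K 0\<close> is only isomorphic to \<open>M\<close>, but the chosen
      resolutions coincide, so row 0 of the table is that of \<open>M\<close>.\<close>
    have SD: "res_idx M = res_idx (K 0)" "res_d M = res_d (K 0)"
      by (simp_all add: fun_eq_iff res_idx_def res_d_def min_res_iso[OF M K0 iso])
    let ?m = "\<lambda>i. nat (deg i - 1)" and ?v = "\<lambda>i. tor_exact N (res_idx (K i)) (res_d (K i))"
    \<comment> \<open>Each stage contributes |eta_l| - 1, which adds up to the length bound in
      (i).\<close>
    have "int (\<Sum>l=1..c. ?m l) = (\<Sum>l=1..c. deg l - 1)" unfolding of_nat_sum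
    proof (rule sum.cong[OF refl])
      fix l assume "l \<in> {1..c}"
      then have "l - 1 < c" "l = Suc (l - 1)" by auto
      then show "int (?m l) = deg l - 1" using step(1)[of "l - 1"] by simp
    qed
    also have "\<dots> = (\<Sum>j=1..c. deg j) - int c" by (simp add: sum_subtractf)
    finally have L: "int (\<Sum>l=1..c. ?m l) = (\<Sum>j=1..c. deg j) - int c" .
    show ?thesis unfolding L[symmetric]
    proof (rule tor_bounds[OF assms(2,3,5,6) K[OF order_refl] dc c0, where v="?v"])
      fix i j assume i: "i < c"
      note s = K_step[OF K K step(1)[OF i] step(2)[OF i] step(3)[OF i] N]
      show "?v i j \<Longrightarrow> ?v i (j + ?m (Suc i)) \<Longrightarrow> ?v (Suc i) j"
        by (rule s(1)) (use i in auto)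
      show "?v (Suc i) j \<Longrightarrow> ?v (Suc i) (Suc j) \<Longrightarrow> ?v i (Suc (j + ?m (Suc i))) = ?v i j"
        by (rule s(2)) (use i in auto)
    qed (simp_all add: SD)
  qed
  then obtain k n g where d: "depth A (self_mod A) = enat (k + g)" "depth A M = enat k" "depth A N = enat n"
    and win: "\<forall>t>int g. (\<forall>i. 0 \<le> i \<and> i \<le> (\<Sum>j=1..c. deg j) - int c \<longrightarrow> is_zero_mod (tor_mod A (t + i) M N)) \<longrightarrow>
       (\<forall>t>int g. is_zero_mod (tor_mod A t M N))"
    and low: "\<forall>q. (\<forall>t>int q. is_zero_mod (tor_mod A t M N)) \<longrightarrow> g \<le> n + q" by blast
  show ?thesis by (rule tor_equivalence[OF assms(2,3,5,6) d]) (use win low in blast)+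
qed

end
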